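(* Let $k$ be a field, let $C/k$ be a smooth, projective, geometrically integral curve of genus $g$, and let $C^\circ=C\setminus\{\infty_1,\ldots,\infty_m\}$ be the affine curve obtained by removing $m\ge1$ given closed points, of degrees $d_1,\ldots,d_m$. Let $R=k[C^\circ]$ be its affine coordinate ring. Then $R$ is of multimetric linear type, and for all $n\in\mathbb{Z}^+$, $$c_M(R,n)\ge n\left(m+1-\sum_{j=1}^md_j-g\right)-1 .$$
   Context: $K=k(C)$ is the fraction field of the Dedekind domain $R$. Fix $q>1$ (with $q=\#k$ if $k$ is finite). For a nonzero ideal $I$ of $R$ put $|I|=q^{\dim_kR/I}$, extended multiplicatively to nonzero fractional ideals; for $x\in K^\times$, $|x|=|xR|$, and $|0|=0$. With $v_{\infty_j}$ the normalized discrete valuation of $K$ at $\infty_j$ and $d_j=[k(\infty_j):k]$, put $|x|_j=q^{-d_jv_{\infty_j}(x)}$; then $|x|=\prod_{j=1}^m|x|_j$ for all $x\in K$. Put $\mathcal{N}=|K^\times|$, $\mathcal{N}_j=|K^\times|_j$, with closures $\overline{\mathcal{N}},\overline{\mathcal{N}_j}$ in $\mathbb{R}^{>0}$ (these are subgroups of $q^{\mathbb{Z}}$). An $R$-lattice in $K^n$ is a finitely generated $R$-submodule $\Lambda\subset K^n$ spanning $K^n$ over $K$. For a finite length $R$-module $M\cong\bigoplus_iR/\mathfrak{p}_i^{n_i}$ put $\chi(M)=\prod_i\mathfrak{p}_i^{n_i}$. For a lattice $\Lambda$ choose nonzero $\alpha\in R$ with $\alpha\Lambda\subset R^n$, and put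 $\chi(\Lambda)=\alpha^{-n}\chi(R^n/\alpha\Lambda)$ (independent of $\alpha$) and $\operatorname{Covol}\Lambda=|\chi(\Lambda)|$. $R$ is of multimetric linear type if for every $n\in\mathbb{Z}^+$ there is $C\in\overline{\mathcal{N}}$ with the property: for all $M=(m_{ik})\in GL_n(K)$, all $R$-lattices $\Lambda\subset K^n$ and all $\epsilon_{ij}\in\overline{\mathcal{N}_j}$ ($1\le i\le n$, $1\le j\le m$) with $|\det M|\operatorname{Covol}\Lambda\le C\prod_{i,j}\epsilon_{ij}$, there is a nonzero $x=(x_1,\ldots,x_n)\in\Lambda$ with $|\sum_{k=1}^nm_{ik}x_k|_j\le\epsilon_{ij}$ for all $i,j$. $C_M(R,n)$ is the supremum of all such $C$, and $c_M(R,n)=\log_qC_M(R,n)$. *)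

theory Defs
  imports
    Complex_Main
    "HOL.Hull"
    "HOL-Library.Function_Algebras"
    "HOL-Computational_Algebra.Polynomial"
    "HOL-Algebra.Algebraic_Closure_Type"
    "HOL-Analysis.Elementary_Topology"
    "Jordan_Normal_Form.Determinant"
begin

section \<open>Subrings, subfields and discrete valuations of a field\<close>

definition is_subring :: "'a::field set \<Rightarrow> bool" where
  "is_subring A \<longleftrightarrow> 1 \<in> A \<and> (\<forall>x\<in>A. \<forall>y\<in>A. x - y \<in> A \<and> x * y \<in> A)"

definition is_subfield :: "'a::field set \<Rightarrow> bool" where
  "is_subfield A \<longleftrightarrow> is_subring A \<and> (\<forall>x\<in>A. inverse x \<in> A)"

definition algebraic_over :: "'a::field set \<Rightarrow> 'a \<Rightarrow> bool" where
  "algebraic_over F x \<longleftrightarrow> (\<exists>p. p \<noteq> 0 \<and> set (coeffs p) \<subseteq> F \<and> poly p x = 0)"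

definition prime_ideal_of :: "'a::field set \<Rightarrow> 'a set \<Rightarrow> bool" where
  "prime_ideal_of A p \<longleftrightarrow> p \<subseteq> A \<and> 0 \<in> p \<and> (\<forall>x\<in>p. \<forall>y\<in>p. x + y \<in> p)
     \<and> (\<forall>a\<in>A. \<forall>x\<in>p. a * x \<in> p) \<and> 1 \<notin> p
     \<and> (\<forall>x\<in>A. \<forall>y\<in>A. x * y \<in> p \<longrightarrow> x \<in> p \<or> y \<in> p)"

definition localization_at :: "'a::field set \<Rightarrow> 'a set \<Rightarrow> 'a set" where
  "localization_at A p = {a / s | a s. a \<in> A \<and> s \<in> A - p}"

text \<open>A normalized discrete valuation of the subfield \<open>F\<close>; only its values on
  \<open>F - {0}\<close> are meaningful.\<close>

definition normalized_valuation :: "'a::field set \<Rightarrow> ('a \<Rightarrow> int) \<Rightarrow> bool" where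
  "normalized_valuation F v \<longleftrightarrow>
     (\<forall>x\<in>F - {0}. \<forall>y\<in>F - {0}. v (x * y) = v x + v y
        \<and> (x + y \<noteq> 0 \<longrightarrow> min (v x) (v y) \<le> v (x + y)))
     \<and> v ` (F - {0}) = UNIV"

definition is_dvr :: "'a::field set \<Rightarrow> 'a set \<Rightarrow> bool" where
  "is_dvr F A \<longleftrightarrow> (\<exists>v. normalized_valuation F v \<and> A = {x \<in> F. x = 0 \<or> 0 \<le> v x})"

text \<open>The normalized valuation of a discrete valuation ring of the whole field; the junk
  value at \<open>0\<close> is fixed to \<open>0\<close> to make the function unique.\<close>

definition ord_at :: "'a::field set \<Rightarrow> 'a \<Rightarrow> int" where
  "ord_at A = (THE v. normalized_valuation UNIV v \<and> v 0 = 0 \<and> A = {x. x = 0 \<or> 0 \<le> v x})"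

definition max_ideal :: "'a::field set \<Rightarrow> 'a set" where
  "max_ideal A = {x \<in> A. x = 0 \<or> inverse x \<notin> A}"


section \<open>Dimension of a quotient of vector spaces\<close>

text \<open>For subspaces \<open>W \<subseteq> U\<close>: the finite set \<open>B\<close> maps bijectively to a basis of \<open>U / W\<close>.\<close>

definition quot_basis ::
  "('k::field \<Rightarrow> 'v::ab_group_add \<Rightarrow> 'v) \<Rightarrow> 'v set \<Rightarrow> 'v set \<Rightarrow> 'v set \<Rightarrow> bool" where
  "quot_basis s U W B \<longleftrightarrow> finite B \<and> B \<subseteq> U \<and> \<not> module.dependent s B
     \<and> module.span s B \<inter> W = {0} \<and> U \<subseteq> {b + w | b w. b \<in> module.span s B \<and> w \<in> W}"

definition has_quot_dim ::
  "('k::field \<Rightarrow> 'v::ab_group_add \<Rightarrow> 'v) \<Rightarrow> 'v set \<Rightarrow> 'v set \<Rightarrow> nat \<Rightarrow> bool" where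
  "has_quot_dim s U W d \<longleftrightarrow> (\<exists>B. quot_basis s U W B \<and> card B = d)"

definition quot_dim ::
  "('k::field \<Rightarrow> 'v::ab_group_add \<Rightarrow> 'v) \<Rightarrow> 'v set \<Rightarrow> 'v set \<Rightarrow> nat" where
  "quot_dim s U W = (THE d. has_quot_dim s U W d)"


section \<open>Curves\<close>

text \<open>
  The type \<open>'K\<close> is the function field, an extension of the field \<open>'k\<close> by means of
  \<open>\<iota>\<close>. An integral scheme that is projective over \<open>k\<close> is represented, following Chevalley
  and Zariski, by the set of its local rings inside its function field: if it is embedded in
  projective space with homogeneous coordinates restricting to \<open>x\<^sub>0, \<dots>, x\<^sub>N\<close> (divided by some
  fixed nonvanishing coordinate, hence elements of the function field), then it is covered by
  the spectra of the rings \<open>k[x\<^sub>0/x\<^sub>i, \<dots>, x\<^sub>N/x\<^sub>i]\<close> for \<open>x\<^sub>i \<noteq> 0\<close>, and its points correspond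
  bijectively to the localizations of these rings at their prime ideals. The generic point
  is the function field itself.
\<close>

definition field_embedding :: "('k::field \<Rightarrow> 'K::field) \<Rightarrow> bool" where
  "field_embedding \<iota> \<longleftrightarrow> \<iota> 1 = 1
     \<and> (\<forall>a b. \<iota> (a + b) = \<iota> a + \<iota> b \<and> \<iota> (a * b) = \<iota> a * \<iota> b)"

definition chart_ring :: "'a::field set \<Rightarrow> 'a list \<Rightarrow> nat \<Rightarrow> 'a set" where
  "chart_ring F xs i = is_subring hull (F \<union> {y / xs ! i | y. y \<in> set xs})"

definition projective_model :: "'a::field set \<Rightarrow> 'a list \<Rightarrow> 'a set set" where
  "projective_model F xs =
     {localization_at (chart_ring F xs i) p | i p.
        i < length xs \<and> xs ! i \<noteq> 0 \<and> prime_ideal_of (chart_ring F xs i) p}"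

definition model_function_field :: "'a::field set \<Rightarrow> 'a list \<Rightarrow> 'a set" where
  "model_function_field F xs =
     is_subfield hull (F \<union> {y / x | x y. x \<in> set xs \<and> y \<in> set xs})"

definition transcendence_degree_one :: "'a::field set \<Rightarrow> bool" where
  "transcendence_degree_one F \<longleftrightarrow>
     (\<exists>t. \<not> algebraic_over F t \<and> (\<forall>x. algebraic_over (is_subfield hull (F \<union> {t})) x))"

text \<open>The algebraic closure of \<open>k\<close> inside an algebraic closure of \<open>K\<close>.\<close>

definition base_closure :: "('k::field \<Rightarrow> 'K::field) \<Rightarrow> 'K alg_closure set" where
  "base_closure \<iota> = {z. algebraic_over (range (to_ac \<circ> \<iota>)) z}"

text \<open>The base change of an integral \<open>k\<close>-scheme with function field \<open>K\<close> to an algebraic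
  closure \<open>k'\<close> of \<open>k\<close> is integral iff \<open>K \<otimes>\<^sub>k k'\<close> is a domain. This ring is integral over the
  field \<open>K\<close>, so it is a domain iff it is a field, that is, iff its multiplication map into
  the algebraic closure of \<open>K\<close> is injective.\<close>

definition geometrically_integral :: "('k::field \<Rightarrow> 'K::field) \<Rightarrow> bool" where
  "geometrically_integral \<iota> \<longleftrightarrow>
     (\<forall>B. finite B \<and> \<not> module.dependent (\<lambda>c x. \<iota> c * x) B \<longrightarrow>
       (\<forall>c. (\<forall>b\<in>B. c b \<in> base_closure \<iota>) \<and> (\<Sum>b\<in>B. c b * to_ac b) = 0
            \<longrightarrow> (\<forall>b\<in>B. c b = 0)))"

text \<open>Regularity in dimension at most one: every local ring is the function field or a
  discrete valuation ring.\<close>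

definition regular_model :: "'a::field set \<Rightarrow> 'a list \<Rightarrow> bool" where
  "regular_model F xs \<longleftrightarrow>
     (\<forall>A \<in> projective_model F xs.
        A = model_function_field F xs \<or> is_dvr (model_function_field F xs) A)"

text \<open>Smoothness over \<open>k\<close> is geometric regularity: the base change to each algebraic extension
  \<open>k'\<close> of \<open>k\<close> (including \<open>k\<close> itself) is regular. For a geometrically integral model, the
  tensor products of \<open>k'\<close> with the rings of the charts embed into the algebraic closure of
  \<open>K\<close>, so the base change is the model over \<open>k'\<close> with the same coordinates.\<close>

definition smooth_model :: "('k::field \<Rightarrow> 'K::field) \<Rightarrow> 'K list \<Rightarrow> bool" where
  "smooth_model \<iota> xs \<longleftrightarrow>
     (\<forall>k'. is_subfield k' \<and> range (to_ac \<circ> \<iota>) \<subseteq> k' \<and> k' \<subseteq> base_closure \<iota>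
        \<longrightarrow> regular_model k' (map to_ac xs))"

definition smooth_projective_geom_integral_curve ::
  "('k::field \<Rightarrow> 'K::field) \<Rightarrow> 'K set set \<Rightarrow> bool" where
  "smooth_projective_geom_integral_curve \<iota> C \<longleftrightarrow>
     field_embedding \<iota> \<and> transcendence_degree_one (range \<iota>) \<and> geometrically_integral \<iota>
     \<and> (\<exists>xs. C = projective_model (range \<iota>) xs
           \<and> model_function_field (range \<iota>) xs = UNIV \<and> smooth_model \<iota> xs)"

definition closed_points :: "'K::field set set \<Rightarrow> 'K set set" where
  "closed_points C = C - {UNIV}"

definition degree_at :: "('k::field \<Rightarrow> 'K::field) \<Rightarrow> 'K set \<Rightarrow> nat" where
  "degree_at \<iota> P = quot_dim (\<lambda>c x. \<iota> c * x) P (max_ideal P)"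

text \<open>The genus is the dimension of \<open>H\<^sup>1(C, \<O>\<^sub>C)\<close>, written as the space of repartitions
  (adeles) modulo the sum of the everywhere integral ones and the constant ones, which is the
  cokernel of the flasque resolution of the structure sheaf by \<open>K\<close> and \<open>K / \<O>\<^sub>C\<close>.
  Values of repartitions outside \<open>closed_points C\<close> are irrelevant: they are arbitrary both in
  the numerator and in the denominator.\<close>

definition repartitions :: "'K::field set set \<Rightarrow> ('K set \<Rightarrow> 'K) set" where
  "repartitions C = {\<alpha>. finite {P \<in> closed_points C. \<alpha> P \<notin> P}}"

definition integral_repartitions :: "'K::field set set \<Rightarrow> ('K set \<Rightarrow> 'K) set" where
  "integral_repartitions C = {\<alpha>. \<forall>P \<in> closed_points C. \<alpha> P \<in> P}"

definition has_genus :: "('k::field \<Rightarrow> 'K::field) \<Rightarrow> 'K set set \<Rightarrow> nat \<Rightarrow> bool" where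
  "has_genus \<iota> C g \<longleftrightarrow>
     has_quot_dim (\<lambda>c \<alpha> P. \<iota> c * \<alpha> P) (repartitions C)
       {\<alpha> + (\<lambda>_. x) | \<alpha> x. \<alpha> \<in> integral_repartitions C} g"

text \<open>The ring of regular functions on the complement of the set \<open>S\<close> of closed points.\<close>

definition affine_coordinate_ring :: "'K::field set set \<Rightarrow> 'K set set \<Rightarrow> 'K set" where
  "affine_coordinate_ring C S = {x. \<forall>P \<in> closed_points C - S. x \<in> P}"


section \<open>Ideals and absolute values\<close>

text \<open>In the rest of the theory \<open>R\<close> is a Dedekind domain with fraction field \<open>'K\<close>.\<close>

definition is_submodule :: "'K::field set \<Rightarrow> 'K set \<Rightarrow> bool" where
  "is_submodule R I \<longleftrightarrow> 0 \<in> I \<and> (\<forall>x\<in>I. \<forall>y\<in>I. x + y \<in> I) \<and> (\<forall>a\<in>R. \<forall>x\<in>I. a * x \<in> I)"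

definition ideal_mult :: "'K::field set \<Rightarrow> 'K set \<Rightarrow> 'K set \<Rightarrow> 'K set" where
  "ideal_mult R I J = is_submodule R hull {x * y | x y. x \<in> I \<and> y \<in> J}"

definition ideal_pow :: "'K::field set \<Rightarrow> 'K set \<Rightarrow> nat \<Rightarrow> 'K set" where
  "ideal_pow R I e = (ideal_mult R I ^^ e) R"

definition integral_ideal_norm ::
  "real \<Rightarrow> ('k::field \<Rightarrow> 'K::field) \<Rightarrow> 'K set \<Rightarrow> 'K set \<Rightarrow> real" where
  "integral_ideal_norm q \<iota> R I = q ^ quot_dim (\<lambda>c x. \<iota> c * x) R I"

text \<open>Multiplicative extension to nonzero fractional ideals: write \<open>I = (a R)\<^sup>-\<^sup>1 (a I)\<close> with
  \<open>a R\<close> and \<open>a I\<close> nonzero ideals of \<open>R\<close>. The value does not depend on \<open>a\<close>.\<close>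

definition ideal_norm ::
  "real \<Rightarrow> ('k::field \<Rightarrow> 'K::field) \<Rightarrow> 'K set \<Rightarrow> 'K set \<Rightarrow> real" where
  "ideal_norm q \<iota> R I =
     (let a = (SOME a. a \<in> R \<and> a \<noteq> 0 \<and> (*) a ` I \<subseteq> R)
      in integral_ideal_norm q \<iota> R ((*) a ` I) / integral_ideal_norm q \<iota> R ((*) a ` R))"

definition abs_R :: "real \<Rightarrow> ('k::field \<Rightarrow> 'K::field) \<Rightarrow> 'K set \<Rightarrow> 'K \<Rightarrow> real" where
  "abs_R q \<iota> R x = (if x = 0 then 0 else ideal_norm q \<iota> R ((*) x ` R))"

definition abs_at :: "real \<Rightarrow> ('k::field \<Rightarrow> 'K::field) \<Rightarrow> 'K set \<Rightarrow> 'K \<Rightarrow> real" where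
  "abs_at q \<iota> P x = (if x = 0 then 0 else q powi (- int (degree_at \<iota> P) * ord_at P x))"

text \<open>Closure of the image of the nonzero elements, taken in the positive reals.\<close>

definition value_group_closure :: "('K::field \<Rightarrow> real) \<Rightarrow> real set" where
  "value_group_closure f = closure (f ` (UNIV - {0})) \<inter> {0<..}"


section \<open>Lattices\<close>

definition is_vec_submodule :: "'K::field set \<Rightarrow> nat \<Rightarrow> 'K vec set \<Rightarrow> bool" where
  "is_vec_submodule R n L \<longleftrightarrow> L \<subseteq> carrier_vec n \<and> 0\<^sub>v n \<in> L
     \<and> (\<forall>x\<in>L. \<forall>y\<in>L. x + y \<in> L) \<and> (\<forall>a\<in>R. \<forall>x\<in>L. a \<cdot>\<^sub>v x \<in> L)"

definition is_lattice :: "'K::field set \<Rightarrow> nat \<Rightarrow> 'K vec set \<Rightarrow> bool" where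
  "is_lattice R n L \<longleftrightarrow>
     (\<exists>S. finite S \<and> S \<subseteq> carrier_vec n \<and> L = is_vec_submodule R n hull S)
     \<and> is_vec_submodule UNIV n hull L = carrier_vec n"

definition std_lattice :: "'K::field set \<Rightarrow> nat \<Rightarrow> 'K vec set" where
  "std_lattice R n = {x \<in> carrier_vec n. \<forall>i<n. x $ i \<in> R}"

text \<open>For \<open>R\<close>-submodules \<open>W \<subseteq> U\<close> of \<open>K\<^sup>n\<close>: the columns of \<open>E\<close> lie in \<open>U\<close>, and sending the
  \<open>i\<close>-th unit vector to the class of the \<open>i\<close>-th column induces an isomorphism from the direct
  sum of the \<open>R / p\<^sub>i\<^sup>e\<^sup>i\<close> onto \<open>U / W\<close>, where \<open>ps\<close> is the list of the pairs \<open>(p\<^sub>i, e\<^sub>i)\<close>.\<close>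

definition primary_decomposition ::
  "'K::field set \<Rightarrow> nat \<Rightarrow> 'K vec set \<Rightarrow> 'K vec set \<Rightarrow> ('K set \<times> nat) list \<Rightarrow> 'K mat \<Rightarrow> bool" where
  "primary_decomposition R n U W ps E \<longleftrightarrow>
     (\<forall>(p, e) \<in> set ps. prime_ideal_of R p \<and> p \<noteq> {0})
     \<and> E \<in> carrier_mat n (length ps) \<and> set (cols E) \<subseteq> U
     \<and> (\<forall>u\<in>U. \<exists>a \<in> std_lattice R (length ps). u - E *\<^sub>v a \<in> W)
     \<and> (\<forall>a \<in> std_lattice R (length ps). E *\<^sub>v a \<in> W \<longleftrightarrow>
          (\<forall>i<length ps. a $ i \<in> ideal_pow R (fst (ps ! i)) (snd (ps ! i))))"

text \<open>The invariant \<open>\<chi>(U / W)\<close> of a finite length quotient, unique by the structure theorem.\<close>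

definition chi_quotient :: "'K::field set \<Rightarrow> nat \<Rightarrow> 'K vec set \<Rightarrow> 'K vec set \<Rightarrow> 'K set" where
  "chi_quotient R n U W =
     (SOME I. \<exists>ps E. primary_decomposition R n U W ps E
        \<and> I = foldr (\<lambda>(p, e). ideal_mult R (ideal_pow R p e)) ps R)"

definition chi_lattice :: "'K::field set \<Rightarrow> nat \<Rightarrow> 'K vec set \<Rightarrow> 'K set" where
  "chi_lattice R n L =
     (let a = (SOME a. a \<in> R \<and> a \<noteq> 0 \<and> (\<lambda>x. a \<cdot>\<^sub>v x) ` L \<subseteq> std_lattice R n)
      in (*) (inverse a ^ n) ` chi_quotient R n (std_lattice R n) ((\<lambda>x. a \<cdot>\<^sub>v x) ` L))"

definition covol ::
  "real \<Rightarrow> ('k::field \<Rightarrow> 'K::field) \<Rightarrow> 'K set \<Rightarrow> nat \<Rightarrow> 'K vec set \<Rightarrow> real" where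
  "covol q \<iota> R n L = ideal_norm q \<iota> R (chi_lattice R n L)"


section \<open>Multimetric linear type\<close>

text \<open>The points at infinity are \<open>P 0, \<dots>, P (m - 1)\<close>; indices of vectors, matrices and
  points start at \<open>0\<close>.\<close>

definition multimetric_constants ::
  "real \<Rightarrow> ('k::field \<Rightarrow> 'K::field) \<Rightarrow> 'K set \<Rightarrow> nat \<Rightarrow> (nat \<Rightarrow> 'K set) \<Rightarrow> nat \<Rightarrow> real set" where
  "multimetric_constants q \<iota> R m P n =
     {c \<in> value_group_closure (abs_R q \<iota> R).
       \<forall>M \<Lambda> \<epsilon>. M \<in> carrier_mat n n \<and> invertible_mat M \<and> is_lattice R n \<Lambda>
         \<and> (\<forall>i<n. \<forall>j<m. \<epsilon> i j \<in> value_group_closure (abs_at q \<iota> (P j)))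
         \<and> abs_R q \<iota> R (det M) * covol q \<iota> R n \<Lambda> \<le> c * (\<Prod>i<n. \<Prod>j<m. \<epsilon> i j)
         \<longrightarrow> (\<exists>x\<in>\<Lambda>. x \<noteq> 0\<^sub>v n
               \<and> (\<forall>i<n. \<forall>j<m. abs_at q \<iota> (P j) ((M *\<^sub>v x) $ i) \<le> \<epsilon> i j))}"

definition multimetric_linear_type ::
  "real \<Rightarrow> ('k::field \<Rightarrow> 'K::field) \<Rightarrow> 'K set \<Rightarrow> nat \<Rightarrow> (nat \<Rightarrow> 'K set) \<Rightarrow> bool" where
  "multimetric_linear_type q \<iota> R m P \<longleftrightarrow>
     (\<forall>n\<ge>1. multimetric_constants q \<iota> R m P n \<noteq> {})"

definition C_M ::
  "real \<Rightarrow> ('k::field \<Rightarrow> 'K::field) \<Rightarrow> 'K set \<Rightarrow> nat \<Rightarrow> (nat \<Rightarrow> 'K set) \<Rightarrow> nat \<Rightarrow> real" where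
  "C_M q \<iota> R m P n = Sup (multimetric_constants q \<iota> R m P n)"

definition c_M ::
  "real \<Rightarrow> ('k::field \<Rightarrow> 'K::field) \<Rightarrow> 'K set \<Rightarrow> nat \<Rightarrow> (nat \<Rightarrow> 'K set) \<Rightarrow> nat \<Rightarrow> real" where
  "c_M q \<iota> R m P n = log q (C_M q \<iota> R m P n)"

end

theory Submission
  imports Defs
begin

text \<open>The theorem is the function field analogue of Minkowski's theorem on linear forms, and it holds
  because Riemann's inequality counts dimensions where Minkowski compares volumes. Let \<open>S\<close> be the
  set of the removed points. For integers \<open>a\<^sub>i\<^sub>Q\<close> let \<open>V\<^sub>a\<close> be the space of the families
  \<open>(\<alpha>\<^sub>i\<^sub>Q)\<close>, for \<open>i < n\<close> and \<open>Q \<in> S\<close>, of elements of the function field \<open>K\<close> such that \<open>\<alpha>\<^sub>i\<^sub>Q\<close> has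
  order at least \<open>a\<^sub>i\<^sub>Q\<close> at \<open>Q\<close>, and embed \<open>K\<^sup>n\<close> diagonally. The inequalities that are to be solved
  say that the vector \<open>M x\<close> of the lattice \<open>M \<Lambda>\<close> lies in \<open>V\<^sub>a\<close>, where the bounds for the absolute
  values are \<open>q\<close> to the powers \<open>- d\<^sub>Q a\<^sub>i\<^sub>Q\<close>. For a lattice \<open>L\<close> the Euler characteristic
  \<open>dim (V\<^sub>a \<inter> L) - codim (V\<^sub>a + L)\<close> changes by the relative dimension whenever \<open>V\<^sub>a\<close> or \<open>L\<close> is replaced
  by a commensurable space (\<open>euler_commens\<close>). As soon as it is positive, \<open>V\<^sub>a \<inter> L\<close> contains a nonzero
  vector (\<open>euler_pos_ex\<close>).

  For \<open>a = 0\<close> and \<open>L = R\<^sup>n\<close> the intersection contains the unit vectors, and the codimension is at most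
  \<open>n g\<close> because the genus is the dimension of the repartitions modulo the integral and the constant
  ones. Hence the characteristic is at least \<open>n (1 - g)\<close> (\<open>riemann_inequality\<close>). Passing to \<open>V\<^sub>a\<close>
  subtracts \<open>\<Sum> d\<^sub>Q a\<^sub>i\<^sub>Q\<close>. Passing to \<open>M \<Lambda>\<close> subtracts the dimension of \<open>R\<^sup>n\<close> relative to \<open>M \<Lambda>\<close>,
  which is the logarithm of \<open>|det M| Covol \<Lambda>\<close>. So \<open>C = q\<^sup>e\<close> has the required property whenever
  \<open>e < n (1 - g)\<close> and \<open>C\<close> is in the value group of \<open>R\<close> (\<open>minkowski_vector\<close>). By the product
  formula this group contains the powers of \<open>q\<close> whose exponents are multiples of the degree \<open>d\<close> of one
  chosen point of \<open>S\<close>, so some such \<open>e\<close> is at least \<open>n (1 - g) - d\<close>. Since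
  \<open>d - 1 \<le> n \<Sum> (d\<^sub>Q - 1)\<close>, this is at least the asserted bound (\<open>multimetric_bound\<close>). The supremum is
  finite, because a nonzero element of \<open>R\<close> cannot vanish at all points of \<open>S\<close>
  (\<open>multimetric_constants_bounded\<close>).

  The identification of covolumes with relative dimensions (\<open>covol_eq\<close>, \<open>idx_mat_fun\<close>) rests on the
  arithmetic of \<open>R\<close>, which is derived from valuations instead of the general theory of Dedekind
  domains: a smooth projective model is a set of discrete valuation rings at which every
  transcendental function has a pole (\<open>transcendental_has_pole\<close>), \<open>K\<close> is finite over \<open>k(t)\<close>
  (\<open>function_field_dependent\<close>), and finiteness of the genus provides functions with a single
  pole (\<open>pole_only_at\<close>). These functions give strong approximation (\<open>strong_approximation\<close>), by which
  submodules of \<open>K\<close> and of \<open>K\<^sup>n\<close> are determined by their localizations.\<close>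


section \<open>Relative dimensions of subspaces\<close>

definition ssum :: "'a::plus set \<Rightarrow> 'a set \<Rightarrow> 'a set" where
  "ssum U V = {u + v | u v. u \<in> U \<and> v \<in> V}"

lemma ssumI: "u \<in> U \<Longrightarrow> v \<in> V \<Longrightarrow> u + v \<in> ssum U V"
  unfolding ssum_def by blast

lemma ssumE:
  assumes "x \<in> ssum U V"
  obtains u v where "u \<in> U" "v \<in> V" "x = u + v"
  using assms unfolding ssum_def by blast

lemma ssum_commute: "ssum (U :: 'a::ab_semigroup_add set) V = ssum V U"
  unfolding ssum_def by (auto simp: add.commute) (metis add.commute)+

lemma quot_dim_cong:
  assumes "\<And>d. has_quot_dim s1 U W d \<longleftrightarrow> has_quot_dim s2 U' W' d"
  shows "quot_dim s1 U W = quot_dim s2 U' W'"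
proof -
  have "has_quot_dim s1 U W = has_quot_dim s2 U' W'" using assms by blast
  then show ?thesis unfolding quot_dim_def by simp
qed

locale relative_dimension = vector_space scale
  for scale :: "'a::field \<Rightarrow> 'b::ab_group_add \<Rightarrow> 'b"
begin

text \<open>The classes of \<open>B\<close> modulo \<open>W\<close> are distinct and linearly independent.\<close>

definition indep_mod :: "'b set \<Rightarrow> 'b set \<Rightarrow> bool" where
  "indep_mod W B \<longleftrightarrow> independent B \<and> span B \<inter> W = {0}"

abbreviation hqd :: "'b set \<Rightarrow> 'b set \<Rightarrow> nat \<Rightarrow> bool" where
  "hqd \<equiv> has_quot_dim scale"

definition fincodim :: "'b set \<Rightarrow> 'b set \<Rightarrow> bool" where
  "fincodim U W \<longleftrightarrow> (\<exists>d. hqd U W d)"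

lemma hqd_iff:
  "hqd U W d \<longleftrightarrow> (\<exists>B. finite B \<and> B \<subseteq> U \<and> indep_mod W B \<and> U \<subseteq> ssum (span B) W \<and> card B = d)"
  unfolding has_quot_dim_def quot_basis_def indep_mod_def ssum_def by blast

lemma subspace_ssum: "subspace U \<Longrightarrow> subspace V \<Longrightarrow> subspace (ssum U V)"
  unfolding ssum_def by (rule subspace_sums)

lemma ssum_superset1: "subspace V \<Longrightarrow> U \<subseteq> ssum U V"
  using ssumI[of _ U 0 V] subspace_0 by fastforce

lemma ssum_superset2: "subspace U \<Longrightarrow> V \<subseteq> ssum U V"
  using ssumI[of 0 U _ V] subspace_0 by fastforce

lemma indep_mod_insert:
  assumes W: "subspace W" and B: "indep_mod W B" and u: "u \<notin> ssum (span B) W"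
  shows "indep_mod W (insert u B)"
proof -
  have "u \<notin> span B" using u ssum_superset1[OF W] by blast
  then have ind: "independent (insert u B)"
    using B independent_insertI unfolding indep_mod_def by blast
  have "x = 0" if x: "x \<in> span (insert u B)" "x \<in> W" for x
  proof -
    obtain k where k: "x - scale k u \<in> span B" using x(1) span_breakdown_eq by blast
    have "k = 0"
    proof (rule ccontr)
      assume k0: "k \<noteq> 0"
      have "scale (inverse k) (- (x - scale k u)) \<in> span B"
        by (rule span_scale[OF span_neg[OF k]])
      moreover have "scale (inverse k) x \<in> W" using x(2) W subspace_scale by blast
      moreover have "u = scale (inverse k) (- (x - scale k u)) + scale (inverse k) x"
        using k0 by (simp add: scale_right_diff_distrib)
      ultimately show False using u ssumI by metis
    qed
    then show ?thesis using k x B unfolding indep_mod_def by auto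
  qed
  moreover have "0 \<in> span (insert u B) \<inter> W" using span_zero W subspace_0 by blast
  ultimately show ?thesis using ind unfolding indep_mod_def by blast
qed

text \<open>Sending each element of \<open>B\<close> to its component in \<open>span G\<close> is an injective linear map,
  so Steinitz exchange in \<open>span G\<close> bounds \<open>B\<close>.\<close>

lemma indep_mod_card_le:
  assumes W: "subspace W" and G: "finite G" and B: "indep_mod W B"
    and sub: "B \<subseteq> ssum (span G) W"
  shows "finite B \<and> card B \<le> card G"
proof -
  interpret p: vector_space_pair scale scale by unfold_locales
  have "\<forall>b\<in>B. \<exists>c. c \<in> span G \<and> c - b \<in> W"
  proof
    fix b assume "b \<in> B"
    then obtain c w where "c \<in> span G" "w \<in> W" "b = c + w" using sub ssumE by blast
    moreover have "c - b = - w" using \<open>b = c + w\<close> by simp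
    ultimately show "\<exists>c. c \<in> span G \<and> c - b \<in> W" using subspace_neg[OF W] by metis
  qed
  then obtain c where c: "\<And>b. b \<in> B \<Longrightarrow> c b \<in> span G" "\<And>b. b \<in> B \<Longrightarrow> c b - b \<in> W" by metis
  have ind: "independent B" and B0: "span B \<inter> W = {0}" using B unfolding indep_mod_def by auto
  define f where "f = p.construct B c"
  have lin: "Vector_Spaces.linear scale scale f" unfolding f_def by (rule p.linear_construct[OF ind])
  interpret f: Vector_Spaces.linear scale scale f by (rule lin)
  have fb: "f b = c b" if "b \<in> B" for b unfolding f_def by (rule p.construct_basis[OF ind that])
  have fW: "f x - x \<in> W" if "x \<in> span B" for x
  proof -
    have "subspace {x. f x - x \<in> W}"
    proof (rule subspaceI)
      show "0 \<in> {x. f x - x \<in> W}" using W subspace_0 f.zero by simp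
    next
      fix x y assume "x \<in> {x. f x - x \<in> W}" "y \<in> {x. f x - x \<in> W}"
      then have "(f x - x) + (f y - y) \<in> W" using W subspace_add by blast
      moreover have "f (x + y) - (x + y) = (f x - x) + (f y - y)" by (simp add: f.add)
      ultimately show "x + y \<in> {x. f x - x \<in> W}" by (metis mem_Collect_eq)
    next
      fix r x assume "x \<in> {x. f x - x \<in> W}"
      then have "scale r (f x - x) \<in> W" using W subspace_scale by blast
      moreover have "f (scale r x) - scale r x = scale r (f x - x)"
        by (simp add: f.scale scale_right_diff_distrib)
      ultimately show "scale r x \<in> {x. f x - x \<in> W}" by (metis mem_Collect_eq)
    qed
    then have "span B \<subseteq> {x. f x - x \<in> W}" by (intro span_minimal) (use fb c in auto)
    then show ?thesis using that by blast
  qed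
  have inj: "inj_on f (span B)"
    unfolding f.inj_on_iff_eq_0[OF subspace_span]
  proof
    fix x assume x: "x \<in> span B"
    show "f x = 0 \<longrightarrow> x = 0"
    proof
      assume "f x = 0"
      then have "- x \<in> W" using fW[OF x] by simp
      then have "x \<in> W" using subspace_neg[OF W] by fastforce
      then show "x = 0" using x B0 by blast
    qed
  qed
  have "independent (f ` B)" by (rule f.independent_injective_image[OF ind inj])
  moreover have "f ` B \<subseteq> span G" using fb c by auto
  ultimately have "finite (f ` B) \<and> card (f ` B) \<le> card G" by (rule independent_span_bound[OF G])
  moreover have "inj_on f B" using inj span_superset inj_on_subset by blast
  ultimately show ?thesis using card_image finite_image_iff by metis
qed

lemma hqd_indep_mod_card_le:
  assumes "subspace W" "hqd U W d" "indep_mod W B" "B \<subseteq> U"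
  shows "finite B \<and> card B \<le> d"
  using indep_mod_card_le assms unfolding hqd_iff by (metis (no_types, lifting) subset_trans)

lemma hqd_unique:
  assumes "subspace W" "hqd U W d" "hqd U W d'"
  shows "d = d'"
  using assms hqd_indep_mod_card_le unfolding hqd_iff by (metis (no_types, lifting) le_antisym hqd_iff)

lemma quot_dim_eq:
  assumes "subspace W" "hqd U W d"
  shows "quot_dim scale U W = d"
  unfolding quot_dim_def using hqd_unique assms by blast

lemma hqd_quot_dim:
  assumes "subspace W" "fincodim U W"
  shows "hqd U W (quot_dim scale U W)"
  using assms quot_dim_eq unfolding fincodim_def by auto

text \<open>A set of greatest size that is independent modulo \<open>W\<close> maps to a basis of \<open>U / W\<close>.\<close>

lemma hqd_ex_if_bounded:
  assumes W: "subspace W"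
    and bound: "\<And>B. finite B \<Longrightarrow> B \<subseteq> U \<Longrightarrow> indep_mod W B \<Longrightarrow> card B \<le> N"
  shows "\<exists>d\<le>N. hqd U W d"
proof -
  let ?P = "\<lambda>B. finite B \<and> B \<subseteq> U \<and> indep_mod W B"
  have "?P {}" using W subspace_0 unfolding indep_mod_def by (auto simp: independent_empty)
  then have "\<exists>B. ?P B \<and> (\<forall>B'. ?P B' \<longrightarrow> card B' \<le> card B)"
    using ex_has_greatest_nat[of ?P _ card "Suc N"] bound by (metis less_Suc_eq_le)
  then obtain B where B: "?P B" "\<And>B'. ?P B' \<Longrightarrow> card B' \<le> card B" by blast
  have "U \<subseteq> ssum (span B) W"
  proof
    fix u assume u: "u \<in> U"
    show "u \<in> ssum (span B) W"
    proof (rule ccontr)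
      assume n: "u \<notin> ssum (span B) W"
      then have "?P (insert u B)" using B(1) u indep_mod_insert[OF W] by blast
      then have "card (insert u B) \<le> card B" using B(2) by blast
      moreover have "u \<notin> B" using n ssum_superset1[OF W] span_base by blast
      ultimately show False using B(1) by simp
    qed
  qed
  then have "hqd U W (card B)" unfolding hqd_iff using B(1) by blast
  then show ?thesis using B(1) bound by blast
qed

lemma fincodimI_span:
  assumes W: "subspace W" and G: "finite G" "U \<subseteq> ssum (span G) W"
  shows "\<exists>d\<le>card G. hqd U W d"
  by (rule hqd_ex_if_bounded[OF W]) (use indep_mod_card_le[OF W G(1)] G(2) in blast)

lemma fincodim_mono:
  assumes "subspace W" "subspace V'" "W \<subseteq> V'" "V \<subseteq> U" "fincodim U W"
  shows "fincodim V V'"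
proof -
  obtain d where d: "hqd U W d" using assms(5) unfolding fincodim_def by blast
  have "\<exists>d'\<le>d. hqd V V' d'"
  proof (rule hqd_ex_if_bounded[OF assms(2)])
    fix B assume "finite B" and B: "B \<subseteq> V" "indep_mod V' B"
    have "0 \<in> W" using assms(1) subspace_0 by blast
    then have "indep_mod W B" using B(2) assms(3) span_zero unfolding indep_mod_def by blast
    then show "card B \<le> d" using hqd_indep_mod_card_le[OF assms(1) d] B(1) assms(4) by blast
  qed
  then show ?thesis unfolding fincodim_def by blast
qed

lemma independent_Un:
  assumes "finite B" "independent B" "independent A" "span A \<inter> span B = {0}"
  shows "independent (A \<union> B)"
  using assms
proof (induction B rule: finite_induct)
  case (insert b B)
  have sub: "span B \<subseteq> span (insert b B)" by (rule span_mono) blast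
  have iB: "independent B" by (rule independent_mono[OF insert.prems(1)]) blast
  have "span A \<inter> span B = {0}" using insert.prems(3) sub span_zero[of A] span_zero[of B] by blast
  then have IH: "independent (A \<union> B)" using insert.IH iB insert.prems(2) by blast
  have "b \<notin> span (A \<union> B)"
  proof
    assume "b \<in> span (A \<union> B)"
    then obtain x y where xy: "x \<in> span A" "y \<in> span B" "b = x + y" unfolding span_Un by blast
    have "x = b - y" using xy(3) by simp
    then have "x \<in> span (insert b B)" using xy(2) sub span_diff[OF span_base[of b "insert b B"]] by blast
    then have "x = 0" using xy(1) insert.prems(3) by blast
    then have "b \<in> span B" using xy by simp
    moreover have "b \<notin> span B" using insert.prems(1) insert.hyps(2)
      unfolding dependent_def by (metis Diff_insert_absorb insertI1)
    ultimately show False by blast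
  qed
  then show ?case using independent_insertI[OF _ IH] by simp
qed auto

lemma hqd_trans:
  assumes sub: "subspace W" "subspace V" "W \<subseteq> V" "V \<subseteq> U"
    and "hqd V W a" "hqd U V b"
  shows "hqd U W (a + b)"
proof -
  obtain B1 where B1: "finite B1" "B1 \<subseteq> V" "indep_mod W B1" "V \<subseteq> ssum (span B1) W" "card B1 = a"
    using assms(5) unfolding hqd_iff by blast
  obtain B2 where B2: "finite B2" "B2 \<subseteq> U" "indep_mod V B2" "U \<subseteq> ssum (span B2) V" "card B2 = b"
    using assms(6) unfolding hqd_iff by blast
  have s1: "span B1 \<subseteq> V" using B1(2) sub(2) span_minimal by blast
  have s12: "span B1 \<inter> span B2 = {0}"
    using s1 B2(3) span_zero[of B1] unfolding indep_mod_def by blast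
  have ind: "independent (B1 \<union> B2)"
    by (rule independent_Un) (use s12 B1 B2 in \<open>auto simp: indep_mod_def\<close>)
  have "0 \<notin> B1" using B1(3) dependent_zero unfolding indep_mod_def by blast
  have disj: "x \<notin> B2" if "x \<in> B1" for x
  proof
    assume "x \<in> B2"
    then have "x \<in> span B1 \<inter> span B2" using that span_base by simp
    then show False using s12 that \<open>0 \<notin> B1\<close> by auto
  qed
  have "x = 0" if x: "x \<in> span (B1 \<union> B2)" "x \<in> W" for x
  proof -
    obtain y z where yz: "y \<in> span B1" "z \<in> span B2" "x = y + z" using x(1) unfolding span_Un by blast
    have "z = x - y" using yz by simp
    then have "z \<in> V" using x(2) sub s1 yz(1) subspace_diff[of V x y] by blast
    then have "z \<in> span B2 \<inter> V" using yz(2) by simp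
    then have "z = 0" using B2(3) unfolding indep_mod_def by simp
    then show ?thesis using yz x(2) B1(3) unfolding indep_mod_def by auto
  qed
  then have "indep_mod W (B1 \<union> B2)"
    using ind span_zero sub(1) subspace_0 unfolding indep_mod_def by blast
  moreover have "U \<subseteq> ssum (span (B1 \<union> B2)) W"
  proof
    fix u assume "u \<in> U"
    then obtain y v where "y \<in> span B2" "v \<in> V" and u: "u = y + v" using B2(4) ssumE by blast
    moreover obtain z w where "z \<in> span B1" "w \<in> W" "v = z + w" using B1(4) \<open>v \<in> V\<close> ssumE by blast
    ultimately have "z + y \<in> span (B1 \<union> B2)" "w \<in> W" "u = (z + y) + w"
      unfolding span_Un by (auto simp: ac_simps)
    then show "u \<in> ssum (span (B1 \<union> B2)) W" using ssumI by metis
  qed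
  ultimately show ?thesis unfolding hqd_iff
    using B1 B2 sub(4) disj by (intro exI[of _ "B1 \<union> B2"]) (auto intro!: card_Un_disjoint)
qed

lemma quot_dim_add:
  assumes "subspace W" "subspace V" "W \<subseteq> V" "V \<subseteq> U" "fincodim V W" "fincodim U V"
  shows "fincodim U W" "quot_dim scale U W = quot_dim scale V W + quot_dim scale U V"
proof -
  have *: "hqd U W (quot_dim scale V W + quot_dim scale U V)"
    by (rule hqd_trans) (use assms hqd_quot_dim in auto)
  show "fincodim U W" using * unfolding fincodim_def by blast
  show "quot_dim scale U W = quot_dim scale V W + quot_dim scale U V"
    by (rule quot_dim_eq[OF assms(1) *])
qed

lemma hqd_refl:
  assumes "subspace U"
  shows "hqd U U 0"
proof -
  have "indep_mod U {}" using subspace_0[OF assms] unfolding indep_mod_def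
    by (simp add: independent_empty)
  moreover have "U \<subseteq> ssum (span {}) U" by (rule ssum_superset2) simp
  ultimately show ?thesis unfolding hqd_iff by (intro exI[of _ "{}"]) simp
qed

lemma fincodim_refl: "subspace U \<Longrightarrow> fincodim U U"
  using hqd_refl unfolding fincodim_def by blast

lemma quot_dim_refl: "subspace U \<Longrightarrow> quot_dim scale U U = 0"
  using quot_dim_eq hqd_refl by blast

lemma quot_dim_pos:
  assumes "subspace W" "fincodim U W" "x \<in> U" "x \<notin> W"
  shows "quot_dim scale U W > 0"
proof (rule ccontr)
  assume "\<not> ?thesis"
  then have "hqd U W 0" using hqd_quot_dim[OF assms(1,2)] by simp
  then have "U \<subseteq> ssum (span {}) W" unfolding hqd_iff by auto
  then show False using assms(3,4) unfolding ssum_def by auto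
qed

end

locale relative_dimension_pair = vs1: relative_dimension s1 + vs2: relative_dimension s2
  for s1 :: "'a::field \<Rightarrow> 'b::ab_group_add \<Rightarrow> 'b"
  and s2 :: "'a::field \<Rightarrow> 'c::ab_group_add \<Rightarrow> 'c"
begin

lemma hqd_inj_transfer:
  assumes f: "Vector_Spaces.linear s1 s2 f"
    and W: "vs1.subspace W" and U: "vs1.subspace U" and W': "vs2.subspace W'"
    and fU: "\<And>u. u \<in> U \<Longrightarrow> f u \<in> U'"
    and fW: "\<And>u. u \<in> U \<Longrightarrow> f u \<in> W' \<longleftrightarrow> u \<in> W"
    and d': "has_quot_dim s2 U' W' d'"
  shows "\<exists>d\<le>d'. has_quot_dim s1 U W d"
proof (rule vs1.hqd_ex_if_bounded[OF W])
  interpret f: Vector_Spaces.linear s1 s2 f by (rule f)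
  fix B assume B: "finite B" "B \<subseteq> U" "vs1.indep_mod W B"
  have sB: "vs1.span B \<subseteq> U" using B(2) U vs1.span_minimal by blast
  have 0: "x = 0" if "x \<in> vs1.span B" "f x \<in> W'" for x
    using that fW[of x] sB B(3) unfolding vs1.indep_mod_def by blast
  have inj: "inj_on f (vs1.span B)"
    unfolding f.inj_on_iff_eq_0[OF vs1.subspace_span] using 0 W' vs2.subspace_0 by auto
  have "vs2.indep_mod W' (f ` B)"
    unfolding vs2.indep_mod_def f.span_image
  proof
    show "vs2.independent (f ` B)"
      by (rule f.independent_injective_image[OF _ inj]) (use B(3) vs1.indep_mod_def in blast)
    have "0 \<in> f ` vs1.span B" using vs1.span_zero f.zero by (metis image_eqI)
    moreover have "y = 0" if "y \<in> f ` vs1.span B" "y \<in> W'" for y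
      using that 0 f.zero by (metis imageE)
    ultimately show "f ` vs1.span B \<inter> W' = {0}" using W' vs2.subspace_0 by blast
  qed
  then have "card (f ` B) \<le> d'"
    using vs2.hqd_indep_mod_card_le[OF W' d'] fU B(2) by blast
  moreover have "inj_on f B" using inj vs1.span_superset inj_on_subset by blast
  ultimately show "card B \<le> d'" using card_image by metis
qed

lemma hqd_iso_transfer:
  assumes f: "Vector_Spaces.linear s1 s2 f"
    and W: "vs1.subspace W" and U: "vs1.subspace U" and W': "vs2.subspace W'"
    and fU: "\<And>u. u \<in> U \<Longrightarrow> f u \<in> U'"
    and fW: "\<And>u. u \<in> U \<Longrightarrow> f u \<in> W' \<longleftrightarrow> u \<in> W"
    and surj: "\<And>y. y \<in> U' \<Longrightarrow> \<exists>u\<in>U. y - f u \<in> W'"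
  shows "has_quot_dim s1 U W d \<longleftrightarrow> has_quot_dim s2 U' W' d"
proof -
  interpret f: Vector_Spaces.linear s1 s2 f by (rule f)
  have fwd: "has_quot_dim s2 U' W' d" if d: "has_quot_dim s1 U W d" for d
  proof -
    obtain B where B: "finite B" "B \<subseteq> U" "vs1.indep_mod W B" "U \<subseteq> ssum (vs1.span B) W" "card B = d"
      using d unfolding vs1.hqd_iff by blast
    have sB: "vs1.span B \<subseteq> U" using B(2) U vs1.span_minimal by blast
    have 0: "x = 0" if "x \<in> vs1.span B" "f x \<in> W'" for x
      using that fW[of x] sB B(3) unfolding vs1.indep_mod_def by blast
    have inj: "inj_on f (vs1.span B)"
      unfolding f.inj_on_iff_eq_0[OF vs1.subspace_span] using 0 W' vs2.subspace_0 by auto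
    have ind: "vs2.indep_mod W' (f ` B)"
      unfolding vs2.indep_mod_def f.span_image
    proof
      show "vs2.independent (f ` B)"
        by (rule f.independent_injective_image[OF _ inj]) (use B(3) vs1.indep_mod_def in blast)
      have "0 \<in> f ` vs1.span B" using vs1.span_zero f.zero by (metis image_eqI)
      moreover have "y = 0" if "y \<in> f ` vs1.span B" "y \<in> W'" for y
        using that 0 f.zero by (metis imageE)
      ultimately show "f ` vs1.span B \<inter> W' = {0}" using W' vs2.subspace_0 by blast
    qed
    have "U' \<subseteq> ssum (vs2.span (f ` B)) W'"
    proof
      fix y assume y: "y \<in> U'"
      then obtain u where u: "u \<in> U" "y - f u \<in> W'" using surj by blast
      obtain b w where bw: "b \<in> vs1.span B" "w \<in> W" "u = b + w" using u(1) B(4) ssumE by blast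
      have "w = u - b" using bw(3) by simp
      then have "w \<in> U" using u(1) bw(1) sB vs1.subspace_diff[OF U] by blast
      then have "f w \<in> W'" using fW bw(2) by blast
      then have "f w + (y - f u) \<in> W'" using u(2) W' vs2.subspace_add by blast
      moreover have "y = f b + (f w + (y - f u))" using bw(3) f.add by simp
      moreover have "f b \<in> vs2.span (f ` B)" using bw(1) f.span_image by blast
      ultimately show "y \<in> ssum (vs2.span (f ` B)) W'" using ssumI by metis
    qed
    moreover have "inj_on f B" using inj vs1.span_superset inj_on_subset by blast
    ultimately show ?thesis unfolding vs2.hqd_iff
      using B(1,2,5) ind fU by (intro exI[of _ "f ` B"] conjI) (auto simp: card_image)
  qed
  have "has_quot_dim s1 U W d" if d: "has_quot_dim s2 U' W' d" for d
  proof -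
    obtain d0 where "has_quot_dim s1 U W d0"
      using hqd_inj_transfer[OF f W U W' fU fW d] by blast
    then show ?thesis using fwd vs2.hqd_unique[OF W'] d by metis
  qed
  then show ?thesis using fwd by blast
qed

end

context relative_dimension
begin

lemma hqd_second_iso:
  assumes "subspace U" "subspace W"
  shows "hqd U (U \<inter> W) d \<longleftrightarrow> hqd (ssum U W) W d"
proof -
  interpret p: relative_dimension_pair scale scale by unfold_locales
  show ?thesis
  proof (rule p.hqd_iso_transfer[where f = "\<lambda>x. x"])
    show "Vector_Spaces.linear scale scale (\<lambda>x. x)" by (rule linear_ident)
    fix u assume u: "u \<in> U"
    show "u \<in> ssum U W" using u ssum_superset1 assms(2) by blast
    show "(u \<in> W) = (u \<in> U \<inter> W)" using u by blast
  next
    fix y assume "y \<in> ssum U W"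
    then obtain u w where "u \<in> U" "w \<in> W" "y = u + w" by (elim ssumE)
    then show "\<exists>u\<in>U. y - u \<in> W" by (intro bexI[of _ u]) auto
  qed (use assms subspace_inter in auto)
qed

lemma quot_dim_second_iso:
  assumes "subspace U" "subspace W"
  shows "fincodim U (U \<inter> W) \<longleftrightarrow> fincodim (ssum U W) W"
    "quot_dim scale U (U \<inter> W) = quot_dim scale (ssum U W) W"
  using hqd_second_iso[OF assms] quot_dim_cong[OF hqd_second_iso[OF assms]]
  unfolding fincodim_def by auto

text \<open>\<open>idx U V\<close> plays the role of \<open>dim U - dim V\<close> for spaces of infinite dimension that are
  commensurable; it is additive and turns the norms and covolumes of the theorem into dimensions.\<close>

definition commens :: "'b set \<Rightarrow> 'b set \<Rightarrow> bool" where
  "commens U V \<longleftrightarrow> subspace U \<and> subspace V \<and> fincodim U (U \<inter> V) \<and> fincodim V (U \<inter> V)"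

definition idx :: "'b set \<Rightarrow> 'b set \<Rightarrow> int" where
  "idx U V = int (quot_dim scale U (U \<inter> V)) - int (quot_dim scale V (U \<inter> V))"

lemma commens_refl: "subspace U \<Longrightarrow> commens U U"
  unfolding commens_def by (simp add: fincodim_refl)

lemma commens_sym: "commens U V \<Longrightarrow> commens V U"
  unfolding commens_def by (simp add: Int_commute)

lemma idx_swap: "idx V U = - idx U V"
  unfolding idx_def by (simp add: Int_commute)

lemma idx_refl [simp]: "idx U U = 0"
  unfolding idx_def by simp

lemma commens_subset:
  assumes "subspace U" "subspace W" "W \<subseteq> U" "fincodim U W"
  shows "commens U W" "idx U W = int (quot_dim scale U W)"
proof -
  have e: "U \<inter> W = W" using assms(3) by blast
  show "commens U W" "idx U W = int (quot_dim scale U W)"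
    unfolding commens_def idx_def e using assms fincodim_refl quot_dim_refl by auto
qed

lemma idx_common:
  assumes "subspace U" "subspace V" "subspace Y" "Y \<subseteq> U" "Y \<subseteq> V" "fincodim U Y" "fincodim V Y"
  shows "commens U V" "idx U V = int (quot_dim scale U Y) - int (quot_dim scale V Y)"
proof -
  have s: "subspace (U \<inter> V)" using assms subspace_inter by blast
  have Y: "Y \<subseteq> U \<inter> V" using assms by blast
  have f1: "fincodim (U \<inter> V) Y" by (rule fincodim_mono[OF assms(3,3) _ _ assms(6)]) auto
  have f2: "fincodim U (U \<inter> V)" by (rule fincodim_mono[OF assms(3) s Y _ assms(6)]) auto
  have f3: "fincodim V (U \<inter> V)" by (rule fincodim_mono[OF assms(3) s Y _ assms(7)]) auto
  show "commens U V" unfolding commens_def using assms f2 f3 by blast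
  have "quot_dim scale U Y = quot_dim scale (U \<inter> V) Y + quot_dim scale U (U \<inter> V)"
    by (rule quot_dim_add(2)[OF assms(3) s Y _ f1 f2]) auto
  moreover have "quot_dim scale V Y = quot_dim scale (U \<inter> V) Y + quot_dim scale V (U \<inter> V)"
    by (rule quot_dim_add(2)[OF assms(3) s Y _ f1 f3]) auto
  ultimately show "idx U V = int (quot_dim scale U Y) - int (quot_dim scale V Y)"
    unfolding idx_def by simp
qed

lemma fincodim_Int:
  assumes "subspace U" "subspace V" "subspace Z" "fincodim U (U \<inter> Z)"
  shows "fincodim (U \<inter> V) (U \<inter> V \<inter> Z)"
proof -
  interpret p: relative_dimension_pair scale scale by unfold_locales
  obtain d where d: "hqd U (U \<inter> Z) d" using assms(4) unfolding fincodim_def by blast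
  have "\<exists>d'\<le>d. hqd (U \<inter> V) (U \<inter> V \<inter> Z) d'"
    by (rule p.hqd_inj_transfer[where f = "\<lambda>x. x", OF linear_ident _ _ _ _ _ d])
      (use assms subspace_inter in auto)
  then show ?thesis unfolding fincodim_def by blast
qed

text \<open>All three spaces are compared with their common intersection.\<close>

lemma commens_trans_idx:
  assumes UV: "commens U V" and VX: "commens V Z"
  shows "commens U Z" "idx U Z = idx U V + idx V Z"
proof -
  let ?Y = "U \<inter> V \<inter> Z"
  have s: "subspace U" "subspace V" "subspace Z" using assms unfolding commens_def by auto
  have sY: "subspace ?Y" using s subspace_inter by blast
  have sI: "subspace (U \<inter> V)" "subspace (V \<inter> Z)" using s subspace_inter by blast+
  have fV: "fincodim V (V \<inter> Z)" and fV': "fincodim V (V \<inter> U)"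
    and fU: "fincodim U (U \<inter> V)" and fX: "fincodim Z (V \<inter> Z)"
    using assms unfolding commens_def by (auto simp: Int_commute)
  have "fincodim (V \<inter> U) (V \<inter> U \<inter> Z)" by (rule fincodim_Int[OF s(2,1,3) fV])
  then have a: "fincodim (U \<inter> V) ?Y" by (simp add: Int_commute)
  have "fincodim (V \<inter> Z) (V \<inter> Z \<inter> U)" by (rule fincodim_Int[OF s(2,3,1) fV'])
  then have b: "fincodim (V \<inter> Z) ?Y" by (simp add: Int_ac)
  have U: "fincodim U ?Y" by (rule quot_dim_add(1)[OF sY sI(1) _ _ a fU]) auto
  have V: "fincodim V ?Y" by (rule quot_dim_add(1)[OF sY sI(1) _ _ a]) (use fV' in \<open>auto simp: Int_commute\<close>)
  have Z: "fincodim Z ?Y" by (rule quot_dim_add(1)[OF sY sI(2) _ _ b fX]) auto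
  have "idx U Z = int (quot_dim scale U ?Y) - int (quot_dim scale Z ?Y)"
    by (rule idx_common(2)[OF s(1,3) sY _ _ U Z]) auto
  moreover have "idx U V = int (quot_dim scale U ?Y) - int (quot_dim scale V ?Y)"
    by (rule idx_common(2)[OF s(1,2) sY _ _ U V]) auto
  moreover have "idx V Z = int (quot_dim scale V ?Y) - int (quot_dim scale Z ?Y)"
    by (rule idx_common(2)[OF s(2,3) sY _ _ V Z]) auto
  ultimately show "idx U Z = idx U V + idx V Z" by simp
  show "commens U Z" by (rule idx_common(1)[OF s(1,3) sY _ _ U Z]) auto
qed

text \<open>For the everywhere integral repartitions \<open>V\<close> and the constant ones \<open>D\<close> the two terms are the
  dimensions of \<open>H\<^sup>0\<close> and \<open>H\<^sup>1\<close> of the structure sheaf. It is a relation because it makes sense only if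
  both dimensions are finite.\<close>

definition euler :: "'b set \<Rightarrow> 'b set \<Rightarrow> int \<Rightarrow> bool" where
  "euler V D c \<longleftrightarrow> subspace V \<and> subspace D \<and> fincodim (V \<inter> D) {0} \<and> fincodim UNIV (ssum V D)
     \<and> c = int (quot_dim scale (V \<inter> D) {0}) - int (quot_dim scale UNIV (ssum V D))"

lemma euler_sym: "euler V D c \<Longrightarrow> euler D V c"
  unfolding euler_def by (simp add: Int_commute ssum_commute)

lemma euler_unique: "euler V D c \<Longrightarrow> euler V D c' \<Longrightarrow> c = c'"
  unfolding euler_def by simp

lemma euler_pos_ex:
  assumes "euler V D c" "c > 0"
  shows "\<exists>x \<in> V \<inter> D. x \<noteq> 0"
proof (rule ccontr)
  assume "\<not> ?thesis"
  then have "V \<inter> D = {0}" using assms(1) subspace_0 unfolding euler_def by blast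
  then show False using assms quot_dim_refl[of "{0}"] unfolding euler_def by simp
qed

text \<open>Passing from \<open>V\<close> to a subspace \<open>V'\<close> splits \<open>V / V'\<close> into the part that is lost from
  \<open>V \<inter> D\<close> and the part that is gained by the cokernel.\<close>

lemma euler_subset:
  assumes s: "subspace V" "subspace V'" "subspace D" and sub: "V' \<subseteq> V" and fin: "fincodim V V'"
  shows "euler V D c \<longleftrightarrow> euler V' D (c - int (quot_dim scale V V'))"
proof -
  define Y where "Y = ssum (V \<inter> D) V'"
  have sI: "subspace (V \<inter> D)" "subspace (V' \<inter> D)" using s subspace_inter by auto
  have sY: "subspace Y" unfolding Y_def using sI s subspace_ssum by blast
  have YV: "Y \<subseteq> V"
  proof
    fix y assume "y \<in> Y"
    then show "y \<in> V" unfolding Y_def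
      by (elim ssumE) (use sub subspace_add[OF s(1)] in blast)
  qed
  have V'Y: "V' \<subseteq> Y" unfolding Y_def by (rule ssum_superset2[OF sI(1)])
  have fY: "fincodim Y V'" by (rule fincodim_mono[OF s(2,2) _ YV fin]) auto
  have fVY: "fincodim V Y" by (rule fincodim_mono[OF s(2) sY V'Y _ fin]) auto
  have dV: "quot_dim scale V V' = quot_dim scale Y V' + quot_dim scale V Y"
    by (rule quot_dim_add(2)[OF s(2) sY V'Y YV fY fVY])
  have e1: "V \<inter> D \<inter> V' = V' \<inter> D" using sub by blast
  have i1: "fincodim (V \<inter> D) (V' \<inter> D)" "quot_dim scale (V \<inter> D) (V' \<inter> D) = quot_dim scale Y V'"
    using quot_dim_second_iso[OF sI(1) s(2)] fY unfolding e1 Y_def by auto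
  have sS: "subspace (ssum V' D)" "subspace (ssum V D)" using s subspace_ssum by auto
  have e2: "V \<inter> ssum V' D = Y"
  proof
    show "V \<inter> ssum V' D \<subseteq> Y"
    proof
      fix x assume x: "x \<in> V \<inter> ssum V' D"
      then obtain v d where vd: "v \<in> V'" "d \<in> D" "x = v + d" using ssumE by blast
      have "d = x - v" using vd(3) by simp
      then have "d \<in> V \<inter> D" using vd x sub subspace_diff[OF s(1), of x v] by blast
      then have "d + v \<in> Y" unfolding Y_def using vd(1) by (rule ssumI)
      then show "x \<in> Y" using vd(3) by (simp add: add.commute)
    qed
    have "Y \<subseteq> ssum V' D"
    proof
      fix x assume "x \<in> Y"
      then obtain d v where "d \<in> V \<inter> D" "v \<in> V'" "x = d + v" unfolding Y_def by (elim ssumE)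
      then have "v + d \<in> ssum V' D" "x = v + d" using ssumI[of v V' d D] by (auto simp: add.commute)
      then show "x \<in> ssum V' D" by simp
    qed
    then show "Y \<subseteq> V \<inter> ssum V' D" using YV by blast
  qed
  have e3: "ssum V (ssum V' D) = ssum V D"
  proof
    show "ssum V (ssum V' D) \<subseteq> ssum V D"
    proof
      fix x assume "x \<in> ssum V (ssum V' D)"
      then obtain a v d where "a \<in> V" "v \<in> V'" "d \<in> D" "x = a + (v + d)" by (elim ssumE) blast
      then show "x \<in> ssum V D" using ssumI[of "a + v" V d D] sub subspace_add[OF s(1)]
        by (auto simp: add.assoc)
    qed
    show "ssum V D \<subseteq> ssum V (ssum V' D)"
      using ssum_superset2[OF s(2), of D] unfolding ssum_def by blast
  qed
  have i2: "fincodim (ssum V D) (ssum V' D)"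
    "quot_dim scale (ssum V D) (ssum V' D) = quot_dim scale V Y"
    using quot_dim_second_iso[OF s(1) sS(1)] fVY unfolding e2 e3 by auto
  have sub0: "{0} \<subseteq> V' \<inter> D" using sI subspace_0 by blast
  have subS: "ssum V' D \<subseteq> ssum V D" unfolding ssum_def using sub by blast
  have A: "fincodim (V \<inter> D) {0} \<longleftrightarrow> fincodim (V' \<inter> D) {0}"
    using quot_dim_add(1)[OF _ sI(2) sub0 _ _ i1(1)]
      fincodim_mono[of "{0}" "{0}" "V' \<inter> D" "V \<inter> D"] sub by auto
  have A': "quot_dim scale (V \<inter> D) {0} = quot_dim scale (V' \<inter> D) {0} + quot_dim scale Y V'"
    if "fincodim (V' \<inter> D) {0}"
    using quot_dim_add(2)[OF _ sI(2) sub0 _ that i1(1)] sub i1(2) by auto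
  have B: "fincodim UNIV (ssum V D) \<longleftrightarrow> fincodim UNIV (ssum V' D)"
    using quot_dim_add(1)[OF sS subS _ i2(1)]
      fincodim_mono[OF sS subS, of UNIV UNIV] by auto
  have B': "quot_dim scale UNIV (ssum V' D) = quot_dim scale V Y + quot_dim scale UNIV (ssum V D)"
    if "fincodim UNIV (ssum V D)"
    using quot_dim_add(2)[OF sS subS _ i2(1) that] i2(2) by auto
  show ?thesis
    unfolding euler_def using A A' B B' s dV by auto
qed

lemma euler_commens1:
  assumes e: "euler V D c" and VV: "commens V V'"
  shows "euler V' D (c + idx V' V)"
proof -
  have s: "subspace V" "subspace V'" "subspace D" "subspace (V \<inter> V')"
    using assms subspace_inter unfolding commens_def euler_def by auto
  have f: "fincodim V (V \<inter> V')" "fincodim V' (V \<inter> V')" using VV unfolding commens_def by auto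
  have "euler (V \<inter> V') D (c - int (quot_dim scale V (V \<inter> V')))"
    using euler_subset[OF s(1,4,3) _ f(1)] e by auto
  then show ?thesis
    using euler_subset[OF s(2,4,3) _ f(2), of "c + idx V' V"] unfolding idx_def
    by (auto simp: Int_commute)
qed

lemma euler_commens:
  assumes e: "euler V D c" and VV: "commens V V'" and DD: "commens D D'"
  shows "euler V' D' (c + idx V' V + idx D' D)"
  using euler_commens1[OF euler_sym[OF euler_commens1[OF e VV]] DD] by (rule euler_sym)

end

context relative_dimension_pair
begin

lemma idx_transfer:
  assumes f: "Vector_Spaces.linear s1 s2 f" and inj: "inj f" and UV: "vs1.commens U V"
  shows "vs2.commens (f ` U) (f ` V)" "vs2.idx (f ` U) (f ` V) = vs1.idx U V"
proof -
  interpret f: Vector_Spaces.linear s1 s2 f by (rule f)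
  have *: "has_quot_dim s1 A (A \<inter> B) d \<longleftrightarrow> has_quot_dim s2 (f ` A) (f ` A \<inter> f ` B) d"
    if "vs1.subspace A" "vs1.subspace B" for A B d
  proof (rule hqd_iso_transfer[OF f])
    show "vs1.subspace (A \<inter> B)" using that vs1.subspace_inter by blast
    show "vs2.subspace (f ` A \<inter> f ` B)" using that f.subspace_image vs2.subspace_inter by blast
    show "\<exists>u\<in>A. y - f u \<in> f ` A \<inter> f ` B" if "y \<in> f ` A" for y
      using that f.zero vs1.subspace_0[OF \<open>vs1.subspace A\<close>] vs1.subspace_0[OF \<open>vs1.subspace B\<close>]
      by (metis (no_types, lifting) IntI diff_self image_iff)
  qed (use that inj in \<open>auto simp: inj_def\<close>)
  have s: "vs1.subspace U" "vs1.subspace V" using UV unfolding vs1.commens_def by auto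
  note 1 = *[OF s] and 2 = *[OF s(2,1)]
  show "vs2.commens (f ` U) (f ` V)"
    using UV 1 2 f.subspace_image
    unfolding vs1.commens_def vs2.commens_def vs1.fincodim_def vs2.fincodim_def
    by (auto simp: Int_commute)
  show "vs2.idx (f ` U) (f ` V) = vs1.idx U V"
    using quot_dim_cong[OF 1] quot_dim_cong[OF 2]
    unfolding vs1.idx_def vs2.idx_def by (simp add: Int_commute)
qed

end


section \<open>The local rings of the curve\<close>

text \<open>The value at \<open>t\<close> of a polynomial with coefficients in \<open>k\<close>.\<close>

definition evp :: "('k::field \<Rightarrow> 'K::field) \<Rightarrow> 'k poly \<Rightarrow> 'K \<Rightarrow> 'K" where
  "evp \<iota> p t = poly (map_poly \<iota> p) t"

locale field_ext =
  fixes \<iota> :: "'k::field \<Rightarrow> 'K::field"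
  assumes emb: "field_embedding \<iota>"
begin

lemma emb_add [simp]: "\<iota> (a + b) = \<iota> a + \<iota> b"
  and emb_mult [simp]: "\<iota> (a * b) = \<iota> a * \<iota> b"
  and emb_1 [simp]: "\<iota> 1 = 1"
  using emb unfolding field_embedding_def by auto

lemma emb_0 [simp]: "\<iota> 0 = 0"
proof -
  have "\<iota> 0 + \<iota> 0 = \<iota> 0" using emb_add[of 0 0] by (simp only: add_0_left)
  then show ?thesis by (metis add_cancel_right_right)
qed

lemma emb_uminus [simp]: "\<iota> (- a) = - \<iota> a"
  using emb_add[of a "- a"] by (simp add: eq_neg_iff_add_eq_0 add.commute)

lemma emb_diff [simp]: "\<iota> (a - b) = \<iota> a - \<iota> b"
  using emb_add[of a "- b"] by simp

lemma emb_inverse_mult: "a \<noteq> 0 \<Longrightarrow> \<iota> (inverse a) * \<iota> a = 1"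
  using emb_mult[of "inverse a" a] by simp

lemma emb_eq_0 [simp]: "\<iota> a = 0 \<longleftrightarrow> a = 0"
  using emb_inverse_mult[of a] emb_0 by (metis mult_zero_right zero_neq_one)

lemma emb_inverse [simp]: "\<iota> (inverse a) = inverse (\<iota> a)"
  using emb_inverse_mult[of a] by (cases "a = 0") (auto simp: field_simps)

lemma evp_0 [simp]: "evp \<iota> 0 t = 0"
  unfolding evp_def by simp

lemma evp_pCons [simp]: "evp \<iota> (pCons c p) t = \<iota> c + t * evp \<iota> p t"
  unfolding evp_def by (simp add: map_poly_pCons)

lemma evp_1 [simp]: "evp \<iota> 1 t = 1"
  unfolding one_pCons by simp

lemma evp_add [simp]: "evp \<iota> (p + q) t = evp \<iota> p t + evp \<iota> q t"
proof (induction p q rule: poly_induct2)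
  case (pCons a p b q)
  then show ?case by (simp add: algebra_simps)
qed simp

lemma evp_smult [simp]: "evp \<iota> (smult c p) t = \<iota> c * evp \<iota> p t"
  by (induction p) (simp_all add: algebra_simps)

lemma evp_uminus [simp]: "evp \<iota> (- p) t = - evp \<iota> p t"
  using evp_smult[of "-1" p t] by simp

lemma evp_diff [simp]: "evp \<iota> (p - q) t = evp \<iota> p t - evp \<iota> q t"
  using evp_add[of p "- q" t] by simp

lemma evp_mult [simp]: "evp \<iota> (p * q) t = evp \<iota> p t * evp \<iota> q t"
  by (induction p) (simp_all add: algebra_simps)

lemma evp_sum: "evp \<iota> (sum f A) t = (\<Sum>a\<in>A. evp \<iota> (f a) t)"
  by (induction A rule: infinite_finite_induct) simp_all

lemma evp_power [simp]: "evp \<iota> (p ^ n) t = evp \<iota> p t ^ n"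
  by (induction n) simp_all

lemma evp_monom [simp]: "evp \<iota> (monom c n) t = \<iota> c * t ^ n"
  unfolding evp_def by (simp add: map_poly_monom poly_monom)

lemma algebraic_iff: "algebraic_over (range \<iota>) t \<longleftrightarrow> (\<exists>p. p \<noteq> 0 \<and> evp \<iota> p t = 0)"
proof
  assume "algebraic_over (range \<iota>) t"
  then obtain P where P: "P \<noteq> 0" "set (coeffs P) \<subseteq> range \<iota>" "poly P t = 0"
    unfolding algebraic_over_def by blast
  have "\<exists>p. map_poly \<iota> p = P"
    using P(2)
  proof (induction P)
    case 0
    then show ?case by (intro exI[of _ 0]) simp
  next
    case (pCons a P)
    then have "set (coeffs P) \<subseteq> range \<iota>" by (auto simp: cCons_def split: if_splits)
    then obtain p where p: "map_poly \<iota> p = P" using pCons by blast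
    have "coeff (pCons a P) 0 \<in> insert 0 (range \<iota>)"
      using pCons(1) pCons.prems by (auto simp: cCons_def split: if_splits)
    then obtain b where "a = \<iota> b" using emb_0 by (metis coeff_pCons_0 insertE rangeE)
    then show ?case using p by (intro exI[of _ "pCons b p"]) (simp add: map_poly_pCons)
  qed
  then obtain p where "map_poly \<iota> p = P" by blast
  then show "\<exists>p. p \<noteq> 0 \<and> evp \<iota> p t = 0" using P unfolding evp_def by (intro exI[of _ p]) auto
next
  assume "\<exists>p. p \<noteq> 0 \<and> evp \<iota> p t = 0"
  then obtain p where p: "p \<noteq> 0" "evp \<iota> p t = 0" by blast
  have "map_poly \<iota> p \<noteq> 0" using p(1) by (simp add: map_poly_eq_0_iff)
  moreover have "set (coeffs (map_poly \<iota> p)) \<subseteq> range \<iota>"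
    by (simp add: set_coeffs_map_poly image_mono)
  ultimately show "algebraic_over (range \<iota>) t"
    using p(2) unfolding algebraic_over_def evp_def by blast
qed

end

subsection \<open>Subrings and subfields\<close>

lemma is_subringD:
  assumes "is_subring A"
  shows "1 \<in> A" "x \<in> A \<Longrightarrow> y \<in> A \<Longrightarrow> x - y \<in> A" "x \<in> A \<Longrightarrow> y \<in> A \<Longrightarrow> x * y \<in> A"
    "0 \<in> A" "x \<in> A \<Longrightarrow> - x \<in> A" "x \<in> A \<Longrightarrow> y \<in> A \<Longrightarrow> x + y \<in> A"
proof -
  have sub: "\<And>x y. x \<in> A \<Longrightarrow> y \<in> A \<Longrightarrow> x - y \<in> A" and one: "1 \<in> A"
    using assms unfolding is_subring_def by auto
  have 0: "0 \<in> A" using sub[OF one one] by simp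
  have neg: "\<And>x. x \<in> A \<Longrightarrow> - x \<in> A" using sub[OF 0] by simp
  show "1 \<in> A" "x \<in> A \<Longrightarrow> y \<in> A \<Longrightarrow> x - y \<in> A" "x \<in> A \<Longrightarrow> y \<in> A \<Longrightarrow> x * y \<in> A"
    "0 \<in> A" "x \<in> A \<Longrightarrow> - x \<in> A"
    using assms 0 neg unfolding is_subring_def by auto
  show "x \<in> A \<Longrightarrow> y \<in> A \<Longrightarrow> x + y \<in> A" using sub[of x "- y"] neg[of y] by simp
qed

lemma is_subring_sum: "is_subring A \<Longrightarrow> (\<And>i. i \<in> I \<Longrightarrow> f i \<in> A) \<Longrightarrow> sum f I \<in> A"
  by (induction I rule: infinite_finite_induct) (auto simp: is_subringD)

lemma is_subring_power: "is_subring A \<Longrightarrow> x \<in> A \<Longrightarrow> x ^ n \<in> A"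
  by (induction n) (auto simp: is_subringD)

lemma is_subring_prod: "is_subring A \<Longrightarrow> (\<And>i. i \<in> I \<Longrightarrow> f i \<in> A) \<Longrightarrow> prod f I \<in> A"
  by (induction I rule: infinite_finite_induct) (auto simp: is_subringD)

lemma is_subring_hull: "is_subring (is_subring hull S)"
  by (rule hull_in) (auto simp: is_subring_def)

lemma is_subfield_hull: "is_subfield (is_subfield hull S)"
  by (rule hull_in) (auto simp: is_subfield_def is_subring_def)

lemma is_subfieldD:
  assumes "is_subfield F"
  shows "is_subring F" "x \<in> F \<Longrightarrow> inverse x \<in> F" "x \<in> F \<Longrightarrow> y \<in> F \<Longrightarrow> x / y \<in> F"
  using assms is_subringD(3)[of F x "inverse y"]
  unfolding is_subfield_def by (auto simp: divide_inverse)

text \<open>The ring \<open>A[x]\<close>.\<close>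

definition adjoin :: "'a::field set \<Rightarrow> 'a \<Rightarrow> 'a set" where
  "adjoin A x = {poly p x | p. \<forall>i. coeff p i \<in> A}"

lemma adjoin_subring:
  assumes A: "is_subring A"
  shows "is_subring (adjoin A x)" "A \<subseteq> adjoin A x" "x \<in> adjoin A x"
proof -
  show "is_subring (adjoin A x)"
    unfolding is_subring_def
  proof (intro conjI ballI)
    show "1 \<in> adjoin A x" unfolding adjoin_def
      by (rule CollectI, rule exI[of _ 1]) (use is_subringD[OF A] in \<open>simp add: coeff_1\<close>)
    fix a b assume "a \<in> adjoin A x" "b \<in> adjoin A x"
    then obtain p q where pq: "a = poly p x" "b = poly q x" "\<And>i. coeff p i \<in> A" "\<And>i. coeff q i \<in> A"
      unfolding adjoin_def by blast
    show "a - b \<in> adjoin A x" unfolding adjoin_def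
      by (rule CollectI, rule exI[of _ "p - q"]) (use is_subringD[OF A] pq in simp)
    show "a * b \<in> adjoin A x" unfolding adjoin_def
      by (rule CollectI, rule exI[of _ "p * q"])
        (use is_subringD[OF A] pq in \<open>simp add: coeff_mult is_subring_sum[OF A]\<close>)
  qed
  show "A \<subseteq> adjoin A x"
  proof
    fix a assume "a \<in> A"
    then show "a \<in> adjoin A x" unfolding adjoin_def
      by (intro CollectI exI[of _ "[:a:]"])
        (use is_subringD[OF A] in \<open>simp add: coeff_pCons split: nat.splits\<close>)
  qed
  show "x \<in> adjoin A x" unfolding adjoin_def
    by (rule CollectI, rule exI[of _ "[:0, 1:]"])
      (use is_subringD[OF A] in \<open>simp add: coeff_pCons split: nat.splits\<close>)
qed

subsection \<open>Every transcendental function has a pole\<close>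

text \<open>A relation \<open>p(x) = 1\<close> of degree at most \<open>n\<close> with coefficients in \<open>u A\<close>. Such relations for
  \<open>x\<close> and for \<open>1/x\<close> can be combined into one of smaller degree: the relation for \<open>1/x\<close>
  eliminates the leading term.\<close>

definition unit_rel :: "'a::field set \<Rightarrow> 'a \<Rightarrow> 'a \<Rightarrow> nat \<Rightarrow> bool" where
  "unit_rel A u x n \<longleftrightarrow> (\<exists>p. degree p \<le> n \<and> (\<forall>i. coeff p i \<in> (*) u ` A) \<and> poly p x = 1)"

lemma unit_rel_reduce:
  assumes A: "is_subring A" and x: "x \<noteq> 0" and u: "u \<in> A"
    and p: "unit_rel A u x (Suc n)" and q: "unit_rel A u (inverse x) m" and m: "m \<le> Suc n"
  shows "unit_rel A u x n"
proof -
  let ?I = "(*) u ` A"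
  have I0: "0 \<in> ?I" using is_subringD(4)[OF A] by (metis imageI mult_zero_right)
  have Iadd: "a + b \<in> ?I" if "a \<in> ?I" "b \<in> ?I" for a b
    using that is_subringD(6)[OF A] by (auto simp flip: distrib_left)
  have Imult: "c * a \<in> ?I" if c: "c \<in> A" and a: "a \<in> ?I" for a c
  proof -
    obtain b where b: "b \<in> A" "a = u * b" using a by blast
    then have "c * a = u * (c * b)" by simp
    then show ?thesis using is_subringD(3)[OF A c b(1)] by blast
  qed
  have IA: "a \<in> A" if "a \<in> ?I" for a using that u is_subringD(3)[OF A] by blast
  have Isum: "sum f S \<in> ?I" if "\<And>i. i \<in> S \<Longrightarrow> f i \<in> ?I" for f :: "nat \<Rightarrow> _" and S
    using that I0 Iadd by (induction S rule: infinite_finite_induct) auto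
  obtain P where P: "degree P \<le> Suc n" "\<And>i. coeff P i \<in> ?I" "poly P x = 1"
    using p unfolding unit_rel_def by blast
  obtain Q where Q: "degree Q \<le> m" "\<And>i. coeff Q i \<in> ?I" "poly Q (inverse x) = 1"
    using q unfolding unit_rel_def by blast
  define a where "a = coeff P (Suc n)"
  define c where "c = coeff Q 0"
  define S where "S = (\<Sum>i\<in>{1..m}. monom (coeff Q i) (Suc n - i))"
  define T where "T = smult (1 - c) (P - monom a (Suc n)) + smult a S + [:c:]"
  have "poly Q (inverse x) = (\<Sum>i\<le>m. coeff Q i * inverse x ^ i)"
    unfolding poly_altdef by (rule sum.mono_neutral_left) (use Q(1) in \<open>auto simp: coeff_eq_0\<close>)
  also have "\<dots> = c + (\<Sum>i\<in>{1..m}. coeff Q i * inverse x ^ i)"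
    unfolding c_def by (subst sum.remove[of _ 0]) (auto intro!: sum.cong)
  finally have "c + (\<Sum>i\<in>{1..m}. coeff Q i * inverse x ^ i) = 1" using Q(3) by metis
  then have cS: "(\<Sum>i\<in>{1..m}. coeff Q i * inverse x ^ i) = 1 - c" by (metis add_diff_cancel_left')
  have "poly S x = (\<Sum>i\<in>{1..m}. coeff Q i * x ^ (Suc n - i))"
    unfolding S_def by (simp add: poly_sum poly_monom)
  also have "\<dots> = x ^ Suc n * (\<Sum>i\<in>{1..m}. coeff Q i * inverse x ^ i)"
    unfolding sum_distrib_left
    by (rule sum.cong) (use m x in \<open>auto simp: power_diff field_simps\<close>)
  finally have S: "poly S x = x ^ Suc n * (1 - c)" unfolding cS .
  have "poly T x = 1"
    unfolding T_def by (simp add: P(3) S poly_monom algebra_simps)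
  moreover have "coeff T i \<in> ?I" for i
  proof -
    have cA: "1 - c \<in> A" using IA[OF Q(2)[of 0]] is_subringD(1,2)[OF A] unfolding c_def by blast
    have aA: "a \<in> A" "- a \<in> A" using IA[OF P(2)] is_subringD(5)[OF A] unfolding a_def by auto
    have "- a \<in> ?I" using Imult[of "-1" a] P(2) is_subringD(1,5)[OF A] unfolding a_def by simp
    then have 1: "coeff (P - monom a (Suc n)) i \<in> ?I"
      using Iadd[OF P(2)[of i], of "- a"] P(2)[of i] I0 by (simp add: a_def)
    have 2: "coeff S i \<in> ?I" unfolding S_def coeff_sum
      by (rule Isum) (use Q(2) I0 in simp)
    have 3: "coeff [:c:] i \<in> ?I" using Q(2) I0 unfolding c_def
      by (simp add: coeff_pCons split: nat.splits)
    show ?thesis unfolding T_def coeff_add coeff_smult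
      by (intro Iadd Imult cA aA 1 2 3)
  qed
  moreover have "degree T \<le> n"
  proof (rule degree_le, intro allI impI)
    fix i assume i: "n < i"
    have "coeff (P - monom a (Suc n)) i = 0"
      using i P(1) by (cases "i = Suc n") (auto simp: a_def coeff_eq_0)
    moreover have "coeff S i = 0"
      unfolding S_def coeff_sum by (rule sum.neutral) (use i in auto)
    ultimately show "coeff T i = 0" unfolding T_def using i
      by (simp add: coeff_pCons split: nat.splits)
  qed
  ultimately show ?thesis unfolding unit_rel_def by blast
qed

text \<open>Reducing alternately the longer of the two relations ends with one of degree \<open>0\<close>, which makes \<open>u\<close>
  invertible in \<open>A\<close>.\<close>

lemma unit_rel_contra:
  assumes A: "is_subring A" and u: "u \<in> A" "inverse u \<notin> A" "u \<noteq> 0"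
  shows "x \<noteq> 0 \<Longrightarrow> unit_rel A u x n \<Longrightarrow> unit_rel A u (inverse x) m \<Longrightarrow> False"
proof (induction "n + m" arbitrary: x n m rule: less_induct)
  case less
  have no0: "\<not> unit_rel A u y 0" for y
  proof
    assume "unit_rel A u y 0"
    then obtain p where p: "degree p = 0" "coeff p 0 \<in> (*) u ` A" "poly p y = 1"
      unfolding unit_rel_def by auto
    from p(1) obtain c where "p = [:c:]" by (metis degree_eq_zeroE)
    then have "1 \<in> (*) u ` A" using p by simp
    then obtain b where "b \<in> A" "1 = u * b" by blast
    then have "inverse u \<in> A" by (metis inverse_unique)
    then show False using u(2) by blast
  qed
  obtain n' m' where nm: "n = Suc n'" "m = Suc m'"
    using no0 less.prems by (metis not0_implies_Suc)
  show False
  proof (cases "m \<le> n")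
    case True
    have "unit_rel A u x n'"
      using unit_rel_reduce[OF A less.prems(1) u(1)] less.prems(2,3) True nm by blast
    then show False using less.hyps[of n' m x] less.prems nm by simp
  next
    case False
    have "unit_rel A u (inverse x) m'"
      using unit_rel_reduce[OF A _ u(1), of "inverse x" m' n] less.prems False nm by simp
    then show False using less.hyps[of n m' x] less.prems nm by simp
  qed
qed

text \<open>A subring that is maximal among those in which \<open>u\<close> is not invertible is a valuation ring: if neither
  \<open>x\<close> nor \<open>1/x\<close> belonged to it, then \<open>u\<close> would become invertible in both extensions, contrary to the
  preceding lemma.\<close>

lemma valuation_ring_avoiding_inverse:
  assumes A0: "is_subring A0" "u \<in> A0" "inverse u \<notin> A0" "u \<noteq> (0 :: 'a :: field)"
  obtains A where "is_subring A" "A0 \<subseteq> A" "inverse u \<notin> A" "\<And>x. x \<in> A \<or> inverse x \<in> A"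
proof -
  let ?S = "{A. is_subring A \<and> A0 \<subseteq> A \<and> inverse u \<notin> A}"
  have "\<exists>M\<in>?S. \<forall>Y\<in>?S. M \<subseteq> Y \<longrightarrow> Y = M"
  proof (rule subset_Zorn_nonempty)
    show "?S \<noteq> {}" using A0 by blast
    fix C assume C: "C \<noteq> {}" "subset.chain ?S C"
    have S: "\<And>A. A \<in> C \<Longrightarrow> A \<in> ?S" using C(2) unfolding subset.chain_def by blast
    have tot: "\<And>A B. A \<in> C \<Longrightarrow> B \<in> C \<Longrightarrow> A \<subseteq> B \<or> B \<subseteq> A"
      using C(2) unfolding subset.chain_def by blast
    have "is_subring (\<Union>C)"
      unfolding is_subring_def
    proof (intro conjI ballI)
      show "1 \<in> \<Union>C" using C(1) S is_subringD(1) by blast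
      fix x y assume "x \<in> \<Union>C" "y \<in> \<Union>C"
      then obtain A where A: "A \<in> C" "x \<in> A" "y \<in> A" using tot by blast
      show "x - y \<in> \<Union>C" using A S[OF A(1)] is_subringD(2)[of A x y] by blast
      show "x * y \<in> \<Union>C" using A S[OF A(1)] is_subringD(3)[of A x y] by blast
    qed
    then show "\<Union>C \<in> ?S" using C(1) S by blast
  qed
  then obtain A where AS: "A \<in> ?S" and m: "\<forall>Y\<in>?S. A \<subseteq> Y \<longrightarrow> Y = A" by (elim bexE)
  from AS have A: "is_subring A" "A0 \<subseteq> A" "inverse u \<notin> A" by auto
  have max: "B = A" if "is_subring B" "A \<subseteq> B" "inverse u \<notin> B" for B
    using m that A(2) by simp
  have rel: "\<exists>n. unit_rel A u x n" if "x \<notin> A" for x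
  proof -
    have "adjoin A x \<noteq> A" using adjoin_subring(3)[OF A(1)] that by blast
    then have "inverse u \<in> adjoin A x" using max adjoin_subring[OF A(1)] by blast
    then obtain p where p: "inverse u = poly p x" "\<And>i. coeff p i \<in> A" unfolding adjoin_def by blast
    have "poly (smult u p) x = 1" using p(1)[symmetric] A0(4) by simp
    then show ?thesis unfolding unit_rel_def
      using p(2) by (intro exI[of _ "degree (smult u p)"] exI[of _ "smult u p"]) auto
  qed
  have "x \<in> A \<or> inverse x \<in> A" for x
  proof (rule ccontr)
    assume n: "\<not> ?thesis"
    then have "x \<noteq> 0" using is_subringD(4)[OF A(1)] by auto
    then show False
      using rel[of x] rel[of "inverse x"] n unit_rel_contra[OF A(1) _ A(3) A0(4)] A0(2) A(2) by blast
  qed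
  then show thesis using that A by blast
qed

lemma valuation_ring_divides_least:
  assumes A: "is_subring A" "\<And>x. x \<in> A \<or> inverse x \<in> (A :: 'a::field set)"
    and S: "finite S" "S \<noteq> {}" "0 \<notin> S"
  shows "\<exists>x\<in>S. \<forall>y\<in>S. y / x \<in> A"
  using S
proof (induction S rule: finite_ne_induct)
  case (singleton x)
  then show ?case using is_subringD(1)[OF A(1)] by simp
next
  case (insert z S)
  then obtain x where x: "x \<in> S" "\<And>y. y \<in> S \<Longrightarrow> y / x \<in> A" by auto
  show ?case
  proof (cases "z / x \<in> A")
    case True
    then show ?thesis using x by blast
  next
    case False
    then have xz: "x / z \<in> A" using A(2)[of "z / x"] by simp
    have x0: "x \<noteq> 0" "z \<noteq> 0" using x insert.prems by auto
    have "y / z \<in> A" if "y \<in> S" for y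
      using is_subringD(3)[OF A(1) x(2)[OF that] xz] x0 by simp
    then show ?thesis using is_subringD(1)[OF A(1)] x0 by (intro bexI[of _ z]) auto
  qed
qed

text \<open>The center of a valuation ring on the model: the coordinates are divided by one of least
  value, and the prime ideal is the set of the elements of the chart that are not units of the
  valuation ring.\<close>

lemma valuation_ring_dominates_point:
  assumes A: "is_subring A" "\<And>x. x \<in> A \<or> inverse x \<in> (A :: 'a::field set)" "F \<subseteq> A"
    and nz: "\<exists>y\<in>set xs. y \<noteq> 0"
  shows "\<exists>B \<in> projective_model F xs. B \<subseteq> A"
proof -
  note D = is_subringD[OF A(1)]
  have "\<exists>x\<in>set xs - {0}. \<forall>y\<in>set xs - {0}. y / x \<in> A"
    by (rule valuation_ring_divides_least[OF A(1,2)]) (use nz in auto)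
  then obtain x where x: "x \<in> set xs" "x \<noteq> 0" "\<And>y. y \<in> set xs - {0} \<Longrightarrow> y / x \<in> A" by blast
  then obtain i where i: "i < length xs" "xs ! i = x" by (metis in_set_conv_nth)
  let ?R = "chart_ring F xs i"
  have R: "is_subring ?R" unfolding chart_ring_def by (rule is_subring_hull)
  have RA: "?R \<subseteq> A" unfolding chart_ring_def
  proof (rule hull_minimal)
    show "F \<union> {y / xs ! i |y. y \<in> set xs} \<subseteq> A"
    proof -
      have "y / x \<in> A" if "y \<in> set xs" for y using x(3)[of y] that D(4) by (cases "y = 0") auto
      then show ?thesis using A(3) i by auto
    qed
  qed (rule A(1))
  define p where "p = {x \<in> ?R. x = 0 \<or> inverse x \<notin> A}"
  have pI: "x + y \<in> p" if xy: "x \<in> p" "y \<in> p" for x y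
  proof (rule ccontr)
    assume n: "x + y \<notin> p"
    have "x + y \<in> ?R" using xy is_subringD(6)[OF R] unfolding p_def by blast
    then have s: "x + y \<noteq> 0" "inverse (x + y) \<in> A" using n unfolding p_def by auto
    have aux: False if "b \<noteq> 0" "inverse b \<notin> A" "a / b \<in> A" "inverse (a + b) \<in> A" "a + b \<noteq> 0" for a b
    proof -
      have "(a / b + 1) * inverse (a + b) \<in> A" by (rule D(3)[OF D(6)[OF that(3) D(1)] that(4)])
      moreover have "(a / b + 1) * inverse (a + b) = inverse b"
        using that(1,5) by (simp add: field_simps)
      ultimately show False using that by simp
    qed
    have xy0: "x \<noteq> 0" "y \<noteq> 0" "inverse x \<notin> A" "inverse y \<notin> A" using n xy unfolding p_def by auto
    show False
      using A(2)[of "x / y"] aux[of y x] aux[of x y] xy0 s by (auto simp: add.commute)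
  qed
  have "prime_ideal_of ?R p"
    unfolding prime_ideal_of_def
  proof (intro conjI ballI impI)
    show "p \<subseteq> ?R" "0 \<in> p" using is_subringD(4)[OF R] unfolding p_def by auto
    show "1 \<notin> p" using D(1) unfolding p_def by simp
    fix a b assume ab: "a \<in> ?R"
    {
      assume b: "b \<in> p"
      show "a * b \<in> p"
      proof (rule ccontr)
        assume n: "a * b \<notin> p"
        have "a * b \<in> ?R" using ab b is_subringD(3)[OF R] unfolding p_def by blast
        then have "a * b \<noteq> 0" "inverse (a * b) \<in> A" using n unfolding p_def by auto
        moreover have "a \<in> A" using ab RA by blast
        ultimately have "a * inverse (a * b) \<in> A" "a * inverse (a * b) = inverse b"
          using D(3) by auto
        then have "inverse b \<in> A" by metis
        then show False using b \<open>a * b \<noteq> 0\<close> unfolding p_def by auto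
      qed
    }
    {
      assume b: "b \<in> ?R" and p: "a * b \<in> p"
      show "a \<in> p \<or> b \<in> p"
      proof (rule ccontr)
        assume "\<not> ?thesis"
        then have "a \<noteq> 0" "b \<noteq> 0" "inverse a \<in> A" "inverse b \<in> A" using ab b unfolding p_def by auto
        then have "a * b \<noteq> 0" "inverse (a * b) \<in> A" using D(3) by auto
        then show False using p unfolding p_def by auto
      qed
    }
  qed (use pI in blast)
  then have "localization_at ?R p \<in> projective_model F xs"
    using i x unfolding projective_model_def by blast
  moreover have "localization_at ?R p \<subseteq> A"
  proof
    fix y assume "y \<in> localization_at ?R p"
    then obtain a s where as: "y = a / s" "a \<in> ?R" "s \<in> ?R" "s \<notin> p" unfolding localization_at_def by blast
    then have "inverse s \<in> A" "a \<in> A" using RA unfolding p_def by auto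
    then show "y \<in> A" using D(3) as(1) by (simp add: divide_inverse)
  qed
  ultimately show ?thesis by blast
qed

text \<open>If \<open>t\<close> is transcendental, then \<open>t\<close> is not in \<open>k[1/t]\<close>, so some valuation ring contains
  \<open>k[1/t]\<close> but not \<open>t\<close>, and it dominates a local ring of the projective model.\<close>

lemma (in field_ext) transcendental_has_pole:
  assumes t: "\<not> algebraic_over (range \<iota>) t" and nz: "\<exists>y\<in>set xs. y \<noteq> 0"
  shows "\<exists>B \<in> projective_model (range \<iota>) xs. t \<notin> B"
proof -
  define u where "u = inverse t"
  have t0: "t \<noteq> 0"
  proof
    assume "t = 0"
    then have "evp \<iota> [:0, 1:] t = 0" by simp
    then show False using t unfolding algebraic_iff by (metis pCons_eq_0_iff zero_neq_one)
  qed
  have r: "is_subring (range \<iota>)"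
    unfolding is_subring_def by (auto simp flip: emb_diff emb_mult) (metis emb_1 rangeI)
  define A0 where "A0 = adjoin (range \<iota>) u"
  have "inverse u \<notin> A0"
  proof
    assume "inverse u \<in> A0"
    then obtain p where p: "t = poly p u" "\<And>i. coeff p i \<in> range \<iota>"
      unfolding A0_def adjoin_def u_def by auto
    define n where "n = degree p"
    have "t ^ n * t = t ^ n * poly p u" using p(1) by simp
    also have "\<dots> = (\<Sum>i\<le>n. coeff p i * t ^ (n - i))"
      unfolding poly_altdef sum_distrib_left n_def u_def
      by (rule sum.cong) (use t0 in \<open>auto simp: power_diff field_simps\<close>)
    finally have e: "t ^ Suc n = (\<Sum>i\<le>n. coeff p i * t ^ (n - i))" unfolding power_Suc2 .
    have "\<forall>i. \<exists>c. coeff p i = \<iota> c" using p(2) by (auto simp: image_iff)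
    from choice[OF this] obtain c where c: "\<And>i. coeff p i = \<iota> (c i)" by blast
    define h where "h = monom 1 (Suc n) - (\<Sum>i\<le>n. monom (c i) (n - i))"
    have "evp \<iota> h t = 0" unfolding h_def using e c by (simp add: evp_sum)
    moreover have "coeff h (Suc n) = 1"
    proof -
      have "coeff (\<Sum>i\<le>n. monom (c i) (n - i)) (Suc n) = 0"
        unfolding coeff_sum by (rule sum.neutral) auto
      then show ?thesis unfolding h_def by simp
    qed
    then have "h \<noteq> 0" by auto
    ultimately show False using t unfolding algebraic_iff by blast
  qed
  moreover have "is_subring A0" "u \<in> A0" "range \<iota> \<subseteq> A0"
    using adjoin_subring[OF r] unfolding A0_def by auto
  moreover have "u \<noteq> 0" using t0 unfolding u_def by simp
  ultimately obtain A where A: "is_subring A" "A0 \<subseteq> A" "inverse u \<notin> A" "\<And>x. x \<in> A \<or> inverse x \<in> A"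
    using valuation_ring_avoiding_inverse by metis
  have "range \<iota> \<subseteq> A" using A(2) \<open>range \<iota> \<subseteq> A0\<close> by blast
  then obtain B where "B \<in> projective_model (range \<iota>) xs" "B \<subseteq> A"
    using valuation_ring_dominates_point[OF A(1,4) _ nz] by blast
  then show ?thesis using A(3) unfolding u_def by auto
qed

subsection \<open>Closed points as discrete valuation rings\<close>

lemma projective_model_contains:
  assumes "A \<in> projective_model F xs" shows "F \<subseteq> A"
proof -
  obtain i p where A: "A = localization_at (chart_ring F xs i) p" and p: "prime_ideal_of (chart_ring F xs i) p"
    using assms unfolding projective_model_def by blast
  have 1: "1 \<in> chart_ring F xs i" unfolding chart_ring_def using is_subringD(1)[OF is_subring_hull] .
  show ?thesis
  proof
    fix c assume "c \<in> F"
    then have "c \<in> chart_ring F xs i" unfolding chart_ring_def by (auto intro: hull_inc)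
    moreover have "1 \<notin> p" using p unfolding prime_ideal_of_def by blast
    ultimately show "c \<in> A" unfolding A localization_at_def using 1
      by (intro CollectI exI[of _ c] exI[of _ 1]) auto
  qed
qed

lemma to_ac_subring_image:
  assumes "is_subring A"
  shows "is_subring (to_ac ` A)"
  unfolding is_subring_def
proof (intro conjI ballI)
  show "1 \<in> to_ac ` A" by (rule image_eqI[of _ _ 1]) (use is_subringD(1)[OF assms] in auto)
  fix x y assume "x \<in> to_ac ` A" "y \<in> to_ac ` A"
  then obtain a b where "x = to_ac a" "y = to_ac b" "a \<in> A" "b \<in> A" by blast
  then show "x - y \<in> to_ac ` A" "x * y \<in> to_ac ` A"
    using is_subringD(2,3)[OF assms, of a b] by (auto simp flip: to_ac_diff to_ac_mult)
qed

lemma to_ac_hull_subring: "to_ac ` (is_subring hull S) = is_subring hull (to_ac ` S)"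
proof
  have "is_subring (to_ac -` (is_subring hull (to_ac ` S)))"
    using is_subringD[OF is_subring_hull] unfolding is_subring_def by auto
  then have "is_subring hull S \<subseteq> to_ac -` (is_subring hull (to_ac ` S))"
    by (intro hull_minimal) (auto intro: hull_inc)
  then show "to_ac ` (is_subring hull S) \<subseteq> is_subring hull (to_ac ` S)" by blast
  show "is_subring hull (to_ac ` S) \<subseteq> to_ac ` (is_subring hull S)"
    by (intro hull_minimal to_ac_subring_image is_subring_hull) (auto intro: hull_inc)
qed

lemma to_ac_hull_subfield: "to_ac ` (is_subfield hull S) = is_subfield hull (to_ac ` S)"
proof
  let ?H = "is_subfield hull (to_ac ` S)" and ?G = "is_subfield hull S"
  have r: "is_subring ?H" "is_subring ?G"
    using is_subfieldD(1)[OF is_subfield_hull] by auto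
  have "is_subring (to_ac -` ?H)"
    using is_subringD[OF r(1)] unfolding is_subring_def by auto
  moreover have "\<forall>x \<in> to_ac -` ?H. inverse x \<in> to_ac -` ?H"
    using is_subfieldD(2)[OF is_subfield_hull[of "to_ac ` S"]] by auto
  ultimately have "?G \<subseteq> to_ac -` ?H"
    by (intro hull_minimal) (auto intro: hull_inc simp: is_subfield_def)
  then show "to_ac ` ?G \<subseteq> ?H" by blast
  have "\<forall>x \<in> to_ac ` ?G. inverse x \<in> to_ac ` ?G"
    using is_subfieldD(2)[OF is_subfield_hull[of S]] by (auto simp flip: to_ac_inverse)
  then have "is_subfield (to_ac ` ?G)"
    using to_ac_subring_image[OF r(2)] unfolding is_subfield_def by blast
  then show "?H \<subseteq> to_ac ` ?G"
    by (intro hull_minimal) (auto intro: hull_inc)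
qed

lemma to_ac_projective_model:
  assumes "A \<in> projective_model F xs"
  shows "to_ac ` A \<in> projective_model (to_ac ` F) (map to_ac xs)"
proof -
  obtain i p where A: "A = localization_at (chart_ring F xs i) p" and i: "i < length xs" "xs ! i \<noteq> 0"
    and p: "prime_ideal_of (chart_ring F xs i) p"
    using assms unfolding projective_model_def by blast
  have gens: "to_ac ` F \<union> {y / map to_ac xs ! i | y. y \<in> set (map to_ac xs)}
      = to_ac ` (F \<union> {y / xs ! i | y. y \<in> set xs})"
  proof -
    have "{y / map to_ac xs ! i | y. y \<in> set (map to_ac xs)} = (\<lambda>y. y / to_ac (xs ! i)) ` to_ac ` set xs"
      using i(1) by auto
    also have "\<dots> = to_ac ` (\<lambda>y. y / xs ! i) ` set xs" by (auto simp: image_image)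
    also have "(\<lambda>y. y / xs ! i) ` set xs = {y / xs ! i | y. y \<in> set xs}" by blast
    finally show ?thesis by (simp add: image_Un)
  qed
  have chart: "chart_ring (to_ac ` F) (map to_ac xs) i = to_ac ` chart_ring F xs i"
    unfolding chart_ring_def to_ac_hull_subring gens ..
  have prime: "prime_ideal_of (to_ac ` B) (to_ac ` p)" if "prime_ideal_of B p" for B p :: "'a set"
    using that unfolding prime_ideal_of_def
    by (auto simp flip: to_ac_0 to_ac_1 to_ac_add to_ac_mult simp: inj_image_mem_iff[OF inj_to_ac] simp del: to_ac_0 to_ac_1)
  have loc: "localization_at (to_ac ` B) (to_ac ` p) = to_ac ` localization_at B p" for B p :: "'a set"
  proof -
    have "localization_at (to_ac ` B) (to_ac ` p) = (\<lambda>(a, s). a / s) ` ((to_ac ` B) \<times> (to_ac ` B - to_ac ` p))"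
      unfolding localization_at_def by auto
    also have "to_ac ` B - to_ac ` p = to_ac ` (B - p)" by (simp add: image_set_diff[OF inj_to_ac])
    also have "(\<lambda>(a, s). a / s) ` ((to_ac ` B) \<times> (to_ac ` (B - p)))
      = to_ac ` (\<lambda>(a, s). a / s) ` (B \<times> (B - p))"
      by (force simp: image_iff)
    also have "(\<lambda>(a, s). a / s) ` (B \<times> (B - p)) = localization_at B p"
      unfolding localization_at_def by auto
    finally show ?thesis .
  qed
  show ?thesis
    unfolding projective_model_def A loc[symmetric]
    using i prime[OF p] chart by (intro CollectI exI[of _ i] exI[of _ "to_ac ` p"]) auto
qed

text \<open>Smoothness speaks about models inside an algebraic closure of \<open>K\<close>; the model over \<open>k\<close> itself is
  isomorphic to its image there.\<close>

lemma regular_model_to_ac: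
  assumes reg: "regular_model (to_ac ` F) (map to_ac xs)"
    and K: "model_function_field F xs = UNIV"
    and A: "A \<in> projective_model F xs"
  shows "A = UNIV \<or> is_dvr UNIV A"
proof -
  have gens: "to_ac ` F \<union> {y / x | x y. x \<in> set (map to_ac xs) \<and> y \<in> set (map to_ac xs)}
      = to_ac ` (F \<union> {y / x | x y. x \<in> set xs \<and> y \<in> set xs})"
  proof -
    have "{y / x | x y. x \<in> set (map to_ac xs) \<and> y \<in> set (map to_ac xs)}
      = to_ac ` {y / x | x y. x \<in> set xs \<and> y \<in> set xs}"
      by (auto simp: image_iff) (metis to_ac_divide)+
    then show ?thesis by (simp add: image_Un)
  qed
  have "model_function_field (to_ac ` F) (map to_ac xs) = to_ac ` model_function_field F xs"
    unfolding model_function_field_def to_ac_hull_subfield gens ..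
  then have ff: "model_function_field (to_ac ` F) (map to_ac xs) = range to_ac" using K by simp
  have "to_ac ` A = range to_ac \<or> is_dvr (range to_ac) (to_ac ` A)"
    using reg to_ac_projective_model[OF A] unfolding regular_model_def ff by blast
  then show ?thesis
  proof
    assume "to_ac ` A = range to_ac"
    then show ?thesis using inj_image_eq_iff[OF inj_to_ac] by blast
  next
    assume "is_dvr (range to_ac) (to_ac ` A)"
    then obtain v where v: "normalized_valuation (range to_ac) v"
      and Av: "to_ac ` A = {x \<in> range to_ac. x = 0 \<or> 0 \<le> v x}" unfolding is_dvr_def by blast
    have "normalized_valuation UNIV (v \<circ> to_ac)"
      unfolding normalized_valuation_def
    proof
      show "\<forall>x\<in>UNIV - {0}. \<forall>y\<in>UNIV - {0}. (v \<circ> to_ac) (x * y) = (v \<circ> to_ac) x + (v \<circ> to_ac) y \<and>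
          (x + y \<noteq> 0 \<longrightarrow> min ((v \<circ> to_ac) x) ((v \<circ> to_ac) y) \<le> (v \<circ> to_ac) (x + y))"
      proof (intro ballI)
        fix x y :: 'a assume "x \<in> UNIV - {0}" "y \<in> UNIV - {0}"
        then have "to_ac x \<in> range to_ac - {0}" "to_ac y \<in> range to_ac - {0}" by auto
        then have "v (to_ac x * to_ac y) = v (to_ac x) + v (to_ac y) \<and>
          (to_ac x + to_ac y \<noteq> 0 \<longrightarrow> min (v (to_ac x)) (v (to_ac y)) \<le> v (to_ac x + to_ac y))"
          using v unfolding normalized_valuation_def by blast
        then show "(v \<circ> to_ac) (x * y) = (v \<circ> to_ac) x + (v \<circ> to_ac) y \<and>
          (x + y \<noteq> 0 \<longrightarrow> min ((v \<circ> to_ac) x) ((v \<circ> to_ac) y) \<le> (v \<circ> to_ac) (x + y))"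
          by (simp flip: to_ac_add)
      qed
      have "v ` (range to_ac - {0}) = UNIV" using v unfolding normalized_valuation_def by blast
      moreover have "range to_ac - {0} = to_ac ` (UNIV - {0 :: 'a})" by auto
      ultimately show "(v \<circ> to_ac) ` (UNIV - {0}) = UNIV" by (metis image_comp)
    qed
    moreover have "A = {x \<in> UNIV. x = 0 \<or> 0 \<le> (v \<circ> to_ac) x}"
    proof -
      have "x \<in> A \<longleftrightarrow> to_ac x \<in> to_ac ` A" for x by (simp add: inj_image_mem_iff[OF inj_to_ac])
      then show ?thesis unfolding Av by auto
    qed
    ultimately show ?thesis unfolding is_dvr_def by blast
  qed
qed

lemma normalized_valuationD:
  assumes "normalized_valuation UNIV v"
  shows "x \<noteq> 0 \<Longrightarrow> y \<noteq> 0 \<Longrightarrow> v (x * y) = v x + v y"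
    "x \<noteq> 0 \<Longrightarrow> y \<noteq> 0 \<Longrightarrow> x + y \<noteq> 0 \<Longrightarrow> min (v x) (v y) \<le> v (x + y)"
    "\<exists>x. x \<noteq> 0 \<and> v x = n" "v 1 = 0" "x \<noteq> 0 \<Longrightarrow> v (inverse x) = - v x"
    "x \<noteq> 0 \<Longrightarrow> v (x ^ k) = int k * v x"
proof -
  show m: "x \<noteq> 0 \<Longrightarrow> y \<noteq> 0 \<Longrightarrow> v (x * y) = v x + v y" for x y
    using assms unfolding normalized_valuation_def by auto
  show "x \<noteq> 0 \<Longrightarrow> y \<noteq> 0 \<Longrightarrow> x + y \<noteq> 0 \<Longrightarrow> min (v x) (v y) \<le> v (x + y)"
    using assms unfolding normalized_valuation_def by auto
  have "n \<in> v ` (UNIV - {0})" using assms unfolding normalized_valuation_def by auto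
  then show "\<exists>x. x \<noteq> 0 \<and> v x = n" by auto
  show 1: "v 1 = 0" using m[of 1 1] by simp
  show "x \<noteq> 0 \<Longrightarrow> v (inverse x) = - v x" using m[of x "inverse x"] 1 by simp
  show "x \<noteq> 0 \<Longrightarrow> v (x ^ k) = int k * v x"
    by (induction k) (simp_all add: 1 m algebra_simps)
qed

text \<open>This uniqueness gives the definite description in \<open>ord_at\<close> a meaning.\<close>

lemma normalized_valuation_eq:
  assumes v: "normalized_valuation UNIV v" and w: "normalized_valuation UNIV w"
    and A: "{x. x = 0 \<or> 0 \<le> v x} = {x. x = 0 \<or> 0 \<le> w x}" and x: "x \<noteq> 0"
  shows "v x = w x"
proof -
  note V = normalized_valuationD[OF v] and W = normalized_valuationD[OF w]
  have ge: "0 \<le> v y \<longleftrightarrow> 0 \<le> w y" if "y \<noteq> 0" for y using A that by blast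
  have unit: "w y = 0" if "y \<noteq> 0" "v y = 0" for y
    using ge[of y] ge[of "inverse y"] V(5)[of y] W(5)[of y] that by auto
  obtain \<pi> where \<pi>: "\<pi> \<noteq> 0" "v \<pi> = 1" using V(3) by blast
  have lin: "w y = v y * w \<pi>" if y: "y \<noteq> 0" for y
  proof -
    define k where "k = nat \<bar>v y\<bar>"
    show ?thesis
    proof (cases "v y \<ge> 0")
      case True
      have "w (y * inverse (\<pi> ^ k)) = 0"
        by (rule unit) (use True y \<pi> V k_def in auto)
      then show ?thesis using True y \<pi> W k_def by auto
    next
      case False
      have "w (y * \<pi> ^ k) = 0"
        by (rule unit) (use False y \<pi> V k_def in auto)
      then show ?thesis using False y \<pi> W k_def by auto
    qed
  qed
  obtain z where z: "z \<noteq> 0" "w z = 1" using W(3) by blast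
  have "w \<pi> \<ge> 0" using ge[OF \<pi>(1)] \<pi>(2) by simp
  moreover have "v z * w \<pi> = 1" using lin[OF z(1)] z(2) by simp
  ultimately have "w \<pi> = 1" using zmult_eq_1_iff[of "v z" "w \<pi>"] by auto
  then show ?thesis using lin[OF x] by simp
qed

lemma ord_at_dvr:
  assumes "is_dvr UNIV A"
  shows "normalized_valuation UNIV (ord_at A)" "A = {x. x = 0 \<or> 0 \<le> ord_at A x}"
proof -
  let ?P = "\<lambda>v. normalized_valuation UNIV v \<and> v 0 = 0 \<and> A = {x. x = 0 \<or> 0 \<le> v x}"
  obtain v where v: "normalized_valuation UNIV v" "A = {x. x = 0 \<or> 0 \<le> v x}"
    using assms unfolding is_dvr_def by auto
  define w where "w = (\<lambda>x. if x = 0 then 0 else v x)"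
  have img: "w ` (UNIV - {0}) = v ` (UNIV - {0})" unfolding w_def by (rule image_cong) auto
  have "normalized_valuation UNIV w"
    using v(1) unfolding normalized_valuation_def img by (auto simp: w_def)
  then have w: "?P w" using v(2) by (auto simp: w_def)
  have "u = w" if u: "?P u" for u
  proof
    fix x show "u x = w x"
      using normalized_valuation_eq[of u w x] u w by (cases "x = 0") auto
  qed
  then have "?P (ord_at A)" unfolding ord_at_def by (intro theI[of ?P w]) (use w in blast)+
  then show "normalized_valuation UNIV (ord_at A)" "A = {x. x = 0 \<or> 0 \<le> ord_at A x}" by auto
qed


section \<open>Linear dependence over a rational function field\<close>

context relative_dimension
begin

lemma family_dependent:
  assumes I: "finite I" and G: "finite G" and v: "\<And>i. i \<in> I \<Longrightarrow> v i \<in> span G" and c: "card G < card I"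
  shows "\<exists>c. (\<exists>i\<in>I. c i \<noteq> 0) \<and> (\<Sum>i\<in>I. scale (c i) (v i)) = 0"
proof (cases "inj_on v I")
  case True
  have "dependent (v ` I)"
  proof (rule ccontr)
    assume "independent (v ` I)"
    then have "card (v ` I) \<le> card G" using independent_span_bound[OF G] v by blast
    then show False using card_image[OF True] c by simp
  qed
  then obtain u where u: "\<exists>w\<in>v ` I. u w \<noteq> 0" "(\<Sum>w\<in>v ` I. scale (u w) w) = 0"
    using dependent_finite[of "v ` I"] I by auto
  have "(\<Sum>i\<in>I. scale (u (v i)) (v i)) = 0"
    using u(2) sum.reindex[OF True, of "\<lambda>w. scale (u w) w"] by simp
  then show ?thesis using u(1) by (intro exI[of _ "u \<circ> v"]) auto
next
  case False
  then obtain i j where ij: "i \<in> I" "j \<in> I" "i \<noteq> j" "v i = v j" unfolding inj_on_def by blast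
  let ?c = "\<lambda>l. if l = i then 1 else if l = j then - 1 else 0"
  have "(\<Sum>l\<in>I. scale (?c l) (v l)) = (\<Sum>l\<in>{i, j}. scale (?c l) (v l))"
    by (rule sum.mono_neutral_right) (use I ij in auto)
  also have "\<dots> = 0" using ij by simp
  finally show ?thesis using ij by (intro exI[of _ ?c] conjI bexI[of _ i]) auto
qed

end

text \<open>The span over a subfield \<open>F\<close> of the same type.\<close>

definition fspan :: "'a::field set \<Rightarrow> 'a set \<Rightarrow> 'a set" where
  "fspan F B = {\<Sum>b\<in>B. c b * b | c. \<forall>b\<in>B. c b \<in> F}"

lemma fspanI: "(\<And>b. b \<in> B \<Longrightarrow> c b \<in> F) \<Longrightarrow> (\<Sum>b\<in>B. c b * b) \<in> fspan F B"
  unfolding fspan_def by blast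

lemma fspan_ex: "x \<in> fspan F B \<Longrightarrow> \<exists>c. (\<forall>b\<in>B. c b \<in> F) \<and> x = (\<Sum>b\<in>B. c b * b)"
  unfolding fspan_def by blast

lemma fspan_closed:
  assumes F: "is_subring F"
  shows "0 \<in> fspan F B" "x \<in> fspan F B \<Longrightarrow> y \<in> fspan F B \<Longrightarrow> x + y \<in> fspan F B"
    "a \<in> F \<Longrightarrow> x \<in> fspan F B \<Longrightarrow> a * x \<in> fspan F B"
    "finite B \<Longrightarrow> b \<in> B \<Longrightarrow> b \<in> fspan F B"
proof -
  note D = is_subringD[OF F]
  show "0 \<in> fspan F B" using fspanI[of B "\<lambda>_. 0" F] D(4) by simp
  show "x + y \<in> fspan F B" if x: "x \<in> fspan F B" and y: "y \<in> fspan F B"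
  proof -
    obtain c where c: "\<And>b. b \<in> B \<Longrightarrow> c b \<in> F" "x = (\<Sum>b\<in>B. c b * b)" using fspan_ex[OF x] by blast
    obtain d where d: "\<And>b. b \<in> B \<Longrightarrow> d b \<in> F" "y = (\<Sum>b\<in>B. d b * b)" using fspan_ex[OF y] by blast
    have "x + y = (\<Sum>b\<in>B. (c b + d b) * b)" unfolding c d by (simp add: sum.distrib distrib_right)
    then show ?thesis using fspanI[of B "\<lambda>b. c b + d b" F] c(1) d(1) D(6) by auto
  qed
  show "a * x \<in> fspan F B" if a: "a \<in> F" and x: "x \<in> fspan F B"
  proof -
    obtain c where c: "\<And>b. b \<in> B \<Longrightarrow> c b \<in> F" "x = (\<Sum>b\<in>B. c b * b)" using fspan_ex[OF x] by blast
    have "a * x = (\<Sum>b\<in>B. (a * c b) * b)" unfolding c by (simp add: sum_distrib_left mult.assoc)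
    then show ?thesis using fspanI[of B "\<lambda>b. a * c b" F] c(1) a D(3) by auto
  qed
  show "b \<in> fspan F B" if b: "finite B" "b \<in> B"
  proof -
    have "(\<Sum>b'\<in>B. (if b' = b then 1 else 0) * b') = (\<Sum>b'\<in>B. if b' = b then b else 0)"
      by (rule sum.cong) auto
    also have "\<dots> = b" using b by simp
    finally show ?thesis using fspanI[of B "\<lambda>b'. if b' = b then 1 else 0" F] D(1,4) by auto
  qed
qed

lemma fspan_sum:
  assumes F: "is_subring F" and f: "\<And>i. i \<in> I \<Longrightarrow> f i \<in> fspan F B"
  shows "sum f I \<in> fspan F B"
  using f by (induction I rule: infinite_finite_induct) (auto intro: fspan_closed[OF F])

lemma algebraic_over_mono: "algebraic_over F x \<Longrightarrow> F \<subseteq> G \<Longrightarrow> algebraic_over G x"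
  unfolding algebraic_over_def by blast

lemma algebraic_power_relation:
  assumes F: "is_subfield F" and z: "algebraic_over F z"
  shows "\<exists>d c. (\<forall>i. c i \<in> F) \<and> z ^ Suc d = (\<Sum>i\<le>d. c i * z ^ i)"
proof -
  obtain P where P: "P \<noteq> 0" "set (coeffs P) \<subseteq> F" "poly P z = 0"
    using z unfolding algebraic_over_def by blast
  note D = is_subringD[OF is_subfieldD(1)[OF F]]
  have cF: "coeff P i \<in> F" for i using P(2) D(4) coeff_in_coeffs[OF P(1), of i] by (cases "i \<le> degree P")
      (auto simp: coeff_eq_0)
  have "degree P \<noteq> 0"
  proof
    assume "degree P = 0"
    then obtain a where "P = [:a:]" by (metis degree_eq_zeroE)
    then show False using P by simp
  qed
  then obtain d where d: "degree P = Suc d" by (metis not0_implies_Suc)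
  define l where "l = coeff P (Suc d)"
  have l0: "l \<noteq> 0" using d P(1) unfolding l_def by (metis leading_coeff_0_iff)
  have "poly P z = (\<Sum>i\<le>d. coeff P i * z ^ i) + l * z ^ Suc d"
    unfolding poly_altdef d l_def by simp
  then have "l * z ^ Suc d = - (\<Sum>i\<le>d. coeff P i * z ^ i)"
    using P(3) by (metis add_eq_0_iff)
  then have "z ^ Suc d = - inverse l * (\<Sum>i\<le>d. coeff P i * z ^ i)"
    using l0 by (simp add: field_simps)
  also have "\<dots> = (\<Sum>i\<le>d. (- inverse l * coeff P i) * z ^ i)"
    by (simp add: sum_distrib_left mult.assoc sum_negf)
  finally have "z ^ Suc d = (\<Sum>i\<le>d. (- inverse l * coeff P i) * z ^ i)" .
  moreover have "- inverse l * coeff P i \<in> F" for i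
    using D(3)[OF D(5)[OF is_subfieldD(2)[OF F cF]] cF] unfolding l_def .
  ultimately show ?thesis by (intro exI[of _ d] exI[of _ "\<lambda>i. - inverse l * coeff P i"]) simp
qed

lemma adjoin_algebraic_finite:
  assumes F: "is_subfield F" and B: "finite B" "M \<subseteq> fspan F B"
    and z: "algebraic_over F z"
  shows "\<exists>B'. finite B' \<and> adjoin M z \<subseteq> fspan F B'"
proof -
  have Fr: "is_subring F" by (rule is_subfieldD(1)[OF F])
  obtain d c where c: "\<And>i. c i \<in> F" "z ^ Suc d = (\<Sum>i\<le>d. c i * z ^ i)"
    using algebraic_power_relation[OF F z] by blast
  define B' where "B' = (\<lambda>(b, i). b * z ^ i) ` (B \<times> {..d})"
  have fB: "finite B'" unfolding B'_def using B(1) by simp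
  have base: "b * z ^ i \<in> fspan F B'" if "b \<in> B" "i \<le> d" for b i
    by (rule fspan_closed(4)[OF Fr fB]) (use that in \<open>auto simp: B'_def\<close>)
  have zV: "z * x \<in> fspan F B'" if x: "x \<in> fspan F B'" for x
  proof -
    obtain e where e: "\<And>b. b \<in> B' \<Longrightarrow> e b \<in> F" "x = (\<Sum>b\<in>B'. e b * b)" using fspan_ex[OF x] by blast
    have "z * x = (\<Sum>b\<in>B'. e b * (z * b))"
      unfolding e(2) by (simp add: sum_distrib_left mult.left_commute)
    also have "\<dots> \<in> fspan F B'"
    proof (rule fspan_sum[OF Fr], rule fspan_closed(3)[OF Fr e(1)])
      fix w assume "w \<in> B'"
      then obtain b i where bi: "b \<in> B" "i \<le> d" "w = b * z ^ i" unfolding B'_def by auto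
      show "z * w \<in> fspan F B'"
      proof (cases "i < d")
        case True
        then show ?thesis using base[OF bi(1), of "Suc i"] bi(3) by (simp add: mult.left_commute)
      next
        case False
        then have "z * w = b * z ^ Suc d" using bi by (simp add: mult.left_commute)
        also have "\<dots> = (\<Sum>i\<le>d. c i * (b * z ^ i))"
          unfolding c(2) by (simp add: sum_distrib_left mult.left_commute)
        also have "\<dots> \<in> fspan F B'"
          by (rule fspan_sum[OF Fr], rule fspan_closed(3)[OF Fr c(1)]) (use base bi(1) in auto)
        finally show ?thesis .
      qed
    qed
    finally show ?thesis .
  qed
  have MV: "m \<in> fspan F B'" if m: "m \<in> M" for m
  proof -
    obtain e where e: "\<And>b. b \<in> B \<Longrightarrow> e b \<in> F" "m = (\<Sum>b\<in>B. e b * b)" using fspan_ex[of m F B] m B(2) by blast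
    show ?thesis unfolding e(2)
      by (rule fspan_sum[OF Fr], rule fspan_closed(3)[OF Fr e(1)]) (use base[of _ 0] in auto)
  qed
  have MzV: "m * z ^ i \<in> fspan F B'" if "m \<in> M" for m i
  proof (induction i)
    case (Suc i)
    from zV[OF this] show ?case by (simp add: mult.left_commute)
  qed (use MV[OF that] in simp)
  have "adjoin M z \<subseteq> fspan F B'"
  proof
    fix y assume "y \<in> adjoin M z"
    then obtain p where p: "y = poly p z" "\<And>i. coeff p i \<in> M" unfolding adjoin_def by blast
    show "y \<in> fspan F B'" unfolding p(1) poly_altdef
      by (rule fspan_sum[OF Fr]) (rule MzV[OF p(2)])
  qed
  then show ?thesis using fB by blast
qed

text \<open>A polynomial relation for \<open>x\<close> with nonzero constant term expresses \<open>1/x\<close> as a polynomial in \<open>x\<close>;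
  factors \<open>x\<close> of the relation are cancelled first.\<close>

lemma algebraic_inverse_mem:
  assumes F: "is_subfield F" and M: "is_subring M" "F \<subseteq> M" and x: "x \<in> M" "x \<noteq> 0"
  shows "P \<noteq> 0 \<Longrightarrow> (\<And>i. coeff P i \<in> F) \<Longrightarrow> poly P x = 0 \<Longrightarrow> inverse x \<in> M"
proof (induction P)
  case (pCons a P)
  note D = is_subringD[OF M(1)]
  have PF: "coeff P i \<in> F" for i using pCons.prems(2)[of "Suc i"] by simp
  have e: "a + x * poly P x = 0" using pCons.prems(3) by simp
  show ?case
  proof (cases "a = 0")
    case True
    then show ?thesis using pCons.IH pCons.hyps PF e x(2) by auto
  next
    case False
    have "poly P x \<in> M" unfolding poly_altdef
      by (rule is_subring_sum[OF M(1)], rule D(3)) (use PF M x is_subring_power[OF M(1)] in auto)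
    moreover have "- inverse a \<in> M"
      using D(5) is_subfieldD(2)[OF F] pCons.prems(2)[of 0] M(2) by auto
    ultimately have "- inverse a * poly P x \<in> M" using D(3) by blast
    moreover have "inverse x = - inverse a * poly P x"
    proof -
      have "x * (- inverse a * poly P x) = - inverse a * (x * poly P x)" by simp
      also have "x * poly P x = - a" using e by (metis add_eq_0_iff)
      also have "- inverse a * - a = 1" using False by simp
      finally show ?thesis by (rule inverse_unique)
    qed
    ultimately show ?thesis by simp
  qed
qed simp

text \<open>The ring generated over \<open>F\<close> by finitely many algebraic elements is finite over \<open>F\<close> and already
  closed under inverses.\<close>

lemma finitely_generated_algebraic_finite:
  assumes F: "is_subfield F" and Z: "finite Z"
    and alg: "\<And>x. algebraic_over F x" and gen: "\<And>G. is_subfield G \<Longrightarrow> F \<union> Z \<subseteq> G \<Longrightarrow> G = UNIV"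
  shows "\<exists>B. finite B \<and> fspan F B = (UNIV :: 'a::field set)"
proof -
  have Fr: "is_subring F" by (rule is_subfieldD(1)[OF F])
  have "\<exists>M B. is_subring M \<and> F \<union> Z \<subseteq> M \<and> finite B \<and> M \<subseteq> fspan F B"
    using Z
  proof (induction Z rule: finite_induct)
    case empty
    have "F \<subseteq> fspan F {1}"
    proof
      fix x assume "x \<in> F"
      then show "x \<in> fspan F {1}" using fspanI[of "{1}" "\<lambda>_. x" F] by simp
    qed
    then show ?case using Fr by (intro exI[of _ F] exI[of _ "{1}"]) auto
  next
    case (insert z Z)
    then obtain M B where M: "is_subring M" "F \<union> Z \<subseteq> M" "finite B" "M \<subseteq> fspan F B" by blast
    obtain B' where "finite B'" "adjoin M z \<subseteq> fspan F B'"
      using adjoin_algebraic_finite[OF F M(3,4) alg] by blast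
    then show ?case using adjoin_subring[OF M(1), of z] M(2)
      by (intro exI[of _ "adjoin M z"] exI[of _ B']) auto
  qed
  then obtain M B where M: "is_subring M" "F \<union> Z \<subseteq> M" "finite B" "M \<subseteq> fspan F B" by blast
  have "inverse x \<in> M" if x: "x \<in> M" for x
  proof (cases "x = 0")
    case False
    obtain P where P: "P \<noteq> 0" "set (coeffs P) \<subseteq> F" "poly P x = 0"
      using alg unfolding algebraic_over_def by blast
    have "coeff P i \<in> F" for i using P(2) is_subringD(4)[OF Fr] coeff_in_coeffs[OF P(1), of i]
      by (cases "i \<le> degree P") (auto simp: coeff_eq_0)
    then show ?thesis using algebraic_inverse_mem[OF F M(1) _ x False P(1) _ P(3)] M(2) by blast
  qed (use x in simp)
  then have "is_subfield M" using M(1) unfolding is_subfield_def by blast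
  then have "M = UNIV" using gen M(2) by blast
  then show ?thesis using M(3,4) by blast
qed

context field_ext
begin

definition rational_functions :: "'K \<Rightarrow> 'K set" where
  "rational_functions t = {evp \<iota> p t / evp \<iota> q t | p q. evp \<iota> q t \<noteq> 0}"

lemma rational_functions_subfield:
  "is_subfield (rational_functions t)" "range \<iota> \<union> {t} \<subseteq> rational_functions t"
proof -
  have I: "evp \<iota> p t / evp \<iota> q t \<in> rational_functions t" if "evp \<iota> q t \<noteq> 0" for p q
    using that unfolding rational_functions_def by blast
  show "is_subfield (rational_functions t)"
    unfolding is_subfield_def is_subring_def
  proof (intro conjI ballI)
    show "1 \<in> rational_functions t" using I[of 1 1] by simp
    fix x y assume "x \<in> rational_functions t" "y \<in> rational_functions t"
    then obtain p q r s where x: "x = evp \<iota> p t / evp \<iota> q t" "evp \<iota> q t \<noteq> 0"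
      and y: "y = evp \<iota> r t / evp \<iota> s t" "evp \<iota> s t \<noteq> 0"
      unfolding rational_functions_def by blast
    have "x - y = evp \<iota> (p * s - r * q) t / evp \<iota> (q * s) t"
      unfolding x(1) y(1) by (subst diff_frac_eq) (use x(2) y(2) in auto)
    then show "x - y \<in> rational_functions t" using I[of "q * s" "p * s - r * q"] x(2) y(2) by simp
    have "x * y = evp \<iota> (p * r) t / evp \<iota> (q * s) t"
      using x y by simp
    then show "x * y \<in> rational_functions t" using I[of "q * s" "p * r"] x(2) y(2) by simp
  next
    fix x assume "x \<in> rational_functions t"
    then obtain p q where x: "x = evp \<iota> p t / evp \<iota> q t" "evp \<iota> q t \<noteq> 0"
      unfolding rational_functions_def by blast
    show "inverse x \<in> rational_functions t"
    proof (cases "evp \<iota> p t = 0")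
      case True
      then show ?thesis using x I[of 1 0] by simp
    next
      case False
      then show ?thesis using x I[of p q] by simp
    qed
  qed
  show "range \<iota> \<union> {t} \<subseteq> rational_functions t"
    using I[of 1 "[:_:]"] I[of 1 "[:0, 1:]"] by auto
qed

end

sublocale field_ext \<subseteq> kv: relative_dimension "\<lambda>c x. \<iota> c * x"
  by unfold_locales (simp_all add: algebra_simps)

context field_ext
begin

text \<open>The elements of the \<open>k\<close>-span of the \<open>t\<^sup>i b\<close> with \<open>i \<le> n\<close> and \<open>b \<in> B\<close>.\<close>

definition bounded_span :: "'K \<Rightarrow> 'K set \<Rightarrow> nat \<Rightarrow> 'K set" where
  "bounded_span t B n = {\<Sum>b\<in>B. evp \<iota> (p b) t * b | p. \<forall>b\<in>B. degree (p b) \<le> n}"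

lemma bounded_spanI:
  "(\<And>b. b \<in> B \<Longrightarrow> degree (p b) \<le> n) \<Longrightarrow> (\<Sum>b\<in>B. evp \<iota> (p b) t * b) \<in> bounded_span t B n"
  unfolding bounded_span_def by blast

lemma bounded_span_ex:
  "x \<in> bounded_span t B n \<Longrightarrow> \<exists>p. (\<forall>b\<in>B. degree (p b) \<le> n) \<and> x = (\<Sum>b\<in>B. evp \<iota> (p b) t * b)"
  unfolding bounded_span_def by blast

lemma bounded_span_add:
  assumes "x \<in> bounded_span t B n" "y \<in> bounded_span t B n"
  shows "x + y \<in> bounded_span t B n"
proof -
  obtain p where p: "\<And>b. b \<in> B \<Longrightarrow> degree (p b) \<le> n" "x = (\<Sum>b\<in>B. evp \<iota> (p b) t * b)"
    using bounded_span_ex[OF assms(1)] by blast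
  obtain q where q: "\<And>b. b \<in> B \<Longrightarrow> degree (q b) \<le> n" "y = (\<Sum>b\<in>B. evp \<iota> (q b) t * b)"
    using bounded_span_ex[OF assms(2)] by blast
  have "x + y = (\<Sum>b\<in>B. evp \<iota> (p b + q b) t * b)"
    unfolding p q by (simp add: sum.distrib distrib_right)
  then show ?thesis using bounded_spanI[of B "\<lambda>b. p b + q b" n t] p(1) q(1)
    by (auto intro: degree_add_le)
qed

lemma bounded_span_mult:
  assumes "x \<in> bounded_span t B n" "degree h \<le> m"
  shows "evp \<iota> h t * x \<in> bounded_span t B (n + m)"
proof -
  obtain p where p: "\<And>b. b \<in> B \<Longrightarrow> degree (p b) \<le> n" "x = (\<Sum>b\<in>B. evp \<iota> (p b) t * b)"
    using bounded_span_ex[OF assms(1)] by blast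
  have "evp \<iota> h t * x = (\<Sum>b\<in>B. evp \<iota> (h * p b) t * b)"
    unfolding p by (simp add: sum_distrib_left mult.assoc)
  moreover have "degree (h * p b) \<le> n + m" if "b \<in> B" for b
    using degree_mult_le[of h "p b"] p(1)[OF that] assms(2) by linarith
  ultimately show ?thesis using bounded_spanI[of B "\<lambda>b. h * p b" "n + m" t] by auto
qed

lemma bounded_span_sum:
  assumes "\<And>i. i \<in> I \<Longrightarrow> f i \<in> bounded_span t B n"
  shows "sum f I \<in> bounded_span t B n"
  using assms
proof (induction I rule: infinite_finite_induct)
  case empty
  then show ?case using bounded_spanI[of B "\<lambda>_. 0" n t] by simp
qed (auto intro: bounded_span_add simp: bounded_spanI[of B "\<lambda>_. 0" n t, simplified])

lemma bounded_span_mono: "n \<le> m \<Longrightarrow> bounded_span t B n \<subseteq> bounded_span t B m"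
  unfolding bounded_span_def by fastforce

lemma bounded_span_subset_span:
  "bounded_span t B n \<subseteq> kv.span ((\<lambda>(b, i). t ^ i * b) ` (B \<times> {..n}))"
proof
  fix x assume "x \<in> bounded_span t B n"
  from bounded_span_ex[OF this]
  obtain p where p: "\<And>b. b \<in> B \<Longrightarrow> degree (p b) \<le> n" "x = (\<Sum>b\<in>B. evp \<iota> (p b) t * b)" by blast
  have ev: "evp \<iota> (p b) t * b = (\<Sum>i\<le>n. \<iota> (coeff (p b) i) * (t ^ i * b))" if "b \<in> B" for b
  proof -
    have "p b = (\<Sum>i\<le>n. monom (coeff (p b) i) i)"
      using poly_as_sum_of_monoms'[OF p(1)[OF that]] by simp
    then have "evp \<iota> (p b) t = (\<Sum>i\<le>n. \<iota> (coeff (p b) i) * t ^ i)"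
      by (metis (no_types, lifting) evp_monom evp_sum sum.cong)
    then show ?thesis by (simp add: sum_distrib_right mult.assoc)
  qed
  show "x \<in> kv.span ((\<lambda>(b, i). t ^ i * b) ` (B \<times> {..n}))"
    unfolding p(2)
  proof (rule kv.span_sum)
    fix b assume b: "b \<in> B"
    show "evp \<iota> (p b) t * b \<in> kv.span ((\<lambda>(b, i). t ^ i * b) ` (B \<times> {..n}))"
      unfolding ev[OF b]
      by (intro kv.span_sum kv.span_scale kv.span_base) (use b in auto)
  qed
qed

lemma rational_functions_common_denominator:
  assumes "finite I" "\<And>i. i \<in> I \<Longrightarrow> x i \<in> rational_functions t"
  shows "\<exists>q p. evp \<iota> q t \<noteq> 0 \<and> (\<forall>i\<in>I. evp \<iota> q t * x i = evp \<iota> (p i) t)"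
  using assms
proof (induction I rule: finite_induct)
  case empty
  then show ?case by (intro exI[of _ 1]) simp
next
  case (insert j I)
  then obtain q p where qp: "evp \<iota> q t \<noteq> 0" "\<And>i. i \<in> I \<Longrightarrow> evp \<iota> q t * x i = evp \<iota> (p i) t" by auto
  obtain r s where rs: "x j = evp \<iota> r t / evp \<iota> s t" "evp \<iota> s t \<noteq> 0"
    using insert.prems[of j] unfolding rational_functions_def by blast
  define p' where "p' = (\<lambda>i. if i = j then q * r else s * p i)"
  have "evp \<iota> (s * q) t * x i = evp \<iota> (p' i) t" if "i \<in> insert j I" for i
  proof (cases "i = j")
    case True
    then show ?thesis unfolding p'_def using rs by simp
  next
    case False
    then show ?thesis unfolding p'_def using qp(2)[of i] that by (simp add: mult.assoc)
  qed
  moreover have "evp \<iota> (s * q) t \<noteq> 0" using qp(1) rs(2) by simp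
  ultimately show ?case by blast
qed

lemma bounded_span_common_denominator:
  assumes B: "finite B" "fspan (rational_functions t) B = UNIV" and I: "finite I"
  shows "\<exists>q n. evp \<iota> q t \<noteq> 0 \<and> (\<forall>i\<in>I. evp \<iota> q t * x i \<in> bounded_span t B n)"
proof -
  have "\<forall>i. \<exists>c. (\<forall>b\<in>B. c b \<in> rational_functions t) \<and> x i = (\<Sum>b\<in>B. c b * b)"
  proof
    fix i
    have "x i \<in> fspan (rational_functions t) B" using B(2) by simp
    then show "\<exists>c. (\<forall>b\<in>B. c b \<in> rational_functions t) \<and> x i = (\<Sum>b\<in>B. c b * b)"
      by (rule fspan_ex)
  qed
  from choice[OF this] obtain c where c: "\<And>i b. b \<in> B \<Longrightarrow> c i b \<in> rational_functions t"
    "\<And>i. x i = (\<Sum>b\<in>B. c i b * b)" by blast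
  obtain q p where q: "evp \<iota> q t \<noteq> 0"
    and p: "\<And>z. z \<in> I \<times> B \<Longrightarrow> evp \<iota> q t * c (fst z) (snd z) = evp \<iota> (p z) t"
    using rational_functions_common_denominator[of "I \<times> B" "\<lambda>z. c (fst z) (snd z)" t] I B(1) c(1)
    by fastforce
  define n where "n = (\<Sum>z\<in>I \<times> B. degree (p z))"
  have "evp \<iota> q t * x i \<in> bounded_span t B n" if i: "i \<in> I" for i
  proof -
    have "evp \<iota> q t * x i = (\<Sum>b\<in>B. (evp \<iota> q t * c i b) * b)"
      unfolding c(2) by (simp add: sum_distrib_left mult.assoc)
    also have "\<dots> = (\<Sum>b\<in>B. evp \<iota> (p (i, b)) t * b)"
      by (rule sum.cong) (use p[of "(i, _)"] i in auto)
    also have "\<dots> \<in> bounded_span t B n"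
      by (rule bounded_spanI) (use i I B(1) in \<open>auto simp: n_def intro!: member_le_sum\<close>)
    finally show ?thesis .
  qed
  then show ?thesis using q by blast
qed

text \<open>If \<open>K\<close> is spanned over \<open>k(s)\<close> by \<open>B\<close> and multiplication by \<open>t\<close> raises the degrees in \<open>s\<close>
  by at most \<open>e\<close>, then the products \<open>t\<^sup>a y\<^sub>i\<close> with \<open>a \<le> A\<close> have coordinates of degree about \<open>e A\<close>.
  So more than \<open>e \<cdot> card B\<close> elements \<open>y\<^sub>i\<close> give too many products for large \<open>A\<close>.\<close>

lemma dependent_over_polynomials:
  assumes B: "finite B" "fspan (rational_functions s) B = UNIV"
  shows "\<exists>N. \<forall>y::nat \<Rightarrow> 'K. \<exists>f. (\<exists>i\<le>N. f i \<noteq> 0) \<and> (\<Sum>i\<le>N. evp \<iota> (f i) t * y i) = 0"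
proof -
  obtain H e0 where H: "evp \<iota> H s \<noteq> 0" "\<And>b. b \<in> B \<Longrightarrow> evp \<iota> H s * (t * b) \<in> bounded_span s B e0"
    using bounded_span_common_denominator[OF B B(1), of "\<lambda>b. t * b"] by blast
  define e where "e = e0 + degree H"
  define D where "D = card B"
  have step: "evp \<iota> H s * t * x \<in> bounded_span s B (n + e)" if x: "x \<in> bounded_span s B n" for x n
  proof -
    obtain p where p: "\<And>b. b \<in> B \<Longrightarrow> degree (p b) \<le> n" "x = (\<Sum>b\<in>B. evp \<iota> (p b) s * b)"
      using bounded_span_ex[OF x] by blast
    have "evp \<iota> H s * t * x = (\<Sum>b\<in>B. evp \<iota> (p b) s * (evp \<iota> H s * (t * b)))"
      unfolding p by (simp add: sum_distrib_left mult_ac)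
    also have "\<dots> \<in> bounded_span s B (e0 + n)"
      by (rule bounded_span_sum, rule bounded_span_mult[OF H(2) p(1)]) auto
    also have "\<dots> \<subseteq> bounded_span s B (n + e)" by (rule bounded_span_mono) (simp add: e_def)
    finally show ?thesis .
  qed
  have step': "evp \<iota> H s * x \<in> bounded_span s B (n + e)" if "x \<in> bounded_span s B n" for x n
    using bounded_span_mult[OF that, of H e] by (simp add: e_def)
  have steps: "evp \<iota> H s ^ (a + c) * t ^ a * x \<in> bounded_span s B (n + (a + c) * e)"
    if x: "x \<in> bounded_span s B n" for x n a c
  proof -
    have 1: "evp \<iota> H s ^ a * t ^ a * x \<in> bounded_span s B (n + a * e)"
    proof (induction a)
      case (Suc a)
      from step[OF Suc] show ?case by (simp add: mult_ac add_ac)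
    qed (use x in simp)
    have "evp \<iota> H s ^ c * (evp \<iota> H s ^ a * t ^ a * x) \<in> bounded_span s B (n + a * e + c * e)"
    proof (induction c)
      case (Suc c)
      from step'[OF Suc] show ?case by (simp add: mult_ac add_ac)
    qed (use 1 in simp)
    moreover have "n + a * e + c * e = n + (a + c) * e" by (simp add: distrib_right)
    ultimately show ?thesis by (simp only: power_add mult_ac)
  qed
  show ?thesis
  \<comment> \<open>Here \<open>D\<close> bounds the rank over \<open>k(s)\<close> and \<open>e\<close> bounds the growth of the degree, denominators included.\<close>
  proof (rule exI[of _ "D * e"], rule allI)
    fix y :: "nat \<Rightarrow> 'K"
    let ?N = "D * e"
    obtain h n0 where h: "evp \<iota> h s \<noteq> 0" "\<And>i. i \<in> {..?N} \<Longrightarrow> evp \<iota> h s * y i \<in> bounded_span s B n0"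
      using bounded_span_common_denominator[OF B, of "{..?N}" y] by blast
    define A where "A = D * n0 + D"
    define G where "G = (\<lambda>(b, i). s ^ i * b) ` (B \<times> {..n0 + A * e})"
    define v where "v = (\<lambda>(a, i). evp \<iota> H s ^ A * evp \<iota> h s * (t ^ a * y i))"
    let ?I = "{..A} \<times> {..?N}"
    have "v z \<in> kv.span G" if z: "z \<in> ?I" for z
    proof -
      obtain a i where ai: "z = (a, i)" "a \<le> A" "i \<le> ?N" using z by auto
      have "evp \<iota> H s ^ (a + (A - a)) * t ^ a * (evp \<iota> h s * y i) \<in> bounded_span s B (n0 + (a + (A - a)) * e)"
        by (rule steps) (use h(2) ai in simp)
      then have "v z \<in> bounded_span s B (n0 + A * e)"
        using ai unfolding v_def by (simp add: mult_ac)
      then show ?thesis using bounded_span_subset_span unfolding G_def by blast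
    qed
    moreover have "card G < card ?I"
    proof -
      have "card G \<le> card (B \<times> {..n0 + A * e})" unfolding G_def by (rule card_image_le) (use B in simp)
      also have "\<dots> = D * (n0 + A * e + 1)" by (simp add: D_def card_cartesian_product)
      also have "\<dots> < (A + 1) * (D * e + 1)" unfolding A_def by (simp add: algebra_simps)
      finally show ?thesis by simp
    qed
    moreover have "finite G" unfolding G_def using B(1) by simp
    ultimately obtain c where c: "\<exists>z\<in>?I. c z \<noteq> 0" "(\<Sum>z\<in>?I. \<iota> (c z) * v z) = 0"
      using kv.family_dependent[of ?I G v] by auto
    define f where "f = (\<lambda>i. \<Sum>a\<le>A. monom (c (a, i)) a)"
    have cf: "coeff (f i) a = c (a, i)" if "a \<le> A" for a i
      unfolding f_def coeff_sum using that by simp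
    have "\<exists>i\<le>?N. f i \<noteq> 0"
    proof -
      obtain a i where ai: "a \<le> A" "i \<le> ?N" "c (a, i) \<noteq> 0" using c(1) by auto
      then have "f i \<noteq> 0" using cf[of a i] by auto
      then show ?thesis using ai by blast
    qed
    moreover have "(\<Sum>i\<le>?N. evp \<iota> (f i) t * y i) = 0"
    proof -
      have "0 = (\<Sum>a\<le>A. \<Sum>i\<le>?N. \<iota> (c (a, i)) * v (a, i))"
        using c(2) by (simp add: sum.cartesian_product case_prod_unfold)
      also have "\<dots> = (\<Sum>i\<le>?N. \<Sum>a\<le>A. \<iota> (c (a, i)) * v (a, i))" by (rule sum.swap)
      also have "\<dots> = evp \<iota> H s ^ A * evp \<iota> h s * (\<Sum>i\<le>?N. evp \<iota> (f i) t * y i)"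
        unfolding f_def evp_sum v_def
        by (simp add: sum_distrib_left sum_distrib_right mult_ac)
      finally show ?thesis using H(1) h(1) by simp
    qed
    ultimately show "\<exists>f. (\<exists>i\<le>?N. f i \<noteq> 0) \<and> (\<Sum>i\<le>?N. evp \<iota> (f i) t * y i) = 0" by blast
  qed
qed

lemma function_field_dependent:
  assumes td: "transcendence_degree_one (range \<iota>)"
    and K: "model_function_field (range \<iota>) xs = UNIV"
  shows "\<exists>N. \<forall>y::nat \<Rightarrow> 'K. \<exists>f. (\<exists>i\<le>N. f i \<noteq> 0) \<and> (\<Sum>i\<le>N. evp \<iota> (f i) t * y i) = 0"
proof -
  obtain s where s: "\<And>x. algebraic_over (is_subfield hull (range \<iota> \<union> {s})) x"
    using td unfolding transcendence_degree_one_def by blast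
  have "is_subfield hull (range \<iota> \<union> {s}) \<subseteq> rational_functions s"
    by (rule hull_minimal) (use rational_functions_subfield in auto)
  then have alg: "algebraic_over (rational_functions s) x" for x
    using algebraic_over_mono s by blast
  have "{y / x | x y. x \<in> set xs \<and> y \<in> set xs} = (\<lambda>(x, y). y / x) ` (set xs \<times> set xs)" by auto
  then have fin: "finite {y / x | x y. x \<in> set xs \<and> y \<in> set xs}" by simp
  obtain B where "finite B" "fspan (rational_functions s) B = UNIV"
  proof -
    have "\<exists>B. finite B \<and> fspan (rational_functions s) B = UNIV"
    proof (rule finitely_generated_algebraic_finite[OF rational_functions_subfield(1) fin alg])
      fix G :: "'K set" assume G: "is_subfield G"
        "rational_functions s \<union> {y / x | x y. x \<in> set xs \<and> y \<in> set xs} \<subseteq> G"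
      have "model_function_field (range \<iota>) xs \<subseteq> G"
        unfolding model_function_field_def
        by (rule hull_minimal) (use G rational_functions_subfield(2)[of s] in auto)
      then show "G = UNIV" using K by blast
    qed
    then show thesis using that by blast
  qed
  then show ?thesis by (rule dependent_over_polynomials)
qed

end


section \<open>Valuations and strong approximation\<close>

lemma sum_fun_apply: "sum f A x = (\<Sum>a\<in>A. f a x)"
  by (induction A rule: infinite_finite_induct) (simp_all add: zero_fun_def plus_fun_def)

text \<open>The power \<open>m\<^sub>P\<^sup>n\<close> of the maximal ideal, also for negative \<open>n\<close>; it contains \<open>0\<close>, where the value of
  \<open>ord_at\<close> is meaningless.\<close>

definition pw :: "'K::field set \<Rightarrow> int \<Rightarrow> 'K set" where
  "pw P n = {x. x = 0 \<or> n \<le> ord_at P x}"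

text \<open>The properties of a smooth projective curve that the proof uses. The assumption \<open>dep\<close> bounds, for
  each \<open>t\<close>, the rank of \<open>K\<close> over \<open>k[t]\<close>; for transcendental \<open>t\<close> it says that \<open>K\<close> is finite over
  \<open>k(t)\<close>.\<close>

locale curve = field_ext \<iota> for \<iota> :: "'k::field \<Rightarrow> 'K::field" +
  fixes C :: "'K set set" and g :: nat
  assumes dvr: "P \<in> closed_points C \<Longrightarrow> is_dvr UNIV P"
    and const: "P \<in> closed_points C \<Longrightarrow> range \<iota> \<subseteq> P"
    and pole: "\<not> algebraic_over (range \<iota>) t \<Longrightarrow> \<exists>P\<in>closed_points C. t \<notin> P"
    and dep: "\<exists>N. \<forall>y::nat \<Rightarrow> 'K. \<exists>f. (\<exists>i\<le>N. f i \<noteq> 0) \<and> (\<Sum>i\<le>N. evp \<iota> (f i) t * y i) = 0"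
    and genus: "has_genus \<iota> C g"

lemma smooth_curve_imp_curve:
  assumes sm: "smooth_projective_geom_integral_curve \<iota> C" and g: "has_genus \<iota> C g"
    and ne: "closed_points C \<noteq> {}"
  shows "curve \<iota> C g"
proof -
  interpret field_ext \<iota>
    using sm unfolding smooth_projective_geom_integral_curve_def by unfold_locales blast
  obtain xs where xs: "C = projective_model (range \<iota>) xs" "model_function_field (range \<iota>) xs = UNIV"
    "smooth_model \<iota> xs" and td: "transcendence_degree_one (range \<iota>)"
    using sm unfolding smooth_projective_geom_integral_curve_def by blast
  \<comment> \<open>Smoothness is applied to the extension \<open>k' = k\<close>.\<close>
  let ?k = "range (to_ac \<circ> \<iota>)"
  have k: "?k = to_ac ` range \<iota>" by (simp add: image_comp)
  have sf: "is_subfield (range \<iota>)"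
    unfolding is_subfield_def is_subring_def
    by (auto simp flip: emb_diff emb_mult emb_inverse) (metis emb_1 rangeI)
  have "is_subfield ?k"
    unfolding is_subfield_def
  proof
    show "is_subring ?k" unfolding k by (rule to_ac_subring_image) (rule is_subfieldD(1)[OF sf])
    show "\<forall>x\<in>?k. inverse x \<in> ?k" by (auto simp flip: to_ac_inverse emb_inverse)
  qed
  moreover have "?k \<subseteq> base_closure \<iota>"
  proof
    fix z assume z: "z \<in> ?k"
    have "poly [:-z, 1:] z = 0" "[:-z, 1:] \<noteq> 0" by simp_all
    moreover have "- z \<in> ?k" using z by (auto simp flip: to_ac_minus emb_uminus)
    moreover have "1 \<in> ?k" by (metis comp_apply emb_1 rangeI to_ac_1)
    ultimately show "z \<in> base_closure \<iota>" unfolding base_closure_def algebraic_over_def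
      by (intro CollectI exI[of _ "[:-z, 1:]"]) (auto simp: cCons_def)
  qed
  ultimately have reg: "regular_model (to_ac ` range \<iota>) (map to_ac xs)"
    using xs(3) unfolding smooth_model_def k by blast
  show ?thesis
  proof (unfold_locales)
    fix P assume P: "P \<in> closed_points C"
    show "is_dvr UNIV P"
      using regular_model_to_ac[OF reg xs(2), of P] P unfolding closed_points_def xs(1) by blast
    show "range \<iota> \<subseteq> P"
      using projective_model_contains[of P "range \<iota>" xs] P unfolding closed_points_def xs(1) by blast
  next
    fix t assume t: "\<not> algebraic_over (range \<iota>) t"
    obtain i where "i < length xs" "xs ! i \<noteq> 0"
      using ne unfolding closed_points_def xs(1) projective_model_def by blast
    then have "\<exists>y\<in>set xs. y \<noteq> 0" by auto
    then obtain B where B: "B \<in> projective_model (range \<iota>) xs" "t \<notin> B"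
      using transcendental_has_pole[OF t] by blast
    then show "\<exists>P\<in>closed_points C. t \<notin> P"
      unfolding closed_points_def xs(1) by blast
  qed (use function_field_dependent[OF td xs(2)] g in blast)+
qed

context curve
begin

abbreviation pts :: "'K set set" where "pts \<equiv> closed_points C"

lemma ord_val: "P \<in> pts \<Longrightarrow> normalized_valuation UNIV (ord_at P)"
  by (rule ord_at_dvr(1)[OF dvr])

lemmas ord_mult = normalized_valuationD(1)[OF ord_val]
  and ord_ex = normalized_valuationD(3)[OF ord_val]
  and ord_one = normalized_valuationD(4)[OF ord_val]
  and ord_inverse = normalized_valuationD(5)[OF ord_val]
  and ord_power = normalized_valuationD(6)[OF ord_val]

lemma pw_iff: "x \<noteq> 0 \<Longrightarrow> x \<in> pw P n \<longleftrightarrow> n \<le> ord_at P x"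
  unfolding pw_def by simp

lemma pw_zero [simp]: "0 \<in> pw P n"
  unfolding pw_def by simp

lemma pw_0_eq: "P \<in> pts \<Longrightarrow> pw P 0 = P"
  using ord_at_dvr(2)[OF dvr] unfolding pw_def by simp

lemma mem_iff: "P \<in> pts \<Longrightarrow> x \<noteq> 0 \<Longrightarrow> x \<in> P \<longleftrightarrow> 0 \<le> ord_at P x"
  using pw_iff[of x P 0] by (simp add: pw_0_eq)

lemma pw_mono: "n \<le> m \<Longrightarrow> pw P m \<subseteq> pw P n"
  unfolding pw_def by auto

lemma pw_monoD: "x \<in> pw P m \<Longrightarrow> n \<le> m \<Longrightarrow> x \<in> pw P n"
  using pw_mono by blast

lemma pw_mult: "P \<in> pts \<Longrightarrow> x \<in> pw P a \<Longrightarrow> y \<in> pw P b \<Longrightarrow> x * y \<in> pw P (a + b)"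
  unfolding pw_def by (cases "x = 0 \<or> y = 0") (auto simp: ord_mult)

lemma pw_add: "P \<in> pts \<Longrightarrow> x \<in> pw P n \<Longrightarrow> y \<in> pw P n \<Longrightarrow> x + y \<in> pw P n"
  using normalized_valuationD(2)[OF ord_val, of P x y] unfolding pw_def by force

lemma ord_const: "P \<in> pts \<Longrightarrow> c \<noteq> 0 \<Longrightarrow> ord_at P (\<iota> c) = 0"
proof -
  assume P: "P \<in> pts" and c: "c \<noteq> 0"
  have ge: "0 \<le> ord_at P (\<iota> d)" if "d \<noteq> 0" for d
    using const[OF P] ord_at_dvr(2)[OF dvr[OF P]] that emb_eq_0[of d] by blast
  show ?thesis using ge[OF c] ge[of "inverse c"] c ord_inverse[OF P, of "\<iota> c"] by simp
qed

lemma const_pw: "P \<in> pts \<Longrightarrow> \<iota> c \<in> pw P 0"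
  using const pw_0_eq by blast

lemma pw_scale: "P \<in> pts \<Longrightarrow> x \<in> pw P n \<Longrightarrow> \<iota> c * x \<in> pw P n"
  using pw_mult[OF _ const_pw, of P x n c] by simp

lemma pw_uminus: "P \<in> pts \<Longrightarrow> x \<in> pw P n \<Longrightarrow> - x \<in> pw P n"
  using pw_scale[of P x n "-1"] by simp

lemma pw_diff: "P \<in> pts \<Longrightarrow> x \<in> pw P n \<Longrightarrow> y \<in> pw P n \<Longrightarrow> x - y \<in> pw P n"
  using pw_add[OF _ _ pw_uminus, of P x n y] by simp

lemma pw_sum: "P \<in> pts \<Longrightarrow> (\<And>i. i \<in> I \<Longrightarrow> f i \<in> pw P n) \<Longrightarrow> sum f I \<in> pw P n"
  by (induction I rule: infinite_finite_induct) (auto intro: pw_add)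

lemma pw_subspace: "P \<in> pts \<Longrightarrow> kv.subspace (pw P n)"
  by (rule kv.subspaceI) (auto intro: pw_add pw_scale)

lemma pw_power: "P \<in> pts \<Longrightarrow> x \<in> pw P a \<Longrightarrow> x ^ k \<in> pw P (int k * a)"
  unfolding pw_def using ord_power[of P x k] ord_one[of P]
  by (cases "x = 0"; cases k) (auto intro: mult_left_mono simp: ord_one)

lemma pts_subring:
  assumes "P \<in> pts"
  shows "is_subring P"
proof -
  have "1 \<in> P" using const[OF assms] emb_1 by (metis rangeI subsetD)
  moreover have "x - y \<in> P" "x * y \<in> P" if "x \<in> P" "y \<in> P" for x y
    using pw_diff[OF assms, of x 0 y] pw_mult[OF assms, of x 0 y 0] that by (simp_all add: pw_0_eq[OF assms])
  ultimately show ?thesis unfolding is_subring_def by blast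
qed

lemma max_ideal_eq: "P \<in> pts \<Longrightarrow> max_ideal P = pw P 1"
proof -
  assume P: "P \<in> pts"
  have "x \<in> max_ideal P \<longleftrightarrow> x \<in> pw P 1" for x
  proof (cases "x = 0")
    case True
    then show ?thesis using is_subringD(4)[OF pts_subring[OF P]] unfolding max_ideal_def by simp
  next
    case False
    then show ?thesis using mem_iff[OF P, of x] mem_iff[OF P, of "inverse x"] pw_iff[of x P 1]
        ord_inverse[OF P, of x]
      unfolding max_ideal_def by auto
  qed
  then show ?thesis by blast
qed

lemma not_in_pw1:
  assumes "P \<in> pts" "x \<in> P" "x \<notin> pw P 1"
  shows "x \<noteq> 0" "ord_at P x = 0"
proof -
  show x: "x \<noteq> 0" using assms(3) by auto
  show "ord_at P x = 0" using assms pw_iff[OF x, of P 1] pw_iff[OF x, of P 0] pw_0_eq[OF assms(1)] by simp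
qed

lemma one_plus_pw1:
  assumes P: "P \<in> pts" and x: "x - 1 \<in> pw P 1"
  shows "x \<noteq> 0" "ord_at P x = 0" "x \<in> P" "x \<notin> pw P 1"
proof -
  have n1: "1 \<notin> pw P 1" unfolding pw_def using ord_one[OF P] by simp
  show n: "x \<notin> pw P 1"
  proof
    assume "x \<in> pw P 1"
    then have "x - (x - 1) \<in> pw P 1" using x pw_diff[OF P] by blast
    then show False using n1 by simp
  qed
  have "x - 1 \<in> P" using pw_monoD[OF x, of 0] pw_0_eq[OF P] by simp
  then have "(x - 1) + 1 \<in> P" using is_subringD(1,6)[OF pts_subring[OF P]] by blast
  then show xP: "x \<in> P" by simp
  show "x \<noteq> 0" "ord_at P x = 0" using not_in_pw1[OF P xP n] by auto
qed

lemma unit_mem: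
  assumes "P \<in> pts" "x \<noteq> 0" "ord_at P x = 0"
  shows "x \<in> P \<and> inverse x \<in> P"
  using assms mem_iff[of P x] mem_iff[of P "inverse x"] ord_inverse[of P x] by simp

lemma not_mem_iff:
  assumes "P \<in> pts"
  shows "x \<notin> P \<longleftrightarrow> x \<noteq> 0 \<and> ord_at P x < 0"
  using mem_iff[OF assms, of x] pw_zero[of P 0] pw_0_eq[OF assms] by (cases "x = 0") auto

lemma inverse_pw1_iff: "P \<in> pts \<Longrightarrow> x \<noteq> 0 \<Longrightarrow> inverse x \<in> pw P 1 \<longleftrightarrow> x \<notin> P"
  using not_mem_iff[of P x] pw_iff[of "inverse x" P 1] ord_inverse[of P x] by auto

lemma evp_mem:
  assumes A: "is_subring A" "range \<iota> \<subseteq> A" and x: "x \<in> A"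
  shows "evp \<iota> p x \<in> A"
  by (induction p) (use A x is_subringD[OF A(1)] in \<open>auto simp: image_subset_iff\<close>)

lemma evp_pw1:
  assumes P: "P \<in> pts" and x: "x \<in> pw P 1"
  shows "evp \<iota> p x - \<iota> (coeff p 0) \<in> pw P 1"
proof (cases p)
  case (pCons a q)
  have "x \<in> P" using pw_monoD[OF x, of 0] pw_0_eq[OF P] by simp
  then have "evp \<iota> q x \<in> pw P 0" using evp_mem[OF pts_subring const] P pw_0_eq by blast
  then have "x * evp \<iota> q x \<in> pw P 1" using pw_mult[OF P x] by force
  then show ?thesis using pCons by simp
qed

text \<open>By Horner's scheme: the product of two functions with a pole at \<open>P\<close> has a pole at \<open>P\<close>, and adding
  a constant does not remove it.\<close>

lemma evp_pole:
  assumes P: "P \<in> pts" and f: "f \<notin> P"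
  shows "degree p \<noteq> 0 \<Longrightarrow> evp \<iota> p f \<notin> P"
proof (induction p)
  case (pCons a p)
  have sub: "x + \<iota> a \<notin> P" if "x \<notin> P" for x
  proof
    assume "x + \<iota> a \<in> P"
    then have "x + \<iota> a - \<iota> a \<in> P" using is_subringD(2)[OF pts_subring[OF P]] const[OF P] by blast
    then show False using that by simp
  qed
  have p0: "p \<noteq> 0" using pCons.prems by auto
  have "f * evp \<iota> p f \<notin> P"
  proof (cases "degree p = 0")
    case True
    then obtain c where c: "p = [:c:]" by (metis degree_eq_zeroE)
    then have "c \<noteq> 0" using p0 by simp
    then show ?thesis using c f ord_const[OF P, of c] not_mem_iff[OF P] ord_mult[OF P, of f "\<iota> c"] by simp
  next
    case False
    then show ?thesis using pCons.IH f not_mem_iff[OF P] ord_mult[OF P, of f "evp \<iota> p f"] by simp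
  qed
  from sub[OF this] show ?case by (simp add: add.commute)
qed simp

lemma pole_transcendental:
  assumes "P \<in> pts" "f \<notin> P" "evp \<iota> p f = 0"
  shows "p = 0"
proof (cases "degree p = 0")
  case True
  then obtain c where "p = [:c:]" by (metis degree_eq_zeroE)
  then show ?thesis using assms(3) by simp
next
  case False
  then show ?thesis using evp_pole[OF assms(1,2) False] assms(3) is_subringD(4)[OF pts_subring[OF assms(1)]] by simp
qed

lemma zero_transcendental:
  assumes P: "P \<in> pts" and x: "x \<noteq> 0" "x \<in> pw P 1"
  shows "evp \<iota> p x = 0 \<Longrightarrow> p = 0"
proof (induction p)
  case (pCons a p)
  have "\<iota> a = - (x * evp \<iota> p x)" using pCons.prems by (simp add: eq_neg_iff_add_eq_0)
  moreover have "x * evp \<iota> p x \<in> pw P 1"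
    using evp_pw1[OF P x(2), of "pCons 0 p"] by simp
  ultimately have "\<iota> a \<in> pw P 1" using pw_uminus[OF P] by simp
  then have "a = 0" using ord_const[OF P, of a] unfolding pw_def by fastforce
  then show ?case using pCons x(1) by simp
qed simp

lemma uniformizer: "P \<in> pts \<Longrightarrow> \<exists>t. t \<noteq> 0 \<and> ord_at P t = n"
  using ord_ex by blast

text \<open>Dividing a relation over \<open>k[t]\<close> by a power of \<open>t\<close> makes some constant term nonzero.\<close>

lemma dep_const:
  assumes t: "t \<noteq> 0"
  shows "\<exists>N. \<forall>y::nat \<Rightarrow> 'K. \<exists>f. (\<exists>i\<le>N. coeff (f i) 0 \<noteq> 0) \<and> (\<Sum>i\<le>N. evp \<iota> (f i) t * y i) = 0"
proof -
  obtain N where N: "\<And>y::nat \<Rightarrow> 'K. \<exists>f. (\<exists>i\<le>N. f i \<noteq> 0) \<and> (\<Sum>i\<le>N. evp \<iota> (f i) t * y i) = 0"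
    using dep by blast
  have red: "\<exists>f. (\<exists>i\<le>N. coeff (f i) 0 \<noteq> 0) \<and> (\<Sum>i\<le>N. evp \<iota> (f i) t * y i) = 0"
    if "\<exists>i\<le>N. f i \<noteq> 0" "(\<Sum>i\<le>N. evp \<iota> (f i) t * y i) = 0" for f and y :: "nat \<Rightarrow> 'K"
    using that
  proof (induction "\<Sum>i\<le>N. degree (f i)" arbitrary: f rule: less_induct)
    case less
    show ?case
    proof (cases "\<exists>i\<le>N. coeff (f i) 0 \<noteq> 0")
      case True
      then show ?thesis using less.prems by blast
    next
      case False
      have "\<exists>h. f i = pCons 0 h" if "i \<le> N" for i
        using False that by (metis pCons_cases coeff_pCons_0)
      then obtain h where h: "\<And>i. i \<le> N \<Longrightarrow> f i = pCons 0 (h i)" by metis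
      have "0 = (\<Sum>i\<le>N. t * (evp \<iota> (h i) t * y i))"
        unfolding less.prems(2)[symmetric] by (rule sum.cong) (use h in \<open>auto simp: mult.assoc\<close>)
      then have z: "(\<Sum>i\<le>N. evp \<iota> (h i) t * y i) = 0" using t by (simp flip: sum_distrib_left)
      obtain j where j: "j \<le> N" "f j \<noteq> 0" using less.prems(1) by blast
      then have hj: "h j \<noteq> 0" using h by auto
      have "(\<Sum>i\<le>N. degree (h i)) < (\<Sum>i\<le>N. degree (f i))"
      proof (rule sum_strict_mono_ex1)
        show "\<forall>i\<in>{..N}. degree (h i) \<le> degree (f i)" using h by (auto simp: degree_pCons_eq_if)
        show "\<exists>i\<in>{..N}. degree (h i) < degree (f i)"
          using h[OF j(1)] j hj by (intro bexI[of _ j]) auto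
      qed simp
      then show ?thesis using less.hyps[of h] j(1) hj z by blast
    qed
  qed
  have "\<exists>f. (\<exists>i\<le>N. coeff (f i) 0 \<noteq> 0) \<and> (\<Sum>i\<le>N. evp \<iota> (f i) t * y i) = 0" for y :: "nat \<Rightarrow> 'K"
    using N[of y] red by blast
  then show ?thesis by blast
qed

text \<open>A relation over \<open>k[t]\<close> with a nonzero constant term, for a uniformizer \<open>t\<close>, becomes a nontrivial
  relation over \<open>k\<close> in the residue field.\<close>

lemma dep_residue:
  assumes P: "P \<in> pts"
  shows "\<exists>N. \<forall>y::nat \<Rightarrow> 'K. (\<forall>i\<le>N. y i \<in> P) \<longrightarrow>
    (\<exists>c. (\<exists>i\<le>N. c i \<noteq> 0) \<and> (\<Sum>i\<le>N. \<iota> (c i) * y i) \<in> pw P 1)"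
proof -
  obtain t where t: "t \<noteq> 0" "ord_at P t = 1" using uniformizer[OF P] by blast
  have tP: "t \<in> pw P 1" using t pw_iff[OF t(1), of P 1] by simp
  obtain N where N: "\<And>y::nat \<Rightarrow> 'K. \<exists>f. (\<exists>i\<le>N. coeff (f i) 0 \<noteq> 0) \<and> (\<Sum>i\<le>N. evp \<iota> (f i) t * y i) = 0"
    using dep_const[OF t(1)] by blast
  show ?thesis
  proof (intro exI[of _ N] allI impI)
    fix y :: "nat \<Rightarrow> 'K" assume y: "\<forall>i\<le>N. y i \<in> P"
    obtain f where f: "\<exists>i\<le>N. coeff (f i) 0 \<noteq> 0" "(\<Sum>i\<le>N. evp \<iota> (f i) t * y i) = 0" using N by blast
    have "(\<Sum>i\<le>N. (evp \<iota> (f i) t - \<iota> (coeff (f i) 0)) * y i) \<in> pw P 1"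
    proof (rule pw_sum[OF P])
      fix i assume "i \<in> {..N}"
      then have "y i \<in> pw P 0" using y pw_0_eq[OF P] by auto
      then show "(evp \<iota> (f i) t - \<iota> (coeff (f i) 0)) * y i \<in> pw P 1"
        using pw_mult[OF P evp_pw1[OF P tP]] by fastforce
    qed
    then have "- (\<Sum>i\<le>N. \<iota> (coeff (f i) 0) * y i) \<in> pw P 1"
      using f(2) by (simp add: left_diff_distrib sum_subtractf)
    then have "(\<Sum>i\<le>N. \<iota> (coeff (f i) 0) * y i) \<in> pw P 1" using pw_uminus[OF P] by fastforce
    then show "\<exists>c. (\<exists>i\<le>N. c i \<noteq> 0) \<and> (\<Sum>i\<le>N. \<iota> (c i) * y i) \<in> pw P 1"
      using f(1) by (intro exI[of _ "\<lambda>i. coeff (f i) 0"]) simp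
  qed
qed

lemma residue_algebraic:
  assumes P: "P \<in> pts" and x: "x \<in> P"
  shows "\<exists>h. h \<noteq> 0 \<and> evp \<iota> h x \<in> pw P 1"
proof -
  obtain N where N: "\<And>y::nat \<Rightarrow> 'K. (\<forall>i\<le>N. y i \<in> P) \<Longrightarrow>
    (\<exists>c. (\<exists>i\<le>N. c i \<noteq> 0) \<and> (\<Sum>i\<le>N. \<iota> (c i) * y i) \<in> pw P 1)"
    using dep_residue[OF P] by blast
  obtain c where c: "\<exists>i\<le>N. c i \<noteq> 0" "(\<Sum>i\<le>N. \<iota> (c i) * x ^ i) \<in> pw P 1"
    using N[of "\<lambda>i. x ^ i"] is_subring_power[OF pts_subring[OF P] x] by blast
  define h where "h = (\<Sum>i\<le>N. monom (c i) i)"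
  have "coeff h i = c i" if "i \<le> N" for i unfolding h_def coeff_sum using that by simp
  then have "h \<noteq> 0" using c(1) by (metis coeff_0)
  moreover have "evp \<iota> h x = (\<Sum>i\<le>N. \<iota> (c i) * x ^ i)" unfolding h_def by (simp add: evp_sum)
  ultimately show ?thesis using c(2) by metis
qed

lemma residue_field_finite:
  assumes P: "P \<in> pts"
  shows "kv.fincodim P (pw P 1)"
proof -
  obtain N where N: "\<And>y::nat \<Rightarrow> 'K. (\<forall>i\<le>N. y i \<in> P) \<Longrightarrow>
    (\<exists>c. (\<exists>i\<le>N. c i \<noteq> 0) \<and> (\<Sum>i\<le>N. \<iota> (c i) * y i) \<in> pw P 1)"
    using dep_residue[OF P] by blast
  have "\<exists>d\<le>N. kv.hqd P (pw P 1) d"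
  proof (rule kv.hqd_ex_if_bounded[OF pw_subspace[OF P]])
    fix B assume B: "finite B" "B \<subseteq> P" "kv.indep_mod (pw P 1) B"
    show "card B \<le> N"
    proof (rule ccontr)
      assume "\<not> card B \<le> N"
      then obtain B' where B': "B' \<subseteq> B" "card B' = Suc N"
        by (metis not_less_eq_eq obtain_subset_with_card_n)
      have fB': "finite B'" using B' B(1) finite_subset by blast
      obtain y where y: "bij_betw y {..N} B'"
        using ex_bij_betw_nat_finite[OF fB'] B'(2) by (auto simp: lessThan_Suc_atMost atLeast0LessThan)
      have yB: "\<And>i. i \<le> N \<Longrightarrow> y i \<in> B'" and yinj: "inj_on y {..N}" and yim: "y ` {..N} = B'"
        using y unfolding bij_betw_def by auto
      obtain c where c: "\<exists>i\<le>N. c i \<noteq> 0" "(\<Sum>i\<le>N. \<iota> (c i) * y i) \<in> pw P 1"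
        using N[of y] yB B' B(2) by blast
      define u where "u = (\<lambda>b. c (the_inv_into {..N} y b))"
      have e: "(\<Sum>i\<le>N. \<iota> (c i) * y i) = (\<Sum>b\<in>B'. \<iota> (u b) * b)"
        unfolding yim[symmetric] sum.reindex[OF yinj]
        by (rule sum.cong) (auto simp: u_def the_inv_into_f_f[OF yinj])
      have "(\<Sum>b\<in>B'. \<iota> (u b) * b) \<in> kv.span B"
        by (intro kv.span_sum kv.span_scale kv.span_base) (use B' in auto)
      then have z: "(\<Sum>b\<in>B'. \<iota> (u b) * b) = 0" using c(2) B(3) unfolding e kv.indep_mod_def by blast
      have "kv.independent B" using B(3) unfolding kv.indep_mod_def by blast
      then have "u b = 0" if "b \<in> B'" for b
        using kv.independentD[OF _ fB' B'(1) z that] by blast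
      then have "c i = 0" if "i \<le> N" for i
        using yB[OF that] that the_inv_into_f_f[OF yinj] unfolding u_def by force
      then show False using c(1) by blast
    qed
  qed
  then show ?thesis unfolding kv.fincodim_def by blast
qed

end

sublocale field_ext \<subseteq> kr: relative_dimension "\<lambda>c (f :: 'K set \<Rightarrow> 'K) i. \<iota> c * f i"
  by unfold_locales (simp_all add: fun_eq_iff algebra_simps)

context curve
begin

text \<open>Among the powers of the inverse of a uniformizer, seen as repartitions supported at \<open>P\<close>,
  more than \<open>g\<close> are dependent modulo the constant and the integral repartitions.\<close>

lemma pole_only_at:
  assumes P: "P \<in> pts"
  shows "\<exists>r. r \<notin> P \<and> (\<forall>Q\<in>pts - {P}. r \<in> Q)"
proof -
  obtain t where t: "t \<noteq> 0" "ord_at P t = - 1" using uniformizer[OF P] by blast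
  let ?U = "repartitions C" and ?W = "{\<alpha> + (\<lambda>_. x) | \<alpha> x. \<alpha> \<in> integral_repartitions C}"
  obtain B where B: "finite B" "card B = g" "?U \<subseteq> {b + w | b w. b \<in> kr.span B \<and> w \<in> ?W}"
    using genus unfolding has_genus_def has_quot_dim_def quot_basis_def by blast
  define \<alpha> where "\<alpha> = (\<lambda>i Q. if Q = P then t ^ Suc i else 0)"
  have \<alpha>U: "\<alpha> i \<in> ?U" for i
  proof -
    have "{Q \<in> pts. \<alpha> i Q \<notin> Q} \<subseteq> {P}"
      using is_subringD(4)[OF pts_subring] by (auto simp: \<alpha>_def)
    then show ?thesis unfolding repartitions_def using finite_subset by blast
  qed
  have "\<forall>i. \<exists>b. b \<in> kr.span B \<and> \<alpha> i - b \<in> ?W"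
  proof
    fix i
    obtain b w where "\<alpha> i = b + w" "b \<in> kr.span B" "w \<in> ?W" using \<alpha>U B(3) by blast
    then show "\<exists>b. b \<in> kr.span B \<and> \<alpha> i - b \<in> ?W"
      by (intro exI[of _ b]) (simp only: add_diff_cancel_left' simp_thms)
  qed
  from choice[OF this] obtain b where b: "\<And>i. b i \<in> kr.span B" "\<And>i. \<alpha> i - b i \<in> ?W" by blast
  obtain c where c: "\<exists>i\<in>{..g}. c i \<noteq> 0" "(\<Sum>i\<in>{..g}. (\<lambda>Q. \<iota> (c i) * b i Q)) = 0"
    using kr.family_dependent[of "{..g}" B b] B b(1) by auto
  define h where "h = (\<Sum>i\<le>g. monom (c i) (Suc i))"
  have "\<forall>i. \<exists>\<beta> x. \<alpha> i - b i = \<beta> + (\<lambda>_. x) \<and> \<beta> \<in> integral_repartitions C" using b(2) by blast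
  from choice[OF this] obtain \<beta> where
    "\<forall>i. \<exists>x. \<alpha> i - b i = \<beta> i + (\<lambda>_. x) \<and> \<beta> i \<in> integral_repartitions C" by blast
  from choice[OF this] obtain x where \<beta>: "\<And>i. \<alpha> i - b i = \<beta> i + (\<lambda>_. x i)"
    "\<And>i. \<beta> i \<in> integral_repartitions C" by blast
  have bQ: "(\<Sum>i\<le>g. \<iota> (c i) * b i Q) = 0" for Q
    using fun_cong[OF c(2), of Q] by (simp add: sum_fun_apply zero_fun_def)
  have key: "(\<Sum>i\<le>g. \<iota> (c i) * \<alpha> i Q) - (\<Sum>i\<le>g. \<iota> (c i) * x i) \<in> Q" if Q: "Q \<in> pts" for Q
  proof -
    have "\<alpha> i Q = b i Q + \<beta> i Q + x i" for i
      using fun_cong[OF \<beta>(1)[of i], of Q] by (simp add: fun_diff_def plus_fun_def diff_eq_eq add_ac)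
    then have "(\<Sum>i\<le>g. \<iota> (c i) * \<alpha> i Q) = (\<Sum>i\<le>g. \<iota> (c i) * b i Q) + (\<Sum>i\<le>g. \<iota> (c i) * \<beta> i Q) + (\<Sum>i\<le>g. \<iota> (c i) * x i)"
      by (simp add: distrib_left sum.distrib)
    then have "(\<Sum>i\<le>g. \<iota> (c i) * \<alpha> i Q) - (\<Sum>i\<le>g. \<iota> (c i) * x i) = (\<Sum>i\<le>g. \<iota> (c i) * \<beta> i Q)"
      using bQ by simp
    moreover have "\<iota> (c i) * \<beta> i Q \<in> Q" for i
      using \<beta>(2)[of i] Q const[OF Q] is_subringD(3)[OF pts_subring[OF Q]]
      unfolding integral_repartitions_def by blast
    ultimately show ?thesis by (auto intro: is_subring_sum[OF pts_subring[OF Q]])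
  qed
  define r where "r = (\<Sum>i\<le>g. \<iota> (c i) * x i)"
  have "r \<in> Q" if Q: "Q \<in> pts - {P}" for Q
  proof -
    have "(\<Sum>i\<le>g. \<iota> (c i) * \<alpha> i Q) = 0" using Q by (simp add: \<alpha>_def)
    then have "- r \<in> Q" using key[of Q] Q unfolding r_def by simp
    then show ?thesis using is_subringD(5)[OF pts_subring, of Q "- r"] Q by simp
  qed
  moreover have "r \<notin> P"
  proof
    assume r: "r \<in> P"
    have "evp \<iota> h t = (\<Sum>i\<le>g. \<iota> (c i) * \<alpha> i P)"
      unfolding h_def by (simp add: evp_sum \<alpha>_def)
    then have "evp \<iota> h t - r \<in> P" using key[OF P] unfolding r_def by simp
    then have "evp \<iota> h t - r + r \<in> P" using r is_subringD(6)[OF pts_subring[OF P]] by blast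
    then have hP: "evp \<iota> h t \<in> P" by simp
    obtain j where j: "j \<le> g" "c j \<noteq> 0" using c(1) by auto
    have "coeff h (Suc j) = (\<Sum>i\<le>g. if i = j then c i else 0)"
      unfolding h_def coeff_sum by (rule sum.cong) auto
    then have "coeff h (Suc j) \<noteq> 0" using j by simp
    then have "degree h \<noteq> 0" by (metis coeff_eq_0 zero_less_Suc)
    moreover have "t \<notin> P" using t not_mem_iff[OF P] by simp
    ultimately show False using evp_pole[OF P] hP by blast
  qed
  ultimately show ?thesis by blast
qed

abbreviation reg :: "'K set set \<Rightarrow> 'K set" where "reg \<equiv> affine_coordinate_ring C"

lemma reg_iff: "x \<in> reg S \<longleftrightarrow> (\<forall>Q\<in>pts - S. x \<in> Q)"
  unfolding affine_coordinate_ring_def by simp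

lemma reg_subring: "is_subring (reg S)"
  using is_subringD(1-3)[OF pts_subring] unfolding is_subring_def by (auto simp: reg_iff)

lemma reg_const: "range \<iota> \<subseteq> reg S"
  using const unfolding reg_iff subset_iff by blast

lemma reg_mono: "S \<subseteq> T \<Longrightarrow> reg S \<subseteq> reg T"
  unfolding reg_iff subset_iff by blast

text \<open>The function \<open>f\<close> with its only pole at \<open>P\<^sub>0\<close> has residues algebraic over \<open>k\<close> at the
  other points, so some polynomial \<open>s\<close> in \<open>f\<close> vanishes at \<open>P\<close> and on \<open>T\<close>. A function
  with its only pole at \<open>P\<close> then compensates the zero of \<open>s\<close> at \<open>P\<close>.\<close>

lemma separate_points:
  assumes P0: "P0 \<in> pts" and P: "P \<in> pts" and T: "finite T" "T \<subseteq> pts"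
    and ne: "P \<noteq> P0" "P0 \<notin> T" "P \<notin> T"
  shows "\<exists>u\<in>reg {P0}. u \<noteq> 0 \<and> ord_at P u = 0 \<and> (\<forall>Q\<in>T. u \<in> pw Q 1)"
proof -
  obtain f where f: "f \<notin> P0" "\<And>Q. Q \<in> pts - {P0} \<Longrightarrow> f \<in> Q" using pole_only_at[OF P0] by blast
  obtain r where r: "r \<notin> P" "\<And>Q. Q \<in> pts - {P} \<Longrightarrow> r \<in> Q" using pole_only_at[OF P] by blast
  have fR: "f \<in> reg {P0}" using f reg_iff by blast
  have "\<forall>Q\<in>insert P T. \<exists>h. h \<noteq> 0 \<and> evp \<iota> h f \<in> pw Q 1"
    using residue_algebraic f(2) P T(2) ne by blast
  from bchoice[OF this] obtain h where h: "\<And>Q. Q \<in> insert P T \<Longrightarrow> h Q \<noteq> 0 \<and> evp \<iota> (h Q) f \<in> pw Q 1"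
    by blast
  define s where "s = (\<Prod>Q\<in>insert P T. evp \<iota> (h Q) f)"
  have hR: "evp \<iota> (h Q) f \<in> reg {P0}" for Q using evp_mem[OF reg_subring reg_const fR] .
  have sR: "s \<in> reg {P0}" unfolding s_def by (rule is_subring_prod[OF reg_subring]) (rule hR)
  have s0: "s \<noteq> 0" unfolding s_def using T(1) h pole_transcendental[OF P0 f(1)] by auto
  have sQ: "s \<in> pw Q 1" if Q: "Q \<in> insert P T" for Q
  proof -
    have Qp: "Q \<in> pts" "Q \<noteq> P0" using Q P T ne by auto
    have "s = evp \<iota> (h Q) f * (\<Prod>Q'\<in>insert P T - {Q}. evp \<iota> (h Q') f)"
      unfolding s_def by (rule prod.remove) (use T Q in auto)
    moreover have "(\<Prod>Q'\<in>insert P T - {Q}. evp \<iota> (h Q') f) \<in> reg {P0}"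
      by (rule is_subring_prod[OF reg_subring]) (rule hR)
    then have "(\<Prod>Q'\<in>insert P T - {Q}. evp \<iota> (h Q') f) \<in> pw Q 0"
      using Qp pw_0_eq[OF Qp(1)] unfolding reg_iff by auto
    ultimately show ?thesis using pw_mult[OF Qp(1)] h[OF Q] by fastforce
  qed
  define a where "a = ord_at P s"
  define b where "b = - ord_at P r"
  have a: "a \<ge> 1" using sQ[of P] pw_iff[OF s0, of P 1] unfolding a_def by simp
  have b: "b \<ge> 1" and r0: "r \<noteq> 0" using r(1) not_mem_iff[OF P, of r] unfolding b_def by auto
  define u where "u = s ^ nat b * r ^ nat a"
  have "ord_at P u = 0"
    unfolding u_def using s0 r0 a b ord_mult[OF P] ord_power[OF P] by (simp add: a_def b_def)
  moreover have "u \<noteq> 0" unfolding u_def using s0 r0 by simp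
  moreover have "u \<in> pw Q 1" if Q: "Q \<in> T" for Q
  proof -
    have Qp: "Q \<in> pts" "Q \<noteq> P" using Q T ne by auto
    have "s ^ nat b \<in> pw Q (int (nat b) * 1)" by (rule pw_power[OF Qp(1) sQ]) (use Q in simp)
    then have 1: "s ^ nat b \<in> pw Q 1" using b by (auto elim: pw_monoD)
    have "r ^ nat a \<in> pw Q 0"
      using is_subring_power[OF pts_subring r(2)] Qp pw_0_eq by auto
    then show ?thesis unfolding u_def using pw_mult[OF Qp(1) 1] by fastforce
  qed
  moreover have "u \<in> reg {P0}"
    unfolding reg_iff
  proof
    fix Q assume Q: "Q \<in> pts - {P0}"
    show "u \<in> Q"
    proof (cases "Q = P")
      case True
      then show ?thesis using unit_mem[OF P] \<open>u \<noteq> 0\<close> \<open>ord_at P u = 0\<close> by blast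
    next
      case False
      have "s \<in> Q" "r \<in> Q" using sR r(2) Q False unfolding reg_iff by auto
      then show ?thesis unfolding u_def
        using is_subringD(3)[OF pts_subring] is_subring_power[OF pts_subring] Q by blast
    qed
  qed
  ultimately show ?thesis by blast
qed

text \<open>A polynomial relation over \<open>k\<close> for the residue of \<open>u\<close> at \<open>P\<close>, with constant term \<open>-1\<close>, provides a
  polynomial in \<open>u\<close> without constant term whose residue at \<open>P\<close> is \<open>1\<close>. It vanishes wherever \<open>u\<close>
  does.\<close>

lemma approx_idempotent1:
  assumes P0: "P0 \<in> pts" and P: "P \<in> pts" and T: "finite T" "T \<subseteq> pts"
    and ne: "P \<noteq> P0" "P0 \<notin> T" "P \<notin> T"
  shows "\<exists>w\<in>reg {P0}. w - 1 \<in> pw P 1 \<and> (\<forall>Q\<in>T. w \<in> pw Q 1)"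
proof -
  obtain u where u: "u \<in> reg {P0}" "u \<noteq> 0" "ord_at P u = 0" "\<And>Q. Q \<in> T \<Longrightarrow> u \<in> pw Q 1"
    using separate_points[OF assms] by blast
  have uP: "u \<in> P" using unit_mem[OF P u(2,3)] by blast
  have "\<exists>h. coeff h 0 \<noteq> 0 \<and> evp \<iota> h u \<in> pw P 1" if "h \<noteq> 0" "evp \<iota> h u \<in> pw P 1" for h
    using that
  proof (induction h)
    case (pCons c h)
    show ?case
    proof (cases "c = 0")
      case True
      then have h0: "h \<noteq> 0" using pCons by auto
      have "inverse u * (u * evp \<iota> h u) \<in> pw P (0 + 1)"
        by (rule pw_mult[OF P]) (use unit_mem[OF P u(2,3)] pw_0_eq[OF P] pCons.prems True in auto)
      then show ?thesis using pCons.IH[OF h0] u(2) by (simp add: mult.assoc[symmetric])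
    next
      case False
      then show ?thesis using pCons.prems by (intro exI[of _ "pCons c h"]) simp
    qed
  qed simp
  then obtain h where h: "coeff h 0 \<noteq> 0" "evp \<iota> h u \<in> pw P 1" using residue_algebraic[OF P uP] by blast
  obtain c h' where ch: "h = pCons c h'" by (cases h)
  have c0: "c \<noteq> 0" using h(1) ch by simp
  define w where "w = - \<iota> (inverse c) * (u * evp \<iota> h' u)"
  have "w - 1 = - \<iota> (inverse c) * evp \<iota> h u"
    unfolding w_def ch using c0 by (simp add: algebra_simps)
  then have w1: "w - 1 \<in> pw P 1" using pw_scale[OF P h(2), of "- inverse c"] by simp
  have R: "u * evp \<iota> h' u \<in> reg {P0}"
    using is_subringD(3)[OF reg_subring u(1) evp_mem[OF reg_subring reg_const u(1)]] .
  have "- \<iota> (inverse c) \<in> reg {P0}" by (metis emb_uminus rangeI reg_const subsetD)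
  then have "w \<in> reg {P0}" unfolding w_def by (rule is_subringD(3)[OF reg_subring _ R])
  moreover have "w \<in> pw Q 1" if Q: "Q \<in> T" for Q
  proof -
    have Qp: "Q \<in> pts" "Q \<noteq> P0" using Q T ne by auto
    have "evp \<iota> h' u \<in> Q" using evp_mem[OF reg_subring reg_const u(1)] Qp unfolding reg_iff by blast
    then have "u * evp \<iota> h' u \<in> pw Q 1" using pw_mult[OF Qp(1) u(4)[OF Q]] pw_0_eq[OF Qp(1)] by fastforce
    then show ?thesis unfolding w_def using pw_scale[OF Qp(1), of _ 1 "- inverse c"] by simp
  qed
  ultimately show ?thesis using w1 by blast
qed

text \<open>The substitution \<open>v \<mapsto> 1 - (1 - v\<^sup>N)\<^sup>N\<close> raises both orders of vanishing to at least \<open>N\<close>.\<close>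

lemma approx_idempotent:
  assumes P0: "P0 \<in> pts" and P: "P \<in> pts" and T: "finite T" "T \<subseteq> pts"
    and ne: "P \<noteq> P0" "P0 \<notin> T" "P \<notin> T"
  shows "\<exists>w\<in>reg {P0}. w - 1 \<in> pw P (int N) \<and> (\<forall>Q\<in>T. w \<in> pw Q (int N))"
proof (cases "N = 0")
  case True
  have "0 \<in> reg {P0}" "0 - 1 \<in> pw P 0"
    using is_subringD(4)[OF reg_subring] is_subringD(1,5)[OF pts_subring[OF P]] pw_0_eq[OF P] by auto
  then show ?thesis using True by (intro bexI[of _ 0]) auto
next
  case False
  obtain v where v: "v \<in> reg {P0}" "v - 1 \<in> pw P 1" "\<And>Q. Q \<in> T \<Longrightarrow> v \<in> pw Q 1"
    using approx_idempotent1[OF assms] by blast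
  define z where "z = 1 - v ^ N"
  define w where "w = 1 - z ^ N"
  have geo: "1 - y ^ N = (1 - y) * (\<Sum>i<N. y ^ i)" for y :: 'K by (rule one_diff_power_eq)
  have zR: "z \<in> reg {P0}" and wR: "w \<in> reg {P0}"
    unfolding w_def z_def using v(1) is_subringD(1,2)[OF reg_subring] is_subring_power[OF reg_subring] by blast+
  have sumR: "(\<Sum>i<N. y ^ i) \<in> pw Q 0" if "Q \<in> pts - {P0}" "y \<in> reg {P0}" for y Q
  proof -
    have "(\<Sum>i<N. y ^ i) \<in> reg {P0}"
      by (rule is_subring_sum[OF reg_subring]) (rule is_subring_power[OF reg_subring that(2)])
    then show ?thesis using that(1) pw_0_eq[of Q] unfolding reg_iff by auto
  qed
  have "1 - v \<in> pw P 1" using pw_uminus[OF P v(2)] by simp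
  then have "z \<in> pw P 1" unfolding z_def geo
    using pw_mult[OF P _ sumR[of P v]] P ne(1) v(1) by fastforce
  then have "z ^ N \<in> pw P (int N)" using pw_power[OF P, of z 1 N] by simp
  then have "w - 1 \<in> pw P (int N)" unfolding w_def using pw_uminus[OF P] by simp
  moreover have "w \<in> pw Q (int N)" if Q: "Q \<in> T" for Q
  proof -
    have Qp: "Q \<in> pts" "Q \<in> pts - {P0}" using Q T ne by auto
    have "1 - z \<in> pw Q (int N)" unfolding z_def using pw_power[OF Qp(1) v(3)[OF Q], of N] by simp
    then show ?thesis unfolding w_def geo using pw_mult[OF Qp(1) _ sumR[OF Qp(2) zR]] by fastforce
  qed
  ultimately show ?thesis using wR by blast
qed

text \<open>Functions \<open>w\<^sub>i\<close> that are \<open>1\<close> at one pole of \<open>y\<close> and \<open>0\<close> at the others are independent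
  over \<open>k(y)\<close>, because \<open>1/y\<close> vanishes at all these poles.\<close>

lemma finite_poles: "finite {Q \<in> pts. y \<notin> Q}"
proof (cases "y = 0")
  case True
  have "{Q \<in> pts. y \<notin> Q} = {}" using True is_subringD(4)[OF pts_subring] by auto
  then show ?thesis by (metis finite.emptyI)
next
  case False
  define t where "t = inverse y"
  have t0: "t \<noteq> 0" using False unfolding t_def by simp
  obtain N where N: "\<And>y::nat \<Rightarrow> 'K. \<exists>f. (\<exists>i\<le>N. coeff (f i) 0 \<noteq> 0) \<and> (\<Sum>i\<le>N. evp \<iota> (f i) t * y i) = 0"
    using dep_const[OF t0] by blast
  show ?thesis
  proof (rule ccontr)
    assume inf: "infinite {Q \<in> pts. y \<notin> Q}"
    obtain T0 where T0: "T0 \<subseteq> {Q \<in> pts. y \<notin> Q}" "finite T0" "card T0 = Suc (Suc N)"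
      using infinite_arbitrarily_large[OF inf] by blast
    then obtain P0 where P0: "P0 \<in> T0" by fastforce
    define T where "T = T0 - {P0}"
    have T: "finite T" "card T = Suc N" "T \<subseteq> pts" "P0 \<in> pts" "P0 \<notin> T"
      using T0 P0 unfolding T_def by auto
    obtain Q where Q: "bij_betw Q {..N} T"
      using ex_bij_betw_nat_finite[OF T(1)] T(2) by (auto simp: lessThan_Suc_atMost atLeast0LessThan)
    have QT: "\<And>i. i \<le> N \<Longrightarrow> Q i \<in> T" and Qinj: "inj_on Q {..N}"
      using Q unfolding bij_betw_def by auto
    have "\<forall>i\<in>{..N}. \<exists>w. w \<in> reg {P0} \<and> w - 1 \<in> pw (Q i) 1 \<and> (\<forall>Q'\<in>T - {Q i}. w \<in> pw Q' 1)"
    proof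
      fix i assume "i \<in> {..N}"
      then have "Q i \<in> T" using QT by simp
      then show "\<exists>w. w \<in> reg {P0} \<and> w - 1 \<in> pw (Q i) 1 \<and> (\<forall>Q'\<in>T - {Q i}. w \<in> pw Q' 1)"
        using approx_idempotent1[OF T(4), of "Q i" "T - {Q i}"] T by blast
    qed
    from bchoice[OF this] obtain w where w: "\<And>i. i \<le> N \<Longrightarrow> w i \<in> reg {P0}"
      "\<And>i. i \<le> N \<Longrightarrow> w i - 1 \<in> pw (Q i) 1"
      "\<And>i Q'. i \<le> N \<Longrightarrow> Q' \<in> T \<Longrightarrow> Q' \<noteq> Q i \<Longrightarrow> w i \<in> pw Q' 1" by auto
    obtain f where f: "\<exists>i\<le>N. coeff (f i) 0 \<noteq> 0" "(\<Sum>i\<le>N. evp \<iota> (f i) t * w i) = 0" using N by blast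
    obtain j where j: "j \<le> N" "coeff (f j) 0 \<noteq> 0" using f(1) by blast
    have Qj: "Q j \<in> T" "Q j \<in> pts" using QT[OF j(1)] T by auto
    have "y \<notin> Q j" using Qj T0 unfolding T_def by auto
    then have tj: "t \<in> pw (Q j) 1" unfolding t_def using inverse_pw1_iff[OF Qj(2) False] by blast
    have tP: "t \<in> Q j" using pw_monoD[OF tj, of 0] pw_0_eq[OF Qj(2)] by simp
    have evP: "evp \<iota> p t \<in> pw (Q j) 0" for p
      using evp_mem[OF pts_subring const tP] Qj(2) pw_0_eq by blast
    have "(\<Sum>i\<in>{..N} - {j}. evp \<iota> (f i) t * w i) \<in> pw (Q j) 1"
    proof (rule pw_sum[OF Qj(2)])
      fix i assume i: "i \<in> {..N} - {j}"
      have "Q j \<noteq> Q i" using i j Qinj unfolding inj_on_def by auto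
      then have "w i \<in> pw (Q j) 1" using w(3)[of i "Q j"] i Qj by auto
      then show "evp \<iota> (f i) t * w i \<in> pw (Q j) 1" using pw_mult[OF Qj(2) evP] by fastforce
    qed
    moreover have "evp \<iota> (f j) t * w j = - (\<Sum>i\<in>{..N} - {j}. evp \<iota> (f i) t * w i)"
      using f(2) sum.remove[of "{..N}" j "\<lambda>i. evp \<iota> (f i) t * w i"] j(1) by (simp add: eq_neg_iff_add_eq_0)
    ultimately have A: "evp \<iota> (f j) t * w j \<in> pw (Q j) 1" using pw_uminus[OF Qj(2)] by simp
    have B: "evp \<iota> (f j) t * (w j - 1) \<in> pw (Q j) 1"
      using pw_mult[OF Qj(2) evP w(2)[OF j(1)]] by fastforce
    have "evp \<iota> (f j) t \<in> pw (Q j) 1"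
      using pw_diff[OF Qj(2) A B] by (simp add: right_diff_distrib)
    then have "\<iota> (coeff (f j) 0) \<in> pw (Q j) 1"
      using pw_diff[OF Qj(2) _ evp_pw1[OF Qj(2) tj, of "f j"]] by fastforce
    then show False using ord_const[OF Qj(2) j(2)] j(2) unfolding pw_def by simp
  qed
qed

lemma finite_zeros: "x \<noteq> 0 \<Longrightarrow> finite {Q \<in> pts. x \<in> pw Q 1}"
proof -
  assume x: "x \<noteq> 0"
  have "{Q \<in> pts. x \<in> pw Q 1} \<subseteq> {Q \<in> pts. inverse x \<notin> Q}"
    using inverse_pw1_iff[of _ "inverse x"] x by auto
  then show ?thesis using finite_poles finite_subset by blast
qed

text \<open>An approximate idempotent that vanishes to a high order at the poles of the elements of \<open>Y\<close> cancels
  these poles.\<close>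

lemma local_approx:
  assumes P0: "P0 \<in> pts" and Q: "Q \<in> pts" "Q \<noteq> P0"
    and T: "finite T" "T \<subseteq> pts" "P0 \<notin> T" "Q \<notin> T" and Y: "finite Y" "Y \<subseteq> Q"
  shows "\<exists>w\<in>reg {P0}. w - 1 \<in> pw Q (int N) \<and> (\<forall>Q'\<in>T. w \<in> pw Q' (int N)) \<and> (\<forall>y\<in>Y. w * y \<in> reg {P0})"
proof -
  define E where "E = {Q' \<in> pts. \<exists>y\<in>Y. y \<notin> Q'} - {P0}"
  have "{Q' \<in> pts. \<exists>y\<in>Y. y \<notin> Q'} = (\<Union>y\<in>Y. {Q' \<in> pts. y \<notin> Q'})" by blast
  then have fE: "finite E" unfolding E_def using Y(1) finite_poles by auto
  define M where "M = N + (\<Sum>(Q', y)\<in>E \<times> Y. nat \<bar>ord_at Q' y\<bar>)"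
  have "\<exists>w\<in>reg {P0}. w - 1 \<in> pw Q (int M) \<and> (\<forall>Q'\<in>E \<union> T. w \<in> pw Q' (int M))"
    by (rule approx_idempotent[OF P0 Q(1)]) (use fE T Q Y in \<open>auto simp: E_def\<close>)
  then obtain w where w: "w \<in> reg {P0}" "w - 1 \<in> pw Q (int M)" "\<And>Q'. Q' \<in> E \<union> T \<Longrightarrow> w \<in> pw Q' (int M)"
    by blast
  have NM: "int N \<le> int M" unfolding M_def by (simp only: of_nat_le_iff le_add1)
  have "w * y \<in> Q'" if y: "y \<in> Y" and Q': "Q' \<in> pts - {P0}" for y Q'
  proof (cases "Q' \<in> E")
    case True
    have "nat \<bar>ord_at Q' y\<bar> \<le> (\<Sum>(Q', y)\<in>E \<times> Y. nat \<bar>ord_at Q' y\<bar>)"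
      using member_le_sum[of "(Q', y)" "E \<times> Y" "\<lambda>(Q', y). nat \<bar>ord_at Q' y\<bar>"] True y fE Y(1) by auto
    then have "- int M \<le> ord_at Q' y" unfolding M_def by linarith
    then have "y \<in> pw Q' (- int M)" unfolding pw_def by simp
    then have "w * y \<in> pw Q' (int M + - int M)" using pw_mult w(3) True Q' by blast
    then show ?thesis using pw_0_eq Q' by simp
  next
    case False
    then have "y \<in> Q'" using y Q' unfolding E_def by blast
    moreover have "w \<in> Q'" using w(1) Q' unfolding reg_iff by blast
    ultimately show ?thesis using is_subringD(3)[OF pts_subring] Q' by blast
  qed
  then have "\<forall>y\<in>Y. w * y \<in> reg {P0}" unfolding reg_iff by blast
  then show ?thesis using w pw_monoD[OF _ NM] by blast
qed

text \<open>Each \<open>y Q\<close> is approximated by a function that is small at the other points of \<open>T\<close>, and these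
  functions are added up.\<close>

lemma strong_approximation:
  assumes P0: "P0 \<in> pts" and T: "finite T" "T \<subseteq> pts" "P0 \<notin> T" and y: "\<And>Q. Q \<in> T \<Longrightarrow> y Q \<in> Q"
  shows "\<exists>z\<in>reg {P0}. \<forall>Q\<in>T. z - y Q \<in> pw Q (int N)"
proof -
  have "\<forall>Q\<in>T. \<exists>z. z \<in> reg {P0} \<and> z - y Q \<in> pw Q (int N) \<and> (\<forall>Q'\<in>T - {Q}. z \<in> pw Q' (int N))"
  proof
    fix Q assume Q: "Q \<in> T"
    have Qp: "Q \<in> pts" "Q \<noteq> P0" using Q T by auto
    obtain v where v: "v \<in> reg {P0}" "v - 1 \<in> pw Q (int N)" "v * y Q \<in> reg {P0}"
      using local_approx[OF P0 Qp, of "{}" "{y Q}" N] y[OF Q] by auto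
    obtain w where w: "w \<in> reg {P0}" "w - 1 \<in> pw Q (int N)" "\<And>Q'. Q' \<in> T - {Q} \<Longrightarrow> w \<in> pw Q' (int N)"
      using approx_idempotent[OF P0 Qp(1), of "T - {Q}" N] T Qp by auto
    define z where "z = w * (v * y Q)"
    have 1: "z \<in> reg {P0}" unfolding z_def using is_subringD(3)[OF reg_subring w(1) v(3)] .
    have vy: "v * y Q \<in> pw Q' 0" if "Q' \<in> T" for Q'
      using v(3) that T pw_0_eq[of Q'] unfolding reg_iff by auto
    have "(w - 1) * (v * y Q) + (v - 1) * y Q \<in> pw Q (int N)"
    proof (rule pw_add[OF Qp(1)])
      show "(w - 1) * (v * y Q) \<in> pw Q (int N)" using pw_mult[OF Qp(1) w(2) vy[OF Q]] by simp
      show "(v - 1) * y Q \<in> pw Q (int N)"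
        using pw_mult[OF Qp(1) v(2), of "y Q" 0] y[OF Q] pw_0_eq[OF Qp(1)] by simp
    qed
    moreover have "(w - 1) * (v * y Q) + (v - 1) * y Q = z - y Q" unfolding z_def by (simp add: algebra_simps)
    ultimately have 2: "z - y Q \<in> pw Q (int N)" by simp
    have "z \<in> pw Q' (int N)" if Q': "Q' \<in> T - {Q}" for Q'
      unfolding z_def using pw_mult[OF _ w(3)[OF Q'] vy[of Q']] Q' T(2) by auto
    then show "\<exists>z. z \<in> reg {P0} \<and> z - y Q \<in> pw Q (int N) \<and> (\<forall>Q'\<in>T - {Q}. z \<in> pw Q' (int N))"
      using 1 2 by blast
  qed
  from bchoice[OF this] obtain z where z: "\<And>Q. Q \<in> T \<Longrightarrow> z Q \<in> reg {P0}"
    "\<And>Q. Q \<in> T \<Longrightarrow> z Q - y Q \<in> pw Q (int N)"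
    "\<And>Q Q'. Q \<in> T \<Longrightarrow> Q' \<in> T \<Longrightarrow> Q' \<noteq> Q \<Longrightarrow> z Q \<in> pw Q' (int N)" by auto
  have "sum z T - y Q \<in> pw Q (int N)" if Q: "Q \<in> T" for Q
  proof -
    have Qp: "Q \<in> pts" using Q T by auto
    have "sum z T - y Q = (z Q - y Q) + sum z (T - {Q})"
      using sum.remove[OF T(1) Q, of z] by simp
    moreover have "sum z (T - {Q}) \<in> pw Q (int N)" by (rule pw_sum[OF Qp]) (use z(3) Q in auto)
    ultimately show ?thesis using pw_add[OF Qp z(2)[OF Q]] by (simp only:)
  qed
  moreover have "sum z T \<in> reg {P0}" by (rule is_subring_sum[OF reg_subring z(1)])
  ultimately show ?thesis by blast
qed

text \<open>Euclid's argument: \<open>1\<close> plus a nonconstant function that vanishes on \<open>T\<close> and has its only pole at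
  \<open>P\<^sub>0\<close> has a zero outside of \<open>T\<close>.\<close>

lemma point_outside:
  assumes P0: "P0 \<in> pts" and T: "finite T" "T \<subseteq> pts"
  shows "\<exists>P\<in>pts. P \<notin> T \<and> P \<noteq> P0"
proof -
  obtain f where f: "f \<notin> P0" "\<And>Q. Q \<in> pts - {P0} \<Longrightarrow> f \<in> Q" using pole_only_at[OF P0] by blast
  have fR: "f \<in> reg {P0}" using f reg_iff by blast
  define T' where "T' = T - {P0}"
  have "\<forall>Q\<in>T'. \<exists>h. h \<noteq> 0 \<and> evp \<iota> h f \<in> pw Q 1"
    using residue_algebraic f(2) T(2) unfolding T'_def by blast
  from bchoice[OF this] obtain h where h: "\<And>Q. Q \<in> T' \<Longrightarrow> h Q \<noteq> 0 \<and> evp \<iota> (h Q) f \<in> pw Q 1"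
    by blast
  define H where "H = pCons 1 (\<Prod>Q\<in>T'. h Q)"
  have "(\<Prod>Q\<in>T'. h Q) \<noteq> 0" using h T(1) unfolding T'_def by simp
  then have "degree H \<noteq> 0" unfolding H_def by simp
  define y where "y = evp \<iota> H f"
  have yP0: "y \<notin> P0" unfolding y_def by (rule evp_pole[OF P0 f(1) \<open>degree H \<noteq> 0\<close>])
  have y0: "y \<noteq> 0" using yP0 is_subringD(4)[OF pts_subring[OF P0]] by auto
  have "\<not> algebraic_over (range \<iota>) (inverse y)"
    using zero_transcendental[OF P0, of "inverse y"] inverse_pw1_iff[OF P0 y0] yP0 y0
    unfolding algebraic_iff by auto
  then obtain P where P: "P \<in> pts" "inverse y \<notin> P" using pole by blast
  have yP: "y \<in> pw P 1" using inverse_pw1_iff[OF P(1), of "inverse y"] P(2) y0 by simp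
  have "P \<noteq> P0" using yP pw_monoD[of y P 1 0] pw_0_eq[OF P(1)] yP0 by auto
  moreover have "P \<notin> T'"
  proof
    assume PT: "P \<in> T'"
    have eR: "evp \<iota> p f \<in> pw P 0" for p
      using evp_mem[OF reg_subring reg_const fR, of p] P(1) \<open>P \<noteq> P0\<close> pw_0_eq unfolding reg_iff by auto
    have fin: "finite T'" using T(1) unfolding T'_def by simp
    have "(\<Prod>Q\<in>T'. h Q) = h P * (\<Prod>Q\<in>T' - {P}. h Q)" by (rule prod.remove[OF fin PT])
    then have "y - 1 = evp \<iota> (h P) f * (f * evp \<iota> (\<Prod>Q\<in>T' - {P}. h Q) f)"
      unfolding y_def H_def by (simp add: mult_ac)
    also have "\<dots> = evp \<iota> (h P) f * evp \<iota> (pCons 0 (\<Prod>Q\<in>T' - {P}. h Q)) f" by simp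
    also have "\<dots> \<in> pw P (1 + 0)" by (rule pw_mult[OF P(1) _ eR]) (use h[OF PT] in blast)
    finally have "y - 1 \<in> pw P 1" by simp
    then show False using one_plus_pw1(4)[OF P(1)] yP by blast
  qed
  ultimately show ?thesis using P(1) unfolding T'_def by blast
qed

end


section \<open>Lattices over the affine coordinate ring\<close>

definition box :: "('i \<Rightarrow> 'K set) \<Rightarrow> ('i \<Rightarrow> 'K) set" where
  "box U = {f. \<forall>i. f i \<in> U i}"

context field_ext
begin

lemma relative_dimension_fun: "relative_dimension (\<lambda>c (f :: 'i \<Rightarrow> 'K) i. \<iota> c * f i)"
  by unfold_locales (simp_all add: fun_eq_iff algebra_simps)

lemma box_subspace:
  assumes "\<And>i. kv.subspace (U i)"
  shows "module.subspace (\<lambda>c (f :: 'i \<Rightarrow> 'K) i. \<iota> c * f i) (box U)"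
proof -
  interpret kf: relative_dimension "\<lambda>c (f :: 'i \<Rightarrow> 'K) i. \<iota> c * f i" by (rule relative_dimension_fun)
  show ?thesis
    by (rule kf.subspaceI) (use assms in \<open>auto simp: box_def kv.subspace_0 kv.subspace_add kv.subspace_scale\<close>)
qed

lemma box_idx_one:
  fixes U :: "'i \<Rightarrow> 'K set"
  assumes U: "\<And>i. kv.subspace (U i)" and V: "kv.commens (U i) V"
  shows "relative_dimension.commens (\<lambda>c (f :: 'i \<Rightarrow> 'K) i. \<iota> c * f i) (box U) (box (U(i := V)))"
    "relative_dimension.idx (\<lambda>c (f :: 'i \<Rightarrow> 'K) i. \<iota> c * f i) (box U) (box (U(i := V))) = kv.idx (U i) V"
proof -
  let ?s = "\<lambda>c (f :: 'i \<Rightarrow> 'K) i. \<iota> c * f i"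
  interpret kf: relative_dimension ?s by (rule relative_dimension_fun)
  interpret pr: relative_dimension_pair ?s "\<lambda>c x. \<iota> c * x" by unfold_locales
  have sV: "kv.subspace V" using V unfolding kv.commens_def by blast
  have step: "kf.hqd (box U') (box (U'(i := Z))) d \<longleftrightarrow> kv.hqd (U' i) Z d"
    if U': "\<And>i. kv.subspace (U' i)" and Z: "kv.subspace Z" "Z \<subseteq> U' i" for U' Z d
  proof (rule pr.hqd_iso_transfer[where f = "\<lambda>f. f i"])
    show "Vector_Spaces.linear ?s (\<lambda>c x. \<iota> c * x) (\<lambda>f. f i)"
      by unfold_locales (simp_all add: algebra_simps)
    show "kf.subspace (box (U'(i := Z)))" by (rule box_subspace) (use U' Z in auto)
    show "kf.subspace (box U')" by (rule box_subspace) (use U' in auto)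
    show "kv.subspace Z" by (rule Z)
    fix u assume u: "u \<in> box U'"
    show "u i \<in> U' i" using u unfolding box_def by blast
    show "(u i \<in> Z) = (u \<in> box (U'(i := Z)))" using u unfolding box_def by auto
  next
    fix y assume y: "y \<in> U' i"
    have "(\<lambda>j. if j = i then y else 0) \<in> box U'"
      using y U' kv.subspace_0 unfolding box_def by auto
    then show "\<exists>u\<in>box U'. y - u i \<in> Z"
      using kv.subspace_0[OF Z(1)] by (intro bexI[of _ "\<lambda>j. if j = i then y else 0"]) auto
  qed
  let ?W = "U(i := V)"
  have sI: "kv.subspace (U i \<inter> V)" using U sV kv.subspace_inter by blast
  have int: "box U \<inter> box ?W = box (U(i := U i \<inter> V))" unfolding box_def by auto
  have int2: "box (U(i := U i \<inter> V)) = box (?W(i := U i \<inter> V))" by simp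
  have 1: "kf.hqd (box U) (box U \<inter> box ?W) d \<longleftrightarrow> kv.hqd (U i) (U i \<inter> V) d" for d
    unfolding int by (rule step[OF U sI]) auto
  have 2: "kf.hqd (box ?W) (box U \<inter> box ?W) d \<longleftrightarrow> kv.hqd V (U i \<inter> V) d" for d
    unfolding int int2 using step[of ?W "U i \<inter> V" d] U sV sI by simp
  have s: "kf.subspace (box U)" "kf.subspace (box ?W)"
    by (rule box_subspace; use U sV in auto)+
  show "kf.commens (box U) (box ?W)"
    using s V 1 2 unfolding kf.commens_def kv.commens_def kf.fincodim_def kv.fincodim_def by blast
  show "kf.idx (box U) (box ?W) = kv.idx (U i) V"
    using quot_dim_cong[OF 1] quot_dim_cong[OF 2] unfolding kf.idx_def kv.idx_def by simp
qed

text \<open>The coordinates in \<open>I\<close> are changed one at a time.\<close>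

lemma box_idx:
  fixes U :: "'i \<Rightarrow> 'K set"
  assumes I: "finite I" and U: "\<And>i. kv.subspace (U i)" and W: "\<And>i. kv.subspace (W i)"
    and c: "\<And>i. i \<in> I \<Longrightarrow> kv.commens (U i) (W i)" and e: "\<And>i. i \<notin> I \<Longrightarrow> U i = W i"
  shows "relative_dimension.commens (\<lambda>c (f :: 'i \<Rightarrow> 'K) i. \<iota> c * f i) (box U) (box W) \<and>
    relative_dimension.idx (\<lambda>c (f :: 'i \<Rightarrow> 'K) i. \<iota> c * f i) (box U) (box W) = (\<Sum>i\<in>I. kv.idx (U i) (W i))"
  using I U c e
proof (induction I arbitrary: U rule: finite_induct)
  let ?s = "\<lambda>c (f :: 'i \<Rightarrow> 'K) i. \<iota> c * f i"
  interpret kf: relative_dimension ?s by (rule relative_dimension_fun)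
  case empty
  then have "U = W" by auto
  then show ?case using kf.commens_refl[OF box_subspace, of W] W by simp
next
  let ?s = "\<lambda>c (f :: 'i \<Rightarrow> 'K) i. \<iota> c * f i"
  interpret kf: relative_dimension ?s by (rule relative_dimension_fun)
  case (insert j I)
  let ?U = "U(j := W j)"
  have "kf.commens (box ?U) (box W) \<and> kf.idx (box ?U) (box W) = (\<Sum>i\<in>I. kv.idx (?U i) (W i))"
    by (rule insert.IH) (use insert.prems insert.hyps W in auto)
  moreover have "(\<Sum>i\<in>I. kv.idx (?U i) (W i)) = (\<Sum>i\<in>I. kv.idx (U i) (W i))"
    by (rule sum.cong) (use insert.hyps in auto)
  moreover have "kf.commens (box U) (box ?U)" "kf.idx (box U) (box ?U) = kv.idx (U j) (W j)"
    using box_idx_one[of U j "W j"] insert.prems by auto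
  ultimately show ?case
    using kf.commens_trans_idx[of "box U" "box ?U" "box W"] insert.hyps by auto
qed

lemma linear_mult: "Vector_Spaces.linear (\<lambda>c x. \<iota> c * x) (\<lambda>c x. \<iota> c * x) ((*) a)"
  by unfold_locales (simp_all add: algebra_simps)

lemma idx_mult:
  assumes "a \<noteq> 0" "kv.commens U V"
  shows "kv.commens ((*) a ` U) ((*) a ` V)" "kv.idx ((*) a ` U) ((*) a ` V) = kv.idx U V"
proof -
  interpret pr: relative_dimension_pair "\<lambda>c x. \<iota> c * x" "\<lambda>c x. \<iota> c * x" by unfold_locales
  have "inj ((*) a)" using assms(1) by (auto simp: inj_def)
  then show "kv.commens ((*) a ` U) ((*) a ` V)" "kv.idx ((*) a ` U) ((*) a ` V) = kv.idx U V"
    using pr.idx_transfer[OF linear_mult _ assms(2)] by auto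
qed

end

context curve
begin

text \<open>Multiplication by an element of order \<open>n\<close> maps the residue field onto this quotient.\<close>

lemma hqd_pw_step:
  assumes P: "P \<in> pts"
  shows "kv.hqd (pw P n) (pw P (n + 1)) (degree_at \<iota> P)"
proof -
  interpret pr: relative_dimension_pair "\<lambda>c x. \<iota> c * x" "\<lambda>c x. \<iota> c * x" by unfold_locales
  obtain t where t: "t \<noteq> 0" "ord_at P t = n" using uniformizer[OF P] by blast
  have "kv.hqd P (pw P 1) (degree_at \<iota> P)"
    unfolding degree_at_def max_ideal_eq[OF P]
    by (rule kv.hqd_quot_dim[OF pw_subspace[OF P] residue_field_finite[OF P]])
  moreover have "kv.hqd P (pw P 1) d \<longleftrightarrow> kv.hqd (pw P n) (pw P (n + 1)) d" for d
  proof (rule pr.hqd_iso_transfer[OF linear_mult[of t]])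
    fix u assume "u \<in> P"
    then have u: "u \<in> pw P 0" using pw_0_eq[OF P] by simp
    have "t \<in> pw P n" using t by (simp add: pw_def)
    from pw_mult[OF P this u] show "t * u \<in> pw P n" by simp
    show "(t * u \<in> pw P (n + 1)) = (u \<in> pw P 1)"
      using t ord_mult[OF P, of t u] by (cases "u = 0") (auto simp: pw_def)
  next
    fix y assume y: "y \<in> pw P n"
    have "inverse t * y \<in> pw P (- n + n)"
      by (rule pw_mult[OF P _ y]) (use t ord_inverse[OF P, of t] in \<open>simp add: pw_def\<close>)
    then have "inverse t * y \<in> P" using pw_0_eq[OF P] by simp
    moreover have "y - t * (inverse t * y) = 0" using t(1) by (simp add: mult.assoc[symmetric])
    ultimately show "\<exists>u\<in>P. y - t * u \<in> pw P (n + 1)" by (intro bexI[of _ "inverse t * y"]) (simp_all only: pw_zero)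
  qed (use pw_subspace[OF P] pw_0_eq[OF P] in \<open>metis+\<close>)
  ultimately show ?thesis by blast
qed

lemma idx_pw:
  assumes P: "P \<in> pts"
  shows "kv.commens (pw P a) (pw P b) \<and> kv.idx (pw P a) (pw P b) = int (degree_at \<iota> P) * (b - a)"
proof -
  have up: "kv.commens (pw P a) (pw P (a + int k)) \<and> kv.idx (pw P a) (pw P (a + int k)) = int (degree_at \<iota> P) * int k"
    for a k
  proof (induction k)
    case 0
    then show ?case using kv.commens_refl[OF pw_subspace[OF P]] by simp
  next
    case (Suc k)
    let ?U = "pw P (a + int k)" and ?V = "pw P (a + int k + 1)"
    have h: "kv.hqd ?U ?V (degree_at \<iota> P)" by (rule hqd_pw_step[OF P])
    have "?V \<subseteq> ?U" by (rule pw_mono) simp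
    moreover have "kv.fincodim ?U ?V" using h unfolding kv.fincodim_def by blast
    ultimately have "kv.commens ?U ?V" "kv.idx ?U ?V = int (degree_at \<iota> P)"
      using kv.commens_subset[OF pw_subspace[OF P] pw_subspace[OF P], of "a + int k + 1" "a + int k"]
        kv.quot_dim_eq[OF pw_subspace[OF P] h] by simp_all
    then have "kv.commens (pw P a) ?V" "kv.idx (pw P a) ?V = int (degree_at \<iota> P) * int k + int (degree_at \<iota> P)"
      using kv.commens_trans_idx[of "pw P a" ?U ?V] Suc by auto
    moreover have "a + int k + 1 = a + int (Suc k)" by simp
    moreover have "int (degree_at \<iota> P) * int (Suc k) = int (degree_at \<iota> P) * int k + int (degree_at \<iota> P)"
      by (simp add: distrib_left)
    ultimately show ?case by (simp only:)
  qed
  show ?thesis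
  proof (cases "a \<le> b")
    case True
    then show ?thesis using up[of a "nat (b - a)"] by simp
  next
    case False
    then have "kv.commens (pw P b) (pw P a)" "kv.idx (pw P b) (pw P a) = int (degree_at \<iota> P) * (a - b)"
      using up[of b "nat (a - b)"] by auto
    then show ?thesis using kv.commens_sym kv.idx_swap[of "pw P a" "pw P b"] by (simp add: algebra_simps)
  qed
qed

end

locale affine_curve = curve \<iota> C g for \<iota> :: "'k::field \<Rightarrow> 'K::field" and C g +
  fixes S :: "'K set set"
  assumes finS: "finite S" and Ssub: "S \<subseteq> closed_points C" and Sne: "S \<noteq> {}"
begin

abbreviation R :: "'K set" where "R \<equiv> affine_coordinate_ring C S"

lemma R_sub: "Q \<in> pts - S \<Longrightarrow> x \<in> R \<Longrightarrow> x \<in> Q"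
  unfolding reg_iff by blast

lemma R_pw0: "Q \<in> pts - S \<Longrightarrow> x \<in> R \<Longrightarrow> x \<in> pw Q 0"
  using R_sub pw_0_eq by auto

lemma pts_outside: "finite T \<Longrightarrow> \<exists>Q\<in>pts - S. Q \<notin> T"
proof -
  assume T: "finite T"
  obtain P0 where "P0 \<in> S" using Sne by blast
  then show ?thesis using point_outside[of P0 "(S \<union> T) \<inter> pts"] finS Ssub T by auto
qed

lemma R_local:
  assumes Q: "Q \<in> pts - S" and T: "finite T" "T \<subseteq> pts - S" "Q \<notin> T" and Y: "finite Y" "Y \<subseteq> Q"
  shows "\<exists>w\<in>R. w \<noteq> 0 \<and> ord_at Q w = 0 \<and> (\<forall>Q'\<in>T. w \<in> pw Q' (int N)) \<and> (\<forall>y\<in>Y. w * y \<in> R)"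
proof -
  obtain P0 where P0: "P0 \<in> S" using Sne by blast
  then have P0': "P0 \<in> pts" using Ssub by blast
  have "\<exists>w\<in>reg {P0}. w - 1 \<in> pw Q (int (Suc N)) \<and> (\<forall>Q'\<in>T. w \<in> pw Q' (int (Suc N))) \<and> (\<forall>y\<in>Y. w * y \<in> reg {P0})"
    by (rule local_approx[OF P0']) (use assms P0 in auto)
  then obtain w where w: "w \<in> reg {P0}" "w - 1 \<in> pw Q (int (Suc N))"
    "\<And>Q'. Q' \<in> T \<Longrightarrow> w \<in> pw Q' (int (Suc N))" "\<And>y. y \<in> Y \<Longrightarrow> w * y \<in> reg {P0}" by blast
  have sub: "reg {P0} \<subseteq> R" using P0 by (intro reg_mono) auto
  have "w - 1 \<in> pw Q 1" using pw_monoD[OF w(2)] by simp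
  then have "w \<noteq> 0" "ord_at Q w = 0" using one_plus_pw1[of Q w] Q by auto
  moreover have "w \<in> pw Q' (int N)" if "Q' \<in> T" for Q' using pw_monoD[OF w(3)[OF that]] by simp
  ultimately show ?thesis using w(1,4) sub by blast
qed

lemma R_denominator:
  assumes Y: "finite Y"
  shows "\<exists>a\<in>R. a \<noteq> 0 \<and> (\<forall>y\<in>Y. a * y \<in> R)"
proof -
  have "finite (\<Union>y\<in>Y. {Q \<in> pts. y \<notin> Q})" using Y finite_poles by auto
  then obtain Q where Q: "Q \<in> pts - S" "Q \<notin> (\<Union>y\<in>Y. {Q \<in> pts. y \<notin> Q})" using pts_outside by blast
  then have "Y \<subseteq> Q" by auto
  then show ?thesis using R_local[OF Q(1), of "{}" Y 0] Y by auto
qed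

lemma R_approximation:
  assumes T: "finite T" "T \<subseteq> pts - S" and y: "\<And>Q. Q \<in> T \<Longrightarrow> y Q \<in> Q"
  shows "\<exists>z\<in>R. \<forall>Q\<in>T. z - y Q \<in> pw Q (int N)"
proof -
  obtain P0 where P0: "P0 \<in> S" using Sne by blast
  then have P0': "P0 \<in> pts" using Ssub by blast
  have "\<exists>z\<in>reg {P0}. \<forall>Q\<in>T. z - y Q \<in> pw Q (int N)"
    by (rule strong_approximation[OF P0']) (use assms P0 in auto)
  moreover have "reg {P0} \<subseteq> R" using P0 by (intro reg_mono) auto
  ultimately show ?thesis by blast
qed

lemma ord_le_bound:
  assumes "finite T"
  shows "\<exists>N. \<forall>Q\<in>T. ord_at Q a \<le> int N"
proof -
  have "ord_at Q a \<le> int (\<Sum>Q\<in>T. nat \<bar>ord_at Q a\<bar>)" if "Q \<in> T" for Q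
  proof -
    have "nat \<bar>ord_at Q a\<bar> \<le> (\<Sum>Q\<in>T. nat \<bar>ord_at Q a\<bar>)"
      by (rule member_le_sum) (use that assms in auto)
    then show ?thesis by linarith
  qed
  then show ?thesis by blast
qed

lemma submoduleD:
  assumes "is_submodule R I"
  shows "0 \<in> I" "x \<in> I \<Longrightarrow> y \<in> I \<Longrightarrow> x + y \<in> I" "a \<in> R \<Longrightarrow> x \<in> I \<Longrightarrow> a * x \<in> I"
    "x \<in> I \<Longrightarrow> a \<in> R \<Longrightarrow> x * a \<in> I" "kv.subspace I"
proof -
  show "0 \<in> I" "x \<in> I \<Longrightarrow> y \<in> I \<Longrightarrow> x + y \<in> I" "a \<in> R \<Longrightarrow> x \<in> I \<Longrightarrow> a * x \<in> I"
    "x \<in> I \<Longrightarrow> a \<in> R \<Longrightarrow> x * a \<in> I"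
    using assms unfolding is_submodule_def by (auto simp: mult.commute)
  have "\<iota> c \<in> R" for c using reg_const[of S] by blast
  then show "kv.subspace I"
    by (intro kv.subspaceI) (use assms in \<open>auto simp: is_submodule_def\<close>)
qed

lemma submodule_sum: "is_submodule R I \<Longrightarrow> (\<And>i. i \<in> A \<Longrightarrow> f i \<in> I) \<Longrightarrow> sum f A \<in> I"
  by (induction A rule: infinite_finite_induct) (auto simp: submoduleD)

lemma R_submodule: "is_submodule R R"
  using is_subringD[OF reg_subring] unfolding is_submodule_def by auto

text \<open>With \<open>c\<close> in the ideal invertible at the zeros of \<open>a\<close>, and \<open>y\<close> an approximate inverse of \<open>c\<close> there,
  the function \<open>(1 - c y) / a\<close> is regular, so \<open>1 - c y\<close> is in the ideal as well.\<close>

lemma unit_ideal: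
  assumes J: "is_submodule R J" "J \<subseteq> R" and a: "a \<in> J" "a \<noteq> 0"
    and loc: "\<And>Q. Q \<in> pts - S \<Longrightarrow> \<exists>b\<in>J. b \<notin> pw Q 1"
  shows "1 \<in> J"
proof -
  define T where "T = {Q \<in> pts. a \<in> pw Q 1} - S"
  have T: "finite T" "T \<subseteq> pts - S" using finite_zeros[OF a(2)] unfolding T_def by auto
  have "\<forall>Q\<in>T. \<exists>b. b \<in> J \<and> b \<notin> pw Q 1" using loc T by blast
  from bchoice[OF this] obtain b where b: "\<And>Q. Q \<in> T \<Longrightarrow> b Q \<in> J" "\<And>Q. Q \<in> T \<Longrightarrow> b Q \<notin> pw Q 1" by blast
  have "\<forall>Q\<in>T. \<exists>w. w \<in> R \<and> w \<noteq> 0 \<and> ord_at Q w = 0 \<and> (\<forall>Q'\<in>T - {Q}. w \<in> pw Q' 1)"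
  proof
    fix Q assume "Q \<in> T"
    then show "\<exists>w. w \<in> R \<and> w \<noteq> 0 \<and> ord_at Q w = 0 \<and> (\<forall>Q'\<in>T - {Q}. w \<in> pw Q' 1)"
      using R_local[of Q "T - {Q}" "{}" 1] T by auto
  qed
  from bchoice[OF this] obtain w where w: "\<And>Q. Q \<in> T \<Longrightarrow> w Q \<in> R \<and> w Q \<noteq> 0 \<and> ord_at Q (w Q) = 0 \<and>
    (\<forall>Q'\<in>T - {Q}. w Q \<in> pw Q' 1)" by blast
  define c where "c = (\<Sum>Q\<in>T. w Q * b Q)"
  have cJ: "c \<in> J" unfolding c_def by (rule submodule_sum[OF J(1)], rule submoduleD(3)[OF J(1)]) (use w b in auto)
  have cQ: "c \<notin> pw Q 1" if Q: "Q \<in> T" for Q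
  proof
    assume c: "c \<in> pw Q 1"
    have Qp: "Q \<in> pts" "Q \<in> pts - S" using Q T by auto
    have rest: "(\<Sum>Q'\<in>T - {Q}. w Q' * b Q') \<in> pw Q 1"
    proof (rule pw_sum[OF Qp(1)])
      fix Q' assume Q': "Q' \<in> T - {Q}"
      have "w Q' \<in> pw Q 1" "b Q' \<in> pw Q 0" using w[of Q'] Q Q' b(1)[of Q'] J(2) R_pw0[OF Qp(2)] by auto
      then show "w Q' * b Q' \<in> pw Q 1" using pw_mult[OF Qp(1)] by fastforce
    qed
    have "w Q * b Q = c - (\<Sum>Q'\<in>T - {Q}. w Q' * b Q')"
      unfolding c_def using sum.remove[OF T(1) Q, of "\<lambda>Q. w Q * b Q"] by simp
    then have wb: "w Q * b Q \<in> pw Q 1" using pw_diff[OF Qp(1) c rest] by simp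
    have "inverse (w Q) \<in> pw Q 0" using unit_mem[OF Qp(1)] w[OF Q] pw_0_eq[OF Qp(1)] by blast
    then have "inverse (w Q) * (w Q * b Q) \<in> pw Q (0 + 1)" using wb by (rule pw_mult[OF Qp(1)])
    then show False using b(2)[OF Q] w[OF Q] by (simp add: mult.assoc[symmetric])
  qed
  have cu: "c \<noteq> 0 \<and> ord_at Q c = 0" if Q: "Q \<in> T" for Q
    using not_in_pw1[of Q c] cQ[OF Q] R_sub[of Q c] T(2) Q cJ J(2) by blast
  obtain N where N: "\<And>Q. Q \<in> T \<Longrightarrow> ord_at Q a \<le> int N" using ord_le_bound[OF T(1)] by blast
  obtain y where y: "y \<in> R" "\<And>Q. Q \<in> T \<Longrightarrow> y - inverse c \<in> pw Q (int N)"
    using R_approximation[OF T, of "\<lambda>_. inverse c" N] unit_mem cu T(2) by blast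
  have "(1 - c * y) / a \<in> R"
    unfolding reg_iff
  proof
    fix Q assume Q: "Q \<in> pts - S"
    have Qp: "Q \<in> pts" using Q by blast
    have "c * y \<in> R" using is_subringD(3)[OF reg_subring _ y(1)] cJ J(2) by blast
    then have cy: "1 - c * y \<in> pw Q 0"
      using R_pw0[OF Q is_subringD(2)[OF reg_subring is_subringD(1)[OF reg_subring]]] by blast
    show "(1 - c * y) / a \<in> Q"
    proof (cases "Q \<in> T")
      case True
      have "c \<in> pw Q 0" using R_pw0[OF Q] cJ J(2) by blast
      then have "c * (y - inverse c) \<in> pw Q (int N)" using pw_mult[OF Qp _ y(2)[OF True], of c 0] by simp
      then have "- (c * (y - inverse c)) \<in> pw Q (int N)" by (rule pw_uminus[OF Qp])
      moreover have "- (c * (y - inverse c)) = 1 - c * y" using cu[OF True] by (simp add: right_diff_distrib)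
      ultimately have 1: "1 - c * y \<in> pw Q (ord_at Q a)" using pw_monoD N[OF True] by simp
      have "inverse a \<in> pw Q (- ord_at Q a)" using ord_inverse[OF Qp a(2)] by (simp add: pw_def)
      from pw_mult[OF Qp 1 this] show ?thesis using pw_0_eq[OF Qp] by (simp add: divide_inverse)
    next
      case False
      then have "a \<notin> pw Q 1" using Q unfolding T_def by blast
      then have "ord_at Q a = 0" using not_in_pw1[OF Qp] R_sub[OF Q] a(1) J(2) by blast
      then have "inverse a \<in> pw Q 0" using unit_mem[OF Qp a(2)] pw_0_eq[OF Qp] by blast
      from pw_mult[OF Qp cy this] show ?thesis using pw_0_eq[OF Qp] by (simp add: divide_inverse)
    qed
  qed
  then have "(1 - c * y) / a * a + y * c \<in> J"
    by (rule submoduleD(2)[OF J(1) submoduleD(3)[OF J(1) _ a(1)] submoduleD(3)[OF J(1) y(1) cJ]])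
  then show ?thesis using a(2) by (simp add: mult.commute)
qed

text \<open>The ideal of the \<open>r\<close> with \<open>r x \<in> I\<close> is contained in no maximal ideal, so it contains \<open>1\<close>.\<close>

lemma submodule_mem_local:
  assumes I: "is_submodule R I" and ne: "\<exists>b\<in>I. b \<noteq> 0"
    and loc: "\<And>Q. Q \<in> pts - S \<Longrightarrow> x \<noteq> 0 \<Longrightarrow> \<exists>b\<in>I. b \<noteq> 0 \<and> ord_at Q b \<le> ord_at Q x"
  shows "x \<in> I"
proof (cases "x = 0")
  case True
  then show ?thesis using submoduleD(1)[OF I] by simp
next
  case False
  let ?J = "{r \<in> R. r * x \<in> I}"
  have J: "is_submodule R ?J"
    unfolding is_submodule_def using is_subringD[OF reg_subring] submoduleD(1-3)[OF I]
    by (auto simp: distrib_right mult.assoc)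
  have quot: "r * x \<in> I" if "b \<in> I" "b \<noteq> 0" "r * (x / b) \<in> R" for r b
    using submoduleD(3)[OF I that(3,1)] that(2) by simp
  obtain b where b: "b \<in> I" "b \<noteq> 0" using ne by blast
  obtain a where a: "a \<in> R" "a \<noteq> 0" "a * (x / b) \<in> R" using R_denominator[of "{x / b}"] by auto
  have aJ: "a \<in> ?J" using a quot b by blast
  have "1 \<in> ?J"
  proof (rule unit_ideal[OF J _ aJ a(2)])
    fix Q assume Q: "Q \<in> pts - S"
    then have Qp: "Q \<in> pts" by blast
    obtain b where b: "b \<in> I" "b \<noteq> 0" "ord_at Q b \<le> ord_at Q x" using loc[OF Q False] by blast
    have "ord_at Q (x / b) \<ge> 0"
      unfolding divide_inverse using ord_mult[OF Qp False, of "inverse b"] ord_inverse[OF Qp b(2)] b by simp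
    then have "x / b \<in> Q" using mem_iff[OF Qp, of "x / b"] False b(2) by simp
    then obtain w where w: "w \<in> R" "w \<noteq> 0" "ord_at Q w = 0" "w * (x / b) \<in> R"
      using R_local[OF Q, of "{}" "{x / b}" 0] by auto
    have "w \<notin> pw Q 1" using w by (simp add: pw_def)
    then show "\<exists>b\<in>?J. b \<notin> pw Q 1" using w quot b by blast
  qed auto
  then show ?thesis by simp
qed

text \<open>By the local criterion the ideal contains every function of \<open>R\<close> that vanishes at the zeros of \<open>a\<close>
  at least to the same order as \<open>a\<close>, and these are cut out by finitely many conditions with values in
  finite-dimensional spaces.\<close>

lemma fincodim_R_ideal:
  assumes I: "is_submodule R I" "I \<subseteq> R" and a: "a \<in> I" "a \<noteq> 0"
  shows "kv.fincodim R I"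
proof -
  define T where "T = {Q \<in> pts. a \<in> pw Q 1} - S"
  have T: "finite T" "T \<subseteq> pts - S" using finite_zeros[OF a(2)] unfolding T_def by auto
  obtain N where N: "\<And>Q. Q \<in> T \<Longrightarrow> ord_at Q a \<le> int N" using ord_le_bound[OF T(1)] by blast
  have sR: "kv.subspace R" by (rule submoduleD(5)[OF R_submodule])
  let ?V = "\<lambda>T. {x \<in> R. \<forall>Q\<in>T. x \<in> pw Q (int N)}"
  have "kv.fincodim R (?V T) \<and> kv.subspace (?V T)"
    using T
  proof (induction T rule: finite_induct)
    case empty
    then show ?case using sR kv.fincodim_refl by simp
  next
    case (insert Q T)
    have Q: "Q \<in> pts" "Q \<in> pts - S" using insert.prems by auto
    have IH: "kv.fincodim R (?V T)" "kv.subspace (?V T)" using insert by auto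
    have sQ: "kv.subspace Q" using pw_subspace[OF Q(1), of 0] pw_0_eq[OF Q(1)] by simp
    have sub: "pw Q (int N) \<subseteq> Q" using pw_mono[of 0 "int N" Q] pw_0_eq[OF Q(1)] by simp
    have "kv.commens Q (pw Q (int N))" using idx_pw[OF Q(1), of 0 "int N"] pw_0_eq[OF Q(1)] by simp
    then have "kv.fincodim Q (Q \<inter> pw Q (int N))" unfolding kv.commens_def by blast
    then have "kv.fincodim (Q \<inter> ?V T) (Q \<inter> ?V T \<inter> pw Q (int N))"
      by (rule kv.fincodim_Int[OF sQ IH(2) pw_subspace[OF Q(1)]])
    moreover have "Q \<inter> ?V T = ?V T" using R_sub[OF Q(2)] by blast
    moreover have e: "?V T \<inter> pw Q (int N) = ?V (insert Q T)" by auto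
    ultimately have 1: "kv.fincodim (?V T) (?V (insert Q T))" by simp
    have s: "kv.subspace (?V (insert Q T))"
      unfolding e[symmetric] by (rule kv.subspace_inter[OF IH(2) pw_subspace[OF Q(1)]])
    have "kv.fincodim R (?V (insert Q T))"
      by (rule kv.quot_dim_add(1)[OF s IH(2) _ _ 1 IH(1)]) auto
    then show ?case using s by blast
  qed
  moreover have "?V T \<subseteq> I"
  proof
    fix x assume x: "x \<in> ?V T"
    show "x \<in> I"
    proof (rule submodule_mem_local[OF I(1)])
      show "\<exists>b\<in>I. b \<noteq> 0" using a by blast
      fix Q assume Q: "Q \<in> pts - S" and x0: "x \<noteq> 0"
      have "ord_at Q a \<le> ord_at Q x"
      proof (cases "Q \<in> T")
        case True
        then show ?thesis using N[OF True] x x0 pw_iff[OF x0, of Q "int N"] by auto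
      next
        case False
        then have "a \<notin> pw Q 1" using Q unfolding T_def by blast
        then have "ord_at Q a = 0" using not_in_pw1[of Q a] R_sub[OF Q] a(1) I(2) Q by blast
        then show ?thesis using R_sub[OF Q] x mem_iff[of Q x] Q x0 by auto
      qed
      then show "\<exists>b\<in>I. b \<noteq> 0 \<and> ord_at Q b \<le> ord_at Q x" using a by blast
    qed
  qed
  ultimately show ?thesis
    using kv.fincodim_mono[of "?V T" I R R] submoduleD(5)[OF I(1)] by blast
qed

lemma mult_image_submodule:
  assumes "is_submodule R I"
  shows "is_submodule R ((*) x ` I)"
  unfolding is_submodule_def
proof (intro conjI ballI)
  show "0 \<in> (*) x ` I" using submoduleD(1)[OF assms] by (metis imageI mult_zero_right)
  fix y z assume "y \<in> (*) x ` I" "z \<in> (*) x ` I"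
  then show "y + z \<in> (*) x ` I" using submoduleD(2)[OF assms] by (auto simp flip: distrib_left)
next
  fix r y assume r: "r \<in> R" "y \<in> (*) x ` I"
  then obtain z where "z \<in> I" "y = x * z" by blast
  then have "r * y = x * (r * z)" "r * z \<in> I" using submoduleD(3)[OF assms r(1)] by auto
  then show "r * y \<in> (*) x ` I" by blast
qed

definition fractional :: "'K set \<Rightarrow> bool" where
  "fractional I \<longleftrightarrow> is_submodule R I \<and> (\<exists>b\<in>I. b \<noteq> 0) \<and> (\<exists>a\<in>R. a \<noteq> 0 \<and> (*) a ` I \<subseteq> R)"

lemma commens_R_ideal:
  assumes I: "is_submodule R I" "I \<subseteq> R" "a \<in> I" "a \<noteq> 0"
  shows "kv.commens R I" "kv.idx R I = int (quot_dim (\<lambda>c x. \<iota> c * x) R I)"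
  using kv.commens_subset[OF submoduleD(5)[OF R_submodule] submoduleD(5)[OF I(1)] I(2) fincodim_R_ideal[OF I]] by auto

lemma fractional_commens:
  assumes I: "fractional I"
  shows "kv.commens R I"
proof -
  obtain a b where ab: "b \<in> I" "b \<noteq> 0" "a \<in> R" "a \<noteq> 0" "(*) a ` I \<subseteq> R" and sI: "is_submodule R I"
    using I unfolding fractional_def by blast
  have "kv.commens R ((*) a ` I)"
    by (rule commens_R_ideal(1)[OF mult_image_submodule[OF sI] ab(5), of "a * b"]) (use ab in auto)
  moreover have "kv.commens R ((*) a ` R)"
  proof (rule commens_R_ideal(1)[OF mult_image_submodule[OF R_submodule]])
    show "(*) a ` R \<subseteq> R" using is_subringD(3)[OF reg_subring ab(3)] by blast
    show "a * 1 \<in> (*) a ` R" using is_subringD(1)[OF reg_subring] by (rule imageI)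
  qed (use ab in simp)
  ultimately have "kv.commens ((*) a ` R) ((*) a ` I)"
    using kv.commens_trans_idx(1) kv.commens_sym by blast
  then have "kv.commens ((*) (inverse a) ` (*) a ` R) ((*) (inverse a) ` (*) a ` I)"
    by (rule idx_mult(1)[rotated]) (use ab in simp)
  moreover have "(*) (inverse a) ` (*) a ` Z = Z" for Z
    using ab(4) by (simp add: image_image mult.assoc[symmetric])
  ultimately show ?thesis by simp
qed

lemma fractional_mult:
  assumes I: "fractional I" and x: "x \<noteq> 0"
  shows "fractional ((*) x ` I)"
proof -
  obtain a b where ab: "b \<in> I" "b \<noteq> 0" "a \<in> R" "a \<noteq> 0" "(*) a ` I \<subseteq> R" and sI: "is_submodule R I"
    using I unfolding fractional_def by blast
  obtain c where c: "c \<in> R" "c \<noteq> 0" "c * x \<in> R" using R_denominator[of "{x}"] by auto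
  have "a * c * (x * y) \<in> R" if "y \<in> I" for y
  proof -
    have "a * y \<in> R" using ab(5) that by blast
    then have "(c * x) * (a * y) \<in> R" using is_subringD(3)[OF reg_subring c(3)] by blast
    then show ?thesis by (simp add: mult_ac)
  qed
  then have "(*) (a * c) ` (*) x ` I \<subseteq> R" by auto
  moreover have "a * c \<in> R" "a * c \<noteq> 0" using is_subringD(3)[OF reg_subring ab(3) c(1)] ab c by auto
  moreover have "x * b \<in> (*) x ` I" "x * b \<noteq> 0" using ab x by auto
  ultimately show ?thesis unfolding fractional_def using mult_image_submodule[OF sI] by blast
qed

lemma fractional_R: "fractional R"
  unfolding fractional_def
proof (intro conjI)
  show "is_submodule R R" by (rule R_submodule)
  have 1: "1 \<in> R" by (rule is_subringD(1)[OF reg_subring])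
  then show "\<exists>b\<in>R. b \<noteq> 0" by (intro bexI[of _ 1]) auto
  show "\<exists>a\<in>R. a \<noteq> 0 \<and> (*) a ` R \<subseteq> R" using 1 by (intro bexI[of _ 1]) auto
qed

lemma idx_R_mult:
  assumes I: "fractional I" and x: "x \<noteq> 0"
  shows "kv.idx R ((*) x ` I) = kv.idx R ((*) x ` R) + kv.idx R I"
proof -
  have "kv.commens ((*) x ` R) ((*) x ` I)" "kv.idx ((*) x ` R) ((*) x ` I) = kv.idx R I"
    using idx_mult[OF x fractional_commens[OF I]] by auto
  then show ?thesis
    using kv.commens_trans_idx(2)[OF fractional_commens[OF fractional_mult[OF fractional_R x]]] by simp
qed

lemma ideal_norm_eq:
  assumes I: "fractional I" and q: "q > 0"
  shows "ideal_norm q \<iota> R I = q powi kv.idx R I"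
proof -
  define a where "a = (SOME a. a \<in> R \<and> a \<noteq> 0 \<and> (*) a ` I \<subseteq> R)"
  have "\<exists>a. a \<in> R \<and> a \<noteq> 0 \<and> (*) a ` I \<subseteq> R" using I unfolding fractional_def by blast
  from someI_ex[OF this] have a: "a \<in> R" "a \<noteq> 0" "(*) a ` I \<subseteq> R" unfolding a_def by auto
  obtain b where b: "b \<in> I" "b \<noteq> 0" and sI: "is_submodule R I" using I unfolding fractional_def by blast
  have 1: "kv.idx R ((*) a ` I) = int (quot_dim (\<lambda>c x. \<iota> c * x) R ((*) a ` I))"
    by (rule commens_R_ideal(2)[OF mult_image_submodule[OF sI] a(3), of "a * b"]) (use a b in auto)
  have 2: "kv.idx R ((*) a ` R) = int (quot_dim (\<lambda>c x. \<iota> c * x) R ((*) a ` R))"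
  proof (rule commens_R_ideal(2)[OF mult_image_submodule[OF R_submodule]])
    show "(*) a ` R \<subseteq> R" using is_subringD(3)[OF reg_subring a(1)] by blast
    show "a * 1 \<in> (*) a ` R" using is_subringD(1)[OF reg_subring] by (rule imageI)
  qed (use a in simp)
  have "ideal_norm q \<iota> R I = q powi kv.idx R ((*) a ` I) / q powi kv.idx R ((*) a ` R)"
    unfolding ideal_norm_def Let_def a_def[symmetric] integral_ideal_norm_def 1 2 by simp
  also have "\<dots> = q powi (kv.idx R ((*) a ` I) - kv.idx R ((*) a ` R))"
    using q by (simp add: power_int_diff)
  also have "kv.idx R ((*) a ` I) - kv.idx R ((*) a ` R) = kv.idx R I"
    using idx_R_mult[OF I a(2)] by simp
  finally show ?thesis .
qed

lemma abs_R_eq: "q > 0 \<Longrightarrow> x \<noteq> 0 \<Longrightarrow> abs_R q \<iota> R x = q powi kv.idx R ((*) x ` R)"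
  unfolding abs_R_def using ideal_norm_eq[OF fractional_mult[OF fractional_R]] by simp

lemma ideal_mult_submodule: "is_submodule R (ideal_mult R I J)"
  unfolding ideal_mult_def by (rule hull_in) (auto simp: is_submodule_def)

lemma ideal_mult_mem: "x \<in> I \<Longrightarrow> y \<in> J \<Longrightarrow> x * y \<in> ideal_mult R I J"
  unfolding ideal_mult_def by (rule hull_inc) blast

lemma ideal_mult_least:
  "is_submodule R M \<Longrightarrow> (\<And>x y. x \<in> I \<Longrightarrow> y \<in> J \<Longrightarrow> x * y \<in> M) \<Longrightarrow> ideal_mult R I J \<subseteq> M"
  unfolding ideal_mult_def by (rule hull_minimal) auto

lemma pw_submodule: "Q \<in> pts - S \<Longrightarrow> is_submodule R (pw Q n)"
  unfolding is_submodule_def using R_pw0 pw_mult[of Q _ 0 _ n] pw_add by auto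

lemma least_order:
  assumes I: "I \<subseteq> R" "b \<in> I" "b \<noteq> 0" and Q: "Q \<in> pts - S"
  shows "\<exists>b\<in>I. b \<noteq> 0 \<and> (\<forall>x\<in>I. x \<in> pw Q (ord_at Q b))"
proof -
  obtain b where b: "b \<in> I \<and> b \<noteq> 0" "\<And>x. x \<in> I \<and> x \<noteq> 0 \<Longrightarrow> nat (ord_at Q b) \<le> nat (ord_at Q x)"
    using ex_has_least_nat[of "\<lambda>b. b \<in> I \<and> b \<noteq> 0" b "\<lambda>x. nat (ord_at Q x)"] I by blast
  have "ord_at Q x \<ge> 0" if "x \<in> I" "x \<noteq> 0" for x
    using R_sub[OF Q] mem_iff[of Q x] that I(1) Q by blast
  then have "x \<in> pw Q (ord_at Q b)" if "x \<in> I" for x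
    using b that unfolding pw_def by (cases "x = 0") fastforce+
  then show ?thesis using b(1) by blast
qed

text \<open>Elements of \<open>I\<close> of least order at the single points are combined with weights \<open>w\<^sub>Q\<close> that are
  invertible at \<open>Q\<close> and vanish at the other points, so that the leading terms cannot cancel.\<close>

lemma simultaneous_least_order:
  assumes I: "is_submodule R I" "I \<subseteq> R" "b \<in> I" "b \<noteq> 0" and T: "finite T" "T \<subseteq> pts - S"
  shows "\<exists>c\<in>I. c \<noteq> 0 \<and> (\<forall>Q\<in>T. \<forall>x\<in>I. x \<in> pw Q (ord_at Q c))"
proof -
  \<comment> \<open>The additional point ensures that the combination is not zero when \<open>T\<close> is empty.\<close>
  obtain Q1 where Q1: "Q1 \<in> pts - S" using pts_outside[of "{}"] by blast
  define T1 where "T1 = insert Q1 T"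
  have T1: "finite T1" "T1 \<subseteq> pts - S" using T Q1 unfolding T1_def by auto
  have "\<forall>Q\<in>T1. \<exists>b. b \<in> I \<and> b \<noteq> 0 \<and> (\<forall>x\<in>I. x \<in> pw Q (ord_at Q b))"
    using least_order[OF I(2-4)] T1 by blast
  from bchoice[OF this] obtain b where b: "\<And>Q. Q \<in> T1 \<Longrightarrow> b Q \<in> I \<and> b Q \<noteq> 0"
    "\<And>Q x. Q \<in> T1 \<Longrightarrow> x \<in> I \<Longrightarrow> x \<in> pw Q (ord_at Q (b Q))" by blast
  have "\<forall>Q\<in>T1. \<exists>w. w \<in> R \<and> w \<noteq> 0 \<and> ord_at Q w = 0 \<and> (\<forall>Q'\<in>T1 - {Q}. w \<in> pw Q' 1)"
  proof
    fix Q assume "Q \<in> T1"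
    then show "\<exists>w. w \<in> R \<and> w \<noteq> 0 \<and> ord_at Q w = 0 \<and> (\<forall>Q'\<in>T1 - {Q}. w \<in> pw Q' 1)"
      using R_local[of Q "T1 - {Q}" "{}" 1] T1 by auto
  qed
  from bchoice[OF this] obtain w where w: "\<And>Q. Q \<in> T1 \<Longrightarrow> w Q \<in> R \<and> w Q \<noteq> 0 \<and> ord_at Q (w Q) = 0 \<and>
    (\<forall>Q'\<in>T1 - {Q}. w Q \<in> pw Q' 1)" by blast
  define c where "c = (\<Sum>Q\<in>T1. w Q * b Q)"
  have cI: "c \<in> I" unfolding c_def by (rule submodule_sum[OF I(1)], rule submoduleD(3)[OF I(1)]) (use w b in auto)
  have c: "c \<noteq> 0 \<and> ord_at Q c = ord_at Q (b Q)" if Q: "Q \<in> T1" for Q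
  proof -
    have Qp: "Q \<in> pts" "Q \<in> pts - S" using Q T1 by auto
    define n where "n = ord_at Q (b Q)"
    have rest: "(\<Sum>Q'\<in>T1 - {Q}. w Q' * b Q') \<in> pw Q (1 + n)"
      unfolding n_def by (rule pw_sum[OF Qp(1)], rule pw_mult[OF Qp(1)]) (use w b Q in auto)
    have e: "w Q * b Q = c - (\<Sum>Q'\<in>T1 - {Q}. w Q' * b Q')"
      unfolding c_def using sum.remove[OF T1(1) Q, of "\<lambda>Q. w Q * b Q"] by simp
    have o: "ord_at Q (w Q * b Q) = n" "w Q * b Q \<noteq> 0"
      using ord_mult[OF Qp(1), of "w Q" "b Q"] w[OF Q] b(1)[OF Q] unfolding n_def by auto
    have "c \<notin> pw Q (1 + n)"
      using pw_diff[OF Qp(1) _ rest, of c] o unfolding e[symmetric] by (auto simp: pw_def)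
    moreover have "c \<in> pw Q n" using b(2)[OF Q cI] unfolding n_def .
    ultimately show ?thesis unfolding n_def[symmetric] by (auto simp: pw_def)
  qed
  have "c \<noteq> 0" using c[of Q1] unfolding T1_def by blast
  moreover have "x \<in> pw Q (ord_at Q c)" if "Q \<in> T" "x \<in> I" for Q x
    using b(2)[of Q x] c[of Q] that unfolding T1_def by auto
  ultimately show ?thesis using cI by blast
qed

text \<open>Multiplication by an element \<open>c\<close> of \<open>I\<close> of least order at the zeros of \<open>J\<close> induces an isomorphism
  from \<open>R / J\<close> onto \<open>I / I J\<close>.\<close>

lemma idx_ideal_mult:
  assumes I: "is_submodule R I" "I \<subseteq> R" "\<exists>b\<in>I. b \<noteq> 0" and J: "is_submodule R J" "J \<subseteq> R" "\<exists>b\<in>J. b \<noteq> 0"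
  shows "kv.idx R (ideal_mult R I J) = kv.idx R I + kv.idx R J"
    "ideal_mult R I J \<subseteq> I" "\<exists>b\<in>ideal_mult R I J. b \<noteq> 0"
proof -
  let ?IJ = "ideal_mult R I J"
  interpret pr: relative_dimension_pair "\<lambda>c x. \<iota> c * x" "\<lambda>c x. \<iota> c * x" by unfold_locales
  obtain b where b: "b \<in> I" "b \<noteq> 0" using I(3) by blast
  obtain a where a: "a \<in> J" "a \<noteq> 0" using J(3) by blast
  show sub: "?IJ \<subseteq> I" by (rule ideal_mult_least[OF I(1)]) (use submoduleD(4)[OF I(1)] J(2) in blast)
  have sIJ: "is_submodule R ?IJ" by (rule ideal_mult_submodule)
  have ab: "b * a \<in> ?IJ" "b * a \<noteq> 0" using ideal_mult_mem a b by auto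
  then show ne: "\<exists>b\<in>?IJ. b \<noteq> 0" by blast
  define T where "T = {Q \<in> pts. a \<in> pw Q 1} - S"
  have T: "finite T" "T \<subseteq> pts - S" using finite_zeros[OF a(2)] unfolding T_def by auto
  have aT: "ord_at Q a = 0" if "Q \<in> pts - S" "Q \<notin> T" for Q
    using not_in_pw1[of Q a] R_sub[of Q a] a(1) J(2) that unfolding T_def by blast
  obtain N where N: "\<And>Q. Q \<in> T \<Longrightarrow> ord_at Q a \<le> int N" using ord_le_bound[OF T(1)] by blast
  obtain c where c: "c \<in> I" "c \<noteq> 0" "\<And>Q x. Q \<in> T \<Longrightarrow> x \<in> I \<Longrightarrow> x \<in> pw Q (ord_at Q c)"
    using simultaneous_least_order[OF I(1,2) b T] by blast
  have fR: "kv.fincodim R J" by (rule fincodim_R_ideal[OF J(1,2) a])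
  have "kv.hqd R J d \<longleftrightarrow> kv.hqd I ?IJ d" for d
  proof (rule pr.hqd_iso_transfer[OF linear_mult[of c]])
    fix r assume r: "r \<in> R"
    show "c * r \<in> I" using submoduleD(4)[OF I(1) c(1) r] .
    show "(c * r \<in> ?IJ) = (r \<in> J)"
    proof
      assume cr: "c * r \<in> ?IJ"
      show "r \<in> J"
      proof (rule submodule_mem_local[OF J(1,3)])
        fix Q assume Q: "Q \<in> pts - S" and r0: "r \<noteq> 0"
        have Qp: "Q \<in> pts" using Q by blast
        show "\<exists>b\<in>J. b \<noteq> 0 \<and> ord_at Q b \<le> ord_at Q r"
        proof (cases "Q \<in> T")
          case True
          obtain b where b: "b \<in> J" "b \<noteq> 0" "\<And>x. x \<in> J \<Longrightarrow> x \<in> pw Q (ord_at Q b)"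
            using least_order[OF J(2) a Q] by blast
          have "?IJ \<subseteq> pw Q (ord_at Q c + ord_at Q b)"
            by (rule ideal_mult_least[OF pw_submodule[OF Q]]) (rule pw_mult[OF Qp c(3)[OF True] b(3)])
          then have "ord_at Q c + ord_at Q b \<le> ord_at Q (c * r)" using cr c(2) r0 by (auto simp: pw_def)
          then show ?thesis using ord_mult[OF Qp c(2) r0] b by auto
        next
          case False
          then show ?thesis using aT[OF Q] a R_sub[OF Q r] mem_iff[OF Qp r0] by auto
        qed
      qed
    qed (rule ideal_mult_mem[OF c(1)])
  next
    fix x assume x: "x \<in> I"
    have "x / c \<in> Q" if Q: "Q \<in> T" for Q
    proof -
      have Qp: "Q \<in> pts" using Q T by blast
      have "inverse c \<in> pw Q (- ord_at Q c)" using ord_inverse[OF Qp c(2)] by (simp add: pw_def)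
      from pw_mult[OF Qp c(3)[OF Q x] this] show ?thesis using pw_0_eq[OF Qp] by (simp add: divide_inverse)
    qed
    then obtain r where r: "r \<in> R" "\<And>Q. Q \<in> T \<Longrightarrow> r - x / c \<in> pw Q (int N)"
      using R_approximation[OF T, of "\<lambda>_. x / c" N] by blast
    have zI: "x - c * r \<in> I"
    proof -
      have "x + (- 1) * (c * r) \<in> I"
        using submoduleD(2,3)[OF I(1)] submoduleD(4)[OF I(1) c(1) r(1)] x is_subringD(1,5)[OF reg_subring] by blast
      then show ?thesis by simp
    qed
    have "x - c * r \<in> ?IJ"
    proof (rule submodule_mem_local[OF sIJ ne])
      fix Q assume Q: "Q \<in> pts - S" and z0: "x - c * r \<noteq> 0"
      have Qp: "Q \<in> pts" using Q by blast
      show "\<exists>b\<in>?IJ. b \<noteq> 0 \<and> ord_at Q b \<le> ord_at Q (x - c * r)"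
      proof (cases "Q \<in> T")
        case True
        have "r - x / c \<in> pw Q (ord_at Q a)" using pw_monoD[OF r(2)[OF True] N[OF True]] .
        then have "c * (r - x / c) \<in> pw Q (ord_at Q c + ord_at Q a)"
          by (rule pw_mult[OF Qp, rotated]) (simp add: pw_def)
        then have "- (c * (r - x / c)) \<in> pw Q (ord_at Q c + ord_at Q a)" by (rule pw_uminus[OF Qp])
        moreover have "- (c * (r - x / c)) = x - c * r" using c(2) by (simp add: right_diff_distrib)
        ultimately have "ord_at Q (c * a) \<le> ord_at Q (x - c * r)"
          using z0 ord_mult[OF Qp c(2) a(2)] by (simp add: pw_def)
        then show ?thesis using ideal_mult_mem[OF c(1) a(1)] c(2) a(2)
          by (intro bexI[of _ "c * a"]) auto
      next
        case False
        have "ord_at Q ((x - c * r) * a) = ord_at Q (x - c * r)"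
          using ord_mult[OF Qp z0 a(2)] aT[OF Q False] by simp
        then show ?thesis using ideal_mult_mem[OF zI a(1)] z0 a(2)
          by (intro bexI[of _ "(x - c * r) * a"]) auto
      qed
    qed
    then show "\<exists>u\<in>R. x - c * u \<in> ?IJ" using r(1) by blast
  qed (use submoduleD(5) J sIJ R_submodule in blast)+
  then have iso: "quot_dim (\<lambda>c x. \<iota> c * x) R J = quot_dim (\<lambda>c x. \<iota> c * x) I ?IJ" "kv.fincodim I ?IJ"
    using fR quot_dim_cong[of "\<lambda>c x. \<iota> c * x" R J "\<lambda>c x. \<iota> c * x" I ?IJ] unfolding kv.fincodim_def by auto
  have "kv.commens I ?IJ" "kv.idx I ?IJ = int (quot_dim (\<lambda>c x. \<iota> c * x) I ?IJ)"
    using kv.commens_subset[OF submoduleD(5)[OF I(1)] submoduleD(5)[OF sIJ] sub iso(2)] by auto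
  then show "kv.idx R ?IJ = kv.idx R I + kv.idx R J"
    using kv.commens_trans_idx(2)[OF commens_R_ideal(1)[OF I(1,2) b]] iso(1)
      commens_R_ideal(2)[OF J(1,2) a] by simp
qed

end


section \<open>Primary decompositions and covolumes\<close>

subsection \<open>Elementary divisors over a discrete valuation ring\<close>

definition supported :: "nat set \<Rightarrow> 'K::zero set \<Rightarrow> (nat \<Rightarrow> 'K) set" where
  "supported I A = {u. (\<forall>i\<in>I. u i \<in> A) \<and> (\<forall>i. i \<notin> I \<longrightarrow> u i = 0)}"

lemma supportedD: "u \<in> supported I A \<Longrightarrow> i \<in> I \<Longrightarrow> u i \<in> A" "u \<in> supported I A \<Longrightarrow> i \<notin> I \<Longrightarrow> u i = 0"
  unfolding supported_def by auto

lemma scaled_imageI: "u \<in> A \<Longrightarrow> v = (\<lambda>l. a * u l) \<Longrightarrow> v \<in> (\<lambda>u l. a * u l) ` A"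
  by blast

context curve
begin

text \<open>The pivot is a coordinate of least order of an element of \<open>N\<close>; it divides all the coordinates of
  elements of \<open>N\<close> and splits off a direct summand.\<close>

lemma local_elementary_divisors:
  assumes Q: "Q \<in> pts" and I: "finite I"
    and N: "N \<subseteq> supported I Q" "(\<lambda>_. 0) \<in> N" "\<And>x y. x \<in> N \<Longrightarrow> y \<in> N \<Longrightarrow> (\<lambda>l. x l + y l) \<in> N"
      "\<And>r x. r \<in> Q \<Longrightarrow> x \<in> N \<Longrightarrow> (\<lambda>l. r * x l) \<in> N"
    and a: "a \<noteq> 0" "\<And>u. u \<in> supported I Q \<Longrightarrow> (\<lambda>l. a * u l) \<in> N"
  shows "\<exists>E e. (\<forall>i\<in>I. E i \<in> supported I Q)
    \<and> (\<forall>u\<in>supported I Q. \<exists>c. (\<forall>i\<in>I. c i \<in> Q) \<and> u = (\<lambda>l. \<Sum>i\<in>I. c i * E i l))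
    \<and> (\<forall>c. (\<forall>i\<in>I. c i \<in> Q) \<longrightarrow> ((\<lambda>l. \<Sum>i\<in>I. c i * E i l) \<in> N \<longleftrightarrow> (\<forall>i\<in>I. c i \<in> pw Q (int (e i)))))"
  using I N a
proof (induction "card I" arbitrary: I N)
  case 0
  then have "I = {}" by simp
  then show ?case using 0 by (auto simp: supported_def)
next
  case (Suc k)
  note Nm = Suc.prems(2-5) and am = Suc.prems(6,7)
  note D = is_subringD[OF pts_subring[OF Q]]
  obtain i0 where i0: "i0 \<in> I" using Suc.hyps(2) by fastforce
  let ?P = "\<lambda>(x, i). x \<in> N \<and> i \<in> I \<and> x i \<noteq> 0"
  have "(\<lambda>l. if l = i0 then 1 else 0) \<in> supported I Q" using D(1,4) i0 unfolding supported_def by auto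
  from am(2)[OF this] have "?P (\<lambda>l. a * (if l = i0 then 1 else 0), i0)" using i0 am(1) by simp
  then obtain z where z: "?P z" "\<And>w. ?P w \<Longrightarrow> nat (ord_at Q (fst z (snd z))) \<le> nat (ord_at Q (fst w (snd w)))"
    using ex_has_least_nat[of ?P _ "\<lambda>z. nat (ord_at Q (fst z (snd z)))"] by blast
  obtain x i where xi: "z = (x, i)" by (cases z)
  have x: "x \<in> N" "i \<in> I" "x i \<noteq> 0" using z(1) xi by auto
  define e where "e = nat (ord_at Q (x i))"
  have NQ: "y l \<in> Q" if "y \<in> N" for y l
    using that Nm(1) D(4) supportedD[of y I Q l] by (cases "l \<in> I") auto
  have ord0: "0 \<le> ord_at Q (x i)" using NQ[OF x(1), of i] x(3) mem_iff[OF Q] by blast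
  have least: "y l \<in> pw Q (int e)" if y: "y \<in> N" for y l
  proof (cases "l \<in> I \<and> y l \<noteq> 0")
    case True
    then have "?P (y, l)" using y by simp
    from z(2)[OF this] have "e \<le> nat (ord_at Q (y l))" unfolding e_def xi by simp
    moreover have "0 \<le> ord_at Q (y l)" using NQ[OF y] True mem_iff[OF Q] by blast
    ultimately have "int e \<le> ord_at Q (y l)" using le_nat_iff by blast
    then show ?thesis by (simp add: pw_def)
  next
    case False
    then show ?thesis using y Nm(1) supportedD(2)[of y I Q l] by auto
  qed
  have divQ: "r / x i \<in> Q" if r: "r \<in> pw Q (int e)" for r
  proof -
    have "inverse (x i) \<in> pw Q (- int e)" using ord_inverse[OF Q x(3)] ord0 by (simp add: pw_def e_def)
    from pw_mult[OF Q r this] show ?thesis using pw_0_eq[OF Q] by (simp add: divide_inverse)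
  qed
  define Ei where "Ei = (\<lambda>l. x l / x i)"
  have Ei1: "Ei i = 1" unfolding Ei_def using x(3) by simp
  have EiQ: "Ei \<in> supported I Q"
    unfolding supported_def Ei_def using divQ[OF least[OF x(1)]] supportedD(2)[of x I Q] x(1) Nm(1) by auto
  define I' where "I' = I - {i}"
  define N' where "N' = {y \<in> N. y i = 0}"
  have card: "k = card I'" unfolding I'_def using Suc.hyps(2) x(2) Suc.prems(1) by simp
  have sup': "u \<in> supported I' Q \<longleftrightarrow> u \<in> supported I Q \<and> u i = 0" for u
    unfolding supported_def I'_def using x(2) D(4) by (auto split: if_splits)
  have "\<exists>E e. (\<forall>i\<in>I'. E i \<in> supported I' Q)
    \<and> (\<forall>u\<in>supported I' Q. \<exists>c. (\<forall>i\<in>I'. c i \<in> Q) \<and> u = (\<lambda>l. \<Sum>i\<in>I'. c i * E i l))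
    \<and> (\<forall>c. (\<forall>i\<in>I'. c i \<in> Q) \<longrightarrow> ((\<lambda>l. \<Sum>i\<in>I'. c i * E i l) \<in> N' \<longleftrightarrow> (\<forall>i\<in>I'. c i \<in> pw Q (int (e i)))))"
  proof (rule Suc.hyps(1)[OF card])
    show "finite I'" using Suc.prems(1) unfolding I'_def by simp
    show "N' \<subseteq> supported I' Q" unfolding N'_def using sup' Nm(1) by blast
    show "(\<lambda>_. 0) \<in> N'" using Nm(2) unfolding N'_def by simp
    show "(\<lambda>l. x l + y l) \<in> N'" if "x \<in> N'" "y \<in> N'" for x y using that Nm(3) unfolding N'_def by simp
    show "(\<lambda>l. r * x l) \<in> N'" if "r \<in> Q" "x \<in> N'" for r x using that Nm(4) unfolding N'_def by simp
    show "(\<lambda>l. a * u l) \<in> N'" if "u \<in> supported I' Q" for u using that am(2) sup' unfolding N'_def by simp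
  qed (rule am(1))
  then obtain E' e' where EE: "(\<forall>i\<in>I'. E' i \<in> supported I' Q)
    \<and> (\<forall>u\<in>supported I' Q. \<exists>c. (\<forall>i\<in>I'. c i \<in> Q) \<and> u = (\<lambda>l. \<Sum>i\<in>I'. c i * E' i l))
    \<and> (\<forall>c. (\<forall>i\<in>I'. c i \<in> Q) \<longrightarrow> ((\<lambda>l. \<Sum>i\<in>I'. c i * E' i l) \<in> N' \<longleftrightarrow> (\<forall>i\<in>I'. c i \<in> pw Q (int (e' i)))))"
    by (elim exE)
  have E': "E' j \<in> supported I' Q" if "j \<in> I'" for j
    by (rule bspec[OF conjunct1[OF EE] that])
  have gen: "\<exists>c. (\<forall>i\<in>I'. c i \<in> Q) \<and> u = (\<lambda>l. \<Sum>i\<in>I'. c i * E' i l)" if "u \<in> supported I' Q" for u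
    by (rule bspec[OF conjunct1[OF conjunct2[OF EE]] that])
  have mem: "(\<lambda>l. \<Sum>i\<in>I'. c i * E' i l) \<in> N' \<longleftrightarrow> (\<forall>i\<in>I'. c i \<in> pw Q (int (e' i)))"
    if "\<And>i. i \<in> I' \<Longrightarrow> c i \<in> Q" for c
    by (rule mp[OF spec[OF conjunct2[OF conjunct2[OF EE]], of c]]) (rule ballI, rule that)
  define E where "E = E'(i := Ei)"
  define ee where "ee = e'(i := e)"
  have sumE: "(\<Sum>j\<in>I. c j * E j l) = c i * Ei l + (\<Sum>j\<in>I'. c j * E' j l)" for c l
  proof -
    have "(\<Sum>j\<in>I. c j * E j l) = c i * E i l + (\<Sum>j\<in>I'. c j * E j l)"
      unfolding I'_def by (rule sum.remove) (use Suc.prems(1) x(2) in auto)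
    also have "(\<Sum>j\<in>I'. c j * E j l) = (\<Sum>j\<in>I'. c j * E' j l)"
      by (rule sum.cong) (auto simp: E_def I'_def)
    finally show ?thesis by (simp add: E_def)
  qed
  have sum0: "(\<Sum>j\<in>I'. c j * E' j i) = 0" for c
    by (rule sum.neutral) (use E' sup' in auto)
  show ?case
  proof (intro exI[of _ E] exI[of _ ee] conjI ballI allI impI)
    fix j assume "j \<in> I"
    then show "E j \<in> supported I Q" using E'[of j] sup' EiQ unfolding E_def I'_def by auto
  next
    fix u assume u: "u \<in> supported I Q"
    have "u l - u i * Ei l \<in> Q" if "l \<in> I" for l
      by (rule D(2)[OF supportedD(1)[OF u that] D(3)[OF supportedD(1)[OF u x(2)] supportedD(1)[OF EiQ that]]])
    moreover have "u l - u i * Ei l = 0" if "l \<notin> I" for l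
      using supportedD(2)[OF u that] supportedD(2)[OF EiQ that] by simp
    ultimately have "(\<lambda>l. u l - u i * Ei l) \<in> supported I Q" unfolding supported_def by blast
    then have "(\<lambda>l. u l - u i * Ei l) \<in> supported I' Q" unfolding sup' using Ei1 by simp
    from gen[OF this] obtain c where c0: "(\<forall>j\<in>I'. c j \<in> Q) \<and>
      (\<lambda>l. u l - u i * Ei l) = (\<lambda>l. \<Sum>j\<in>I'. c j * E' j l)" by (elim exE)
    have c: "\<And>j. j \<in> I' \<Longrightarrow> c j \<in> Q" "\<And>l. u l - u i * Ei l = (\<Sum>j\<in>I'. c j * E' j l)"
      using bspec[OF conjunct1[OF c0]] fun_cong[OF conjunct2[OF c0]] by simp_all
    define c' where "c' = c(i := u i)"
    have "(\<Sum>j\<in>I'. c' j * E' j l) = (\<Sum>j\<in>I'. c j * E' j l)" for l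
      by (rule sum.cong) (auto simp: c'_def I'_def)
    then have "(\<Sum>j\<in>I. c' j * E j l) = u l" for l
      unfolding sumE c(2)[symmetric] by (simp add: c'_def)
    then have "u = (\<lambda>l. \<Sum>j\<in>I. c' j * E j l)" by simp
    moreover have "\<forall>j\<in>I. c' j \<in> Q"
      using c(1) supportedD(1)[OF u x(2)] unfolding c'_def I'_def by simp
    ultimately show "\<exists>c. (\<forall>i\<in>I. c i \<in> Q) \<and> u = (\<lambda>l. \<Sum>i\<in>I. c i * E i l)" by blast
  next
    fix c assume c: "\<forall>i\<in>I. c i \<in> Q"
    let ?u = "\<lambda>l. \<Sum>j\<in>I. c j * E j l" and ?w = "\<lambda>l. \<Sum>j\<in>I'. c j * E' j l"
    have ui: "?u i = c i" unfolding sumE sum0 Ei1 by simp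
    have part: "(\<lambda>l. s * Ei l) \<in> N" if "s \<in> pw Q (int e)" for s
    proof -
      have "(\<lambda>l. s / x i * x l) \<in> N" by (rule Nm(4)[OF divQ[OF that] x(1)])
      then show ?thesis unfolding Ei_def by (simp add: field_simps)
    qed
    have w: "?u \<in> N \<longleftrightarrow> ?w \<in> N'" if ci: "c i \<in> pw Q (int e)"
    proof
      assume "?u \<in> N"
      have "- c i \<in> pw Q (int e)" by (rule pw_uminus[OF Q ci])
      from Nm(3)[OF \<open>?u \<in> N\<close> part[OF this]] have "?w \<in> N" unfolding sumE by simp
      then show "?w \<in> N'" unfolding N'_def using sum0 by simp
    next
      assume "?w \<in> N'"
      then have "?w \<in> N" unfolding N'_def by blast
      from Nm(3)[OF part[OF ci] this] show "?u \<in> N" unfolding sumE .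
    qed
    have I'c: "\<And>j. j \<in> I' \<Longrightarrow> c j \<in> Q" using c unfolding I'_def by blast
    have eq: "(\<forall>j\<in>I. c j \<in> pw Q (int (ee j))) \<longleftrightarrow> c i \<in> pw Q (int e) \<and> (\<forall>j\<in>I'. c j \<in> pw Q (int (e' j)))"
      using x(2) unfolding ee_def I'_def by auto
    show "(?u \<in> N) = (\<forall>j\<in>I. c j \<in> pw Q (int (ee j)))"
      unfolding eq using least[of ?u i] ui w mem[OF I'c] by auto
  qed
qed

end

subsection \<open>Lattices as spaces of functions\<close>

sublocale field_ext \<subseteq> kn: relative_dimension "\<lambda>c (f :: nat \<Rightarrow> 'K) i. \<iota> c * f i"
  by (rule relative_dimension_fun)

context affine_curve
begin

abbreviation Rn :: "nat \<Rightarrow> (nat \<Rightarrow> 'K) set" where "Rn n \<equiv> supported {..<n} R"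

text \<open>Lattices of rank \<open>n\<close>, as spaces of functions on all of \<open>nat\<close> that vanish from \<open>n\<close> on; this makes
  products of ideals instances of \<open>box\<close>. Finite generation and spanning are replaced by the equivalent
  condition that the lattice and \<open>R\<^sup>n\<close> contain multiples of each other.\<close>

definition fun_lattice :: "nat \<Rightarrow> (nat \<Rightarrow> 'K) set \<Rightarrow> bool" where
  "fun_lattice n L \<longleftrightarrow> L \<subseteq> supported {..<n} UNIV \<and> (\<lambda>_. 0) \<in> L
     \<and> (\<forall>x\<in>L. \<forall>y\<in>L. (\<lambda>l. x l + y l) \<in> L) \<and> (\<forall>r\<in>R. \<forall>x\<in>L. (\<lambda>l. r * x l) \<in> L)
     \<and> (\<exists>a\<in>R. a \<noteq> 0 \<and> (\<forall>x\<in>L. (\<lambda>l. a * x l) \<in> Rn n))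
     \<and> (\<exists>b\<in>R. b \<noteq> 0 \<and> (\<forall>x\<in>Rn n. (\<lambda>l. b * x l) \<in> L))"

lemma fun_latticeD:
  assumes "fun_lattice n L"
  shows "L \<subseteq> supported {..<n} UNIV" "(\<lambda>_. 0) \<in> L" "x \<in> L \<Longrightarrow> y \<in> L \<Longrightarrow> (\<lambda>l. x l + y l) \<in> L"
    "r \<in> R \<Longrightarrow> x \<in> L \<Longrightarrow> (\<lambda>l. r * x l) \<in> L" "kn.subspace L"
proof -
  show "L \<subseteq> supported {..<n} UNIV" "(\<lambda>_. 0) \<in> L" "x \<in> L \<Longrightarrow> y \<in> L \<Longrightarrow> (\<lambda>l. x l + y l) \<in> L"
    "r \<in> R \<Longrightarrow> x \<in> L \<Longrightarrow> (\<lambda>l. r * x l) \<in> L"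
    using assms unfolding fun_lattice_def by auto
  have "\<iota> c \<in> R" for c using reg_const[of S] by blast
  then show "kn.subspace L"
    by (intro kn.subspaceI) (use assms in \<open>auto simp: fun_lattice_def zero_fun_def plus_fun_def\<close>)
qed

lemma supported_box: "supported I A = box (\<lambda>i. if i \<in> I then A else {0})"
  unfolding supported_def box_def by auto

lemma subspace_R: "kv.subspace R"
  by (rule submoduleD(5)[OF R_submodule])

lemma supported_subspace: "kv.subspace A \<Longrightarrow> kn.subspace (supported I A)"
  unfolding supported_box by (rule box_subspace) auto

lemma scale_supported:
  "a \<noteq> 0 \<Longrightarrow> (\<lambda>u l. a * u l) ` supported I A = supported I ((*) a ` A)" for a :: 'K
proof
  assume a: "a \<noteq> 0"
  show "(\<lambda>u l. a * u l) ` supported I A \<subseteq> supported I ((*) a ` A)" unfolding supported_def by auto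
  show "supported I ((*) a ` A) \<subseteq> (\<lambda>u l. a * u l) ` supported I A"
  proof
    fix v assume v: "v \<in> supported I ((*) a ` A)"
    have "(\<lambda>l. inverse a * v l) \<in> supported I A"
      unfolding supported_def
    proof (intro CollectI conjI ballI allI impI)
      fix i assume "i \<in> I"
      then have "v i \<in> (*) a ` A" by (rule supportedD(1)[OF v])
      then show "inverse a * v i \<in> A" using a by (auto simp: mult.assoc[symmetric])
    next
      fix i assume "i \<notin> I"
      then show "inverse a * v i = 0" using supportedD(2)[OF v] by simp
    qed
    moreover have "v = (\<lambda>l. a * (inverse a * v l))" using a by (simp add: mult.assoc[symmetric])
    ultimately show "v \<in> (\<lambda>u l. a * u l) ` supported I A" by (rule scaled_imageI)
  qed
qed

lemma idx_supported:
  assumes A: "kv.commens A B"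
  shows "kn.commens (supported {..<n} A) (supported {..<n} B)"
    "kn.idx (supported {..<n} A) (supported {..<n} B) = int n * kv.idx A B"
proof -
  have s: "kv.subspace A" "kv.subspace B" using A unfolding kv.commens_def by auto
  have "kn.commens (supported {..<n} A) (supported {..<n} B) \<and>
    kn.idx (supported {..<n} A) (supported {..<n} B)
      = (\<Sum>i\<in>{..<n}. kv.idx (if i \<in> {..<n} then A else {0}) (if i \<in> {..<n} then B else {0}))"
    unfolding supported_box by (rule box_idx) (use A s in auto)
  then show "kn.commens (supported {..<n} A) (supported {..<n} B)"
    "kn.idx (supported {..<n} A) (supported {..<n} B) = int n * kv.idx A B" by auto
qed

lemma commens_mult_R: "a \<noteq> 0 \<Longrightarrow> kv.commens R ((*) a ` R)"
  by (rule fractional_commens[OF fractional_mult[OF fractional_R]])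

lemma fun_lattice_Rn: "fun_lattice n (Rn n)"
  unfolding fun_lattice_def
proof (intro conjI ballI)
  note D = is_subringD[OF reg_subring]
  show "Rn n \<subseteq> supported {..<n} UNIV" "(\<lambda>_. 0) \<in> Rn n" unfolding supported_def using D(4) by auto
  show "(\<lambda>l. x l + y l) \<in> Rn n" if "x \<in> Rn n" "y \<in> Rn n" for x y
    using that D(6) unfolding supported_def by auto
  show "(\<lambda>l. r * x l) \<in> Rn n" if "r \<in> R" "x \<in> Rn n" for r x
    using that D(3) unfolding supported_def by auto
  show "\<exists>a\<in>R. a \<noteq> 0 \<and> (\<forall>x\<in>Rn n. (\<lambda>l. a * x l) \<in> Rn n)"
    "\<exists>a\<in>R. a \<noteq> 0 \<and> (\<forall>x\<in>Rn n. (\<lambda>l. a * x l) \<in> Rn n)"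
    using D(1) by (auto intro!: bexI[of _ 1])
qed

text \<open>The lattice lies between two multiples of \<open>R\<^sup>n\<close>.\<close>

lemma fun_lattice_commens:
  assumes L: "fun_lattice n L"
  shows "kn.commens (Rn n) L"
proof -
  obtain a b where a: "a \<in> R" "a \<noteq> 0" "\<And>x. x \<in> L \<Longrightarrow> (\<lambda>l. a * x l) \<in> Rn n"
    and b: "b \<in> R" "b \<noteq> 0" "\<And>x. x \<in> Rn n \<Longrightarrow> (\<lambda>l. b * x l) \<in> L"
    using L unfolding fun_lattice_def by blast
  let ?A = "supported {..<n} ((*) (inverse a) ` R)" and ?B = "supported {..<n} ((*) b ` R)"
  have B: "?B = (\<lambda>u l. b * u l) ` Rn n" using scale_supported[OF b(2), of "{..<n}" R] by simp
  have A: "?A = (\<lambda>u l. inverse a * u l) ` Rn n" using scale_supported[of "inverse a" "{..<n}" R] a(2) by simp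
  have LA: "L \<subseteq> ?A"
  proof
    fix x assume "x \<in> L"
    then have "(\<lambda>l. a * x l) \<in> Rn n" by (rule a(3))
    moreover have "x = (\<lambda>l. inverse a * (a * x l))" using a(2) by (simp add: mult.assoc[symmetric])
    ultimately show "x \<in> ?A" unfolding A by (rule scaled_imageI)
  qed
  have BL: "?B \<subseteq> L" unfolding B using b(3) by blast
  have BR: "?B \<subseteq> Rn n" unfolding B using fun_latticeD(4)[OF fun_lattice_Rn b(1)] by blast
  have RA: "Rn n \<subseteq> ?A"
  proof
    fix x assume "x \<in> Rn n"
    then have "(\<lambda>l. a * x l) \<in> Rn n" by (rule fun_latticeD(4)[OF fun_lattice_Rn a(1)])
    moreover have "x = (\<lambda>l. inverse a * (a * x l))" using a(2) by (simp add: mult.assoc[symmetric])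
    ultimately show "x \<in> ?A" unfolding A by (rule scaled_imageI)
  qed
  have "kv.commens ((*) (inverse a) ` R) ((*) b ` R)"
    using kv.commens_trans_idx(1)[OF kv.commens_sym[OF commens_mult_R] commens_mult_R] a(2) b(2) by simp
  from idx_supported(1)[OF this, of n] have AB: "kn.fincodim ?A (?A \<inter> ?B)" "kn.subspace ?B"
    unfolding kn.commens_def by auto
  have "?A \<inter> ?B = ?B" using BL LA by blast
  then have fA: "kn.fincodim ?A ?B" using AB by simp
  have "kn.fincodim (Rn n) ?B" by (rule kn.fincodim_mono[OF AB(2,2) _ RA fA]) auto
  moreover have "kn.fincodim L ?B" by (rule kn.fincodim_mono[OF AB(2,2) _ LA fA]) auto
  ultimately show ?thesis
    using kn.idx_common(1)[OF supported_subspace[OF subspace_R] fun_latticeD(5)[OF L] AB(2) BR BL] by blast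
qed

lemma linear_fun_mult: "Vector_Spaces.linear (\<lambda>c (f :: nat \<Rightarrow> 'K) i. \<iota> c * f i) (\<lambda>c f i. \<iota> c * f i) (\<lambda>u l. a * u l)"
  by unfold_locales (simp_all add: fun_eq_iff algebra_simps)

lemma idx_scale_lattice:
  assumes L: "fun_lattice n L" and a: "a \<noteq> 0"
  shows "kn.idx (Rn n) ((\<lambda>u l. a * u l) ` L) = int n * kv.idx R ((*) a ` R) + kn.idx (Rn n) L"
proof -
  interpret pr: relative_dimension_pair "\<lambda>c (f :: nat \<Rightarrow> 'K) i. \<iota> c * f i" "\<lambda>c (f :: nat \<Rightarrow> 'K) i. \<iota> c * f i"
    by unfold_locales
  have "inj (\<lambda>(u :: nat \<Rightarrow> 'K) l. a * u l)" using a by (auto simp: inj_def fun_eq_iff)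
  from pr.idx_transfer[OF linear_fun_mult this fun_lattice_commens[OF L]]
  have 1: "kn.commens ((\<lambda>u l. a * u l) ` Rn n) ((\<lambda>u l. a * u l) ` L)"
    "kn.idx ((\<lambda>u l. a * u l) ` Rn n) ((\<lambda>u l. a * u l) ` L) = kn.idx (Rn n) L" by auto
  have "kn.commens (Rn n) ((\<lambda>u l. a * u l) ` Rn n)"
    "kn.idx (Rn n) ((\<lambda>u l. a * u l) ` Rn n) = int n * kv.idx R ((*) a ` R)"
    unfolding scale_supported[OF a] using idx_supported[OF commens_mult_R[OF a]] by auto
  then show ?thesis using kn.commens_trans_idx(2)[OF _ 1(1)] 1(2) by simp
qed

subsection \<open>Existence of primary decompositions\<close>

abbreviation prime_at :: "'K set \<Rightarrow> 'K set" where "prime_at Q \<equiv> R \<inter> pw Q 1"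

lemma prime_at_prime:
  assumes Q: "Q \<in> pts - S"
  shows "prime_ideal_of R (prime_at Q)" "prime_at Q \<noteq> {0}"
proof -
  have Qp: "Q \<in> pts" using Q by blast
  note D = is_subringD[OF reg_subring]
  show "prime_ideal_of R (prime_at Q)"
    unfolding prime_ideal_of_def
  proof (intro conjI ballI impI)
    show "prime_at Q \<subseteq> R" "0 \<in> prime_at Q" using D(4) by auto
    show "1 \<notin> prime_at Q" using ord_one[OF Qp] by (simp add: pw_def)
    show "x + y \<in> prime_at Q" if "x \<in> prime_at Q" "y \<in> prime_at Q" for x y
      using that D(6) pw_add[OF Qp] by blast
    show "a * x \<in> prime_at Q" if "a \<in> R" "x \<in> prime_at Q" for a x
      using that D(3) pw_mult[OF Qp R_pw0[OF Q that(1)], of x 1] by auto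
    show "x \<in> prime_at Q \<or> y \<in> prime_at Q" if xy: "x \<in> R" "y \<in> R" "x * y \<in> prime_at Q" for x y
    proof (rule ccontr)
      assume "\<not> ?thesis"
      then have "x \<noteq> 0" "ord_at Q x = 0" "y \<noteq> 0" "ord_at Q y = 0"
        using not_in_pw1[OF Qp] R_sub[OF Q] xy by blast+
      then show False using xy(3) ord_mult[OF Qp, of x y] by (simp add: pw_def)
    qed
  qed
  obtain Q' where Q': "Q' \<in> pts - S" "Q' \<notin> {Q}" using pts_outside[of "{Q}"] by blast
  then obtain w where "w \<in> R" "w \<noteq> 0" "w \<in> pw Q 1"
    using R_local[OF Q'(1), of "{Q}" "{}" 1] Q by auto
  then show "prime_at Q \<noteq> {0}" by blast
qed

lemma ideal_pow_Suc: "ideal_pow R p (Suc e) = ideal_mult R p (ideal_pow R p e)"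
  unfolding ideal_pow_def by simp

text \<open>In the induction step, the local criterion is met at \<open>Q\<close> by a power of an element of order \<open>1\<close>, and
  at every other point by the square of a function that is invertible there and vanishes at \<open>Q\<close>.\<close>

lemma ideal_pow_prime_at:
  assumes Q: "Q \<in> pts - S"
  shows "ideal_pow R (prime_at Q) e = R \<inter> pw Q (int e)"
proof (induction e)
  case 0
  then show ?case unfolding ideal_pow_def using R_pw0[OF Q] by auto
next
  case (Suc e)
  have Qp: "Q \<in> pts" using Q by blast
  let ?M = "R \<inter> pw Q (int (Suc e))" and ?I = "ideal_mult R (prime_at Q) (R \<inter> pw Q (int e))"
  have sM: "is_submodule R ?M"
    using R_submodule pw_submodule[OF Q] unfolding is_submodule_def by auto
  have "?I \<subseteq> ?M"
  proof (rule ideal_mult_least[OF sM])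
    fix x y assume "x \<in> prime_at Q" "y \<in> R \<inter> pw Q (int e)"
    then show "x * y \<in> ?M" using is_subringD(3)[OF reg_subring] pw_mult[OF Qp, of x 1 y "int e"] by auto
  qed
  moreover have "?M \<subseteq> ?I"
  proof
    fix x assume x: "x \<in> ?M"
    obtain t where t: "t \<noteq> 0" "ord_at Q t = 1" using uniformizer[OF Qp] by blast
    then have "t \<in> Q" using mem_iff[OF Qp t(1)] by simp
    then obtain w where w: "w \<in> R" "w \<noteq> 0" "ord_at Q w = 0" "w * t \<in> R"
      using R_local[OF Q, of "{}" "{t}" 0] by auto
    define p where "p = w * t"
    have p: "p \<in> R" "p \<noteq> 0" "ord_at Q p = 1" using w t ord_mult[OF Qp w(2) t(1)] unfolding p_def by auto
    have pe: "p * p ^ e \<in> ?I"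
      by (rule ideal_mult_mem) (use p is_subring_power[OF reg_subring p(1)] ord_power[OF Qp p(2)] in \<open>auto simp: pw_def\<close>)
    show "x \<in> ?I"
    proof (rule submodule_mem_local[OF ideal_mult_submodule])
      show "\<exists>b\<in>?I. b \<noteq> 0" using pe p(2) by (intro bexI[of _ "p * p ^ e"]) auto
      fix Q' assume Q': "Q' \<in> pts - S" and x0: "x \<noteq> 0"
      show "\<exists>b\<in>?I. b \<noteq> 0 \<and> ord_at Q' b \<le> ord_at Q' x"
      proof (cases "Q' = Q")
        case True
        have "ord_at Q (p * p ^ e) = 1 + int e"
          using ord_mult[OF Qp, of p "p ^ e"] ord_power[OF Qp p(2)] p by simp
        moreover have "1 + int e \<le> ord_at Q x" using x x0 by (simp add: pw_def)
        ultimately show ?thesis using pe p(2) True by (intro bexI[of _ "p * p ^ e"]) auto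
      next
        case False
        obtain s where s: "s \<in> R" "s \<noteq> 0" "ord_at Q' s = 0" "s \<in> pw Q (int (Suc e))"
          using R_local[OF Q', of "{Q}" "{}" "Suc e"] Q False by auto
        have "s * s \<in> ?I"
          by (rule ideal_mult_mem) (use s pw_monoD[OF s(4)] in auto)
        moreover have "ord_at Q' (s * s) \<le> ord_at Q' x"
          using ord_mult[of Q' s s] s Q' R_sub[OF Q'] x x0 mem_iff[of Q' x] by auto
        ultimately show ?thesis using s(2) by (intro bexI[of _ "s * s"]) auto
      qed
    qed
  qed
  ultimately show ?case unfolding ideal_pow_Suc Suc.IH by blast
qed

lemma lattice_mem_local:
  assumes L: "fun_lattice n L" and v: "b \<in> R" "b \<noteq> 0" "(\<lambda>l. b * v l) \<in> L"
    and loc: "\<And>Q. Q \<in> pts - S \<Longrightarrow> b \<in> pw Q 1 \<Longrightarrow> \<exists>s\<in>R. s \<notin> pw Q 1 \<and> (\<lambda>l. s * v l) \<in> L"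
  shows "v \<in> L"
proof -
  let ?J = "{r \<in> R. (\<lambda>l. r * v l) \<in> L}"
  have J: "is_submodule R ?J"
    unfolding is_submodule_def
    using is_subringD[OF reg_subring] fun_latticeD(2)[OF L] fun_latticeD(3)[OF L, of "\<lambda>l. _ * v l" "\<lambda>l. _ * v l"]
      fun_latticeD(4)[OF L, of _ "\<lambda>l. _ * v l"]
    by (auto simp: distrib_right mult.assoc)
  have "1 \<in> ?J"
  proof (rule unit_ideal[OF J])
    show "b \<in> ?J" using v by simp
    show "b \<noteq> 0" by (rule v)
    fix Q assume "Q \<in> pts - S"
    then show "\<exists>b\<in>?J. b \<notin> pw Q 1" using loc[of Q] v by (cases "b \<in> pw Q 1") auto
  qed auto
  then show ?thesis by simp
qed

text \<open>The elementary divisors of the localizations of \<open>L\<close> at the finitely many points \<open>Q\<close> with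
  \<open>L\<^sub>Q \<noteq> R\<^sub>Q\<^sup>n\<close>, with bases that are approximated at all these points at once.\<close>

lemma primary_decomposition_fun:
  assumes L: "fun_lattice n L" "L \<subseteq> Rn n"
  shows "\<exists>T F e. finite T \<and> T \<subseteq> pts - S \<and> (\<forall>z\<in>T \<times> {..<n}. F z \<in> Rn n)
    \<and> (\<forall>u\<in>Rn n. \<exists>\<alpha>. (\<forall>z\<in>T \<times> {..<n}. \<alpha> z \<in> R) \<and> (\<lambda>l. u l - (\<Sum>z\<in>T \<times> {..<n}. F z l * \<alpha> z)) \<in> L)
    \<and> (\<forall>\<alpha>. (\<forall>z\<in>T \<times> {..<n}. \<alpha> z \<in> R) \<longrightarrow> ((\<lambda>l. \<Sum>z\<in>T \<times> {..<n}. F z l * \<alpha> z) \<in> L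
        \<longleftrightarrow> (\<forall>z\<in>T \<times> {..<n}. \<alpha> z \<in> pw (fst z) (int (e z)))))"
proof -
  let ?I = "{..<n}"
  note RD = is_subringD[OF reg_subring]
  obtain b where b: "b \<in> R" "b \<noteq> 0" "\<And>x. x \<in> Rn n \<Longrightarrow> (\<lambda>l. b * x l) \<in> L"
    using L(1) unfolding fun_lattice_def by blast
  define T where "T = {Q \<in> pts. b \<in> pw Q 1} - S"
  have T: "finite T" "T \<subseteq> pts - S" using finite_zeros[OF b(2)] unfolding T_def by auto
  obtain N where N: "\<And>Q. Q \<in> T \<Longrightarrow> ord_at Q b \<le> int N" using ord_le_bound[OF T(1)] by blast
  define LQ where "LQ = (\<lambda>Q. {u \<in> supported ?I Q. \<exists>s\<in>R. s \<notin> pw Q 1 \<and> (\<lambda>l. s * u l) \<in> L})"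
  have unit_mult: "s * t \<in> R \<and> s * t \<notin> pw Q 1" if Q: "Q \<in> T" and st: "s \<in> R" "t \<in> R" "s \<notin> pw Q 1" "t \<notin> pw Q 1" for Q s t
  proof -
    have Qp: "Q \<in> pts" "Q \<in> pts - S" using Q T by auto
    have "s \<noteq> 0" "ord_at Q s = 0" "t \<noteq> 0" "ord_at Q t = 0"
      using not_in_pw1[OF Qp(1)] R_sub[OF Qp(2)] st by blast+
    then show ?thesis using RD(3)[OF st(1,2)] ord_mult[OF Qp(1), of s t] by (simp add: pw_def)
  qed
  have LQ0: "(\<lambda>_. 0) \<in> LQ Q" if Q: "Q \<in> T" for Q
  proof -
    have Qp: "Q \<in> pts" using Q T by auto
    have "1 \<notin> pw Q 1" using ord_one[OF Qp] by (simp add: pw_def)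
    then show ?thesis unfolding LQ_def supported_def
      using RD(1) is_subringD(4)[OF pts_subring[OF Qp]] fun_latticeD(2)[OF L(1)] by auto
  qed
  have LQadd: "(\<lambda>l. x l + y l) \<in> LQ Q" if Q: "Q \<in> T" and xy: "x \<in> LQ Q" "y \<in> LQ Q" for Q x y
  proof -
    have Qp: "Q \<in> pts" using Q T by auto
    obtain s t where s: "s \<in> R" "s \<notin> pw Q 1" "(\<lambda>l. s * x l) \<in> L" and t: "t \<in> R" "t \<notin> pw Q 1" "(\<lambda>l. t * y l) \<in> L"
      using xy unfolding LQ_def by blast
    have "(\<lambda>l. t * (s * x l) + s * (t * y l)) \<in> L"
      by (rule fun_latticeD(3)[OF L(1) fun_latticeD(4)[OF L(1) t(1) s(3)] fun_latticeD(4)[OF L(1) s(1) t(3)]])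
    then have "(\<lambda>l. s * t * (x l + y l)) \<in> L" by (simp add: algebra_simps)
    moreover have "(\<lambda>l. x l + y l) \<in> supported ?I Q"
      using xy is_subringD(6)[OF pts_subring[OF Qp]] unfolding LQ_def supported_def by auto
    ultimately show ?thesis unfolding LQ_def using unit_mult[OF Q s(1) t(1) s(2) t(2)] by blast
  qed
  have LQmult: "(\<lambda>l. r * x l) \<in> LQ Q" if Q: "Q \<in> T" and r: "r \<in> Q" and x: "x \<in> LQ Q" for Q r x
  proof -
    have Qp: "Q \<in> pts" "Q \<in> pts - S" using Q T by auto
    obtain s where s: "s \<in> R" "s \<notin> pw Q 1" "(\<lambda>l. s * x l) \<in> L" using x unfolding LQ_def by blast
    obtain w where w: "w \<in> R" "w \<noteq> 0" "ord_at Q w = 0" "w * r \<in> R"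
      using R_local[OF Qp(2), of "{}" "{r}" 0] r by auto
    have "w \<notin> pw Q 1" using w by (simp add: pw_def)
    have "(\<lambda>l. w * r * (s * x l)) \<in> L" by (rule fun_latticeD(4)[OF L(1) w(4) s(3)])
    then have "(\<lambda>l. w * s * (r * x l)) \<in> L" by (simp add: mult_ac)
    moreover have "(\<lambda>l. r * x l) \<in> supported ?I Q"
      using x r is_subringD(3)[OF pts_subring[OF Qp(1)]] unfolding LQ_def supported_def by auto
    ultimately show ?thesis unfolding LQ_def using unit_mult[OF Q w(1) s(1) \<open>w \<notin> pw Q 1\<close> s(2)] by blast
  qed
  have LQb: "(\<lambda>l. b * u l) \<in> LQ Q" if Q: "Q \<in> T" and u: "u \<in> supported ?I Q" for Q u
  proof -
    have Qp: "Q \<in> pts" "Q \<in> pts - S" using Q T by auto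
    have "u ` ?I \<subseteq> Q" using u unfolding supported_def by auto
    then obtain w where w: "w \<in> R" "w \<noteq> 0" "ord_at Q w = 0" "\<And>i. i < n \<Longrightarrow> w * u i \<in> R"
      using R_local[OF Qp(2), of "{}" "u ` ?I" 0] by auto
    have "(\<lambda>l. w * u l) \<in> Rn n" using w(4) u unfolding supported_def by auto
    from b(3)[OF this] have "(\<lambda>l. w * (b * u l)) \<in> L" by (simp add: mult_ac)
    moreover have "w \<notin> pw Q 1" using w by (simp add: pw_def)
    moreover have "b \<in> Q" using R_sub[OF Qp(2) b(1)] .
    then have "(\<lambda>l. b * u l) \<in> supported ?I Q"
      using u is_subringD(3)[OF pts_subring[OF Qp(1)]] unfolding supported_def by auto
    ultimately show ?thesis unfolding LQ_def using w(1) by blast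
  qed
  \<comment> \<open>Vectors that vanish at \<open>Q\<close> to the order \<open>N\<close> are in the localization, so approximate bases
  are as good as exact ones.\<close>
  have LQsmall: "u \<in> LQ Q" if Q: "Q \<in> T" and u: "u \<in> supported ?I (pw Q (int N))" for Q u
  proof -
    have Qp: "Q \<in> pts" using Q T by auto
    have "inverse b \<in> pw Q (- ord_at Q b)" using ord_inverse[OF Qp b(2)] by (simp add: pw_def)
    then have "inverse b * x \<in> Q" if "x \<in> pw Q (int N)" for x
      using pw_mult[OF Qp _ pw_monoD[OF that N[OF Q]], of "inverse b" "- ord_at Q b"] pw_0_eq[OF Qp] by simp
    then have "(\<lambda>l. inverse b * u l) \<in> supported ?I Q" using u unfolding supported_def by auto
    from LQb[OF Q this] show ?thesis using b(2) by (simp add: mult.assoc[symmetric])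
  qed
  have "\<forall>Q\<in>T. \<exists>E e. (\<forall>i\<in>?I. E i \<in> supported ?I Q)
    \<and> (\<forall>u\<in>supported ?I Q. \<exists>c. (\<forall>i\<in>?I. c i \<in> Q) \<and> u = (\<lambda>l. \<Sum>i\<in>?I. c i * E i l))
    \<and> (\<forall>c. (\<forall>i\<in>?I. c i \<in> Q) \<longrightarrow> ((\<lambda>l. \<Sum>i\<in>?I. c i * E i l) \<in> LQ Q \<longleftrightarrow> (\<forall>i\<in>?I. c i \<in> pw Q (int (e i)))))"
  proof
    fix Q assume Q: "Q \<in> T"
    have Qp: "Q \<in> pts" using Q T by auto
    show "\<exists>E e. (\<forall>i\<in>?I. E i \<in> supported ?I Q)
    \<and> (\<forall>u\<in>supported ?I Q. \<exists>c. (\<forall>i\<in>?I. c i \<in> Q) \<and> u = (\<lambda>l. \<Sum>i\<in>?I. c i * E i l))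
    \<and> (\<forall>c. (\<forall>i\<in>?I. c i \<in> Q) \<longrightarrow> ((\<lambda>l. \<Sum>i\<in>?I. c i * E i l) \<in> LQ Q \<longleftrightarrow> (\<forall>i\<in>?I. c i \<in> pw Q (int (e i)))))"
    proof (rule local_elementary_divisors[OF Qp _ _ LQ0[OF Q] LQadd[OF Q] LQmult[OF Q] b(2) LQb[OF Q]])
      show "LQ Q \<subseteq> supported ?I Q" unfolding LQ_def by blast
    qed auto
  qed
  from bchoice[OF this] obtain E where "\<forall>Q\<in>T. \<exists>e. (\<forall>i\<in>?I. E Q i \<in> supported ?I Q)
    \<and> (\<forall>u\<in>supported ?I Q. \<exists>c. (\<forall>i\<in>?I. c i \<in> Q) \<and> u = (\<lambda>l. \<Sum>i\<in>?I. c i * E Q i l))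
    \<and> (\<forall>c. (\<forall>i\<in>?I. c i \<in> Q) \<longrightarrow> ((\<lambda>l. \<Sum>i\<in>?I. c i * E Q i l) \<in> LQ Q \<longleftrightarrow> (\<forall>i\<in>?I. c i \<in> pw Q (int (e i)))))"
    by blast
  from bchoice[OF this] obtain e where Ee: "\<forall>Q\<in>T. (\<forall>i\<in>?I. E Q i \<in> supported ?I Q)
    \<and> (\<forall>u\<in>supported ?I Q. \<exists>c. (\<forall>i\<in>?I. c i \<in> Q) \<and> u = (\<lambda>l. \<Sum>i\<in>?I. c i * E Q i l))
    \<and> (\<forall>c. (\<forall>i\<in>?I. c i \<in> Q) \<longrightarrow> ((\<lambda>l. \<Sum>i\<in>?I. c i * E Q i l) \<in> LQ Q \<longleftrightarrow> (\<forall>i\<in>?I. c i \<in> pw Q (int (e Q i)))))"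
    by blast
  have E: "E Q i \<in> supported ?I Q" if "Q \<in> T" "i \<in> ?I" for Q i using Ee that by blast
  have gen: "\<exists>c. (\<forall>i\<in>?I. c i \<in> Q) \<and> u = (\<lambda>l. \<Sum>i\<in>?I. c i * E Q i l)" if "Q \<in> T" "u \<in> supported ?I Q" for Q u
    using Ee that by blast
  have mem: "(\<lambda>l. \<Sum>i\<in>?I. c i * E Q i l) \<in> LQ Q \<longleftrightarrow> (\<forall>i\<in>?I. c i \<in> pw Q (int (e Q i)))"
    if Q: "Q \<in> T" and c: "\<And>i. i \<in> ?I \<Longrightarrow> c i \<in> Q" for Q c
  proof -
    from bspec[OF Ee Q] have "\<forall>c. (\<forall>i\<in>?I. c i \<in> Q) \<longrightarrow>
      ((\<lambda>l. \<Sum>i\<in>?I. c i * E Q i l) \<in> LQ Q \<longleftrightarrow> (\<forall>i\<in>?I. c i \<in> pw Q (int (e Q i))))" by (elim conjE)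
    from mp[OF spec[OF this, of c]] show ?thesis using c by blast
  qed
  have EQ: "E Q i l \<in> Q" if "Q \<in> T" "i \<in> ?I" for Q i l
    using supportedD[OF E[OF that]] T(2) that is_subringD(4)[OF pts_subring, of Q] by (cases "l \<in> ?I") auto
  have "\<forall>z\<in>(T \<times> ?I) \<times> ?I. \<exists>f. f \<in> R \<and> (\<forall>Q\<in>T. f - (if Q = fst (fst z) then E Q (snd (fst z)) (snd z) else 0) \<in> pw Q (int N))"
  proof
    fix z assume z: "z \<in> (T \<times> ?I) \<times> ?I"
    have "\<exists>f\<in>R. \<forall>Q\<in>T. f - (if Q = fst (fst z) then E Q (snd (fst z)) (snd z) else 0) \<in> pw Q (int N)"
    proof (rule R_approximation[OF T])
      fix Q assume Q: "Q \<in> T"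
      then show "(if Q = fst (fst z) then E Q (snd (fst z)) (snd z) else 0) \<in> Q"
        using EQ[OF Q] z T(2) is_subringD(4)[OF pts_subring, of Q] by auto
    qed
    then show "\<exists>f. f \<in> R \<and> (\<forall>Q\<in>T. f - (if Q = fst (fst z) then E Q (snd (fst z)) (snd z) else 0) \<in> pw Q (int N))"
      by blast
  qed
  from bchoice[OF this] obtain f where f0: "\<forall>z\<in>(T \<times> ?I) \<times> ?I. f z \<in> R \<and>
    (\<forall>Q\<in>T. f z - (if Q = fst (fst z) then E Q (snd (fst z)) (snd z) else 0) \<in> pw Q (int N))" by (elim exE)
  have f1: "f z \<in> R" if "z \<in> (T \<times> ?I) \<times> ?I" for z
    by (rule conjunct1[OF bspec[OF f0 that]])
  have f2: "f z - (if Q = fst (fst z) then E Q (snd (fst z)) (snd z) else 0) \<in> pw Q (int N)"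
    if "z \<in> (T \<times> ?I) \<times> ?I" "Q \<in> T" for z Q
    by (rule bspec[OF conjunct2[OF bspec[OF f0 that(1)]] that(2)])
  define F where "F = (\<lambda>z l. if l < n then f (z, l) else 0)"
  have FR: "F z \<in> Rn n" if "z \<in> T \<times> ?I" for z
    unfolding F_def supported_def using f1[of "(z, _)"] that by auto
  have approx: "(\<lambda>l. (\<Sum>z\<in>T \<times> ?I. F z l * \<alpha> z) - (\<Sum>i\<in>?I. \<alpha> (Q, i) * E Q i l)) \<in> supported ?I (pw Q (int N))"
    if Q: "Q \<in> T" and \<alpha>: "\<And>z. z \<in> T \<times> ?I \<Longrightarrow> \<alpha> z \<in> R" for Q \<alpha>
  proof -
    have Qp: "Q \<in> pts" "Q \<in> pts - S" using Q T by auto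
    define G where "G = (\<lambda>z l. if Q = fst z then E Q (snd z) l else 0)"
    have "(\<Sum>i\<in>?I. \<alpha> (Q, i) * E Q i l) = (\<Sum>z\<in>{Q} \<times> ?I. G z l * \<alpha> z)" for l
    proof -
      have "{Q} \<times> ?I = Pair Q ` ?I" by auto
      then show ?thesis by (simp add: G_def sum.reindex inj_on_def mult.commute)
    qed
    also have "(\<Sum>z\<in>{Q} \<times> ?I. G z l * \<alpha> z) = (\<Sum>z\<in>T \<times> ?I. G z l * \<alpha> z)" for l
      by (rule sum.mono_neutral_left) (use T(1) Q in \<open>auto simp: G_def\<close>)
    finally have e: "(\<Sum>z\<in>T \<times> ?I. F z l * \<alpha> z) - (\<Sum>i\<in>?I. \<alpha> (Q, i) * E Q i l)
      = (\<Sum>z\<in>T \<times> ?I. (F z l - G z l) * \<alpha> z)" for l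
      by (simp add: left_diff_distrib sum_subtractf)
    show ?thesis
      unfolding e supported_def
    proof (intro CollectI conjI ballI allI impI)
      fix l assume l: "l \<in> ?I"
      show "(\<Sum>z\<in>T \<times> ?I. (F z l - G z l) * \<alpha> z) \<in> pw Q (int N)"
      proof (rule pw_sum[OF Qp(1)])
        fix z assume z: "z \<in> T \<times> ?I"
        have "F z l - G z l \<in> pw Q (int N)" using f2[of "(z, l)" Q] z l Q
          unfolding F_def G_def by (cases "Q = fst z") simp_all
        from pw_mult[OF Qp(1) this R_pw0[OF Qp(2) \<alpha>[OF z]]]
        show "(F z l - G z l) * \<alpha> z \<in> pw Q (int N)" by simp
      qed
    next
      fix l assume l: "l \<notin> ?I"
      have "G z l = 0" if z: "z \<in> T \<times> ?I" for z
      proof -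
        have "snd z \<in> ?I" using z by (simp add: mem_Times_iff)
        from supportedD(2)[OF E[OF Q this] l] show ?thesis unfolding G_def by (simp only: if_cancel)
      qed
      then show "(\<Sum>z\<in>T \<times> ?I. (F z l - G z l) * \<alpha> z) = 0"
        using l by (intro sum.neutral) (simp add: F_def)
    qed
  qed
  have sumR: "(\<lambda>l. \<Sum>z\<in>T \<times> ?I. F z l * \<alpha> z) \<in> Rn n" if \<alpha>: "\<And>z. z \<in> T \<times> ?I \<Longrightarrow> \<alpha> z \<in> R" for \<alpha>
    unfolding supported_def
  proof (intro CollectI conjI ballI allI impI)
    fix l assume "l \<in> ?I"
    then show "(\<Sum>z\<in>T \<times> ?I. F z l * \<alpha> z) \<in> R"
    proof (intro is_subring_sum[OF reg_subring])
      fix z assume z: "z \<in> T \<times> ?I"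
      show "F z l * \<alpha> z \<in> R" by (rule RD(3)[OF supportedD(1)[OF FR[OF z] \<open>l \<in> ?I\<close>] \<alpha>[OF z]])
    qed
  next
    fix l assume "l \<notin> ?I"
    then show "(\<Sum>z\<in>T \<times> ?I. F z l * \<alpha> z) = 0" by (intro sum.neutral) (use supportedD(2)[OF FR] in auto)
  qed
  have glob: "v \<in> L" if v: "v \<in> Rn n" and loc: "\<And>Q. Q \<in> T \<Longrightarrow> v \<in> LQ Q" for v
    by (rule lattice_mem_local[OF L(1) b(1,2) b(3)[OF v]]) (use loc in \<open>auto simp: T_def LQ_def\<close>)
  have LLQ: "v \<in> LQ Q" if v: "v \<in> L" and Q: "Q \<in> T" for v Q
  proof -
    have Qp: "Q \<in> pts" "Q \<in> pts - S" using Q T by auto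
    have "v \<in> supported ?I Q" using v L(2) R_sub[OF Qp(2)] unfolding supported_def by auto
    moreover have "1 \<notin> pw Q 1" using ord_one[OF Qp(1)] by (simp add: pw_def)
    ultimately show ?thesis unfolding LQ_def using RD(1) v by (auto intro!: bexI[of _ 1])
  qed
  have LQneg: "(\<lambda>l. x l - y l) \<in> LQ Q" if Q: "Q \<in> T" and xy: "x \<in> LQ Q" "y \<in> LQ Q" for Q x y
  proof -
    have "- 1 \<in> Q" using T(2) Q is_subringD(1,5)[OF pts_subring, of Q] by blast
    from LQadd[OF Q xy(1) LQmult[OF Q this xy(2)]] show ?thesis by simp
  qed
  show ?thesis
  proof (rule exI[of _ T], rule exI[of _ F], rule exI[of _ "\<lambda>z. e (fst z) (snd z)"], intro conjI ballI allI impI)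
    show "finite T" "T \<subseteq> pts - S" using T by auto
    show "F z \<in> Rn n" if "z \<in> T \<times> ?I" for z by (rule FR[OF that])
  next
    fix u assume u: "u \<in> Rn n"
    have "\<forall>Q\<in>T. \<exists>c. (\<forall>i\<in>?I. c i \<in> Q) \<and> u = (\<lambda>l. \<Sum>i\<in>?I. c i * E Q i l)"
    proof
      fix Q assume Q: "Q \<in> T"
      then have "u \<in> supported ?I Q" using u R_sub[of Q] T(2) unfolding supported_def by auto
      then show "\<exists>c. (\<forall>i\<in>?I. c i \<in> Q) \<and> u = (\<lambda>l. \<Sum>i\<in>?I. c i * E Q i l)" by (rule gen[OF Q])
    qed
    from bchoice[OF this] obtain c where c: "\<And>Q i. Q \<in> T \<Longrightarrow> i \<in> ?I \<Longrightarrow> c Q i \<in> Q"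
      "\<And>Q. Q \<in> T \<Longrightarrow> u = (\<lambda>l. \<Sum>i\<in>?I. c Q i * E Q i l)" by blast
    have "\<forall>z\<in>T \<times> ?I. \<exists>r. r \<in> R \<and> r - c (fst z) (snd z) \<in> pw (fst z) (int N)"
    proof
      fix z assume z: "z \<in> T \<times> ?I"
      have "\<exists>r\<in>R. \<forall>Q\<in>{fst z}. r - c (fst z) (snd z) \<in> pw Q (int N)"
        by (rule R_approximation) (use z c(1) T in auto)
      then show "\<exists>r. r \<in> R \<and> r - c (fst z) (snd z) \<in> pw (fst z) (int N)" by auto
    qed
    from bchoice[OF this] obtain \<alpha> where
      \<alpha>0: "\<forall>z\<in>T \<times> ?I. \<alpha> z \<in> R \<and> \<alpha> z - c (fst z) (snd z) \<in> pw (fst z) (int N)" by (elim exE)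
    have \<alpha>: "\<alpha> z \<in> R" "\<alpha> z - c (fst z) (snd z) \<in> pw (fst z) (int N)" if "z \<in> T \<times> ?I" for z
      using bspec[OF \<alpha>0 that] by simp_all
    let ?v = "\<lambda>l. \<Sum>z\<in>T \<times> ?I. F z l * \<alpha> z"
    have "(\<lambda>l. u l - ?v l) \<in> L"
    proof (rule glob)
      show "(\<lambda>l. u l - ?v l) \<in> Rn n" using u sumR[OF \<alpha>(1)] RD(2) unfolding supported_def by auto
      fix Q assume Q: "Q \<in> T"
      have Qp: "Q \<in> pts" using Q T by auto
      let ?w = "\<lambda>l. \<Sum>i\<in>?I. \<alpha> (Q, i) * E Q i l"
      have 1: "(\<lambda>l. ?v l - ?w l) \<in> LQ Q" by (rule LQsmall[OF Q approx[OF Q \<alpha>(1)]])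
      have "(\<lambda>l. ?w l - u l) \<in> supported ?I (pw Q (int N))"
        unfolding supported_def
      proof (intro CollectI conjI ballI allI impI)
        fix l assume "l \<in> ?I"
        have "?w l - u l = (\<Sum>i\<in>?I. (\<alpha> (Q, i) - c Q i) * E Q i l)"
          using fun_cong[OF c(2)[OF Q], of l] by (simp add: left_diff_distrib sum_subtractf)
        also have "\<dots> \<in> pw Q (int N)"
        proof (rule pw_sum[OF Qp])
          fix i assume i: "i \<in> ?I"
          have "E Q i l \<in> pw Q 0" using EQ[OF Q i] pw_0_eq[OF Qp] by simp
          then show "(\<alpha> (Q, i) - c Q i) * E Q i l \<in> pw Q (int N)"
            using pw_mult[OF Qp, of "\<alpha> (Q, i) - c Q i" "int N" "E Q i l" 0] \<alpha>(2)[of "(Q, i)"] Q i by auto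
        qed
        finally show "?w l - u l \<in> pw Q (int N)" .
      next
        fix l assume "l \<notin> ?I"
        then show "?w l - u l = 0" using supportedD(2)[OF u] supportedD(2)[OF E[OF Q]] by simp
      qed
      then have 2: "(\<lambda>l. ?w l - u l) \<in> LQ Q" by (rule LQsmall[OF Q])
      have "(\<lambda>l. 0 - ((?v l - ?w l) + (?w l - u l))) \<in> LQ Q"
        by (rule LQneg[OF Q LQ0[OF Q] LQadd[OF Q 1 2]])
      then show "(\<lambda>l. u l - ?v l) \<in> LQ Q" by simp
    qed
    then show "\<exists>\<alpha>. (\<forall>z\<in>T \<times> ?I. \<alpha> z \<in> R) \<and> (\<lambda>l. u l - (\<Sum>z\<in>T \<times> ?I. F z l * \<alpha> z)) \<in> L"
      using \<alpha>(1) by blast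
  next
    fix \<alpha> assume "\<forall>z\<in>T \<times> ?I. \<alpha> z \<in> R"
    then have \<alpha>: "\<And>z. z \<in> T \<times> ?I \<Longrightarrow> \<alpha> z \<in> R" by blast
    let ?v = "\<lambda>l. \<Sum>z\<in>T \<times> ?I. F z l * \<alpha> z"
    have iff: "?v \<in> LQ Q \<longleftrightarrow> (\<forall>i\<in>?I. \<alpha> (Q, i) \<in> pw Q (int (e Q i)))" if Q: "Q \<in> T" for Q
    proof -
      let ?w = "\<lambda>l. \<Sum>i\<in>?I. \<alpha> (Q, i) * E Q i l"
      have d: "(\<lambda>l. ?v l - ?w l) \<in> LQ Q" by (rule LQsmall[OF Q approx[OF Q \<alpha>]])
      have "?v \<in> LQ Q \<longleftrightarrow> ?w \<in> LQ Q"
      proof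
        assume "?v \<in> LQ Q"
        from LQneg[OF Q this d] show "?w \<in> LQ Q" by simp
      next
        assume "?w \<in> LQ Q"
        from LQadd[OF Q this d] show "?v \<in> LQ Q" by simp
      qed
      also have "\<dots> \<longleftrightarrow> (\<forall>i\<in>?I. \<alpha> (Q, i) \<in> pw Q (int (e Q i)))"
        by (rule mem[OF Q]) (use \<alpha> Q R_sub[of Q] T(2) in blast)
      finally show ?thesis .
    qed
    have vR: "?v \<in> Rn n" using \<alpha> by (rule sumR)
    have "?v \<in> L \<longleftrightarrow> (\<forall>Q\<in>T. ?v \<in> LQ Q)"
    proof
      show "\<forall>Q\<in>T. ?v \<in> LQ Q" if v: "?v \<in> L" using LLQ[OF v] by (rule ballI)
      show "?v \<in> L" if "\<forall>Q\<in>T. ?v \<in> LQ Q" by (rule glob[OF vR]) (rule bspec[OF that])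
    qed
    also have "\<dots> \<longleftrightarrow> (\<forall>Q\<in>T. \<forall>i\<in>?I. \<alpha> (Q, i) \<in> pw Q (int (e Q i)))"
      by (rule ball_cong[OF refl iff])
    also have "\<dots> \<longleftrightarrow> (\<forall>z\<in>T \<times> ?I. \<alpha> z \<in> pw (fst z) (int (e (fst z) (snd z))))"
      by (simp only: split_paired_Ball_Sigma fst_conv snd_conv)
    finally show "(?v \<in> L) = (\<forall>z\<in>T \<times> ?I. \<alpha> z \<in> pw (fst z) (int (e (fst z) (snd z))))" .
  qed
qed

end


subsection \<open>The index of a linear map is its determinant\<close>

text \<open>The matrix acts as the identity on the coordinates from \<open>n\<close> on, so that invertible matrices give
  injective maps on all functions.\<close>

definition mat_fun :: "nat \<Rightarrow> 'K::comm_ring_1 mat \<Rightarrow> (nat \<Rightarrow> 'K) \<Rightarrow> nat \<Rightarrow> 'K" where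
  "mat_fun n M u = (\<lambda>i. if i < n then \<Sum>k<n. M $$ (i, k) * u k else u i)"

lemma mult_mat_index:
  assumes "A \<in> carrier_mat n m" "B \<in> carrier_mat m l" "i < n" "j < l"
  shows "(A * B) $$ (i, j) = (\<Sum>k<m. A $$ (i, k) * B $$ (k, j))"
  using assms by (auto simp: scalar_prod_def atLeast0LessThan intro!: sum.cong)

lemma mult_vec_index:
  assumes "A \<in> carrier_mat n m" "v \<in> carrier_vec m" "i < n"
  shows "(A *\<^sub>v v) $ i = (\<Sum>k<m. A $$ (i, k) * v $ k)"
  using assms by (auto simp: scalar_prod_def atLeast0LessThan intro!: sum.cong)

lemma mat_fun_mult:
  assumes "A \<in> carrier_mat n n" "B \<in> carrier_mat n n"
  shows "mat_fun n (A * B) u = mat_fun n A (mat_fun n B u)"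
proof
  fix i
  show "mat_fun n (A * B) u i = mat_fun n A (mat_fun n B u) i"
  proof (cases "i < n")
    case True
    have "mat_fun n (A * B) u i = (\<Sum>k<n. \<Sum>l<n. A $$ (i, l) * B $$ (l, k) * u k)"
      unfolding mat_fun_def using True by (simp add: mult_mat_index[OF assms] sum_distrib_right)
    also have "\<dots> = (\<Sum>l<n. \<Sum>k<n. A $$ (i, l) * B $$ (l, k) * u k)" by (rule sum.swap)
    also have "\<dots> = mat_fun n A (mat_fun n B u) i"
      unfolding mat_fun_def using True by (simp add: sum_distrib_left mult.assoc)
    finally show ?thesis .
  qed (simp add: mat_fun_def)
qed

lemma mat_fun_one: "mat_fun n (1\<^sub>m n) u = u"
proof
  fix i
  show "mat_fun n (1\<^sub>m n) u i = u i"
  proof (cases "i < n")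
    case True
    have "mat_fun n (1\<^sub>m n) u i = (\<Sum>k<n. 1\<^sub>m n $$ (i, k) * u k)"
      unfolding mat_fun_def using True by simp
    also have "\<dots> = (\<Sum>k<n. if k = i then u i else 0)"
      by (rule sum.cong) (use True in auto)
    finally have "mat_fun n (1\<^sub>m n) u i = (\<Sum>k<n. if k = i then u i else 0)" .
    then show ?thesis using True by simp
  qed (simp add: mat_fun_def)
qed

lemma det_nonzero_inverse:
  assumes "A \<in> carrier_mat n n" "det A \<noteq> (0 :: 'a :: field)"
  shows "\<exists>B\<in>carrier_mat n n. A * B = 1\<^sub>m n \<and> B * A = 1\<^sub>m n"
  using det_non_zero_imp_unit[OF assms, of "()"] unfolding Units_def ring_mat_def by auto

text \<open>The identity matrix with its column \<open>k\<close> replaced by \<open>c\<close>.\<close>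

definition column_matrix :: "nat \<Rightarrow> nat \<Rightarrow> (nat \<Rightarrow> 'K) \<Rightarrow> 'K::comm_ring_1 mat" where
  "column_matrix n k c = mat n n (\<lambda>(i, j). if j = k then c i else if i = j then 1 else 0)"

lemma column_matrix_carrier [simp]: "column_matrix n k c \<in> carrier_mat n n"
  unfolding column_matrix_def by simp

lemma column_matrix_index:
  "i < n \<Longrightarrow> j < n \<Longrightarrow> column_matrix n k c $$ (i, j) = (if j = k then c i else if i = j then 1 else 0)"
  unfolding column_matrix_def by simp

lemma det_column_matrix:
  assumes k: "k < n"
  shows "det (column_matrix n k c) = c k"
proof -
  let ?N = "column_matrix n k c"
  have del: "mat_delete ?N k k = 1\<^sub>m (n - 1)"
    by (rule eq_matI) (use k in \<open>auto simp: mat_delete_def column_matrix_def\<close>)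
  have "det ?N = (\<Sum>j<n. ?N $$ (k, j) * cofactor ?N k j)"
    by (rule laplace_expansion_row[OF column_matrix_carrier k])
  also have "\<dots> = (\<Sum>j<n. if j = k then c k * cofactor ?N k k else 0)"
    by (rule sum.cong) (use k in \<open>auto simp: column_matrix_index\<close>)
  also have "\<dots> = c k * cofactor ?N k k" using k by simp
  also have "cofactor ?N k k = 1" unfolding cofactor_def del by simp
  finally show ?thesis by simp
qed

lemma mat_fun_column_matrix:
  assumes "k < n"
  shows "mat_fun n (column_matrix n k c) u i
    = (if i < n then (if i = k then c k * u k else u i + c i * u k) else u i)"
proof (cases "i < n")
  case True
  have "mat_fun n (column_matrix n k c) u i = (\<Sum>j<n. column_matrix n k c $$ (i, j) * u j)"
    unfolding mat_fun_def using True by simp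
  also have "\<dots> = (\<Sum>j<n. (if j = k then c i * u k else if i = j then u i else 0))"
    by (rule sum.cong) (use True in \<open>auto simp: column_matrix_index\<close>)
  also have "\<dots> = c i * u k + (\<Sum>j\<in>{..<n} - {k}. (if j = k then c i * u k else if i = j then u i else 0))"
    by (subst sum.remove[of _ k]) (use assms in auto)
  also have "(\<Sum>j\<in>{..<n} - {k}. (if j = k then c i * u k else if i = j then u i else 0))
    = (\<Sum>j\<in>{..<n} - {k}. if j = i then u i else 0)"
    by (rule sum.cong) auto
  also have "\<dots> = (if i = k then 0 else u i)" using True by simp
  finally show ?thesis using True by auto
qed (simp add: mat_fun_def)

context affine_curve
begin

lemma linear_mat_fun:
  "Vector_Spaces.linear (\<lambda>c (f :: nat \<Rightarrow> 'K) i. \<iota> c * f i) (\<lambda>c f i. \<iota> c * f i) (mat_fun n M)"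
  by unfold_locales (auto simp: mat_fun_def fun_eq_iff sum_distrib_left sum.distrib algebra_simps)

lemma mat_fun_inj:
  assumes "A \<in> carrier_mat n n" "det A \<noteq> (0 :: 'K)"
  shows "inj (mat_fun n A)"
proof -
  obtain B where B: "B \<in> carrier_mat n n" "B * A = 1\<^sub>m n" using det_nonzero_inverse[OF assms] by blast
  have "mat_fun n B (mat_fun n A u) = u" for u
    using mat_fun_mult[OF B(1) assms(1), of u] B(2) mat_fun_one by metis
  then show ?thesis by (metis injI)
qed

lemma mat_denominator: "\<exists>c\<in>R. c \<noteq> 0 \<and> (\<forall>i<n. \<forall>j<n. c * M $$ (i, j) \<in> R)"
proof -
  obtain c where "c \<in> R" "c \<noteq> 0" "\<And>y. y \<in> (\<lambda>(i, j). M $$ (i, j)) ` ({..<n} \<times> {..<n}) \<Longrightarrow> c * y \<in> R"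
    using R_denominator[of "(\<lambda>(i, j). M $$ (i, j)) ` ({..<n} \<times> {..<n})"] by blast
  then show ?thesis by (intro bexI[of _ c]) auto
qed

lemma mat_fun_denominator:
  assumes c: "\<And>i j. i < n \<Longrightarrow> j < n \<Longrightarrow> c * M $$ (i, j) \<in> R" and u: "u \<in> Rn n"
  shows "(\<lambda>l. c * mat_fun n M u l) \<in> Rn n"
  unfolding supported_def
proof (intro CollectI conjI ballI allI impI)
  fix l assume l: "l \<in> {..<n}"
  then have "c * mat_fun n M u l = (\<Sum>k<n. (c * M $$ (l, k)) * u k)"
    unfolding mat_fun_def by (simp add: sum_distrib_left mult.assoc)
  also have "\<dots> \<in> R"
  proof (rule is_subring_sum[OF reg_subring])
    fix k assume k: "k \<in> {..<n}"
    show "c * M $$ (l, k) * u k \<in> R"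
      by (rule is_subringD(3)[OF reg_subring c supportedD(1)[OF u k]]) (use l k in auto)
  qed
  finally show "c * mat_fun n M u l \<in> R" .
next
  fix l assume "l \<notin> {..<n}"
  then show "c * mat_fun n M u l = 0" using supportedD(2)[OF u, of l] unfolding mat_fun_def by simp
qed

lemma mat_fun_scale: "mat_fun n M (\<lambda>l. a * u l) = (\<lambda>l. a * mat_fun n M u l)"
  by (auto simp: mat_fun_def fun_eq_iff sum_distrib_left mult.left_commute)

lemma mat_fun_add: "mat_fun n M (\<lambda>l. u l + v l) = (\<lambda>l. mat_fun n M u l + mat_fun n M v l)"
  by (auto simp: mat_fun_def fun_eq_iff sum.distrib distrib_left)

lemma mat_fun_lattice:
  assumes M: "M \<in> carrier_mat n n" "det M \<noteq> 0" and L: "fun_lattice n L"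
  shows "fun_lattice n (mat_fun n M ` L)"
  unfolding fun_lattice_def
proof (intro conjI ballI)
  show "mat_fun n M ` L \<subseteq> supported {..<n} UNIV"
    using fun_latticeD(1)[OF L] unfolding supported_def mat_fun_def by auto
  have "(\<lambda>_. 0) = mat_fun n M (\<lambda>_. 0)" by (auto simp: mat_fun_def)
  then show "(\<lambda>_. 0) \<in> mat_fun n M ` L" using fun_latticeD(2)[OF L] by blast
next
  fix x y assume "x \<in> mat_fun n M ` L" "y \<in> mat_fun n M ` L"
  then obtain u v where uv: "u \<in> L" "v \<in> L" "x = mat_fun n M u" "y = mat_fun n M v" by blast
  have "(\<lambda>l. x l + y l) = mat_fun n M (\<lambda>l. u l + v l)" unfolding mat_fun_add uv ..
  then show "(\<lambda>l. x l + y l) \<in> mat_fun n M ` L" using fun_latticeD(3)[OF L uv(1,2)] by (rule image_eqI)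
next
  fix r x assume r: "r \<in> R" and "x \<in> mat_fun n M ` L"
  then obtain u where u: "u \<in> L" "x = mat_fun n M u" by blast
  have "(\<lambda>l. r * x l) = mat_fun n M (\<lambda>l. r * u l)" unfolding mat_fun_scale u ..
  then show "(\<lambda>l. r * x l) \<in> mat_fun n M ` L" using fun_latticeD(4)[OF L r u(1)] by (rule image_eqI)
next
  obtain a b where a: "a \<in> R" "a \<noteq> 0" "\<And>x. x \<in> L \<Longrightarrow> (\<lambda>l. a * x l) \<in> Rn n"
    and b: "b \<in> R" "b \<noteq> 0" "\<And>x. x \<in> Rn n \<Longrightarrow> (\<lambda>l. b * x l) \<in> L"
    using L unfolding fun_lattice_def by blast
  obtain c where c: "c \<in> R" "c \<noteq> 0" "\<And>i j. i < n \<Longrightarrow> j < n \<Longrightarrow> c * M $$ (i, j) \<in> R"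
    using mat_denominator[of n M] by blast
  have "(\<lambda>l. a * c * mat_fun n M x l) \<in> Rn n" if "x \<in> L" for x
    using mat_fun_denominator[where c = c and M = M, OF c(3) a(3)[OF that]]
    unfolding mat_fun_scale by (simp add: mult_ac)
  then show "\<exists>a\<in>R. a \<noteq> 0 \<and> (\<forall>x\<in>mat_fun n M ` L. (\<lambda>l. a * x l) \<in> Rn n)"
    using is_subringD(3)[OF reg_subring a(1) c(1)] a(2) c(2) by (intro bexI[of _ "a * c"]) auto
  obtain B where B: "B \<in> carrier_mat n n" "M * B = 1\<^sub>m n" using det_nonzero_inverse[OF M] by blast
  obtain d where d: "d \<in> R" "d \<noteq> 0" "\<And>i j. i < n \<Longrightarrow> j < n \<Longrightarrow> d * B $$ (i, j) \<in> R"
    using mat_denominator[of n B] by blast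
  have "(\<lambda>l. b * d * x l) \<in> mat_fun n M ` L" if x: "x \<in> Rn n" for x
  proof -
    have "(\<lambda>l. b * (d * mat_fun n B x l)) \<in> L"
      by (rule b(3)[OF mat_fun_denominator[where c = d and M = B, OF d(3) x]])
    then have 1: "mat_fun n B (\<lambda>l. b * d * x l) \<in> L" unfolding mat_fun_scale by (simp add: mult.assoc)
    have 2: "(\<lambda>l. b * d * x l) = mat_fun n M (mat_fun n B (\<lambda>l. b * d * x l))"
      using mat_fun_mult[OF M(1) B(1)] unfolding B(2) mat_fun_one by simp
    show ?thesis using imageI[OF 1, of "mat_fun n M"] unfolding 2[symmetric] .
  qed
  then show "\<exists>b\<in>R. b \<noteq> 0 \<and> (\<forall>x\<in>Rn n. (\<lambda>l. b * x l) \<in> mat_fun n M ` L)"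
    using is_subringD(3)[OF reg_subring b(1) d(1)] b(2) d(2) by (intro bexI[of _ "b * d"]) auto
qed

definition index_is_det :: "nat \<Rightarrow> 'K mat \<Rightarrow> bool" where
  "index_is_det n M \<longleftrightarrow> (\<forall>L. fun_lattice n L \<longrightarrow>
     kn.idx (Rn n) (mat_fun n M ` L) = kv.idx R ((*) (det M) ` R) + kn.idx (Rn n) L)"

text \<open>The index of \<open>M L\<close> in \<open>L\<close> does not depend on \<open>L\<close>, so one lattice suffices.\<close>

lemma index_is_detI:
  assumes M: "M \<in> carrier_mat n n" "det M \<noteq> 0" and D: "fun_lattice n D"
    and e: "kn.idx D (mat_fun n M ` D) = kv.idx R ((*) (det M) ` R)"
  shows "index_is_det n M"
  unfolding index_is_det_def
proof (intro allI impI)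
  fix L assume L: "fun_lattice n L"
  interpret pr: relative_dimension_pair "\<lambda>c (f :: nat \<Rightarrow> 'K) i. \<iota> c * f i" "\<lambda>c (f :: nat \<Rightarrow> 'K) i. \<iota> c * f i"
    by unfold_locales
  have c: "kn.commens A B" if "fun_lattice n A" "fun_lattice n B" for A B
    using kn.commens_trans_idx(1)[OF kn.commens_sym[OF fun_lattice_commens] fun_lattice_commens] that by blast
  note TL = mat_fun_lattice[OF M L] and TD = mat_fun_lattice[OF M D]
  have t: "kn.idx (mat_fun n M ` D) (mat_fun n M ` L) = kn.idx D L"
    by (rule pr.idx_transfer(2)[OF linear_mat_fun mat_fun_inj[OF M] c[OF D L]])
  have "kn.idx (Rn n) (mat_fun n M ` L) = kn.idx (Rn n) (mat_fun n M ` D) + kn.idx (mat_fun n M ` D) (mat_fun n M ` L)"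
    by (rule kn.commens_trans_idx(2)[OF c c]) (use TL TD fun_lattice_Rn in auto)
  also have "kn.idx (Rn n) (mat_fun n M ` D) = kn.idx (Rn n) D + kn.idx D (mat_fun n M ` D)"
    by (rule kn.commens_trans_idx(2)[OF c c]) (use D TD fun_lattice_Rn in auto)
  also have "kn.idx (Rn n) D = kn.idx (Rn n) L + kn.idx L D"
    by (rule kn.commens_trans_idx(2)[OF c c]) (use D L fun_lattice_Rn in auto)
  finally show "kn.idx (Rn n) (mat_fun n M ` L) = kv.idx R ((*) (det M) ` R) + kn.idx (Rn n) L"
    unfolding t e using kn.idx_swap[of L D] by simp
qed

lemma idx_R_prod:
  assumes "x \<noteq> 0" "y \<noteq> 0"
  shows "kv.idx R ((*) (x * y) ` R) = kv.idx R ((*) x ` R) + kv.idx R ((*) y ` R)"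
proof -
  have "(*) (x * y) ` R = (*) x ` (*) y ` R" by (simp add: image_image mult.assoc)
  then show ?thesis using idx_R_mult[OF fractional_mult[OF fractional_R assms(2)] assms(1)] by simp
qed

lemma mat_fun_image_mult:
  "A \<in> carrier_mat n n \<Longrightarrow> B \<in> carrier_mat n n \<Longrightarrow> mat_fun n (A * B) ` L = mat_fun n A ` mat_fun n B ` L"
  by (simp add: image_image mat_fun_mult)

lemma index_is_det_mult:
  assumes A: "A \<in> carrier_mat n n" "det A \<noteq> 0" "index_is_det n A"
    and B: "B \<in> carrier_mat n n" "det B \<noteq> 0"
  shows "index_is_det n (A * B) \<longleftrightarrow> index_is_det n B"
proof -
  have "kn.idx (Rn n) (mat_fun n (A * B) ` L) = kv.idx R ((*) (det A) ` R) + kn.idx (Rn n) (mat_fun n B ` L)"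
    if "fun_lattice n L" for L
    using A(3) mat_fun_lattice[OF B that] mat_fun_image_mult[OF A(1) B(1)] unfolding index_is_det_def by simp
  then show ?thesis
    unfolding index_is_det_def det_mult[OF A(1) B(1)] idx_R_prod[OF A(2) B(2)] by auto
qed

text \<open>On a lattice \<open>R \<oplus> \<dots> \<oplus> a R \<oplus> \<dots> \<oplus> R\<close> with \<open>a\<close> a common denominator of the column, the
  matrix only changes the summand \<open>a R\<close>.\<close>

lemma index_is_det_column_matrix:
  assumes k: "k < n" and c: "c k \<noteq> 0"
  shows "index_is_det n (column_matrix n k c)"
proof -
  obtain a where a: "a \<in> R" "a \<noteq> 0" "\<And>y. y \<in> c ` {..<n} \<Longrightarrow> a * y \<in> R"
    using R_denominator[of "c ` {..<n}"] by blast
  note RD = is_subringD[OF reg_subring]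
  define U where "U = (\<lambda>x i. if i = k then (*) x ` R else if i < n then R else {0})"
  have U_sub: "is_submodule R (U x i)" for x i
    unfolding U_def using R_submodule mult_image_submodule[OF R_submodule] by (auto simp: is_submodule_def)
  let ?D = "box (U a)"
  have D: "fun_lattice n ?D"
    unfolding fun_lattice_def
  proof (intro conjI ballI)
    show "?D \<subseteq> supported {..<n} UNIV" unfolding box_def supported_def U_def using k by (auto split: if_splits)
    show "(\<lambda>_. 0) \<in> ?D" using submoduleD(1)[OF U_sub] unfolding box_def by blast
    show "(\<lambda>l. x l + y l) \<in> ?D" if "x \<in> ?D" "y \<in> ?D" for x y
      using that submoduleD(2)[OF U_sub] unfolding box_def by blast
    show "(\<lambda>l. r * x l) \<in> ?D" if "r \<in> R" "x \<in> ?D" for r x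
      using that submoduleD(3)[OF U_sub] unfolding box_def by blast
    have "?D \<subseteq> Rn n"
    proof
      fix x assume "x \<in> ?D"
      then have x: "x i \<in> U a i" for i unfolding box_def by blast
      show "x \<in> Rn n" unfolding supported_def
      proof (intro CollectI conjI ballI allI impI)
        fix i assume "i \<in> {..<n}"
        then show "x i \<in> R" using x[of i] RD(3)[OF a(1)] unfolding U_def by (auto split: if_splits)
      next
        fix i assume "i \<notin> {..<n}"
        then show "x i = 0" using x[of i] k unfolding U_def by (auto split: if_splits)
      qed
    qed
    then show "\<exists>a\<in>R. a \<noteq> 0 \<and> (\<forall>x\<in>?D. (\<lambda>l. a * x l) \<in> Rn n)"
      using RD(1) by (intro bexI[of _ 1]) auto
    have "(\<lambda>l. a * x l) \<in> ?D" if "x \<in> Rn n" for x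
      using supportedD[OF that] RD(3)[OF a(1)] k unfolding box_def U_def by auto
    then show "\<exists>b\<in>R. b \<noteq> 0 \<and> (\<forall>x\<in>Rn n. (\<lambda>l. b * x l) \<in> ?D)"
      using a by (intro bexI[of _ a]) auto
  qed
  have "mat_fun n (column_matrix n k c) ` ?D = box (U (c k * a))"
  proof
    show "mat_fun n (column_matrix n k c) ` ?D \<subseteq> box (U (c k * a))"
    proof
      fix y assume "y \<in> mat_fun n (column_matrix n k c) ` ?D"
      then obtain u where u: "y = mat_fun n (column_matrix n k c) u" "\<And>i. u i \<in> U a i" unfolding box_def by blast
      have "u k \<in> (*) a ` R" using u(2)[of k] unfolding U_def by simp
      then obtain r where r: "r \<in> R" "u k = a * r" by blast
      have "y i \<in> U (c k * a) i" for i
      proof -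
        consider "i = k" | "i \<noteq> k" "i < n" | "i \<noteq> k" "\<not> i < n" by blast
        then show ?thesis
        proof cases
          case 1
          then have "y i = c k * a * r" unfolding u(1) mat_fun_column_matrix[OF k] using k r(2) by simp
          then show ?thesis using 1 r(1) unfolding U_def by auto
        next
          case 2
          have "u i \<in> R" using u(2)[of i] 2 unfolding U_def by simp
          moreover have "a * c i * r \<in> R" using RD(3)[OF a(3) r(1), of "c i"] 2 by simp
          ultimately have "u i + c i * u k \<in> R" using RD(6) unfolding r(2) by (simp add: mult_ac)
          then show ?thesis using 2 unfolding u(1) mat_fun_column_matrix[OF k] U_def by simp
        next
          case 3
          then show ?thesis using u(2)[of i] unfolding u(1) mat_fun_column_matrix[OF k] U_def by simp
        qed
      qed
      then show "y \<in> box (U (c k * a))" unfolding box_def by blast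
    qed
    show "box (U (c k * a)) \<subseteq> mat_fun n (column_matrix n k c) ` ?D"
    proof
      fix y assume "y \<in> box (U (c k * a))"
      then have y: "\<And>i. y i \<in> U (c k * a) i" unfolding box_def by blast
      have "y k \<in> (*) (c k * a) ` R" using y[of k] unfolding U_def by simp
      then obtain r where r: "r \<in> R" "y k = c k * a * r" by blast
      define u where "u = (\<lambda>i. if i = k then a * r else if i < n then y i - c i * (a * r) else y i)"
      have "u i \<in> U a i" for i
      proof -
        consider "i = k" | "i \<noteq> k" "i < n" | "i \<noteq> k" "\<not> i < n" by blast
        then show ?thesis
        proof cases
          case 1
          then show ?thesis using r(1) unfolding U_def u_def by auto
        next
          case 2
          have "y i \<in> R" using y[of i] 2 unfolding U_def by simp
          moreover have "a * c i * r \<in> R" using RD(3)[OF a(3) r(1), of "c i"] 2 by simp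
          ultimately have "y i - c i * (a * r) \<in> R" using RD(2) by (simp add: mult_ac)
          then show ?thesis using 2 unfolding u_def U_def by simp
        next
          case 3
          then show ?thesis using y[of i] unfolding u_def U_def by simp
        qed
      qed
      then have "u \<in> ?D" unfolding box_def by blast
      moreover have "y = mat_fun n (column_matrix n k c) u"
        by (rule ext) (use k in \<open>auto simp: mat_fun_column_matrix[OF k] u_def r(2)\<close>)
      ultimately show "y \<in> mat_fun n (column_matrix n k c) ` ?D" by (simp only: imageI)
    qed
  qed
  moreover have "kn.idx ?D (box (U (c k * a))) = kv.idx (U a k) (U (c k * a) k)"
  proof -
    have e: "U (c k * a) = (U a)(k := U (c k * a) k)" unfolding U_def by (rule ext) simp
    have cm: "kv.commens (U a k) (U (c k * a) k)"
      unfolding U_def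
      using kv.commens_trans_idx(1)[OF kv.commens_sym[OF commens_mult_R[OF a(2)]] commens_mult_R, of "c k * a"] a(2) c by simp
    show ?thesis
      by (subst e) (rule box_idx_one(2)[where U = "U a" and i = k, OF submoduleD(5)[OF U_sub] cm])
  qed
  moreover have "kv.idx (U a k) (U (c k * a) k) = kv.idx R ((*) (c k) ` R)"
  proof -
    have "kv.idx ((*) a ` R) ((*) (c k * a) ` R) = kv.idx R ((*) (c k * a) ` R) - kv.idx R ((*) a ` R)"
      using kv.commens_trans_idx(2)[OF kv.commens_sym[OF commens_mult_R[OF a(2)]] commens_mult_R, of "c k * a"]
        kv.idx_swap[of R "(*) a ` R"] a(2) c by simp
    then show ?thesis unfolding U_def using idx_R_prod[OF c a(2)] by simp
  qed
  ultimately have "kn.idx ?D (mat_fun n (column_matrix n k c) ` ?D) = kv.idx R ((*) (det (column_matrix n k c)) ` R)"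
    unfolding det_column_matrix[OF k] by simp
  then show ?thesis by (intro index_is_detI[OF column_matrix_carrier _ D]) (use c det_column_matrix[OF k, of c] in auto)
qed

text \<open>Gaussian elimination: the matrices that replace one column of the identity generate \<open>GL\<^sub>n\<close>.\<close>

lemma index_is_det_elimination:
  assumes "k + d = n" and "M \<in> carrier_mat n n" "det M \<noteq> 0"
    and "\<And>i j. i < n \<Longrightarrow> j < k \<Longrightarrow> M $$ (i, j) = (if i = j then 1 else 0)"
  shows "index_is_det n M"
  using assms
proof (induction d arbitrary: k M)
  case 0
  have "M = 1\<^sub>m n" by (rule eq_matI) (use 0 in auto)
  then show ?case unfolding index_is_det_def by (simp add: mat_fun_one image_def)
next
  case (Suc d)
  note M = Suc.prems(2,3) and unit = Suc.prems(4)
  have k: "k < n" using Suc.prems(1) by simp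
  have main: "index_is_det n A"
    if A: "A \<in> carrier_mat n n" "det A \<noteq> 0" and u: "\<And>i j. i < n \<Longrightarrow> j < k \<Longrightarrow> A $$ (i, j) = (if i = j then 1 else 0)"
      and p: "A $$ (k, k) \<noteq> 0" for A
  proof -
    define N where "N = column_matrix n k (\<lambda>i. A $$ (i, k))"
    have N: "N \<in> carrier_mat n n" "det N \<noteq> 0"
      using p det_column_matrix[OF k, of "\<lambda>i. A $$ (i, k)"] unfolding N_def by simp_all
    obtain N' where N': "N' \<in> carrier_mat n n" "N * N' = 1\<^sub>m n" "N' * N = 1\<^sub>m n"
      using det_nonzero_inverse[OF N] by blast
    define A' where "A' = N' * A"
    have A': "A' \<in> carrier_mat n n" unfolding A'_def using N' A by simp
    have NA: "N * A' = A" unfolding A'_def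
      using assoc_mult_mat[OF N(1) N'(1) A(1)] N'(2) A(1) by simp
    have dA': "det A' \<noteq> 0" using det_mult[OF N(1) A'] NA A(2) by auto
    have "A' $$ (i, j) = (if i = j then 1 else 0)" if ij: "i < n" "j < Suc k" for i j
    proof -
      have jn: "j < n" using ij k by simp
      have "A $$ (l, j) = N $$ (l, j)" if "l < n" for l
        unfolding N_def column_matrix_index[OF that jn] using u[OF that, of j] ij by auto
      then have "A' $$ (i, j) = (N' * N) $$ (i, j)"
        unfolding A'_def mult_mat_index[OF N'(1) A(1) ij(1) jn] mult_mat_index[OF N'(1) N(1) ij(1) jn] by simp
      then show ?thesis unfolding N'(3) using ij jn by simp
    qed
    then have iA': "index_is_det n A'" using Suc.IH[of "Suc k" A'] Suc.prems(1) A' dA' by simp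
    have "index_is_det n N"
      using index_is_det_column_matrix[OF k, of "\<lambda>i. A $$ (i, k)"] p unfolding N_def by simp
    then have "index_is_det n (N * A')" using index_is_det_mult[OF N _ A' dA'] iA' by blast
    then show ?thesis unfolding NA .
  qed
  have "\<exists>i. k \<le> i \<and> i < n \<and> M $$ (i, k) \<noteq> 0"
  proof (rule ccontr)
    assume "\<not> ?thesis"
    then have z: "M $$ (i, k) = 0" if "k \<le> i" "i < n" for i using that by blast
    define v where "v = vec n (\<lambda>j. if j = k then 1 else if j < k then - M $$ (j, k) else 0)"
    have v: "v \<in> carrier_vec n" unfolding v_def by simp
    have "v $ k = 1" unfolding v_def using k by simp
    then have "v \<noteq> 0\<^sub>v n" using k by auto
    moreover have "M *\<^sub>v v = 0\<^sub>v n"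
    proof (rule eq_vecI)
      fix i assume "i < dim_vec (0\<^sub>v n :: 'K vec)"
      then have i: "i < n" by simp
      have "(M *\<^sub>v v) $ i = (\<Sum>j<n. M $$ (i, j) * v $ j)" by (rule mult_vec_index[OF M(1) v i])
      also have "\<dots> = M $$ (i, k) + (\<Sum>j\<in>{..<n} - {k}. M $$ (i, j) * v $ j)"
        by (subst sum.remove[of _ k]) (use k in \<open>auto simp: v_def\<close>)
      also have "(\<Sum>j\<in>{..<n} - {k}. M $$ (i, j) * v $ j) = (\<Sum>j\<in>{..<n} - {k}. if j = i then (if i < k then - M $$ (i, k) else 0) else 0)"
        by (rule sum.cong) (use unit i in \<open>auto simp: v_def\<close>)
      also have "\<dots> = (if i < k then - M $$ (i, k) else 0)" using i by simp
      finally show "(M *\<^sub>v v) $ i = 0\<^sub>v n $ i" using i z[of i] by auto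
    qed (use M in auto)
    ultimately show False using det_0_iff_vec_prod_zero_field[OF M(1)] M(2) v by blast
  qed
  then obtain i where i: "k \<le> i" "i < n" "M $$ (i, k) \<noteq> 0" by blast
  show ?case
  proof (cases "M $$ (k, k) = 0")
    case False
    then show ?thesis using main[OF M unit] by blast
  next
    case True
    then have ik: "i \<noteq> k" using i by auto
    define c where "c = (\<lambda>l. if l = k \<or> l = i then 1 else 0 :: 'K)"
    define N where "N = column_matrix n i c"
    have N: "N \<in> carrier_mat n n" "det N \<noteq> 0" "index_is_det n N"
      using det_column_matrix[OF i(2), of c] index_is_det_column_matrix[OF i(2), of c] unfolding N_def c_def by auto
    have NM: "(N * M) $$ (r, j) = M $$ (r, j) + (if r = k then M $$ (i, j) else 0)" if rj: "r < n" "j < n" for r j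
    proof -
      have "(N * M) $$ (r, j) = (\<Sum>l<n. N $$ (r, l) * M $$ (l, j))" by (rule mult_mat_index[OF N(1) M(1) rj])
      also have "\<dots> = mat_fun n N (\<lambda>l. M $$ (l, j)) r" unfolding mat_fun_def using rj by simp
      also have "\<dots> = M $$ (r, j) + (if r = k then M $$ (i, j) else 0)"
        unfolding N_def mat_fun_column_matrix[OF i(2)] using rj ik by (auto simp: c_def)
      finally show ?thesis .
    qed
    have dNM: "det (N * M) \<noteq> 0" using det_mult[OF N(1) M(1)] N(2) M(2) by simp
    have "index_is_det n (N * M)"
    proof (rule main)
      show "N * M \<in> carrier_mat n n" using N M by simp
      show "det (N * M) \<noteq> 0" by (rule dNM)
      show "(N * M) $$ (r, j) = (if r = j then 1 else 0)" if "r < n" "j < k" for r j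
        using NM[of r j] unit[of r j] unit[of i j] that k i by auto
      show "(N * M) $$ (k, k) \<noteq> 0" using NM[OF k k] True i(3) by simp
    qed
    then show ?thesis using index_is_det_mult[OF N M] by blast
  qed
qed

lemma idx_mat_fun:
  assumes "M \<in> carrier_mat n n" "det M \<noteq> 0" "fun_lattice n L"
  shows "kn.idx (Rn n) (mat_fun n M ` L) = kv.idx R ((*) (det M) ` R) + kn.idx (Rn n) L"
  using index_is_det_elimination[of 0 n n M] assms unfolding index_is_det_def by auto

subsection \<open>The covolume of a lattice\<close>

definition vfun :: "'K vec \<Rightarrow> nat \<Rightarrow> 'K" where
  "vfun v = (\<lambda>i. if i < dim_vec v then v $ i else 0)"

lemma vfun_inj: "v \<in> carrier_vec n \<Longrightarrow> w \<in> carrier_vec n \<Longrightarrow> vfun v = vfun w \<Longrightarrow> v = w"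
proof (rule eq_vecI)
  assume v: "v \<in> carrier_vec n" and w: "w \<in> carrier_vec n" and e: "vfun v = vfun w"
  then show "dim_vec v = dim_vec w" by simp
  fix i assume "i < dim_vec w"
  then show "v $ i = w $ i" using fun_cong[OF e, of i] v w unfolding vfun_def by simp
qed

lemma vfun_image_mem: "L \<subseteq> carrier_vec n \<Longrightarrow> v \<in> carrier_vec n \<Longrightarrow> vfun v \<in> vfun ` L \<longleftrightarrow> v \<in> L"
  using vfun_inj by (metis image_iff subsetD)

lemma vfun_vec: "u \<in> supported {..<n} A \<Longrightarrow> vfun (vec n u) = u"
  by (auto simp: vfun_def supported_def)

lemma vfun_smult: "vfun (a \<cdot>\<^sub>v v) = (\<lambda>l. a * vfun v l)"
  by (auto simp: vfun_def)

lemma vfun_add: "v \<in> carrier_vec n \<Longrightarrow> w \<in> carrier_vec n \<Longrightarrow> vfun (v + w) = (\<lambda>l. vfun v l + vfun w l)"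
  by (auto simp: vfun_def)

lemma vfun_diff: "v \<in> carrier_vec n \<Longrightarrow> w \<in> carrier_vec n \<Longrightarrow> vfun (v - w) = (\<lambda>l. vfun v l - vfun w l)"
  by (auto simp: vfun_def)

lemma vfun_std: "vfun ` std_lattice R n = Rn n"
proof
  show "vfun ` std_lattice R n \<subseteq> Rn n" unfolding std_lattice_def vfun_def supported_def by auto
  show "Rn n \<subseteq> vfun ` std_lattice R n"
  proof
    fix u assume u: "u \<in> Rn n"
    then have "vec n u \<in> std_lattice R n" unfolding std_lattice_def supported_def by auto
    then show "u \<in> vfun ` std_lattice R n" using vfun_vec[OF u] by (metis image_eqI)
  qed
qed

lemma std_lattice_iff: "v \<in> carrier_vec n \<Longrightarrow> v \<in> std_lattice R n \<longleftrightarrow> vfun v \<in> Rn n"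
  unfolding std_lattice_def vfun_def supported_def by auto

text \<open>The list of prime ideals runs through all pairs of a point in \<open>T\<close> and an index below \<open>n\<close>; the
  exponents may be \<open>0\<close>.\<close>

lemma primary_decomposition_exists:
  assumes W: "W \<subseteq> carrier_vec n" "fun_lattice n (vfun ` W)" "vfun ` W \<subseteq> Rn n"
  shows "\<exists>ps E. primary_decomposition R n (std_lattice R n) W ps E"
proof -
  obtain T F e where T: "finite T" "T \<subseteq> pts - S" and F': "\<forall>z\<in>T \<times> {..<n}. F z \<in> Rn n"
    and gen: "\<forall>u\<in>Rn n. \<exists>\<alpha>. (\<forall>z\<in>T \<times> {..<n}. \<alpha> z \<in> R) \<and>
      (\<lambda>l. u l - (\<Sum>z\<in>T \<times> {..<n}. F z l * \<alpha> z)) \<in> vfun ` W"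
    and mem: "\<forall>\<alpha>. (\<forall>z\<in>T \<times> {..<n}. \<alpha> z \<in> R) \<longrightarrow> ((\<lambda>l. \<Sum>z\<in>T \<times> {..<n}. F z l * \<alpha> z) \<in> vfun ` W
        \<longleftrightarrow> (\<forall>z\<in>T \<times> {..<n}. \<alpha> z \<in> pw (fst z) (int (e z))))"
    using primary_decomposition_fun[OF W(2,3)] by (elim exE conjE) (rule that; assumption)
  note F = bspec[OF F']
  obtain zs where zs: "set zs = T \<times> {..<n}" "distinct zs"
    using finite_distinct_list[of "T \<times> {..<n}"] T(1) by auto
  let ?len = "length zs"
  have bij: "bij_betw ((!) zs) {..<?len} (T \<times> {..<n})" using bij_betw_nth[OF zs(2) refl] zs(1) by blast
  have zT: "zs ! j \<in> T \<times> {..<n}" if "j < ?len" for j using that zs(1) nth_mem by blast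
  define ps where "ps = map (\<lambda>z. (prime_at (fst z), e z)) zs"
  define E where "E = mat n ?len (\<lambda>(l, j). F (zs ! j) l)"
  have E: "E \<in> carrier_mat n ?len" unfolding E_def by simp
  have Ea: "vfun (E *\<^sub>v a) = (\<lambda>l. \<Sum>z\<in>T \<times> {..<n}. F z l * \<alpha> z)"
    if a: "a \<in> carrier_vec ?len" and \<alpha>: "\<And>j. j < ?len \<Longrightarrow> a $ j = \<alpha> (zs ! j)" for a :: "'K vec" and \<alpha>
  proof
    fix l
    have s: "(\<Sum>z\<in>T \<times> {..<n}. F z l * \<alpha> z) = (\<Sum>j<?len. F (zs ! j) l * \<alpha> (zs ! j))"
      by (rule sum.reindex_bij_betw[OF bij, symmetric])
    show "vfun (E *\<^sub>v a) l = (\<Sum>z\<in>T \<times> {..<n}. F z l * \<alpha> z)"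
    proof (cases "l < n")
      case True
      have "vfun (E *\<^sub>v a) l = (\<Sum>j<?len. E $$ (l, j) * a $ j)"
        unfolding vfun_def using True E mult_vec_index[OF E a True] by simp
      then show ?thesis unfolding s using True \<alpha> by (simp add: E_def)
    next
      case False
      have "(\<Sum>z\<in>T \<times> {..<n}. F z l * \<alpha> z) = 0"
        by (rule sum.neutral) (use supportedD(2)[OF F, of _ l] False in auto)
      then show ?thesis unfolding vfun_def using False E by simp
    qed
  qed
  have FR: "F (zs ! j) i \<in> R" if "j < ?len" "i < n" for j i
    by (rule supportedD(1)[OF F[OF zT]]) (use that in auto)
  have Ecv: "E *\<^sub>v a \<in> carrier_vec n" for a by (rule carrier_vecI) (use E in auto)
  have "primary_decomposition R n (std_lattice R n) W ps E"
    unfolding primary_decomposition_def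
  proof (intro conjI)
    show "\<forall>(p, e)\<in>set ps. prime_ideal_of R p \<and> p \<noteq> {0}"
      unfolding ps_def using prime_at_prime T(2) zs(1) by auto
    show "E \<in> carrier_mat n (length ps)" using E unfolding ps_def by simp
    show "set (cols E) \<subseteq> std_lattice R n"
      unfolding cols_def std_lattice_def using FR by (auto simp: E_def)
    show "\<forall>u\<in>std_lattice R n. \<exists>a\<in>std_lattice R (length ps). u - E *\<^sub>v a \<in> W"
    proof
      fix u assume u: "u \<in> std_lattice R n"
      then have uc: "u \<in> carrier_vec n" unfolding std_lattice_def by blast
      obtain \<alpha> where \<alpha>: "\<forall>z\<in>T \<times> {..<n}. \<alpha> z \<in> R"
        "(\<lambda>l. vfun u l - (\<Sum>z\<in>T \<times> {..<n}. F z l * \<alpha> z)) \<in> vfun ` W"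
        using gen std_lattice_iff[OF uc] u by blast
      define a where "a = vec ?len (\<lambda>j. \<alpha> (zs ! j))"
      have a: "a \<in> carrier_vec ?len" "\<And>j. j < ?len \<Longrightarrow> a $ j = \<alpha> (zs ! j)" unfolding a_def by auto
      have e: "vfun (E *\<^sub>v a) l = (\<Sum>z\<in>T \<times> {..<n}. F z l * \<alpha> z)" for l
        by (rule fun_cong[OF Ea]) (use a in auto)
      have "vfun (u - E *\<^sub>v a) \<in> vfun ` W"
        unfolding vfun_diff[OF uc Ecv] e by (rule \<alpha>(2))
      then have "u - E *\<^sub>v a \<in> W" using vfun_image_mem[OF W(1)] uc Ecv by simp
      moreover have "a \<in> std_lattice R (length ps)"
        using a bspec[OF \<alpha>(1) zT] unfolding std_lattice_def ps_def by simp
      ultimately show "\<exists>a\<in>std_lattice R (length ps). u - E *\<^sub>v a \<in> W" by blast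
    qed
    show "\<forall>a\<in>std_lattice R (length ps). E *\<^sub>v a \<in> W \<longleftrightarrow>
          (\<forall>i<length ps. a $ i \<in> ideal_pow R (fst (ps ! i)) (snd (ps ! i)))"
    proof
      fix a assume a: "a \<in> std_lattice R (length ps)"
      then have ac: "a \<in> carrier_vec ?len" and aR: "\<And>j. j < ?len \<Longrightarrow> a $ j \<in> R"
        unfolding std_lattice_def ps_def by auto
      define \<alpha> where "\<alpha> = (\<lambda>z. a $ the_inv_into {..<?len} ((!) zs) z)"
      have inj: "inj_on ((!) zs) {..<?len}" using bij unfolding bij_betw_def by blast
      have \<alpha>: "a $ j = \<alpha> (zs ! j)" if "j < ?len" for j
        unfolding \<alpha>_def using the_inv_into_f_f[OF inj] that by simp
      have im: "T \<times> {..<n} = (!) zs ` {..<?len}" using bij unfolding bij_betw_def by blast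
      have \<alpha>R: "\<forall>z\<in>T \<times> {..<n}. \<alpha> z \<in> R" unfolding im using \<alpha> aR by auto
      have "E *\<^sub>v a \<in> W \<longleftrightarrow> (\<lambda>l. \<Sum>z\<in>T \<times> {..<n}. F z l * \<alpha> z) \<in> vfun ` W"
        using vfun_image_mem[OF W(1) Ecv[of a]] Ea[where \<alpha> = \<alpha>, OF ac \<alpha>] by simp
      also have "\<dots> \<longleftrightarrow> (\<forall>z\<in>T \<times> {..<n}. \<alpha> z \<in> pw (fst z) (int (e z)))"
        using spec[OF mem, of \<alpha>, THEN mp, OF \<alpha>R] .
      also have "\<dots> \<longleftrightarrow> (\<forall>j<?len. a $ j \<in> pw (fst (zs ! j)) (int (e (zs ! j))))"
        unfolding im using \<alpha> by auto
      also have "\<dots> \<longleftrightarrow> (\<forall>j<?len. a $ j \<in> ideal_pow R (fst (ps ! j)) (snd (ps ! j)))"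
      proof -
        have "ideal_pow R (fst (ps ! j)) (snd (ps ! j)) = R \<inter> pw (fst (zs ! j)) (int (e (zs ! j)))" if "j < ?len" for j
          using that zT[OF that] T(2) ideal_pow_prime_at[of "fst (zs ! j)"] unfolding ps_def by auto
        then show ?thesis using aR by auto
      qed
      finally show "E *\<^sub>v a \<in> W \<longleftrightarrow>
          (\<forall>i<length ps. a $ i \<in> ideal_pow R (fst (ps ! i)) (snd (ps ! i)))" unfolding ps_def by simp
    qed
  qed
  then show ?thesis by blast
qed

lemma ideal_pow_ideal:
  assumes p: "is_submodule R p" "p \<subseteq> R" "\<exists>b\<in>p. b \<noteq> 0"
  shows "is_submodule R (ideal_pow R p e) \<and> ideal_pow R p e \<subseteq> R \<and> (\<exists>b\<in>ideal_pow R p e. b \<noteq> 0)"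
proof (induction e)
  case 0
  then show ?case using R_submodule fractional_R unfolding ideal_pow_def fractional_def by simp
next
  case (Suc e)
  then show ?case unfolding ideal_pow_Suc
    using idx_ideal_mult(2,3)[OF p] ideal_mult_submodule p(2) by blast
qed

text \<open>The map defined by the columns of \<open>E\<close> identifies \<open>U / W\<close> with a direct sum of cyclic modules.\<close>

lemma idx_primary_decomposition:
  assumes W: "W \<subseteq> carrier_vec n" "fun_lattice n (vfun ` W)" "vfun ` W \<subseteq> Rn n"
    and d: "primary_decomposition R n (std_lattice R n) W ps E"
    and I: "I = foldr (\<lambda>(p, e). ideal_mult R (ideal_pow R p e)) ps R"
  shows "is_submodule R I \<and> I \<subseteq> R \<and> (\<exists>b\<in>I. b \<noteq> 0) \<and> kv.idx R I = kn.idx (Rn n) (vfun ` W)"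
proof -
  let ?len = "length ps"
  have pr: "\<forall>(p, e) \<in> set ps. prime_ideal_of R p \<and> p \<noteq> {0}" and E: "E \<in> carrier_mat n ?len"
    and cols: "set (cols E) \<subseteq> std_lattice R n"
    and gen: "\<forall>u\<in>std_lattice R n. \<exists>a \<in> std_lattice R ?len. u - E *\<^sub>v a \<in> W"
    and mem: "\<forall>a \<in> std_lattice R ?len. E *\<^sub>v a \<in> W \<longleftrightarrow>
          (\<forall>i<?len. a $ i \<in> ideal_pow R (fst (ps ! i)) (snd (ps ! i)))"
    using d unfolding primary_decomposition_def by blast+
  have pI: "is_submodule R (ideal_pow R p e) \<and> ideal_pow R p e \<subseteq> R \<and> (\<exists>b\<in>ideal_pow R p e. b \<noteq> 0)"
    if "(p, e) \<in> set ps" for p e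
  proof -
    have "prime_ideal_of R p" "p \<noteq> {0}" using pr that by auto
    then have "is_submodule R p" "p \<subseteq> R" "\<exists>b\<in>p. b \<noteq> 0"
      unfolding prime_ideal_of_def is_submodule_def by blast+
    then show ?thesis by (rule ideal_pow_ideal)
  qed
  have fold: "is_submodule R (foldr (\<lambda>(p, e). ideal_mult R (ideal_pow R p e)) qs R) \<and>
      foldr (\<lambda>(p, e). ideal_mult R (ideal_pow R p e)) qs R \<subseteq> R \<and>
      (\<exists>b\<in>foldr (\<lambda>(p, e). ideal_mult R (ideal_pow R p e)) qs R. b \<noteq> 0) \<and>
      kv.idx R (foldr (\<lambda>(p, e). ideal_mult R (ideal_pow R p e)) qs R)
        = (\<Sum>(p, e)\<leftarrow>qs. kv.idx R (ideal_pow R p e))" if "set qs \<subseteq> set ps" for qs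
    using that
  proof (induction qs)
    case Nil
    then show ?case using R_submodule fractional_R unfolding fractional_def by simp
  next
    case (Cons q qs)
    obtain p e where q: "q = (p, e)" by (cases q)
    let ?I = "ideal_pow R p e" and ?J = "foldr (\<lambda>(p, e). ideal_mult R (ideal_pow R p e)) qs R"
    have 1: "is_submodule R ?I" "?I \<subseteq> R" "\<exists>b\<in>?I. b \<noteq> 0" using pI[of p e] Cons.prems q by auto
    have 2: "is_submodule R ?J" "?J \<subseteq> R" "\<exists>b\<in>?J. b \<noteq> 0" using Cons by auto
    have 3: "kv.idx R ?J = (\<Sum>(p, e)\<leftarrow>qs. kv.idx R (ideal_pow R p e))" using Cons by auto
    have "foldr (\<lambda>(p, e). ideal_mult R (ideal_pow R p e)) (q # qs) R = ideal_mult R ?I ?J" using q by simp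
    then show ?case
      using idx_ideal_mult[OF 1 2] ideal_mult_submodule 1(2) 3 q by auto
  qed
  define J where "J = (\<lambda>j. if j < ?len then ideal_pow R (fst (ps ! j)) (snd (ps ! j)) else {0})"
  have J: "is_submodule R (J j) \<and> J j \<subseteq> R \<and> (\<exists>b\<in>J j. b \<noteq> 0)" if "j < ?len" for j
    using pI[of "fst (ps ! j)" "snd (ps ! j)"] that unfolding J_def by simp
  have Jsub: "kv.subspace (J j)" for j
    using J[of j] submoduleD(5) by (cases "j < ?len") (auto simp: J_def)
  have "(\<Sum>(p, e)\<leftarrow>ps. kv.idx R (ideal_pow R p e)) = (\<Sum>j<?len. kv.idx R (J j))"
    unfolding sum_list_sum_nth atLeast0LessThan
    by (simp add: J_def case_prod_beta)
  then have idxI: "kv.idx R I = (\<Sum>j<?len. kv.idx R (J j))" using fold[of ps] I by simp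
  have bx: "kn.commens (Rn ?len) (box J) \<and> kn.idx (Rn ?len) (box J) = (\<Sum>j<?len. kv.idx R (J j))"
  proof -
    have "kn.commens (box (\<lambda>i. if i \<in> {..<?len} then R else {0})) (box J) \<and>
      kn.idx (box (\<lambda>i. if i \<in> {..<?len} then R else {0})) (box J)
        = (\<Sum>j<?len. kv.idx (if j \<in> {..<?len} then R else {0}) (J j))"
    proof (rule box_idx)
      show "kv.subspace (if i \<in> {..<?len} then R else {0})" for i using subspace_R by simp
      show "kv.commens (if i \<in> {..<?len} then R else {0}) (J i)" if i: "i \<in> {..<?len}" for i
      proof -
        have "is_submodule R (J i)" "J i \<subseteq> R" "\<exists>b\<in>J i. b \<noteq> 0" using J[of i] i by auto
        then show ?thesis using commens_R_ideal(1) i by auto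
      qed
    qed (use Jsub in \<open>auto simp: J_def\<close>)
    then show ?thesis unfolding supported_box by simp
  qed
  have Jle: "box J \<subseteq> Rn ?len"
    unfolding supported_box box_def using J by (auto simp: J_def split: if_splits)
  have bxh: "kn.hqd (Rn ?len) (box J) d \<longleftrightarrow> kn.hqd (Rn n) (vfun ` W) d" for d
  proof -
    interpret prr: relative_dimension_pair "\<lambda>c (f :: nat \<Rightarrow> 'K) i. \<iota> c * f i" "\<lambda>c (f :: nat \<Rightarrow> 'K) i. \<iota> c * f i"
      by unfold_locales
    let ?\<phi> = "\<lambda>u. vfun (E *\<^sub>v vec ?len u)"
    have \<phi>: "?\<phi> u l = (if l < n then \<Sum>j<?len. E $$ (l, j) * u j else 0)" for u l
      unfolding vfun_def using E mult_vec_index[OF E, of "vec ?len u" l] by auto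
    have Ecv: "E *\<^sub>v a \<in> carrier_vec n" for a by (rule carrier_vecI) (use E in auto)
    show ?thesis
    proof (rule prr.hqd_iso_transfer[where f = ?\<phi>])
      show "Vector_Spaces.linear (\<lambda>c (f :: nat \<Rightarrow> 'K) i. \<iota> c * f i) (\<lambda>c (f :: nat \<Rightarrow> 'K) i. \<iota> c * f i) ?\<phi>"
        by unfold_locales (auto simp: \<phi> fun_eq_iff sum_distrib_left sum.distrib algebra_simps)
      show "kn.subspace (box J)" by (rule box_subspace) (rule Jsub)
      show "kn.subspace (Rn ?len)" by (rule supported_subspace[OF subspace_R])
      show "kn.subspace (vfun ` W)" by (rule fun_latticeD(5)[OF W(2)])
    next
      fix u assume u: "u \<in> Rn ?len"
      have a: "vec ?len u \<in> std_lattice R ?len" using u unfolding std_lattice_def supported_def by auto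
      show "?\<phi> u \<in> Rn n"
        unfolding supported_def
      proof (intro CollectI conjI ballI allI impI)
        fix l assume l: "l \<in> {..<n}"
        have ER: "E $$ (l, j) \<in> R" if "j < ?len" for j
        proof -
          have "col E j \<in> set (cols E)" using E that by (auto simp: cols_def)
          then have "col E j \<in> std_lattice R n" using cols by blast
          then show ?thesis using E that l unfolding std_lattice_def by auto
        qed
        have "(\<Sum>j<?len. E $$ (l, j) * u j) \<in> R"
        proof (rule is_subring_sum[OF reg_subring])
          fix j assume "j \<in> {..<?len}"
          then show "E $$ (l, j) * u j \<in> R"
            using is_subringD(3)[OF reg_subring ER supportedD(1)[OF u]] by simp
        qed
        then show "?\<phi> u l \<in> R" unfolding \<phi> using l by simp
      qed (simp add: \<phi>)
      have "?\<phi> u \<in> vfun ` W \<longleftrightarrow> E *\<^sub>v vec ?len u \<in> W" by (rule vfun_image_mem[OF W(1) Ecv])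
      also have "\<dots> \<longleftrightarrow> (\<forall>i<?len. u i \<in> ideal_pow R (fst (ps ! i)) (snd (ps ! i)))"
        using bspec[OF mem a] by auto
      also have "\<dots> \<longleftrightarrow> u \<in> box J" unfolding box_def J_def using supportedD(2)[OF u] by auto
      finally show "(?\<phi> u \<in> vfun ` W) = (u \<in> box J)" .
    next
      fix y assume y: "y \<in> Rn n"
      have yv: "vfun (vec n y) = y" by (rule vfun_vec[OF y])
      have yc: "vec n y \<in> carrier_vec n" by simp
      have "vec n y \<in> std_lattice R n" using std_lattice_iff[OF yc] yv y by simp
      then obtain a where a: "a \<in> std_lattice R ?len" "vec n y - E *\<^sub>v a \<in> W" using gen by blast
      have ac: "a \<in> carrier_vec ?len" using a(1) unfolding std_lattice_def by blast
      have "vec ?len (vfun a) = a" using ac by (auto simp: vfun_def)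
      then have "y - ?\<phi> (vfun a) = vfun (vec n y - E *\<^sub>v a)"
        unfolding vfun_diff[OF yc Ecv] yv by (simp add: fun_eq_iff)
      then have "y - ?\<phi> (vfun a) \<in> vfun ` W" using a(2) by simp
      moreover have "vfun a \<in> Rn ?len" using a(1) std_lattice_iff[OF ac] by blast
      ultimately show "\<exists>u\<in>Rn ?len. y - ?\<phi> u \<in> vfun ` W" by blast
    qed
  qed
  have sR: "kn.subspace (Rn m)" for m by (rule supported_subspace[OF subspace_R])
  have i1: "Rn ?len \<inter> box J = box J" using Jle by blast
  have i2: "Rn n \<inter> vfun ` W = vfun ` W" using W(3) by blast
  have sub: "kn.subspace (box J)" "kn.subspace (vfun ` W)"
    using bx fun_latticeD(5)[OF W(2)] unfolding kn.commens_def by auto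
  have "kn.idx (Rn ?len) (box J) = kn.idx (Rn n) (vfun ` W)"
    unfolding kn.idx_def i1 i2 using quot_dim_cong[OF bxh] kn.quot_dim_refl[OF sub(1)] kn.quot_dim_refl[OF sub(2)] by simp
  then show ?thesis using bx idxI fold[of ps] I by simp
qed

text \<open>The scalar \<open>a\<close> that moves \<open>\<Lambda>\<close> into \<open>R\<^sup>n\<close> changes the dimension relative to \<open>R\<^sup>n\<close> by that of the
  \<open>n\<close>-th power of \<open>a\<close>, and the definition of \<open>chi_lattice\<close> compensates for it.\<close>

lemma covol_eq:
  assumes \<Lambda>: "\<Lambda> \<subseteq> carrier_vec n" and L: "fun_lattice n (vfun ` \<Lambda>)" and q: "q > 0"
  shows "covol q \<iota> R n \<Lambda> = q powi kn.idx (Rn n) (vfun ` \<Lambda>)"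
proof -
  define a where "a = (SOME a. a \<in> R \<and> a \<noteq> 0 \<and> (\<lambda>x. a \<cdot>\<^sub>v x) ` \<Lambda> \<subseteq> std_lattice R n)"
  have "\<exists>a. a \<in> R \<and> a \<noteq> 0 \<and> (\<lambda>x. a \<cdot>\<^sub>v x) ` \<Lambda> \<subseteq> std_lattice R n"
  proof -
    obtain a where a: "a \<in> R" "a \<noteq> 0" "\<And>x. x \<in> vfun ` \<Lambda> \<Longrightarrow> (\<lambda>l. a * x l) \<in> Rn n"
      using L unfolding fun_lattice_def by blast
    have "a \<cdot>\<^sub>v x \<in> std_lattice R n" if "x \<in> \<Lambda>" for x
      using std_lattice_iff[of "a \<cdot>\<^sub>v x" n] a(3)[of "vfun x"] that \<Lambda> by (auto simp: vfun_smult)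
    then show ?thesis using a by blast
  qed
  from someI_ex[OF this] have a: "a \<in> R" "a \<noteq> 0" "(\<lambda>x. a \<cdot>\<^sub>v x) ` \<Lambda> \<subseteq> std_lattice R n"
    unfolding a_def by auto
  define W where "W = (\<lambda>x. a \<cdot>\<^sub>v x) ` \<Lambda>"
  have Wf: "vfun ` W = (\<lambda>u l. a * u l) ` vfun ` \<Lambda>" unfolding W_def by (simp add: image_image vfun_smult)
  have Wc: "W \<subseteq> carrier_vec n" unfolding W_def using \<Lambda> by auto
  have WR: "vfun ` W \<subseteq> Rn n" using a(3) std_lattice_iff Wc unfolding W_def[symmetric] by blast
  have "mat_fun n (a \<cdot>\<^sub>m 1\<^sub>m n) u = (\<lambda>l. if l < n then a * u l else u l)" for u
  proof
    fix l
    show "mat_fun n (a \<cdot>\<^sub>m 1\<^sub>m n) u l = (if l < n then a * u l else u l)"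
    proof (cases "l < n")
      case True
      have "mat_fun n (a \<cdot>\<^sub>m 1\<^sub>m n) u l = (\<Sum>k<n. (a \<cdot>\<^sub>m 1\<^sub>m n) $$ (l, k) * u k)"
        unfolding mat_fun_def using True by simp
      also have "\<dots> = (\<Sum>k<n. if k = l then a * u l else 0)"
        by (rule sum.cong) (use True in auto)
      finally have "mat_fun n (a \<cdot>\<^sub>m 1\<^sub>m n) u l = (\<Sum>k<n. if k = l then a * u l else 0)" .
      then show ?thesis using True by simp
    qed (simp add: mat_fun_def)
  qed
  moreover have "u l = 0" if "u \<in> vfun ` \<Lambda>" "\<not> l < n" for u l
    using supportedD(2)[of u "{..<n}" UNIV l] fun_latticeD(1)[OF L] that by auto
  ultimately have "mat_fun n (a \<cdot>\<^sub>m 1\<^sub>m n) u = (\<lambda>l. a * u l)" if "u \<in> vfun ` \<Lambda>" for u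
    using that by (simp add: fun_eq_iff)
  then have Wm: "vfun ` W = mat_fun n (a \<cdot>\<^sub>m 1\<^sub>m n) ` vfun ` \<Lambda>" unfolding Wf by (intro image_cong) auto
  have "det (a \<cdot>\<^sub>m 1\<^sub>m n) \<noteq> 0" using a(2) by simp
  then have WL: "fun_lattice n (vfun ` W)" unfolding Wm by (intro mat_fun_lattice L) auto
  define I where "I = chi_quotient R n (std_lattice R n) W"
  have "\<exists>I. \<exists>ps E. primary_decomposition R n (std_lattice R n) W ps E
        \<and> I = foldr (\<lambda>(p, e). ideal_mult R (ideal_pow R p e)) ps R"
    using primary_decomposition_exists[OF Wc WL WR] by blast
  from someI_ex[OF this] have "\<exists>ps E. primary_decomposition R n (std_lattice R n) W ps E
        \<and> I = foldr (\<lambda>(p, e). ideal_mult R (ideal_pow R p e)) ps R"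
    unfolding I_def chi_quotient_def .
  then obtain ps E where pE: "primary_decomposition R n (std_lattice R n) W ps E"
    and If: "I = foldr (\<lambda>(p, e). ideal_mult R (ideal_pow R p e)) ps R" by blast
  have I: "is_submodule R I" "I \<subseteq> R" "\<exists>b\<in>I. b \<noteq> 0" "kv.idx R I = kn.idx (Rn n) (vfun ` W)"
    using idx_primary_decomposition[OF Wc WL WR pE If] by auto
  have fI: "fractional I" unfolding fractional_def
    using I is_subringD(1)[OF reg_subring] by (auto intro!: bexI[of _ 1])
  define b where "b = inverse a ^ n"
  have b: "b \<noteq> 0" unfolding b_def using a(2) by simp
  have "kv.idx R ((*) (a ^ m) ` R) = int m * kv.idx R ((*) a ` R)" for m
  proof (induction m)
    case 0
    have "(*) (a ^ 0) ` R = R" by simp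
    then show ?case by (simp only: kv.idx_refl of_nat_0 mult_zero_left)
  next
    case (Suc m)
    have "kv.idx R ((*) (a ^ Suc m) ` R) = kv.idx R ((*) a ` R) + kv.idx R ((*) (a ^ m) ` R)"
      unfolding power_Suc by (rule idx_R_prod) (use a(2) in auto)
    then show ?case unfolding Suc.IH by (simp add: distrib_right)
  qed
  moreover have "kv.idx R ((*) (a ^ n * b) ` R) = 0" unfolding b_def using a(2) by (simp add: power_mult_distrib[symmetric])
  moreover have "kv.idx R ((*) (a ^ n * b) ` R) = kv.idx R ((*) (a ^ n) ` R) + kv.idx R ((*) b ` R)"
    by (rule idx_R_prod) (use a(2) b in auto)
  ultimately have ib: "kv.idx R ((*) b ` R) = - (int n * kv.idx R ((*) a ` R))" by simp
  have "chi_lattice R n \<Lambda> = (*) b ` I"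
    unfolding chi_lattice_def Let_def a_def[symmetric] W_def[symmetric] I_def b_def ..
  then have "covol q \<iota> R n \<Lambda> = q powi kv.idx R ((*) b ` I)"
    unfolding covol_def using ideal_norm_eq[OF fractional_mult[OF fI b] q] by simp
  also have "kv.idx R ((*) b ` I) = kv.idx R ((*) b ` R) + kv.idx R I" by (rule idx_R_mult[OF fI b])
  also have "\<dots> = kn.idx (Rn n) (vfun ` \<Lambda>)"
    unfolding ib I(4) Wf idx_scale_lattice[OF L a(2)] by simp
  finally show ?thesis .
qed

end


context affine_curve
begin

subsection \<open>Lattices of vectors\<close>

lemma is_vec_submoduleD:
  assumes "is_vec_submodule A n L"
  shows "L \<subseteq> carrier_vec n" "0\<^sub>v n \<in> L" "x \<in> L \<Longrightarrow> y \<in> L \<Longrightarrow> x + y \<in> L" "a \<in> A \<Longrightarrow> x \<in> L \<Longrightarrow> a \<cdot>\<^sub>v x \<in> L"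
  using assms unfolding is_vec_submodule_def by auto

lemma common_multiple:
  assumes "finite Y" "\<And>y. y \<in> Y \<Longrightarrow> \<exists>a\<in>R. a \<noteq> 0 \<and> P a y" "\<And>a b y. y \<in> Y \<Longrightarrow> b \<in> R \<Longrightarrow> P a y \<Longrightarrow> P (b * a) y"
  shows "\<exists>a\<in>R. a \<noteq> 0 \<and> (\<forall>y\<in>Y. P a y)"
  using assms
proof (induction Y rule: finite_induct)
  case empty
  then show ?case using is_subringD(1)[OF reg_subring] by (auto intro!: bexI[of _ 1])
next
  case (insert z Y)
  have "\<exists>a\<in>R. a \<noteq> 0 \<and> (\<forall>y\<in>Y. P a y)" by (rule insert.IH) (use insert.prems in auto)
  then obtain a where a: "a \<in> R" "a \<noteq> 0" "\<And>y. y \<in> Y \<Longrightarrow> P a y" by blast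
  obtain b where b: "b \<in> R" "b \<noteq> 0" "P b z" using insert.prems(1) by blast
  have "P (b * a) y" if "y \<in> Y" for y using insert.prems(2)[of y b a] a(3) b(1) that by blast
  moreover have "P (b * a) z" using insert.prems(2)[of z a b] a(1) b(3) by (simp add: mult.commute)
  moreover have "b * a \<in> R" "b * a \<noteq> 0" using is_subringD(3)[OF reg_subring b(1) a(1)] a b by auto
  ultimately show ?case by blast
qed

text \<open>Common denominators of the finitely many generators give the first inclusion up to a multiple, and
  common denominators for the unit vectors, which lie in the span of \<open>\<Lambda>\<close>, give the second.\<close>

lemma is_lattice_fun_lattice:
  assumes "is_lattice R n \<Lambda>"
  shows "\<Lambda> \<subseteq> carrier_vec n" "fun_lattice n (vfun ` \<Lambda>)"
proof -
  obtain G where G: "finite G" "G \<subseteq> carrier_vec n" "\<Lambda> = is_vec_submodule R n hull G"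
    and sp: "is_vec_submodule UNIV n hull \<Lambda> = carrier_vec n"
    using assms unfolding is_lattice_def by blast
  note RD = is_subringD[OF reg_subring]
  have "is_vec_submodule R n \<Lambda>"
  proof -
    have int: "is_vec_submodule R n (\<Inter>T)" if T: "\<forall>L\<in>T. is_vec_submodule R n L" "T \<noteq> {}" for T
    proof -
      obtain L0 where "L0 \<in> T" using T(2) by blast
      then have "\<Inter>T \<subseteq> carrier_vec n" using T(1) is_vec_submoduleD(1) by blast
      then show ?thesis using T(1) unfolding is_vec_submodule_def by auto
    qed
    have ne: "{L. is_vec_submodule R n L \<and> G \<subseteq> L} \<noteq> {}"
    proof -
      have "is_vec_submodule R n (carrier_vec n)" unfolding is_vec_submodule_def by auto
      then show ?thesis using G(2) by blast
    qed
    show ?thesis unfolding G(3) hull_def by (rule int[OF _ ne]) simp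
  qed
  note \<Lambda> = is_vec_submoduleD[OF this]
  show cv: "\<Lambda> \<subseteq> carrier_vec n" by (rule \<Lambda>(1))
  show "fun_lattice n (vfun ` \<Lambda>)"
    unfolding fun_lattice_def
  proof (intro conjI ballI)
    show "vfun ` \<Lambda> \<subseteq> supported {..<n} UNIV" using cv unfolding vfun_def supported_def by auto
    have "vfun (0\<^sub>v n) = (\<lambda>_. 0)" by (auto simp: vfun_def)
    then show "(\<lambda>_. 0) \<in> vfun ` \<Lambda>" using \<Lambda>(2) by (metis imageI)
  next
    fix x y assume "x \<in> vfun ` \<Lambda>" "y \<in> vfun ` \<Lambda>"
    then obtain v w where vw: "v \<in> \<Lambda>" "w \<in> \<Lambda>" "x = vfun v" "y = vfun w" by blast
    have "v \<in> carrier_vec n" "w \<in> carrier_vec n" using vw cv by auto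
    from vfun_add[OF this] show "(\<lambda>l. x l + y l) \<in> vfun ` \<Lambda>"
      using imageI[OF \<Lambda>(3)[OF vw(1,2)], of vfun] unfolding vw(3,4) by simp
  next
    fix r x assume r: "r \<in> R" and "x \<in> vfun ` \<Lambda>"
    then obtain v where v: "v \<in> \<Lambda>" "x = vfun v" by blast
    show "(\<lambda>l. r * x l) \<in> vfun ` \<Lambda>"
      using imageI[OF \<Lambda>(4)[OF r v(1)], of vfun] unfolding v(2) vfun_smult .
  next
    have "\<exists>a\<in>R. a \<noteq> 0 \<and> (\<forall>v\<in>G. a \<cdot>\<^sub>v v \<in> std_lattice R n)"
    proof (rule common_multiple[OF G(1)])
      fix v assume "v \<in> G"
      then have v: "v \<in> carrier_vec n" using G(2) by blast
      obtain a where "a \<in> R" "a \<noteq> 0" "\<And>y. y \<in> (($) v) ` {..<n} \<Longrightarrow> a * y \<in> R"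
        using R_denominator[of "(($) v) ` {..<n}"] by blast
      then show "\<exists>a\<in>R. a \<noteq> 0 \<and> a \<cdot>\<^sub>v v \<in> std_lattice R n"
        using v unfolding std_lattice_def by (intro bexI[of _ a]) auto
    next
      fix a b v assume "v \<in> G" "b \<in> R" "a \<cdot>\<^sub>v v \<in> std_lattice R n"
      moreover have "v \<in> carrier_vec n" using \<open>v \<in> G\<close> G(2) by blast
      ultimately show "(b * a) \<cdot>\<^sub>v v \<in> std_lattice R n"
        using RD(3) unfolding std_lattice_def by (auto simp: mult.assoc)
    qed
    then obtain a where a: "a \<in> R" "a \<noteq> 0" "\<And>v. v \<in> G \<Longrightarrow> a \<cdot>\<^sub>v v \<in> std_lattice R n" by blast
    have "is_vec_submodule R n {v \<in> carrier_vec n. a \<cdot>\<^sub>v v \<in> std_lattice R n}"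
      unfolding is_vec_submodule_def std_lattice_def
    proof (intro conjI ballI)
      fix v w assume "v \<in> {v \<in> carrier_vec n. a \<cdot>\<^sub>v v \<in> {x \<in> carrier_vec n. \<forall>i<n. x $ i \<in> R}}"
        "w \<in> {v \<in> carrier_vec n. a \<cdot>\<^sub>v v \<in> {x \<in> carrier_vec n. \<forall>i<n. x $ i \<in> R}}"
      then show "v + w \<in> {v \<in> carrier_vec n. a \<cdot>\<^sub>v v \<in> {x \<in> carrier_vec n. \<forall>i<n. x $ i \<in> R}}"
        using RD(6) by (auto simp: distrib_left)
    next
      fix r v assume "r \<in> R" "v \<in> {v \<in> carrier_vec n. a \<cdot>\<^sub>v v \<in> {x \<in> carrier_vec n. \<forall>i<n. x $ i \<in> R}}"
      then show "r \<cdot>\<^sub>v v \<in> {v \<in> carrier_vec n. a \<cdot>\<^sub>v v \<in> {x \<in> carrier_vec n. \<forall>i<n. x $ i \<in> R}}"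
        using RD(3) by (auto simp: mult.left_commute[of a r])
    qed (use RD(4) in auto)
    then have "\<Lambda> \<subseteq> {v \<in> carrier_vec n. a \<cdot>\<^sub>v v \<in> std_lattice R n}"
      unfolding G(3) by (rule hull_minimal[rotated]) (use a(3) G(2) in auto)
    then have "(\<lambda>l. a * x l) \<in> Rn n" if "x \<in> vfun ` \<Lambda>" for x
      using that std_lattice_iff[of "a \<cdot>\<^sub>v _" n] by (auto simp flip: vfun_smult)
    then show "\<exists>a\<in>R. a \<noteq> 0 \<and> (\<forall>x\<in>vfun ` \<Lambda>. (\<lambda>l. a * x l) \<in> Rn n)" using a by blast
  next
    let ?H = "{v \<in> carrier_vec n. \<exists>r\<in>R. r \<noteq> 0 \<and> r \<cdot>\<^sub>v v \<in> \<Lambda>}"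
    have "is_vec_submodule UNIV n ?H"
      unfolding is_vec_submodule_def
    proof (intro conjI ballI)
      show "?H \<subseteq> carrier_vec n" by blast
      show "0\<^sub>v n \<in> ?H" using RD(1) \<Lambda>(2) by (auto intro!: bexI[of _ 1])
    next
      fix v w assume "v \<in> ?H" "w \<in> ?H"
      then obtain r s where v: "v \<in> carrier_vec n" "r \<in> R" "r \<noteq> 0" "r \<cdot>\<^sub>v v \<in> \<Lambda>"
        and w: "w \<in> carrier_vec n" "s \<in> R" "s \<noteq> 0" "s \<cdot>\<^sub>v w \<in> \<Lambda>" by blast
      have "s \<cdot>\<^sub>v (r \<cdot>\<^sub>v v) + r \<cdot>\<^sub>v (s \<cdot>\<^sub>v w) \<in> \<Lambda>" by (rule \<Lambda>(3)[OF \<Lambda>(4)[OF w(2) v(4)] \<Lambda>(4)[OF v(2) w(4)]])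
      moreover have "s \<cdot>\<^sub>v (r \<cdot>\<^sub>v v) + r \<cdot>\<^sub>v (s \<cdot>\<^sub>v w) = (r * s) \<cdot>\<^sub>v (v + w)"
        using v(1) w(1) by (intro eq_vecI) (auto simp: algebra_simps)
      ultimately show "v + w \<in> ?H" using v w RD(3)[OF v(2) w(2)] by (intro CollectI conjI bexI[of _ "r * s"]) auto
    next
      fix c v assume "v \<in> ?H"
      then obtain r where v: "v \<in> carrier_vec n" "r \<in> R" "r \<noteq> 0" "r \<cdot>\<^sub>v v \<in> \<Lambda>" by blast
      obtain s where s: "s \<in> R" "s \<noteq> 0" "s * c \<in> R" using R_denominator[of "{c}"] by auto
      have "(s * c) \<cdot>\<^sub>v (r \<cdot>\<^sub>v v) \<in> \<Lambda>" by (rule \<Lambda>(4)[OF s(3) v(4)])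
      moreover have "(s * c) \<cdot>\<^sub>v (r \<cdot>\<^sub>v v) = (s * r) \<cdot>\<^sub>v (c \<cdot>\<^sub>v v)"
        using v(1) by (intro eq_vecI) (auto simp: algebra_simps)
      ultimately show "c \<cdot>\<^sub>v v \<in> ?H" using v s RD(3)[OF s(1) v(2)] by (intro CollectI conjI bexI[of _ "s * r"]) auto
    qed
    moreover have "\<Lambda> \<subseteq> ?H"
    proof
      fix v assume "v \<in> \<Lambda>"
      then show "v \<in> ?H" using cv RD(1) by (auto intro!: bexI[of _ 1])
    qed
    ultimately have "is_vec_submodule UNIV n hull \<Lambda> \<subseteq> ?H" by (rule hull_minimal[rotated])
    then have H: "\<exists>r\<in>R. r \<noteq> 0 \<and> r \<cdot>\<^sub>v v \<in> \<Lambda>" if "v \<in> carrier_vec n" for v using sp that by blast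
    have "\<exists>b\<in>R. b \<noteq> 0 \<and> (\<forall>i\<in>{..<n}. b \<cdot>\<^sub>v unit_vec n i \<in> \<Lambda>)"
    proof (rule common_multiple)
      fix a b i assume "b \<in> R" "a \<cdot>\<^sub>v unit_vec n i \<in> \<Lambda>"
      then have "b \<cdot>\<^sub>v (a \<cdot>\<^sub>v unit_vec n i) \<in> \<Lambda>" by (rule \<Lambda>(4))
      then show "(b * a) \<cdot>\<^sub>v unit_vec n i \<in> \<Lambda>" by (simp add: smult_smult_assoc)
    qed (use H in auto)
    then obtain b where b: "b \<in> R" "b \<noteq> 0" "\<And>i. i < n \<Longrightarrow> b \<cdot>\<^sub>v unit_vec n i \<in> \<Lambda>" by auto
    have "(\<lambda>l. b * x l) \<in> vfun ` \<Lambda>" if x: "x \<in> Rn n" for x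
    proof -
      have "k \<le> n \<Longrightarrow> vec n (\<lambda>l. if l < k then b * x l else 0) \<in> \<Lambda>" for k
      proof (induction k)
        case 0
        have "vec n (\<lambda>l. if l < 0 then b * x l else 0) = 0\<^sub>v n" by auto
        then show ?case using \<Lambda>(2) by simp
      next
        case (Suc k)
        have "x k \<cdot>\<^sub>v (b \<cdot>\<^sub>v unit_vec n k) \<in> \<Lambda>"
          by (rule \<Lambda>(4)[OF supportedD(1)[OF x] b(3)]) (use Suc.prems in auto)
        from \<Lambda>(3)[OF Suc.IH this] Suc.prems
        have "vec n (\<lambda>l. if l < k then b * x l else 0) + x k \<cdot>\<^sub>v (b \<cdot>\<^sub>v unit_vec n k) \<in> \<Lambda>" by simp
        moreover have "vec n (\<lambda>l. if l < k then b * x l else 0) + x k \<cdot>\<^sub>v (b \<cdot>\<^sub>v unit_vec n k)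
          = vec n (\<lambda>l. if l < Suc k then b * x l else 0)"
          using Suc.prems by (intro eq_vecI) (auto simp: less_Suc_eq)
        ultimately show ?case by simp
      qed
      from this[of n] have "vec n (\<lambda>l. if l < n then b * x l else 0) \<in> \<Lambda>" by simp
      moreover have "vfun (vec n (\<lambda>l. if l < n then b * x l else 0)) = (\<lambda>l. b * x l)"
        using supportedD(2)[OF x] by (auto simp: vfun_def)
      ultimately show ?thesis by (rule rev_image_eqI[OF _ sym])
    qed
    then show "\<exists>b\<in>R. b \<noteq> 0 \<and> (\<forall>x\<in>Rn n. (\<lambda>l. b * x l) \<in> vfun ` \<Lambda>)" using b by blast
  qed
qed

end


section \<open>Riemann's inequality and the product formula\<close>

context relative_dimension_pair
begin

text \<open>Multiplication by a function is such a map on the repartitions; comparing the two ways to compute the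
  characteristic of the image yields the product formula.\<close>

lemma euler_transfer:
  assumes f: "Vector_Spaces.linear s1 s2 f" and bij: "bij f" and e: "vs1.euler V D c"
  shows "vs2.euler (f ` V) (f ` D) c"
proof -
  interpret f: Vector_Spaces.linear s1 s2 f by (rule f)
  have inj: "inj f" and surj: "surj f" using bij by (auto simp: bij_def)
  have s: "vs1.subspace V" "vs1.subspace D" using e unfolding vs1.euler_def by auto
  have i: "f ` V \<inter> f ` D = f ` (V \<inter> D)" using image_Int[OF inj] by auto
  have "f ` ssum V D = {f (u + v) | u v. u \<in> V \<and> v \<in> D}" unfolding ssum_def by blast
  also have "\<dots> = ssum (f ` V) (f ` D)" unfolding ssum_def f.add by blast
  finally have im: "f ` ssum V D = ssum (f ` V) (f ` D)" .
  have 1: "has_quot_dim s1 (V \<inter> D) {0} d \<longleftrightarrow> has_quot_dim s2 (f ` V \<inter> f ` D) {0} d" for d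
    unfolding i
  proof (rule hqd_iso_transfer[OF f])
    show "vs1.subspace (V \<inter> D)" using s vs1.subspace_inter by blast
    show "f u \<in> {0} \<longleftrightarrow> u \<in> {0}" for u using inj f.zero by (metis injD singletonD singletonI)
    show "\<exists>u\<in>V \<inter> D. y - f u \<in> {0}" if "y \<in> f ` (V \<inter> D)" for y using that by auto
  qed auto
  have 2: "has_quot_dim s1 UNIV (ssum V D) d \<longleftrightarrow> has_quot_dim s2 UNIV (ssum (f ` V) (f ` D)) d" for d
    unfolding im[symmetric]
  proof (rule hqd_iso_transfer[OF f])
    show "vs1.subspace (ssum V D)" using s vs1.subspace_ssum by blast
    then show "vs2.subspace (f ` ssum V D)" by (rule f.subspace_image)
    then have 0: "0 \<in> f ` ssum V D" by (rule vs2.subspace_0)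
    show "f u \<in> f ` ssum V D \<longleftrightarrow> u \<in> ssum V D" for u using inj by (simp add: inj_image_mem_iff)
    show "\<exists>u\<in>UNIV. y - f u \<in> f ` ssum V D" for y
    proof -
      obtain u where "y = f u" using surj by (metis surjD)
      then show ?thesis using 0 by (intro bexI[of _ u]) auto
    qed
  qed auto
  show ?thesis
    using e s f.subspace_image
    unfolding vs1.euler_def vs2.euler_def vs1.fincodim_def vs2.fincodim_def quot_dim_def 1 2 by auto
qed

end

definition diag :: "(nat \<Rightarrow> 'K) \<Rightarrow> nat \<times> 'K set \<Rightarrow> 'K" where
  "diag x = (\<lambda>p. x (fst p))"

lemma diag_inj: "inj diag"
proof (rule injI)
  fix x y :: "nat \<Rightarrow> 'a" assume "diag x = diag y"
  then have "diag x (i, {}) = diag y (i, {})" for i by simp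
  then show "x = y" unfolding diag_def by auto
qed

sublocale field_ext \<subseteq> km: relative_dimension "\<lambda>c (f :: nat \<times> 'K set \<Rightarrow> 'K) i. \<iota> c * f i"
  by (rule relative_dimension_fun)

sublocale field_ext \<subseteq> nm: relative_dimension_pair
  "\<lambda>c (f :: nat \<Rightarrow> 'K) i. \<iota> c * f i" "\<lambda>c (f :: nat \<times> 'K set \<Rightarrow> 'K) i. \<iota> c * f i"
  by unfold_locales

sublocale field_ext \<subseteq> mm: relative_dimension_pair
  "\<lambda>c (f :: nat \<times> 'K set \<Rightarrow> 'K) i. \<iota> c * f i" "\<lambda>c (f :: nat \<times> 'K set \<Rightarrow> 'K) i. \<iota> c * f i"
  by unfold_locales

context affine_curve
begin

lemma linear_diag:
  "Vector_Spaces.linear (\<lambda>c (f :: nat \<Rightarrow> 'K) i. \<iota> c * f i) (\<lambda>c (f :: nat \<times> 'K set \<Rightarrow> 'K) i. \<iota> c * f i) diag"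
  by unfold_locales (auto simp: diag_def fun_eq_iff algebra_simps)

text \<open>The families with prescribed orders at the points of \<open>S\<close>. All other coordinates are arbitrary, so
  that they do not contribute to the codimension.\<close>

definition local_box :: "nat \<Rightarrow> (nat \<Rightarrow> 'K set \<Rightarrow> int) \<Rightarrow> (nat \<times> 'K set \<Rightarrow> 'K) set" where
  "local_box n a = box (\<lambda>p. if fst p < n \<and> snd p \<in> S then pw (snd p) (a (fst p) (snd p)) else UNIV)"

lemma local_box_iff: "\<alpha> \<in> local_box n a \<longleftrightarrow> (\<forall>i<n. \<forall>Q\<in>S. \<alpha> (i, Q) \<in> pw Q (a i Q))"
  unfolding local_box_def box_def by auto

lemma coord_subspace: "kv.subspace (if fst p < n \<and> snd p \<in> S then pw (snd p) (a (fst p) (snd p)) else UNIV)"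
  using pw_subspace Ssub by auto

lemma local_box_subspace: "km.subspace (local_box n a)"
  unfolding local_box_def by (rule box_subspace[OF coord_subspace])

lemma local_box_idx:
  "km.commens (local_box n a) (local_box n b)"
  "km.idx (local_box n a) (local_box n b) = (\<Sum>i<n. \<Sum>Q\<in>S. int (degree_at \<iota> Q) * (b i Q - a i Q))"
proof -
  let ?U = "\<lambda>a p. if fst p < n \<and> snd p \<in> S then pw (snd p) (a (fst p) (snd p)) else UNIV"
  have c: "kv.commens (?U a p) (?U b p)" "kv.idx (?U a p) (?U b p) = int (degree_at \<iota> (snd p)) * (b (fst p) (snd p) - a (fst p) (snd p))"
    if "p \<in> {..<n} \<times> S" for p
    using that idx_pw[of "snd p" "a (fst p) (snd p)" "b (fst p) (snd p)"] Ssub by auto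
  have "km.commens (box (?U a)) (box (?U b)) \<and> km.idx (box (?U a)) (box (?U b))
    = (\<Sum>p\<in>{..<n} \<times> S. kv.idx (?U a p) (?U b p))"
  proof (rule box_idx)
    show "finite ({..<n} \<times> S)" using finS by simp
    show "kv.commens (?U a p) (?U b p)" if "p \<in> {..<n} \<times> S" for p by (rule c(1)[OF that])
    show "?U a p = ?U b p" if "p \<notin> {..<n} \<times> S" for p using that by (cases p) auto
  qed (rule coord_subspace)+
  moreover have "(\<Sum>p\<in>{..<n} \<times> S. kv.idx (?U a p) (?U b p))
    = (\<Sum>(i, Q)\<in>{..<n} \<times> S. int (degree_at \<iota> Q) * (b i Q - a i Q))"
    by (rule sum.cong) (simp_all only: c split_beta)
  ultimately show "km.commens (local_box n a) (local_box n b)"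
    "km.idx (local_box n a) (local_box n b) = (\<Sum>i<n. \<Sum>Q\<in>S. int (degree_at \<iota> Q) * (b i Q - a i Q))"
    unfolding local_box_def by (simp_all add: sum.cartesian_product)
qed

text \<open>A nonzero function with a zero is transcendental and therefore has a pole.\<close>

lemma everywhere_regular_vanishing:
  assumes u: "u \<in> reg {}" and Q: "Q \<in> pts" "u \<in> pw Q 1"
  shows "u = 0"
proof (rule ccontr)
  assume "u \<noteq> 0"
  then have "\<not> algebraic_over (range \<iota>) u"
    using zero_transcendental[OF Q(1) _ Q(2)] unfolding algebraic_iff by blast
  then show False using pole u reg_iff[of u "{}"] by blast
qed

text \<open>The everywhere regular functions embed into a residue field.\<close>

lemma global_sections_finite: "kv.fincodim (reg {}) {0}"
proof -
  interpret vv: relative_dimension_pair "\<lambda>c x. \<iota> c * x" "\<lambda>c x. \<iota> c * x" by unfold_locales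
  obtain Q where Q: "Q \<in> pts" using Sne Ssub by blast
  obtain d where "kv.hqd Q (pw Q 1) d" using residue_field_finite[OF Q] unfolding kv.fincodim_def by blast
  then have "\<exists>d'\<le>d. kv.hqd (reg {}) {0} d'"
  proof (rule vv.hqd_inj_transfer[where f = "\<lambda>x. x", rotated -1])
    show "Vector_Spaces.linear (\<lambda>c x. \<iota> c * x) (\<lambda>c x. \<iota> c * x) (\<lambda>x. x)" by unfold_locales auto
    show "kv.subspace {0}" by (rule kv.subspace_single_0)
    show "kv.subspace (reg {})"
      by (rule kv.subspaceI) (use is_subringD[OF reg_subring[of "{}"]] reg_const[of "{}"] in \<open>auto simp: image_subset_iff\<close>)
    show "kv.subspace (pw Q 1)" by (rule pw_subspace[OF Q])
    show "u \<in> Q" if "u \<in> reg {}" for u using that Q reg_iff[of u "{}"] by blast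
    show "u \<in> pw Q 1 \<longleftrightarrow> u \<in> {0}" if "u \<in> reg {}" for u
      using everywhere_regular_vanishing[OF that Q] by auto
  qed
  then show ?thesis unfolding kv.fincodim_def by blast
qed

text \<open>Families indexed by \<open>S\<close>, extended by \<open>0\<close>, embed into the repartitions modulo the integral and the
  constant ones: a constant that makes the extended family integral is regular outside of \<open>S\<close>.\<close>

lemma repartition_cokernel:
  "\<exists>d\<le>g. kr.hqd UNIV {\<alpha>. \<exists>x\<in>R. \<forall>Q\<in>S. \<alpha> Q - x \<in> Q} d"
proof -
  let ?U = "repartitions C" and ?W = "{\<alpha> + (\<lambda>_. x) | \<alpha> x. \<alpha> \<in> integral_repartitions C}"
  let ?f = "\<lambda>\<alpha> :: 'K set \<Rightarrow> 'K. \<lambda>Q. if Q \<in> S then \<alpha> Q else 0"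
  have g: "kr.hqd ?U ?W g" using genus unfolding has_genus_def .
  interpret rr: relative_dimension_pair "\<lambda>c (f :: 'K set \<Rightarrow> 'K) i. \<iota> c * f i" "\<lambda>c (f :: 'K set \<Rightarrow> 'K) i. \<iota> c * f i"
    by unfold_locales
  note pR = is_subringD[OF pts_subring]
  have cm: "\<iota> c * x \<in> Q" if "Q \<in> pts" "x \<in> Q" for c x Q
    using that pR(3)[OF that(1)] const[OF that(1)] by blast
  show ?thesis
  proof (rule rr.hqd_inj_transfer[where f = ?f, OF _ _ _ _ _ _ g])
    show "Vector_Spaces.linear (\<lambda>c (f :: 'K set \<Rightarrow> 'K) i. \<iota> c * f i) (\<lambda>c f i. \<iota> c * f i) ?f"
      by unfold_locales (auto simp: fun_eq_iff algebra_simps)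
    show "kr.subspace {\<alpha>. \<exists>x\<in>R. \<forall>Q\<in>S. \<alpha> Q - x \<in> Q}"
    proof (rule kr.subspaceI)
      show "0 \<in> {\<alpha>. \<exists>x\<in>R. \<forall>Q\<in>S. \<alpha> Q - x \<in> Q}"
        using is_subringD(4)[OF reg_subring[of S]] pR(4) Ssub by (auto intro!: bexI[of _ 0])
    next
      fix \<alpha> \<beta> assume "\<alpha> \<in> {\<alpha>. \<exists>x\<in>R. \<forall>Q\<in>S. \<alpha> Q - x \<in> Q}" "\<beta> \<in> {\<alpha>. \<exists>x\<in>R. \<forall>Q\<in>S. \<alpha> Q - x \<in> Q}"
      then obtain x y where x: "x \<in> R" "\<And>Q. Q \<in> S \<Longrightarrow> \<alpha> Q - x \<in> Q" and y: "y \<in> R" "\<And>Q. Q \<in> S \<Longrightarrow> \<beta> Q - y \<in> Q"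
        by blast
      have "(\<alpha> + \<beta>) Q - (x + y) \<in> Q" if "Q \<in> S" for Q
        using pR(6)[OF _ x(2) y(2), OF _ that that] that Ssub by (auto simp: algebra_simps)
      then show "\<alpha> + \<beta> \<in> {\<alpha>. \<exists>x\<in>R. \<forall>Q\<in>S. \<alpha> Q - x \<in> Q}"
        using is_subringD(6)[OF reg_subring x(1) y(1)] by blast
    next
      fix c \<alpha> assume "\<alpha> \<in> {\<alpha>. \<exists>x\<in>R. \<forall>Q\<in>S. \<alpha> Q - x \<in> Q}"
      then obtain x where x: "x \<in> R" "\<And>Q. Q \<in> S \<Longrightarrow> \<alpha> Q - x \<in> Q" by blast
      have "\<iota> c * \<alpha> Q - \<iota> c * x \<in> Q" if "Q \<in> S" for Q
        using cm[OF _ x(2)[OF that], of c] that Ssub by (auto simp: algebra_simps)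
      moreover have "\<iota> c * x \<in> R" using is_subringD(3)[OF reg_subring _ x(1)] reg_const[of S] by blast
      ultimately show "(\<lambda>i. \<iota> c * \<alpha> i) \<in> {\<alpha>. \<exists>x\<in>R. \<forall>Q\<in>S. \<alpha> Q - x \<in> Q}" by blast
    qed
    show "kr.subspace ?W"
    proof (rule kr.subspaceI)
      have "0 + (\<lambda>_. 0) \<in> ?W" using pR(4) unfolding integral_repartitions_def by fastforce
      then show "0 \<in> ?W" by (simp add: zero_fun_def plus_fun_def)
    next
      fix \<alpha> \<beta> assume "\<alpha> \<in> ?W" "\<beta> \<in> ?W"
      then obtain \<alpha>' x \<beta>' y where e: "\<alpha> = \<alpha>' + (\<lambda>_. x)" "\<beta> = \<beta>' + (\<lambda>_. y)"
        and i: "\<alpha>' \<in> integral_repartitions C" "\<beta>' \<in> integral_repartitions C" by blast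
      have "\<alpha>' + \<beta>' \<in> integral_repartitions C"
        using i pR(6) unfolding integral_repartitions_def by auto
      moreover have "\<alpha> + \<beta> = (\<alpha>' + \<beta>') + (\<lambda>_. x + y)" unfolding e by (auto simp: fun_eq_iff)
      ultimately show "\<alpha> + \<beta> \<in> ?W" by blast
    next
      fix c \<alpha> assume "\<alpha> \<in> ?W"
      then obtain \<alpha>' x where e: "\<alpha> = \<alpha>' + (\<lambda>_. x)" and i: "\<alpha>' \<in> integral_repartitions C" by blast
      have "(\<lambda>i. \<iota> c * \<alpha>' i) \<in> integral_repartitions C"
        using i cm unfolding integral_repartitions_def by auto
      moreover have "(\<lambda>i. \<iota> c * \<alpha> i) = (\<lambda>i. \<iota> c * \<alpha>' i) + (\<lambda>_. \<iota> c * x)"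
        unfolding e by (auto simp: fun_eq_iff algebra_simps)
      ultimately show "(\<lambda>i. \<iota> c * \<alpha> i) \<in> ?W" by blast
    qed
    show "?f u \<in> ?U" for u
    proof -
      have "{Q \<in> pts. ?f u Q \<notin> Q} \<subseteq> S" using pR(4) by auto
      then show ?thesis unfolding repartitions_def using finS finite_subset by blast
    qed
    show "?f u \<in> ?W \<longleftrightarrow> u \<in> {\<alpha>. \<exists>x\<in>R. \<forall>Q\<in>S. \<alpha> Q - x \<in> Q}" for u
    proof
      assume "?f u \<in> ?W"
      then obtain \<alpha> x where e: "?f u = \<alpha> + (\<lambda>_. x)" and i: "\<alpha> \<in> integral_repartitions C" by blast
      have v: "?f u Q - x \<in> Q" if "Q \<in> pts" for Q
      proof -
        have "?f u Q - x = \<alpha> Q" using fun_cong[OF e, of Q] by (simp add: algebra_simps)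
        then show ?thesis using i that unfolding integral_repartitions_def by auto
      qed
      have "x \<in> Q" if "Q \<in> pts - S" for Q
        using v[of Q] that pR(2)[of Q 0 "- x"] pR(4)[of Q] by auto
      then have "x \<in> R" unfolding reg_iff by blast
      moreover have "u Q - x \<in> Q" if "Q \<in> S" for Q using v[of Q] that Ssub by auto
      ultimately show "u \<in> {\<alpha>. \<exists>x\<in>R. \<forall>Q\<in>S. \<alpha> Q - x \<in> Q}" by blast
    next
      assume "u \<in> {\<alpha>. \<exists>x\<in>R. \<forall>Q\<in>S. \<alpha> Q - x \<in> Q}"
      then obtain x where x: "x \<in> R" "\<And>Q. Q \<in> S \<Longrightarrow> u Q - x \<in> Q" by blast
      have "?f u Q - x \<in> Q" if "Q \<in> pts" for Q
        using x(2)[of Q] R_sub[OF _ x(1), of Q] pR(2)[OF that, of 0 x] pR(4)[OF that] that by auto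
      then have "(\<lambda>Q. ?f u Q - x) \<in> integral_repartitions C" unfolding integral_repartitions_def by blast
      moreover have "?f u = (\<lambda>Q. ?f u Q - x) + (\<lambda>_. x)" by (auto simp: fun_eq_iff)
      ultimately show "?f u \<in> ?W" by blast
    qed
  qed simp
qed

definition at_row :: "nat \<Rightarrow> ('K set \<Rightarrow> 'K) \<Rightarrow> nat \<times> 'K set \<Rightarrow> 'K" where
  "at_row i \<beta> = (\<lambda>p. if fst p = i then \<beta> (snd p) else 0)"

lemma Rn_local_box: "local_box n (\<lambda>_ _. 0) \<inter> diag ` Rn n = diag ` supported {..<n} (reg {})"
proof
  show "local_box n (\<lambda>_ _. 0) \<inter> diag ` Rn n \<subseteq> diag ` supported {..<n} (reg {})"
  proof
    fix \<alpha> assume "\<alpha> \<in> local_box n (\<lambda>_ _. 0) \<inter> diag ` Rn n"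
    then obtain x where x: "x \<in> Rn n" "\<alpha> = diag x" "diag x \<in> local_box n (\<lambda>_ _. 0)" by blast
    have "x i \<in> Q" if "i < n" "Q \<in> pts" for i Q
      using that x(3) pw_0_eq[OF that(2)] R_sub[of Q "x i"] supportedD(1)[OF x(1), of i]
      unfolding local_box_iff diag_def by (cases "Q \<in> S") auto
    then have "x \<in> supported {..<n} (reg {})"
      using supportedD(2)[OF x(1)] unfolding supported_def by (auto simp: reg_iff)
    then show "\<alpha> \<in> diag ` supported {..<n} (reg {})" using x(2) by blast
  qed
  show "diag ` supported {..<n} (reg {}) \<subseteq> local_box n (\<lambda>_ _. 0) \<inter> diag ` Rn n"
  proof
    fix \<alpha> assume "\<alpha> \<in> diag ` supported {..<n} (reg {})"
    then obtain x where x: "x \<in> supported {..<n} (reg {})" "\<alpha> = diag x" by blast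
    have Q: "x i \<in> Q" if "i < n" "Q \<in> pts" for i Q
      using supportedD(1)[OF x(1), of i] that unfolding reg_iff by auto
    have "x \<in> Rn n" using Q supportedD(2)[OF x(1)] unfolding supported_def by (auto simp: reg_iff)
    moreover have "\<alpha> \<in> local_box n (\<lambda>_ _. 0)"
      unfolding local_box_iff x(2) diag_def using Q pw_0_eq Ssub by auto
    ultimately show "\<alpha> \<in> local_box n (\<lambda>_ _. 0) \<inter> diag ` Rn n" using x(2) by blast
  qed
qed

lemma global_sections_commens:
  "kv.commens (reg {}) {0}" "kv.idx (reg {}) {0} \<ge> 1"
proof -
  have s: "kv.subspace (reg {})"
    by (rule kv.subspaceI) (use is_subringD[OF reg_subring[of "{}"]] reg_const[of "{}"] in \<open>auto simp: image_subset_iff\<close>)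
  have sub: "{0} \<subseteq> reg {}" using kv.subspace_0[OF s] by blast
  note c = kv.commens_subset[OF s kv.subspace_single_0 sub global_sections_finite]
  show "kv.commens (reg {}) {0}" by (rule c(1))
  have "1 \<in> reg {}" by (rule is_subringD(1)[OF reg_subring])
  then show "kv.idx (reg {}) {0} \<ge> 1"
    unfolding c(2) using kv.quot_dim_pos[OF kv.subspace_single_0 global_sections_finite, of 1] by simp
qed

lemma euler_std_sections:
  "km.fincodim (local_box n (\<lambda>_ _. 0) \<inter> diag ` Rn n) {0}"
  "n \<le> quot_dim (\<lambda>c f i. \<iota> c * f i) (local_box n (\<lambda>_ _. 0) \<inter> diag ` Rn n) {0}"
proof -
  let ?U = "diag ` supported {..<n} (reg {})"
  have k: "kn.commens (supported {..<n} (reg {})) (supported {..<n} {0})"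
    "int n \<le> kn.idx (supported {..<n} (reg {})) (supported {..<n} {0})"
    using idx_supported[OF global_sections_commens(1), of n]
      mult_left_mono[OF global_sections_commens(2), of "int n"] by auto
  have z: "diag ` supported {..<n} {0} = {0}"
    by (auto simp: supported_def diag_def fun_eq_iff image_iff) (metis lessThan_iff)
  note m = nm.idx_transfer[OF linear_diag diag_inj k(1), unfolded z]
  have 0: "{0} \<subseteq> ?U" "?U \<inter> {0} = {0}" "{0} \<inter> ?U = {0}"
    using m(1) km.subspace_0 unfolding km.commens_def by blast+
  show "km.fincodim (local_box n (\<lambda>_ _. 0) \<inter> diag ` Rn n) {0}"
    unfolding Rn_local_box using m(1) 0 unfolding km.commens_def by simp
  have "km.idx ?U {0} = int (quot_dim (\<lambda>c f i. \<iota> c * f i) ?U {0})"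
    unfolding km.idx_def using 0 km.quot_dim_refl[OF km.subspace_single_0] by simp
  then show "n \<le> quot_dim (\<lambda>c f i. \<iota> c * f i) (local_box n (\<lambda>_ _. 0) \<inter> diag ` Rn n) {0}"
    unfolding Rn_local_box using m(2) k(2) by simp
qed

lemma diag_subspace: "kn.subspace L \<Longrightarrow> km.subspace (diag ` L)"
proof -
  interpret f: Vector_Spaces.linear "\<lambda>c (f :: nat \<Rightarrow> 'K) i. \<iota> c * f i" "\<lambda>c (f :: nat \<times> 'K set \<Rightarrow> 'K) i. \<iota> c * f i" diag
    by (rule linear_diag)
  show "kn.subspace L \<Longrightarrow> km.subspace (diag ` L)" by (rule f.subspace_image)
qed

lemma linear_at_row:
  "Vector_Spaces.linear (\<lambda>c (f :: 'K set \<Rightarrow> 'K) i. \<iota> c * f i) (\<lambda>c (f :: nat \<times> 'K set \<Rightarrow> 'K) i. \<iota> c * f i) (at_row i)"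
  by unfold_locales (auto simp: at_row_def fun_eq_iff algebra_simps)

text \<open>Since the vectors in \<open>R\<^sup>n\<close> have independent coordinates, \<open>n\<close> copies of a basis for \<open>n = 1\<close>
  generate the cokernel.\<close>

lemma euler_std_cokernel:
  "\<exists>d\<le>n * g. km.hqd UNIV (ssum (local_box n (\<lambda>_ _. 0)) (diag ` Rn n)) d"
proof -
  let ?W = "{\<alpha>. \<exists>x\<in>R. \<forall>Q\<in>S. \<alpha> Q - x \<in> Q}"
  obtain d where d: "d \<le> g" "kr.hqd UNIV ?W d" using repartition_cokernel by blast
  then obtain B where B: "finite B" "UNIV \<subseteq> ssum (kr.span B) ?W" "card B = d" unfolding kr.hqd_iff by blast
  define G where "G = (\<Union>i<n. at_row i ` B)"
  have fG: "finite G" unfolding G_def using B(1) by auto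
  have "card G \<le> (\<Sum>i<n. card (at_row i ` B))" unfolding G_def by (rule card_UN_le) simp
  also have "\<dots> \<le> (\<Sum>i<n. d)" by (rule sum_mono) (use card_image_le[OF B(1)] B(3) in auto)
  also have "\<dots> \<le> n * g" using d(1) by simp
  finally have cG: "card G \<le> n * g" .
  have row: "at_row i \<beta> \<in> km.span G" if "\<beta> \<in> kr.span B" "i < n" for i \<beta>
  proof -
    interpret f: Vector_Spaces.linear "\<lambda>c (f :: 'K set \<Rightarrow> 'K) i. \<iota> c * f i"
      "\<lambda>c (f :: nat \<times> 'K set \<Rightarrow> 'K) i. \<iota> c * f i" "at_row i" by (rule linear_at_row)
    have "at_row i \<beta> \<in> km.span (at_row i ` B)" unfolding f.span_image using that(1) by (rule imageI)
    moreover have "at_row i ` B \<subseteq> G" unfolding G_def using that(2) by blast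
    ultimately show ?thesis using km.span_mono by blast
  qed
  have "UNIV \<subseteq> ssum (km.span G) (ssum (local_box n (\<lambda>_ _. 0)) (diag ` Rn n))"
  proof
    fix \<alpha> :: "nat \<times> 'K set \<Rightarrow> 'K"
    have "\<exists>s x. s \<in> kr.span B \<and> x \<in> R \<and> (\<forall>Q\<in>S. \<alpha> (i, Q) - s Q - x \<in> Q)" for i
    proof -
      have "(\<lambda>Q. \<alpha> (i, Q)) \<in> ssum (kr.span B) ?W" using B(2) by blast
      then obtain s w where sw: "s \<in> kr.span B" "w \<in> ?W" "(\<lambda>Q. \<alpha> (i, Q)) = s + w" by (elim ssumE)
      obtain x where x: "x \<in> R" "\<forall>Q\<in>S. w Q - x \<in> Q" using sw(2) by blast
      have "\<alpha> (i, Q) - s Q - x = w Q - x" for Q using fun_cong[OF sw(3), of Q] by simp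
      then show ?thesis using sw(1) x by (intro exI[of _ s] exI[of _ x]) simp
    qed
    then have "\<forall>i. \<exists>s x. s \<in> kr.span B \<and> x \<in> R \<and> (\<forall>Q\<in>S. \<alpha> (i, Q) - s Q - x \<in> Q)" by blast
    from choice[OF this] obtain s where
      "\<forall>i. \<exists>x. s i \<in> kr.span B \<and> x \<in> R \<and> (\<forall>Q\<in>S. \<alpha> (i, Q) - s i Q - x \<in> Q)" by blast
    from choice[OF this] obtain x where
      sx: "\<And>i. s i \<in> kr.span B" "\<And>i. x i \<in> R" "\<And>i Q. Q \<in> S \<Longrightarrow> \<alpha> (i, Q) - s i Q - x i \<in> Q" by blast
    define \<sigma> where "\<sigma> = (\<Sum>i<n. at_row i (s i))"
    have \<sigma>: "\<sigma> \<in> km.span G" unfolding \<sigma>_def by (intro km.span_sum row) (use sx in auto)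
    have \<sigma>v: "\<sigma> (i, Q) = s i Q" if "i < n" for i Q
      unfolding \<sigma>_def sum_fun_apply at_row_def using that by (simp add: sum.delta)
    define y where "y = (\<lambda>i. if i < n then x i else 0)"
    have y: "y \<in> Rn n" using sx(2) unfolding y_def supported_def by auto
    have "\<alpha> - \<sigma> - diag y \<in> local_box n (\<lambda>_ _. 0)"
      unfolding local_box_iff
    proof (intro allI impI ballI)
      fix i Q assume iQ: "i < n" "Q \<in> S"
      then have e: "(\<alpha> - \<sigma> - diag y) (i, Q) = \<alpha> (i, Q) - s i Q - x i"
        using \<sigma>v by (simp add: diag_def y_def)
      show "(\<alpha> - \<sigma> - diag y) (i, Q) \<in> pw Q 0" unfolding e using sx(3)[OF iQ(2)] pw_0_eq iQ(2) Ssub by auto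
    qed
    then have "(\<alpha> - \<sigma> - diag y) + diag y \<in> ssum (local_box n (\<lambda>_ _. 0)) (diag ` Rn n)"
      using y by (intro ssumI) auto
    from ssumI[OF \<sigma> this] show "\<alpha> \<in> ssum (km.span G) (ssum (local_box n (\<lambda>_ _. 0)) (diag ` Rn n))" by simp
  qed
  from km.fincodimI_span[OF _ fG this] have
    "\<exists>d\<le>card G. km.hqd UNIV (ssum (local_box n (\<lambda>_ _. 0)) (diag ` Rn n)) d"
    using km.subspace_ssum local_box_subspace diag_subspace supported_subspace subspace_R by blast
  then show ?thesis using cG order_trans by blast
qed

lemma riemann_inequality:
  "\<exists>c \<ge> int n * (1 - int g). km.euler (local_box n (\<lambda>_ _. 0)) (diag ` Rn n) c"
proof -
  let ?V = "local_box n (\<lambda>_ _. 0)" and ?D = "diag ` Rn n"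
  have s: "km.subspace ?D" by (intro diag_subspace supported_subspace subspace_R)
  obtain d where d: "d \<le> n * g" "km.hqd UNIV (ssum ?V ?D) d" using euler_std_cokernel by blast
  have qd: "quot_dim (\<lambda>c f i. \<iota> c * f i) UNIV (ssum ?V ?D) = d"
    by (rule km.quot_dim_eq[OF km.subspace_ssum[OF local_box_subspace s] d(2)])
  have "km.euler ?V ?D (int (quot_dim (\<lambda>c f i. \<iota> c * f i) (?V \<inter> ?D) {0}) - int d)"
    unfolding km.euler_def using local_box_subspace s euler_std_sections(1) d(2) qd
    unfolding km.fincodim_def by auto
  moreover have "int n * (1 - int g) \<le> int (quot_dim (\<lambda>c f i. \<iota> c * f i) (?V \<inter> ?D) {0}) - int d"
  proof -
    have "int n \<le> int (quot_dim (\<lambda>c f i. \<iota> c * f i) (?V \<inter> ?D) {0})"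
      using euler_std_sections(2)[of n] by linarith
    moreover have "int d \<le> int n * int g" using d(1) by (metis of_nat_le_iff of_nat_mult)
    ultimately show ?thesis by (simp add: right_diff_distrib)
  qed
  ultimately show ?thesis by blast
qed

text \<open>Multiplication by \<open>y\<close> preserves the Euler characteristic, so the relative dimension of \<open>R\<close> and \<open>y R\<close>
  balances the one of the boxes at \<open>S\<close>.\<close>

lemma product_formula:
  assumes y: "y \<noteq> 0"
  shows "kv.idx R ((*) y ` R) = - (\<Sum>Q\<in>S. int (degree_at \<iota> Q) * ord_at Q y)"
proof -
  let ?V = "local_box 1 (\<lambda>_ _. 0)" and ?D = "diag ` Rn 1"
  let ?f = "\<lambda>(\<alpha> :: nat \<times> 'K set \<Rightarrow> 'K) p. y * \<alpha> p"
  obtain c where c: "km.euler ?V ?D c" using riemann_inequality by blast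
  have f: "Vector_Spaces.linear (\<lambda>c (f :: nat \<times> 'K set \<Rightarrow> 'K) i. \<iota> c * f i) (\<lambda>c f i. \<iota> c * f i) ?f"
    by unfold_locales (auto simp: fun_eq_iff algebra_simps)
  have bij: "bij ?f"
    by (rule bij_betw_byWitness[where f' = "\<lambda>\<alpha> p. inverse y * \<alpha> p"]) (use y in \<open>auto simp: fun_eq_iff\<close>)
  have V: "?f ` ?V = local_box 1 (\<lambda>_ Q. ord_at Q y)"
  proof (intro subset_antisym subsetI)
    fix \<alpha> assume "\<alpha> \<in> ?f ` ?V"
    then obtain \<beta> where b: "\<beta> \<in> ?V" "\<alpha> = ?f \<beta>" by blast
    have yQ: "y \<in> pw Q (ord_at Q y)" for Q unfolding pw_def by simp
    show "\<alpha> \<in> local_box 1 (\<lambda>_ Q. ord_at Q y)"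
      using pw_mult[OF _ yQ, of _ _ 0] b Ssub unfolding local_box_iff by auto
  next
    fix \<alpha> assume a: "\<alpha> \<in> local_box 1 (\<lambda>_ Q. ord_at Q y)"
    have "inverse y \<in> pw Q (- ord_at Q y)" if "Q \<in> pts" for Q
      unfolding pw_def using ord_inverse[OF that y] by simp
    from pw_mult[OF _ this, of _ _ "ord_at _ y"]
    have "inverse y * x \<in> pw Q 0" if "Q \<in> pts" "x \<in> pw Q (ord_at Q y)" for x Q using that by fastforce
    then have "(\<lambda>p. inverse y * \<alpha> p) \<in> ?V" using a Ssub unfolding local_box_iff by auto
    moreover have "\<alpha> = ?f (\<lambda>p. inverse y * \<alpha> p)" using y by (auto simp: fun_eq_iff)
    ultimately show "\<alpha> \<in> ?f ` ?V" by (simp only: image_iff) (rule bexI)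
  qed
  have D: "?f ` ?D = diag ` supported {..<1} ((*) y ` R)"
    unfolding scale_supported[OF y, symmetric] image_image diag_def by simp
  have e1: "km.euler (local_box 1 (\<lambda>_ Q. ord_at Q y)) (diag ` supported {..<1} ((*) y ` R)) c"
    using mm.euler_transfer[OF f bij c] unfolding V D .
  note k = idx_supported[OF commens_mult_R[OF y], of 1]
  note m = nm.idx_transfer[OF linear_diag diag_inj k(1)]
  note b = local_box_idx[of 1 "\<lambda>_ _. 0" "\<lambda>_ Q. ord_at Q y"]
  from km.euler_unique[OF e1 km.euler_commens[OF c b(1) m(1)]]
  have "km.idx (local_box 1 (\<lambda>_ Q. ord_at Q y)) ?V + km.idx (diag ` supported {..<1} ((*) y ` R)) ?D = 0" by simp
  then show ?thesis
    using km.idx_swap[of "local_box 1 (\<lambda>_ Q. ord_at Q y)" ?V] km.idx_swap[of "diag ` supported {..<1} ((*) y ` R)" ?D]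
      b(2) m(2) k(2) by simp
qed

text \<open>The left hand side of the assumption \<open>small\<close> is what the Euler characteristic loses in passing from
  the integral box and \<open>R\<^sup>n\<close> to the box \<open>a\<close> and the lattice \<open>M L\<close>.\<close>

lemma minkowski_vector:
  assumes M: "M \<in> carrier_mat n n" "det M \<noteq> 0" and L: "fun_lattice n L"
    and small: "(\<Sum>i<n. \<Sum>Q\<in>S. int (degree_at \<iota> Q) * a i Q) + kv.idx R ((*) (det M) ` R) + kn.idx (Rn n) L
      < int n * (1 - int g)"
  shows "\<exists>x\<in>L. x \<noteq> (\<lambda>_. 0) \<and> (\<forall>i<n. \<forall>Q\<in>S. mat_fun n M x i \<in> pw Q (a i Q))"
proof -
  obtain c where c: "c \<ge> int n * (1 - int g)" "km.euler (local_box n (\<lambda>_ _. 0)) (diag ` Rn n) c"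
    using riemann_inequality by blast
  let ?L = "mat_fun n M ` L"
  have k: "kn.commens (Rn n) ?L" by (rule fun_lattice_commens[OF mat_fun_lattice[OF M L]])
  note m = nm.idx_transfer[OF linear_diag diag_inj k]
  note b = local_box_idx[of n "\<lambda>_ _. 0" a]
  have "km.idx (local_box n a) (local_box n (\<lambda>_ _. 0)) = - (\<Sum>i<n. \<Sum>Q\<in>S. int (degree_at \<iota> Q) * a i Q)"
    using km.idx_swap[of "local_box n a" "local_box n (\<lambda>_ _. 0)"] b(2) by simp
  moreover have "km.idx (diag ` ?L) (diag ` Rn n) = - (kv.idx R ((*) (det M) ` R) + kn.idx (Rn n) L)"
    using km.idx_swap[of "diag ` ?L" "diag ` Rn n"] m(2) idx_mat_fun[OF M L] by simp
  ultimately have "0 < c + km.idx (local_box n a) (local_box n (\<lambda>_ _. 0)) + km.idx (diag ` ?L) (diag ` Rn n)"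
    using c(1) small by linarith
  from km.euler_pos_ex[OF km.euler_commens[OF c(2) b(1) m(1)] this]
  obtain x where x: "x \<in> L" "diag (mat_fun n M x) \<in> local_box n a" "diag (mat_fun n M x) \<noteq> 0" by blast
  have "diag (mat_fun n M (\<lambda>_. 0)) = 0" by (auto simp: mat_fun_def diag_def fun_eq_iff)
  then have "x \<noteq> (\<lambda>_. 0)" using x(3) by metis
  then show ?thesis using x(1,2) unfolding local_box_iff diag_def by auto
qed

end


section \<open>Minkowski's theorem\<close>

text \<open>The powers of \<open>q\<close> are discrete in the positive reals, so the closures in the definition of the value
  groups add nothing.\<close>

lemma closure_powers:
  fixes q :: real
  assumes q: "1 < q" and A: "A \<subseteq> range (\<lambda>z :: int. q powi z)" and e: "\<epsilon> \<in> closure A" "0 < \<epsilon>"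
  shows "\<epsilon> \<in> A"
proof -
  define z where "z = \<lfloor>log q \<epsilon>\<rfloor>"
  have pw: "q powr real_of_int k = q powi k" for k using q by (simp add: powr_real_of_int')
  have "q powr real_of_int z \<le> \<epsilon>"
    using q e(2) le_log_iff[of q \<epsilon> "real_of_int z"] unfolding z_def by simp
  moreover have "\<epsilon> < q powr real_of_int (z + 1)"
    using q e(2) log_less_iff[of q \<epsilon> "real_of_int (z + 1)"] unfolding z_def by linarith
  ultimately have z: "q powi z \<le> \<epsilon>" "\<epsilon> < q powi (z + 1)" unfolding pw by auto
  have "q powi (z - 1) < q powi z" using q by (intro power_int_strict_increasing) auto
  then have z': "q powi (z - 1) < \<epsilon>" using z by linarith
  \<comment> \<open>Between two neighbours of the power \<open>z\<close> there is no other power.\<close>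
  have near: "\<exists>\<delta>>0. \<forall>y\<in>A. \<bar>y - \<epsilon>\<bar> < \<delta> \<longrightarrow> y = q powi z"
  proof (intro exI[of _ "min (\<epsilon> - q powi (z - 1)) (q powi (z + 1) - \<epsilon>)"] conjI ballI impI)
    show "0 < min (\<epsilon> - q powi (z - 1)) (q powi (z + 1) - \<epsilon>)" using z z' by simp
    fix y assume "y \<in> A" and d: "\<bar>y - \<epsilon>\<bar> < min (\<epsilon> - q powi (z - 1)) (q powi (z + 1) - \<epsilon>)"
    then obtain k :: int where k: "y = q powi k" using A by blast
    have "q powi (z - 1) < q powi k" "q powi k < q powi (z + 1)" using d unfolding k by linarith+
    moreover have "q powi k \<le> q powi (z - 1)" if "k \<le> z - 1" using that q by (intro power_int_increasing) auto
    moreover have "q powi (z + 1) \<le> q powi k" if "z + 1 \<le> k" using that q by (intro power_int_increasing) auto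
    ultimately have "k = z" by (metis add_le_cancel_right diff_add_cancel int_one_le_iff_zero_less leD le_less_linear not_less_iff_gr_or_eq zle_diff1_eq zless_imp_add1_zle)
    then show "y = q powi z" using k by simp
  qed
  then obtain \<delta> where \<delta>: "\<delta> > 0" "\<And>y. y \<in> A \<Longrightarrow> \<bar>y - \<epsilon>\<bar> < \<delta> \<Longrightarrow> y = q powi z" by blast
  have cl: "\<exists>y\<in>A. \<bar>y - \<epsilon>\<bar> < r" if "r > 0" for r
  proof -
    have "\<epsilon> \<in> {\<epsilon> - r<..<\<epsilon> + r} \<inter> closure A" using e(1) that by auto
    then obtain y where y: "y \<in> {\<epsilon> - r<..<\<epsilon> + r}" "y \<in> A"
      using open_Int_closure_eq_empty[OF open_greaterThanLessThan, of "\<epsilon> - r" "\<epsilon> + r" A] by blast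
    have "\<bar>y - \<epsilon>\<bar> < r" using y(1) by auto
    then show ?thesis using y(2) by blast
  qed
  have "\<epsilon> = q powi z"
  proof (rule ccontr)
    assume ne: "\<epsilon> \<noteq> q powi z"
    obtain y where y: "y \<in> A" "\<bar>y - \<epsilon>\<bar> < min \<delta> \<bar>q powi z - \<epsilon>\<bar>" using cl[of "min \<delta> \<bar>q powi z - \<epsilon>\<bar>"] \<delta>(1) ne by auto
    then show False using \<delta>(2)[of y] by auto
  qed
  moreover obtain y where "y \<in> A" "\<bar>y - \<epsilon>\<bar> < \<delta>" using cl[OF \<delta>(1)] by blast
  ultimately show ?thesis using \<delta>(2) by metis
qed

lemma prod_powi:
  fixes q :: real
  assumes "q > 0" "finite I"
  shows "(\<Prod>i\<in>I. q powi f i) = q powi (\<Sum>i\<in>I. f i)"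
  using assms(2) by (induction I rule: finite_induct) (use assms(1) in \<open>auto simp: power_int_add\<close>)

lemma powi_le_iff:
  fixes q :: real
  assumes "1 < q"
  shows "q powi a \<le> q powi b \<longleftrightarrow> a \<le> b"
  using power_int_increasing[of a b q] power_int_strict_increasing[of b a q] assms by (cases "a \<le> b") auto

lemma invertible_det_nonzero:
  assumes M: "M \<in> carrier_mat n n" and inv: "invertible_mat M"
  shows "det (M :: 'a::field mat) \<noteq> 0"
proof -
  obtain B where B: "M * B = 1\<^sub>m n" "B * M = 1\<^sub>m (dim_row B)"
    using inv M unfolding invertible_mat_def inverts_mat_def by auto
  have "dim_col (M * B) = n" "dim_col (B * M) = dim_row B" unfolding B by simp_all
  then have "B \<in> carrier_mat n n" using M by auto
  then have "det M * det B = 1" using det_mult[OF M, of B] B(1) by (simp add: det_one)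
  then show ?thesis by auto
qed

lemma std_lattice_least:
  assumes L: "is_vec_submodule A n L" and u: "\<And>i. i < n \<Longrightarrow> unit_vec n i \<in> L"
  shows "std_lattice A n \<subseteq> L"
proof
  fix x assume x: "x \<in> std_lattice A n"
  have "k \<le> n \<Longrightarrow> vec n (\<lambda>l. if l < k then x $ l else 0) \<in> L" for k
  proof (induction k)
    case 0
    have "vec n (\<lambda>l. if l < 0 then x $ l else 0) = 0\<^sub>v n" by auto
    then show ?case using L unfolding is_vec_submodule_def by simp
  next
    case (Suc k)
    have "x $ k \<cdot>\<^sub>v unit_vec n k \<in> L"
      using L u[of k] x Suc.prems unfolding is_vec_submodule_def std_lattice_def by auto
    then have "vec n (\<lambda>l. if l < k then x $ l else 0) + x $ k \<cdot>\<^sub>v unit_vec n k \<in> L"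
      using L Suc unfolding is_vec_submodule_def by auto
    moreover have "vec n (\<lambda>l. if l < k then x $ l else 0) + x $ k \<cdot>\<^sub>v unit_vec n k
      = vec n (\<lambda>l. if l < Suc k then x $ l else 0)"
      using Suc.prems by (intro eq_vecI) (auto simp: less_Suc_eq)
    ultimately show ?case by simp
  qed
  from this[of n] have "vec n (\<lambda>l. if l < n then x $ l else 0) \<in> L" by simp
  moreover have "vec n (\<lambda>l. if l < n then x $ l else 0) = x" using x unfolding std_lattice_def by auto
  ultimately show "x \<in> L" by simp
qed

context affine_curve
begin

lemma is_lattice_std: "is_lattice R n (std_lattice R n)"
proof -
  note RD = is_subringD[OF reg_subring[of S]]
  have s: "is_vec_submodule R n (std_lattice R n)"
    unfolding is_vec_submodule_def std_lattice_def using RD by auto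
  have u: "unit_vec n i \<in> std_lattice R n" if "i < n" for i
    using that RD(1,4) unfolding std_lattice_def unit_vec_def by auto
  have c: "is_vec_submodule UNIV n (carrier_vec n)" unfolding is_vec_submodule_def by auto
  have "std_lattice R n = is_vec_submodule R n hull (unit_vec n ` {..<n})"
  proof
    show "std_lattice R n \<subseteq> is_vec_submodule R n hull (unit_vec n ` {..<n})"
      unfolding hull_def by (intro Inter_greatest std_lattice_least) auto
    show "is_vec_submodule R n hull (unit_vec n ` {..<n}) \<subseteq> std_lattice R n"
      by (rule hull_minimal) (use s u in auto)
  qed
  moreover have "is_vec_submodule UNIV n hull std_lattice R n = carrier_vec n"
  proof
    show "is_vec_submodule UNIV n hull std_lattice R n \<subseteq> carrier_vec n"
      by (rule hull_minimal) (use c in \<open>auto simp: std_lattice_def\<close>)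
    have "carrier_vec n = std_lattice UNIV n" for n unfolding std_lattice_def by auto
    then show "carrier_vec n \<subseteq> is_vec_submodule UNIV n hull std_lattice R n"
      unfolding hull_def using std_lattice_least u by (intro Inter_greatest) blast
  qed
  ultimately show ?thesis
    unfolding is_lattice_def by (intro conjI exI[of _ "unit_vec n ` {..<n}"]) auto
qed

lemma degree_pos: "Q \<in> pts \<Longrightarrow> degree_at \<iota> Q \<ge> 1"
proof -
  assume Q: "Q \<in> pts"
  have "1 \<in> Q" by (rule is_subringD(1)[OF pts_subring[OF Q]])
  moreover have "1 \<notin> pw Q 1" unfolding pw_def using ord_one[OF Q] by simp
  ultimately show ?thesis
    using kv.quot_dim_pos[OF pw_subspace[OF Q] residue_field_finite[OF Q]]
    unfolding degree_at_def max_ideal_eq[OF Q] by (simp add: Suc_le_eq)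
qed

text \<open>For \<open>k \<ge> 0\<close> by strong approximation with poles allowed at a point outside of \<open>S\<close>, where the precision
  \<open>k + 1\<close> determines the order at \<open>P0\<close>; for negative \<open>k\<close> by passing to inverses.\<close>

lemma prescribed_orders:
  assumes P0: "P0 \<in> S"
  shows "\<exists>y. y \<noteq> 0 \<and> ord_at P0 y = k \<and> (\<forall>Q\<in>S - {P0}. ord_at Q y = 0)"
proof -
  have nn: "\<exists>y. y \<noteq> 0 \<and> ord_at P0 y = int k \<and> (\<forall>Q\<in>S - {P0}. ord_at Q y = 0)" for k
  proof -
    have P: "P0 \<in> pts" using P0 Ssub by blast
    obtain t where t: "t \<noteq> 0" "ord_at P0 t = int k" using uniformizer[OF P] by blast
    have tP: "t \<in> P0" using mem_iff[OF P t(1)] t(2) by simp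
    obtain Q0 where Q0: "Q0 \<in> pts - S" using pts_outside[of "{}"] by auto
    have "\<exists>z\<in>reg {Q0}. \<forall>Q\<in>S. z - (if Q = P0 then t else 1) \<in> pw Q (int (Suc k))"
      by (rule strong_approximation) (use Q0 finS Ssub tP is_subringD(1)[OF pts_subring] in auto)
    then obtain z where z: "\<And>Q. Q \<in> S \<Longrightarrow> z - (if Q = P0 then t else 1) \<in> pw Q (int (Suc k))" by blast
    have zt: "z - t \<in> pw P0 (int (Suc k))" using z[OF P0] by simp
    have tn: "t \<notin> pw P0 (int (Suc k))" using t pw_iff[of t P0] by simp
    have zn: "z \<notin> pw P0 (int (Suc k))" using pw_diff[OF P _ zt, of z] tn by auto
    then have z0: "z \<noteq> 0" by auto
    have "z \<in> pw P0 (int k)"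
      using pw_add[OF P pw_monoD[OF zt, of "int k"], of t] t pw_iff[of t P0 "int k"] by simp
    then have "ord_at P0 z = int k" using zn pw_iff[OF z0, of P0] by auto
    moreover have "ord_at Q z = 0" if "Q \<in> S - {P0}" for Q
      using one_plus_pw1(2)[of Q z] z[of Q] pw_monoD[of "z - 1" Q "int (Suc k)" 1] that Ssub by auto
    ultimately show ?thesis using z0 by blast
  qed
  show ?thesis
  proof (cases "k \<ge> 0")
    case True
    then show ?thesis using nn[of "nat k"] by simp
  next
    case False
    obtain y where y: "y \<noteq> 0" "ord_at P0 y = int (nat (- k))" "\<And>Q. Q \<in> S - {P0} \<Longrightarrow> ord_at Q y = 0"
      using nn[of "nat (- k)"] by blast
    have "ord_at P0 (inverse y) = k" using ord_inverse[of P0 y] P0 Ssub y(1,2) False by auto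
    moreover have "ord_at Q (inverse y) = 0" if "Q \<in> S - {P0}" for Q
      using ord_inverse[of Q y] y(1) y(3)[OF that] Ssub that by auto
    ultimately show ?thesis using y(1) by (intro exI[of _ "inverse y"]) auto
  qed
qed

lemma value_group_abs_at:
  assumes q: "1 < q" and e: "\<epsilon> \<in> value_group_closure (abs_at q \<iota> Q)"
  shows "\<exists>a. \<epsilon> = q powi (- int (degree_at \<iota> Q) * a)"
proof -
  have "\<epsilon> \<in> abs_at q \<iota> Q ` (UNIV - {0})"
    by (rule closure_powers[OF q]) (use e in \<open>auto simp: value_group_closure_def abs_at_def\<close>)
  then show ?thesis by (auto simp: abs_at_def)
qed

lemma value_group_abs_R_power:
  assumes q: "1 < q" and P0: "P0 \<in> S"
  shows "q powi (int (degree_at \<iota> P0) * z) \<in> value_group_closure (abs_R q \<iota> R)"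
proof -
  obtain y where y: "y \<noteq> 0" "ord_at P0 y = - z" "\<And>Q. Q \<in> S - {P0} \<Longrightarrow> ord_at Q y = 0"
    using prescribed_orders[OF P0, of "- z"] by blast
  have "(\<Sum>Q\<in>S. int (degree_at \<iota> Q) * ord_at Q y) = int (degree_at \<iota> P0) * ord_at P0 y"
    unfolding sum.remove[OF finS P0] using y(3) by simp
  then have "abs_R q \<iota> R y = q powi (int (degree_at \<iota> P0) * z)"
    using abs_R_eq[of q y] q y(1,2) product_formula[OF y(1)] by simp
  then have "q powi (int (degree_at \<iota> P0) * z) \<in> abs_R q \<iota> R ` (UNIV - {0})" using y(1) by (auto intro: rev_image_eqI)
  then show ?thesis
    using closure_subset[of "abs_R q \<iota> R ` (UNIV - {0})"] q unfolding value_group_closure_def by auto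
qed

lemma abs_at_le_iff:
  assumes q: "1 < q" and Q: "Q \<in> pts"
  shows "abs_at q \<iota> Q x \<le> q powi (- int (degree_at \<iota> Q) * a) \<longleftrightarrow> x \<in> pw Q a"
proof (cases "x = 0")
  case True
  then show ?thesis using q by (simp add: abs_at_def)
next
  case False
  then show ?thesis
    using degree_pos[OF Q] unfolding pw_iff[OF False] abs_at_def by (simp add: powi_le_iff[OF q])
qed

text \<open>After taking logarithms to the base \<open>q\<close>, the inequality between determinant, covolume and bounds is
  the assumption of \<open>minkowski_vector\<close>.\<close>

lemma multimetric_constants_mem:
  assumes q: "1 < q" and inj: "inj_on P {..<m}" and S: "S = P ` {..<m}"
    and c: "q powi e \<in> value_group_closure (abs_R q \<iota> R)" and e: "e < int n * (1 - int g)"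
  shows "q powi e \<in> multimetric_constants q \<iota> R m P n"
  unfolding multimetric_constants_def
proof (intro CollectI conjI allI impI, rule c, elim conjE)
  fix M :: "'K mat" and \<Lambda> \<epsilon>
  assume M: "M \<in> carrier_mat n n" "invertible_mat M" and \<Lambda>: "is_lattice R n \<Lambda>"
    and \<epsilon>: "\<forall>i<n. \<forall>j<m. \<epsilon> i j \<in> value_group_closure (abs_at q \<iota> (P j))"
    and le: "abs_R q \<iota> R (det M) * covol q \<iota> R n \<Lambda> \<le> q powi e * (\<Prod>i<n. \<Prod>j<m. \<epsilon> i j)"
  have q0: "q > 0" using q by simp
  have dM: "det M \<noteq> 0" by (rule invertible_det_nonzero[OF M])
  note L = is_lattice_fun_lattice[OF \<Lambda>]
  have "\<forall>i j. \<exists>a. i < n \<longrightarrow> j < m \<longrightarrow> \<epsilon> i j = q powi (- int (degree_at \<iota> (P j)) * a)"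
    using \<epsilon> value_group_abs_at[OF q] by blast
  then have "\<forall>i. \<exists>a. \<forall>j. i < n \<longrightarrow> j < m \<longrightarrow> \<epsilon> i j = q powi (- int (degree_at \<iota> (P j)) * a j)"
    by (intro allI choice) blast
  from choice[OF this] obtain a where
    a: "\<And>i j. i < n \<Longrightarrow> j < m \<Longrightarrow> \<epsilon> i j = q powi (- int (degree_at \<iota> (P j)) * a i j)" by blast
  define b where "b = (\<lambda>i Q. a i (the_inv_into {..<m} P Q))"
  have b: "b i (P j) = a i j" if "j < m" for i j
    unfolding b_def using the_inv_into_f_f[OF inj] that by simp
  have bs: "(\<Sum>Q\<in>S. int (degree_at \<iota> Q) * b i Q) = (\<Sum>j<m. int (degree_at \<iota> (P j)) * a i j)" for i
    unfolding S sum.reindex[OF inj] using b by simp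
  have "(\<Prod>i<n. \<Prod>j<m. \<epsilon> i j) = (\<Prod>i<n. \<Prod>j<m. q powi (- int (degree_at \<iota> (P j)) * a i j))"
    using a by (intro prod.cong refl) auto
  also have "\<dots> = q powi (- (\<Sum>i<n. \<Sum>Q\<in>S. int (degree_at \<iota> Q) * b i Q))"
    unfolding bs prod_powi[OF q0 finite_lessThan] by (simp add: sum_negf)
  finally have pe: "(\<Prod>i<n. \<Prod>j<m. \<epsilon> i j) = q powi (- (\<Sum>i<n. \<Sum>Q\<in>S. int (degree_at \<iota> Q) * b i Q))" .
  have qa: "q powi (x + y) = q powi x * q powi y" for x y by (rule power_int_add) (use q0 in simp)
  have "q powi (kv.idx R ((*) (det M) ` R) + kn.idx (Rn n) (vfun ` \<Lambda>))
      \<le> q powi (e + - (\<Sum>i<n. \<Sum>Q\<in>S. int (degree_at \<iota> Q) * b i Q))"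
    using le unfolding pe abs_R_eq[OF q0 dM] covol_eq[OF L q0] qa .
  then have "(\<Sum>i<n. \<Sum>Q\<in>S. int (degree_at \<iota> Q) * b i Q) + kv.idx R ((*) (det M) ` R) + kn.idx (Rn n) (vfun ` \<Lambda>)
      < int n * (1 - int g)"
    using e unfolding powi_le_iff[OF q] by linarith
  from minkowski_vector[OF M(1) dM L(2) this] obtain x where
    x: "x \<in> \<Lambda>" "vfun x \<noteq> (\<lambda>_. 0)" "\<And>i Q. i < n \<Longrightarrow> Q \<in> S \<Longrightarrow> mat_fun n M (vfun x) i \<in> pw Q (b i Q)" by blast
  have xc: "x \<in> carrier_vec n" using x(1) L(1) by blast
  have "x \<noteq> 0\<^sub>v n" using x(2) by (auto simp: vfun_def)
  moreover have "abs_at q \<iota> (P j) ((M *\<^sub>v x) $ i) \<le> \<epsilon> i j" if ij: "i < n" "j < m" for i j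
  proof -
    have "(M *\<^sub>v x) $ i = mat_fun n M (vfun x) i"
      unfolding mult_vec_index[OF M(1) xc ij(1)] mat_fun_def vfun_def using ij(1) xc by auto
    moreover have "P j \<in> S" using S ij(2) by blast
    ultimately show ?thesis
      unfolding a[OF ij] using x(3)[OF ij(1), of "P j"] abs_at_le_iff[OF q, of "P j"] b[OF ij(2)] Ssub by auto
  qed
  ultimately show "\<exists>x\<in>\<Lambda>. x \<noteq> 0\<^sub>v n \<and> (\<forall>i<n. \<forall>j<m. abs_at q \<iota> (P j) ((M *\<^sub>v x) $ i) \<le> \<epsilon> i j)"
    using x(1) by blast
qed

text \<open>For the identity matrix and the standard lattice, the bounds \<open>q\<close> to the power \<open>- d\<^sub>j\<close> force the
  coordinates of \<open>x\<close> to be regular everywhere and to vanish on \<open>S\<close>.\<close>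

lemma multimetric_constants_bounded:
  assumes q: "1 < q" and S: "S = P ` {..<m}"
    and c: "c \<in> multimetric_constants q \<iota> R m P n"
  shows "c \<le> q powi (int n * (\<Sum>j<m. int (degree_at \<iota> (P j))))"
proof (rule ccontr)
  assume big: "\<not> ?thesis"
  have q0: "q > 0" using q by simp
  have Pp: "P j \<in> pts" if "j < m" for j using that S Ssub by blast
  define \<epsilon> where "\<epsilon> = (\<lambda>(i :: nat) j. q powi (- int (degree_at \<iota> (P j)) * 1))"
  have "\<epsilon> i j \<in> value_group_closure (abs_at q \<iota> (P j))" if j: "j < m" for i j
  proof -
    obtain t where t: "t \<noteq> 0" "ord_at (P j) t = 1" using uniformizer[OF Pp[OF j]] by blast
    have "\<epsilon> i j = abs_at q \<iota> (P j) t" unfolding \<epsilon>_def abs_at_def using t by simp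
    then have "\<epsilon> i j \<in> abs_at q \<iota> (P j) ` (UNIV - {0})" using t(1) by blast
    moreover have "\<epsilon> i j > 0" unfolding \<epsilon>_def using q0 by simp
    ultimately show ?thesis
      using closure_subset[of "abs_at q \<iota> (P j) ` (UNIV - {0})"] unfolding value_group_closure_def by blast
  qed
  then have 1: "\<forall>i<n. \<forall>j<m. \<epsilon> i j \<in> value_group_closure (abs_at q \<iota> (P j))" by blast
  have std: "std_lattice R n \<subseteq> carrier_vec n" unfolding std_lattice_def by blast
  have "covol q \<iota> R n (std_lattice R n) = 1"
    using covol_eq[OF std _ q0] fun_lattice_Rn unfolding vfun_std by simp
  moreover have "abs_R q \<iota> R (det (1\<^sub>m n)) = 1"
    using abs_R_eq[OF q0, of 1] by (simp add: det_one)
  moreover have "(\<Prod>i<n. \<Prod>j<m. \<epsilon> i j) = q powi (- (int n * (\<Sum>j<m. int (degree_at \<iota> (P j)))))"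
    unfolding \<epsilon>_def prod_powi[OF q0 finite_lessThan] by (simp add: sum_negf)
  moreover have "1 \<le> c * q powi (- (int n * (\<Sum>j<m. int (degree_at \<iota> (P j)))))"
    using big q0 by (simp add: power_int_minus field_simps)
  ultimately have 2: "abs_R q \<iota> R (det (1\<^sub>m n)) * covol q \<iota> R n (std_lattice R n)
    \<le> c * (\<Prod>i<n. \<Prod>j<m. \<epsilon> i j)" by simp
  have 3: "invertible_mat (1\<^sub>m n :: 'K mat)"
    unfolding invertible_mat_def inverts_mat_def by (auto intro!: exI[of _ "1\<^sub>m n"])
  have "\<forall>M \<Lambda> \<epsilon>. M \<in> carrier_mat n n \<and> invertible_mat M \<and> is_lattice R n \<Lambda>
         \<and> (\<forall>i<n. \<forall>j<m. \<epsilon> i j \<in> value_group_closure (abs_at q \<iota> (P j)))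
         \<and> abs_R q \<iota> R (det M) * covol q \<iota> R n \<Lambda> \<le> c * (\<Prod>i<n. \<Prod>j<m. \<epsilon> i j)
         \<longrightarrow> (\<exists>x\<in>\<Lambda>. x \<noteq> 0\<^sub>v n \<and> (\<forall>i<n. \<forall>j<m. abs_at q \<iota> (P j) ((M *\<^sub>v x) $ i) \<le> \<epsilon> i j))"
    using c unfolding multimetric_constants_def by blast
  from this[rule_format, of "1\<^sub>m n" "std_lattice R n" \<epsilon>]
  have "\<exists>x\<in>std_lattice R n. x \<noteq> 0\<^sub>v n \<and> (\<forall>i<n. \<forall>j<m. abs_at q \<iota> (P j) ((1\<^sub>m n *\<^sub>v x) $ i) \<le> \<epsilon> i j)"
    using 1 2 3 is_lattice_std by simp
  then obtain x where x: "x \<in> std_lattice R n" "x \<noteq> 0\<^sub>v n"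
    "\<And>i j. i < n \<Longrightarrow> j < m \<Longrightarrow> abs_at q \<iota> (P j) ((1\<^sub>m n *\<^sub>v x) $ i) \<le> \<epsilon> i j" by blast
  have xc: "x \<in> carrier_vec n" and xR: "\<And>i. i < n \<Longrightarrow> x $ i \<in> R" using x(1) unfolding std_lattice_def by auto
  have "x $ i = 0" if i: "i < n" for i
  proof -
    have v: "x $ i \<in> pw Q 1" if Q: "Q \<in> S" for Q
    proof -
      obtain j where j: "j < m" "Q = P j" using S Q by blast
      show ?thesis
        using x(3)[OF i j(1)] abs_at_le_iff[OF q Pp[OF j(1)], of "x $ i" 1] xc j(2) unfolding \<epsilon>_def by simp
    qed
    have "x $ i \<in> reg {}" unfolding reg_iff
    proof
      fix Q assume Q: "Q \<in> pts - {}"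
      show "x $ i \<in> Q"
        using R_sub[OF _ xR[OF i], of Q] pw_monoD[OF v, of Q 0] pw_0_eq[of Q] Q by (cases "Q \<in> S") auto
    qed
    moreover obtain Q where "Q \<in> S" using Sne by blast
    ultimately show ?thesis using everywhere_regular_vanishing v Ssub by blast
  qed
  then have "x = 0\<^sub>v n" using xc by auto
  then show False using x(2) by blast
qed

text \<open>The exponent \<open>e\<close> is the greatest multiple of the degree \<open>d\<close> of \<open>P 0\<close> below \<open>n (1 - g)\<close>. Compared
  with \<open>n (1 - g) - 1\<close>, this rounding loses at most \<open>d - 1 \<le> n \<Sum> (d\<^sub>j - 1)\<close>.\<close>

lemma multimetric_bound:
  assumes q: "1 < q" and inj: "inj_on P {..<m}" and S: "S = P ` {..<m}" and n: "1 \<le> n"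
  shows "\<exists>c\<in>multimetric_constants q \<iota> R m P n.
    q powr (real n * (real m + 1 - (\<Sum>j<m. real (degree_at \<iota> (P j))) - real g) - 1) \<le> c"
proof -
  have m: "0 < m" using S Sne by auto
  have P0: "P 0 \<in> S" using S m by blast
  have Pp: "P j \<in> pts" if "j < m" for j using that S Ssub by blast
  let ?d = "int (degree_at \<iota> (P 0))" and ?b = "int n * (1 - int g) - 1"
  define e where "e = ?d * (?b div ?d)"
  have d: "?d \<ge> 1" using degree_pos[OF Pp[OF m]] by simp
  have e1: "e \<le> ?b" and e2: "?b - ?d < e"
  proof -
    have "e = ?b - ?b mod ?d" unfolding e_def by (simp add: minus_mod_eq_mult_div)
    moreover have "0 \<le> ?b mod ?d" "?b mod ?d < ?d" using d by auto
    ultimately show "e \<le> ?b" "?b - ?d < e" by linarith+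
  qed
  have mem: "q powi e \<in> multimetric_constants q \<iota> R m P n"
    by (rule multimetric_constants_mem[OF q inj S])
      (use value_group_abs_R_power[OF q P0] e1 in \<open>auto simp: e_def\<close>)
  let ?D = "\<Sum>j<m. int (degree_at \<iota> (P j))"
  have "?d - 1 \<le> (\<Sum>j<m. int (degree_at \<iota> (P j)) - 1)"
    by (rule member_le_sum) (use m degree_pos[OF Pp] in \<open>auto simp: Suc_le_eq\<close>)
  then have dD: "?d - 1 \<le> ?D - int m" by (simp add: sum_subtractf)
  have "1 * (?D - int m) \<le> int n * (?D - int m)" by (rule mult_right_mono) (use n dD d in auto)
  then have "int n * (int m + 1 - ?D - int g) - 1 \<le> e" using e2 dD by (simp add: algebra_simps)
  then have "real_of_int (int n * (int m + 1 - ?D - int g) - 1) \<le> real_of_int e" by (simp only: of_int_le_iff)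
  then have "q powr (real n * (real m + 1 - (\<Sum>j<m. real (degree_at \<iota> (P j))) - real g) - 1) \<le> q powr real_of_int e"
    by (intro powr_mono) (use q in auto)
  also have "\<dots> = q powi e" using q by (simp add: powr_real_of_int')
  finally show ?thesis using mem by blast
qed

end

theorem theorem4p6:
  fixes \<iota> :: "'k::field \<Rightarrow> 'K::field" and C :: "'K set set"
    and P :: "nat \<Rightarrow> 'K set" and R :: "'K set"
    and g m :: nat and q :: real
  assumes "smooth_projective_geom_integral_curve \<iota> C"
    and "has_genus \<iota> C g"
    and "1 \<le> m"
    and "inj_on P {..<m}"
    and "P ` {..<m} \<subseteq> closed_points C"
    and "R = affine_coordinate_ring C (P ` {..<m})"
    and "1 < q"
    and "finite (UNIV :: 'k set) \<longrightarrow> q = real (card (UNIV :: 'k set))"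
  shows "multimetric_linear_type q \<iota> R m P \<and>
    (\<forall>n\<ge>1. c_M q \<iota> R m P n \<ge>
       real n * (real m + 1 - (\<Sum>j<m. real (degree_at \<iota> (P j))) - real g) - 1)"
proof -
  have "P 0 \<in> P ` {..<m}" using assms(3) by auto
  then have ne: "P ` {..<m} \<noteq> {}" by blast
  interpret curve \<iota> C g
    by (rule smooth_curve_imp_curve[OF assms(1,2)]) (use ne assms(5) in blast)
  interpret A: affine_curve \<iota> C g "P ` {..<m}"
    by unfold_locales (use ne assms(5) in auto)
  note R = assms(6)
  have "multimetric_constants q \<iota> R m P n \<noteq> {}" if "1 \<le> n" for n
    using A.multimetric_bound[OF assms(7,4) refl that] unfolding R by blast
  moreover have "c_M q \<iota> R m P n \<ge> real n * (real m + 1 - (\<Sum>j<m. real (degree_at \<iota> (P j))) - real g) - 1"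
    (is "_ \<ge> ?b") if n: "1 \<le> n" for n
  proof -
    obtain c where c: "c \<in> multimetric_constants q \<iota> R m P n" "q powr ?b \<le> c"
      using A.multimetric_bound[OF assms(7,4) refl n] unfolding R by blast
    have "bdd_above (multimetric_constants q \<iota> R m P n)"
      unfolding R by (rule bdd_aboveI) (rule A.multimetric_constants_bounded[OF assms(7) refl])
    then have le: "q powr ?b \<le> C_M q \<iota> R m P n"
      unfolding C_M_def using cSup_upper[OF c(1)] c(2) by linarith
    then have "0 < C_M q \<iota> R m P n" using assms(7) powr_gt_zero[of q ?b] by linarith
    then show ?thesis unfolding c_M_def using le le_log_iff[OF assms(7)] by simp
  qed
  ultimately show ?thesis unfolding multimetric_linear_type_def by blast
qed

end
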